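(* Let $p$ be a prime, let $k$ be an algebraically closed field of characteristic $p$, let $n\geq1$, and let $\delta\in k$ with $\delta\neq0$. Let $\lambda,\mu\in\Lambda_{\leq n}$. If $\mu\in\mathcal{B}_\lambda(P_n^k(\delta))$, then $\hat\mu+\rho_n(\delta)\sim_k\hat\lambda+\rho_n(\delta)$.
   Context: Partition algebra. For a field $F$, $n\ge 1$ and $\delta\in F$, $P_n^F(\delta)$ is the $F$-algebra with basis the set-partitions (diagrams) of $\{1,\dots,n,\bar1,\dots,\bar n\}$ (northern nodes $1,\dots,n$, southern nodes $\bar1,\dots,\bar n$). The product $xy$ of diagrams is obtained by placing $x$ on top of $y$, identifying southern node $\bar i$ of $x$ with northern node $i$ of $y$, removing the $s$ connected components not connected to the northern nodes of $x$ or the southern nodes of $y$, and multiplying the resulting diagram by $\delta^s$. A block of a set-partition is propagating if it contains both a northern and a southern node. Partitions. $\Lambda_m$ is the set of partitions of $m$, $\Lambda_{\leq n}=\bigcup_{0\le m\le n}\Lambda_m$, and $|\lambda|$ is the sum of the parts of $\lambda$. A partition is $p$-regular if no non-zero part is repeated $p$ or more times; $\Lambda_{\leq n}^*\subseteq\Lambda_{\leq n}$ is the subset of $p$-regular partitions. Cell modules. For $\lambda\in\Lambda_{\leq n}$ with $|\lambda|=n-t$, the cell module is $\Delta_\lambda^F(n;\delta)=V^F(n,n-t)\otimes_{F\mathfrak{S}_{n-t}}S^\lambda_F$, where $V^F(n,n-t)$ has basis the diagrams with exactly $n-t$ propagating blocks in which $\bar1,\dots,\bar t$ are singleton blocks,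 $\mathfrak{S}_{n-t}$ acts on the right by permuting the $n-t$ rightmost southern nodes, and $S^\lambda_F$ is the (James) Specht module. A diagram $x$ acts by $x(v\otimes s)=(xv)\otimes s$ if the concatenation of $x$ and $v$ has $n-t$ propagating blocks, and by $0$ otherwise. For $F=k$ of characteristic $p$ and $\delta\neq0$, $\Delta_\lambda^k(n;\delta)$ has a simple head $L_\lambda^k(n;\delta)$ for each $\lambda\in\Lambda^*_{\leq n}$, and these form a complete set of non-isomorphic simple $P_n^k(\delta)$-modules. Cell-blocks. The cell-blocks of $P_n^k(\delta)$ are the classes of the equivalence relation on $\Lambda_{\leq n}$ generated by relating $\mu\in\Lambda_{\leq n}$ and $\lambda\in\Lambda^*_{\leq n}$ whenever the composition multiplicity $[\Delta_\mu^k(n;\delta):L_\lambda^k(n;\delta)]\neq0$. $\mathcal{B}_\lambda(P_n^k(\delta))$ is the cell-block containing $\lambda$. For $\lambda\in\Lambda_{\leq n}$ put $\hat\lambda=(-|\lambda|,\lambda_1,\dots,\lambda_n)$ (with $\lambda_i=0$ beyond the length of $\lambda$) and $\rho_n(\delta)=(\delta,-1,-2,\dots,-n)$, both regarded as $(n+1)$-tuples of elements of $k$ indexed by $0,\dots,n$. For such tuples $x\sim_k y$ means there is a permutation $\sigma$ of $\{0,\dots,n\}$ with $x_i=y_{\sigma(i)}$ in $k$ for all $0\le i\le n$. *)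

theory Defs
  imports
    "HOL-Algebra.Module"
    "HOL-Algebra.AbelCoset"
    "HOL-Combinatorics.Permutations"
    "HOL-Library.Disjoint_Sets"
    "HOL-Library.Function_Algebras"
    "HOL-Computational_Algebra.Polynomial"
begin

section \<open>Left modules over a not necessarily commutative ring\<close>

text \<open>
  Modules are records over rings of \<open>HOL-Algebra\<close>. The library locale \<open>module\<close> is for commutative
  rings only, but \<open>submodule\<close> is not. The fields \<open>mult\<close> and \<open>one\<close>, which the record inherits from
  rings, are meaningless for modules and are left \<open>undefined\<close>.
\<close>

definition quot_module :: "('a, 'b) module \<Rightarrow> 'b set \<Rightarrow> ('a, 'b set) module" where
  "quot_module M N =
     \<lparr>carrier = a_rcosets\<^bsub>M\<^esub> N, monoid.mult = undefined, one = undefined,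
      zero = N, add = set_add M,
      module.smult = (\<lambda>a X. \<Union>x\<in>X. N +>\<^bsub>M\<^esub> (a \<odot>\<^bsub>M\<^esub> x))\<rparr>"

definition module_isomorphic :: "'a ring \<Rightarrow> ('a, 'b) module \<Rightarrow> ('a, 'c) module \<Rightarrow> bool" where
  "module_isomorphic R M N \<longleftrightarrow>
     (\<exists>f. bij_betw f (carrier M) (carrier N) \<and>
          (\<forall>x\<in>carrier M. \<forall>y\<in>carrier M. f (x \<oplus>\<^bsub>M\<^esub> y) = f x \<oplus>\<^bsub>N\<^esub> f y) \<and>
          (\<forall>a\<in>carrier R. \<forall>x\<in>carrier M. f (a \<odot>\<^bsub>M\<^esub> x) = a \<odot>\<^bsub>N\<^esub> f x))"

definition simple_module :: "'a ring \<Rightarrow> ('a, 'b) module \<Rightarrow> bool" where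
  "simple_module R M \<longleftrightarrow>
     carrier M \<noteq> {\<zero>\<^bsub>M\<^esub>} \<and> (\<forall>N. submodule N R M \<longrightarrow> N = {\<zero>\<^bsub>M\<^esub>} \<or> N = carrier M)"

definition maximal_submodule :: "'a ring \<Rightarrow> ('a, 'b) module \<Rightarrow> 'b set \<Rightarrow> bool" where
  "maximal_submodule R M N \<longleftrightarrow>
     submodule N R M \<and> N \<noteq> carrier M \<and>
     (\<forall>N'. submodule N' R M \<and> N \<subseteq> N' \<longrightarrow> N' = N \<or> N' = carrier M)"

definition radical :: "'a ring \<Rightarrow> ('a, 'b) module \<Rightarrow> 'b set" where
  "radical R M = carrier M \<inter> \<Inter> {N. maximal_submodule R M N}"

definition head :: "'a ring \<Rightarrow> ('a, 'b) module \<Rightarrow> ('a, 'b set) module" where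
  "head R M = quot_module M (radical R M)"

definition series_factor :: "('a, 'b) module \<Rightarrow> 'b set list \<Rightarrow> nat \<Rightarrow> ('a, 'b set) module" where
  "series_factor M Ns i = quot_module (M\<lparr>carrier := Ns ! Suc i\<rparr>) (Ns ! i)"

definition composition_series :: "'a ring \<Rightarrow> ('a, 'b) module \<Rightarrow> 'b set list \<Rightarrow> bool" where
  "composition_series R M Ns \<longleftrightarrow>
     Ns \<noteq> [] \<and> hd Ns = {\<zero>\<^bsub>M\<^esub>} \<and> last Ns = carrier M \<and>
     (\<forall>N\<in>set Ns. submodule N R M) \<and>
     (\<forall>i. Suc i < length Ns \<longrightarrow>
        Ns ! i \<subseteq> Ns ! Suc i \<and> simple_module R (series_factor M Ns i))"

text \<open>
  By the Jordan--Hoelder theorem the choice of the composition series is immaterial. The notion is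
  meaningful only for modules that have a composition series, such as the finite-dimensional
  cell modules below.
\<close>

definition composition_multiplicity ::
    "'a ring \<Rightarrow> ('a, 'b) module \<Rightarrow> ('a, 'c) module \<Rightarrow> nat" where
  "composition_multiplicity R M L =
     (SOME m. \<exists>Ns. composition_series R M Ns \<and>
        m = card {i. Suc i < length Ns \<and> module_isomorphic R (series_factor M Ns i) L})"


section \<open>The partition algebra\<close>

text \<open>\<^term>\<open>Inl i\<close> is the northern node \<open>i\<close>, and \<^term>\<open>Inr i\<close> is the southern node \<open>i\<close>.\<close>

type_synonym node = "nat + nat"
type_synonym diagram = "node set set"

definition diagrams :: "nat \<Rightarrow> diagram set" where
  "diagrams n = {d. partition_on ({1..n} <+> {1..n}) d}"

definition propagating :: "node set \<Rightarrow> bool" where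
  "propagating B \<longleftrightarrow> (\<exists>i. Inl i \<in> B) \<and> (\<exists>j. Inr j \<in> B)"

definition num_propagating :: "diagram \<Rightarrow> nat" where
  "num_propagating d = card {B\<in>d. propagating B}"

text \<open>
  Placing \<open>x\<close> on top of \<open>y\<close> yields three rows of nodes, of type \<^typ>\<open>nat + (nat + nat)\<close>: the northern
  nodes \<^term>\<open>Inl i\<close> of \<open>x\<close>, the middle nodes \<^term>\<open>Inr (Inl i)\<close>, where the southern nodes of \<open>x\<close>
  and the northern nodes of \<open>y\<close> are identified, and the southern nodes \<^term>\<open>Inr (Inr i)\<close> of \<open>y\<close>.
  The map \<^term>\<open>map_sum id Inr\<close> embeds the nodes of the resulting diagram as the outer rows.
\<close>

definition stacked_blocks :: "diagram \<Rightarrow> diagram \<Rightarrow> (nat + node) set set" where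
  "stacked_blocks x y = (\<lambda>B. map_sum id Inl ` B) ` x \<union> (\<lambda>B. Inr ` B) ` y"

definition stacked_components :: "diagram \<Rightarrow> diagram \<Rightarrow> (nat + node) set set" where
  "stacked_components x y =
     \<Union> (stacked_blocks x y) // (\<Union>B\<in>stacked_blocks x y. B \<times> B)\<^sup>+"

definition outer_nodes :: "(nat + node) set \<Rightarrow> node set" where
  "outer_nodes C = map_sum id Inr -` C"

definition concat_diagram :: "diagram \<Rightarrow> diagram \<Rightarrow> diagram" where
  "concat_diagram x y = outer_nodes ` stacked_components x y - {{}}"

definition num_removed :: "diagram \<Rightarrow> diagram \<Rightarrow> nat" where
  "num_removed x y = card {C\<in>stacked_components x y. outer_nodes C = {}}"

definition id_diagram :: "nat \<Rightarrow> diagram" where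
  "id_diagram n = (\<lambda>i. {Inl i, Inr i}) ` {1..n}"

text \<open>The element \<open>a\<close> stands for the linear combination of the diagrams \<open>d\<close> with coefficients \<open>a d\<close>.\<close>

definition partition_algebra :: "nat \<Rightarrow> 'k::field \<Rightarrow> (diagram \<Rightarrow> 'k) ring" where
  "partition_algebra n \<delta> =
     \<lparr>carrier = {a. \<forall>d. d \<notin> diagrams n \<longrightarrow> a d = 0},
      monoid.mult = (\<lambda>a b d. \<Sum>(x, y) \<in> {(x, y) \<in> diagrams n \<times> diagrams n. concat_diagram x y = d}.
                a x * b y * \<delta> ^ num_removed x y),
      one = (\<lambda>d. if d = id_diagram n then 1 else 0),
      zero = (\<lambda>d. 0),
      add = (\<lambda>a b d. a d + b d)\<rparr>"


section \<open>Integer partitions\<close>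

text \<open>A partition is the weakly decreasing list of its non-zero parts.\<close>

definition partitions :: "nat \<Rightarrow> nat list set" where
  "partitions m = {lam. sorted_wrt (\<ge>) lam \<and> 0 \<notin> set lam \<and> sum_list lam = m}"

definition partitions_upto :: "nat \<Rightarrow> nat list set" where
  "partitions_upto n = (\<Union>m\<in>{0..n}. partitions m)"

definition p_regular :: "nat \<Rightarrow> nat list \<Rightarrow> bool" where
  "p_regular p lam \<longleftrightarrow> (\<forall>i\<in>set lam. count_list lam i < p)"

definition part :: "nat list \<Rightarrow> nat \<Rightarrow> nat" where
  "part lam i = (if 1 \<le> i \<and> i \<le> length lam then lam ! (i - 1) else 0)"


section \<open>Specht modules\<close>

text \<open>
  A \<open>lam\<close>-tableau is the list of its rows. Since tableaux have distinct entries, their classes under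
  row equivalence (tabloids) are given by the lists of the sets of entries of the rows.
  Permutations compose as functions, and act on the left on entries.
\<close>

type_synonym tableau = "nat list list"
type_synonym tabloid = "nat set list"

definition tableaux :: "nat list \<Rightarrow> tableau set" where
  "tableaux lam = {t. map length t = lam \<and> distinct (concat t) \<and> set (concat t) = {1..sum_list lam}}"

definition tabloid_of :: "tableau \<Rightarrow> tabloid" where
  "tabloid_of t = map set t"

definition perm_tabloid :: "(nat \<Rightarrow> nat) \<Rightarrow> tabloid \<Rightarrow> tabloid" where
  "perm_tabloid \<sigma> T = map (\<lambda>r. \<sigma> ` r) T"

definition column :: "tableau \<Rightarrow> nat \<Rightarrow> nat set" where
  "column t j = {r ! j | r. r \<in> set t \<and> j < length r}"

definition column_stabilizer :: "nat list \<Rightarrow> tableau \<Rightarrow> (nat \<Rightarrow> nat) set" where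
  "column_stabilizer lam t =
     {\<sigma>. \<sigma> permutes {1..sum_list lam} \<and> (\<forall>j. \<sigma> ` column t j = column t j)}"

definition polytabloid :: "nat list \<Rightarrow> tableau \<Rightarrow> tabloid \<Rightarrow> 'k::field" where
  "polytabloid lam t =
     (\<lambda>T. \<Sum>\<sigma>\<in>column_stabilizer lam t.
            if T = perm_tabloid \<sigma> (tabloid_of t) then of_int (sign \<sigma>) else 0)"

text \<open>
  James's Specht module: the subspace of the permutation module on tabloids that is spanned by the
  polytabloids. Here \<open>Modules.module.span\<close> is the library's linear span, for the pointwise scalar
  multiplication.
\<close>

definition specht :: "nat list \<Rightarrow> (tabloid \<Rightarrow> 'k::field) set" where
  "specht lam = Modules.module.span (\<lambda>c s T. c * s T) (polytabloid lam ` tableaux lam)"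

text \<open>The linear extension of the left action \<^const>\<open>perm_tabloid\<close>.\<close>

definition perm_specht :: "(nat \<Rightarrow> nat) \<Rightarrow> (tabloid \<Rightarrow> 'k::field) \<Rightarrow> tabloid \<Rightarrow> 'k" where
  "perm_specht \<sigma> s = (\<lambda>T. s (perm_tabloid (inv_into UNIV \<sigma>) T))"


section \<open>Cell modules\<close>

text \<open>The basis of \<open>V(n, m)\<close>, where \<open>m = n - t\<close>.\<close>

definition half_diagrams :: "nat \<Rightarrow> nat \<Rightarrow> diagram set" where
  "half_diagrams n m =
     {v \<in> diagrams n. num_propagating v = m \<and> (\<forall>i\<in>{1..n - m}. {Inr i} \<in> v)}"

text \<open>
  The right action of \<open>\<sigma>\<close>, a permutation of \<open>{1..m}\<close>, on \<open>V(n, m)\<close>: it moves the southern node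
  \<open>n - m + \<sigma> i\<close> to \<open>n - m + i\<close>. The inverse makes this a right action for the composition of
  functions; it is right multiplication by the diagram that joins the northern node
  \<open>n - m + \<sigma> i\<close> to the southern node \<open>n - m + i\<close>.
\<close>

definition perm_half_diagram ::
    "nat \<Rightarrow> nat \<Rightarrow> diagram \<Rightarrow> (nat \<Rightarrow> nat) \<Rightarrow> diagram" where
  "perm_half_diagram n m v \<sigma> =
     (\<lambda>B. map_sum id (\<lambda>j. if j \<le> n - m then j else n - m + inv_into UNIV \<sigma> (j - (n - m))) ` B) ` v"

text \<open>
  The tensor product over the field, of \<open>V(n, |lam|)\<close> and the Specht module: as the former has a basis
  of diagrams, the elements are the families \<open>f\<close> of elements of the Specht module indexed by these
  diagrams, where \<open>f\<close> stands for the sum of the tensors \<open>v \<otimes> f v\<close>.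
  The action of diagrams \<open>x\<close> is \<open>x (v \<otimes> s) = (x v) \<otimes> s\<close> if the concatenation \<open>w\<close> of \<open>x\<close> and
  \<open>v\<close> has \<open>|lam|\<close> propagating blocks (so that \<open>w\<close> is again in the basis), and \<open>0\<close> otherwise.
\<close>

definition cell_tensor ::
    "nat \<Rightarrow> 'k::field \<Rightarrow> nat list \<Rightarrow> (diagram \<Rightarrow> 'k, diagram \<Rightarrow> tabloid \<Rightarrow> 'k) module" where
  "cell_tensor n \<delta> lam =
     \<lparr>carrier = {f. \<forall>v. if v \<in> half_diagrams n (sum_list lam) then f v \<in> specht lam
                        else f v = (\<lambda>T. 0)},
      monoid.mult = undefined, one = undefined,
      zero = (\<lambda>v T. 0),
      add = (\<lambda>f g v T. f v T + g v T),
      module.smult = (\<lambda>a f w T.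
        if num_propagating w = sum_list lam then
          \<Sum>(x, v) \<in> {(x, v) \<in> diagrams n \<times> half_diagrams n (sum_list lam). concat_diagram x v = w}.
             a x * \<delta> ^ num_removed x v * f v T
        else 0)\<rparr>"

definition pure_tensor :: "diagram \<Rightarrow> (tabloid \<Rightarrow> 'k::field) \<Rightarrow> diagram \<Rightarrow> tabloid \<Rightarrow> 'k" where
  "pure_tensor v s = (\<lambda>w T. if w = v then s T else 0)"

text \<open>The subspace to be factored out to obtain the tensor product over the group algebra.\<close>

definition balancing_relations ::
    "nat \<Rightarrow> nat list \<Rightarrow> (diagram \<Rightarrow> tabloid \<Rightarrow> 'k::field) set" where
  "balancing_relations n lam =
     Modules.module.span (\<lambda>c f v T. c * f v T)
       {pure_tensor (perm_half_diagram n (sum_list lam) v \<sigma>) s - pure_tensor v (perm_specht \<sigma> s) | v \<sigma> s.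
          v \<in> half_diagrams n (sum_list lam) \<and> \<sigma> permutes {1..sum_list lam} \<and> s \<in> specht lam}"

definition cell_module ::
    "nat \<Rightarrow> 'k::field \<Rightarrow> nat list \<Rightarrow> (diagram \<Rightarrow> 'k, (diagram \<Rightarrow> tabloid \<Rightarrow> 'k) set) module" where
  "cell_module n \<delta> lam = quot_module (cell_tensor n \<delta> lam) (balancing_relations n lam)"

definition simple_head ::
    "nat \<Rightarrow> 'k::field \<Rightarrow> nat list \<Rightarrow> (diagram \<Rightarrow> 'k, (diagram \<Rightarrow> tabloid \<Rightarrow> 'k) set set) module" where
  "simple_head n \<delta> lam = head (partition_algebra n \<delta>) (cell_module n \<delta> lam)"


section \<open>Cell-blocks\<close>

text \<open>
  The prime \<open>p\<close> is the characteristic of the field. The definition is meant for prime characteristic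
  and \<open>\<delta> \<noteq> 0\<close>; only then are the simple modules indexed by all \<open>p\<close>-regular partitions.
\<close>

definition cell_linked :: "nat \<Rightarrow> 'k::field \<Rightarrow> nat list rel" where
  "cell_linked n \<delta> =
     {(\<mu>, lam). \<mu> \<in> partitions_upto n \<and> lam \<in> partitions_upto n \<and> p_regular CHAR('k) lam \<and>
       composition_multiplicity (partition_algebra n \<delta>) (cell_module n \<delta> \<mu>) (simple_head n \<delta> lam) \<noteq> 0}"

definition cell_block_rel :: "nat \<Rightarrow> 'k::field \<Rightarrow> nat list rel" where
  "cell_block_rel n \<delta> =
     Restr ((cell_linked n \<delta> \<union> (cell_linked n \<delta>)\<inverse>)\<^sup>*) (partitions_upto n)"

definition cell_block :: "nat \<Rightarrow> 'k::field \<Rightarrow> nat list \<Rightarrow> nat list set" where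
  "cell_block n \<delta> lam = cell_block_rel n \<delta> `` {lam}"


section \<open>Weights\<close>

text \<open>Tuples indexed by \<open>0, \<dots>, n\<close> are functions on \<^typ>\<open>nat\<close> of which only these values are used.\<close>

definition hat :: "nat list \<Rightarrow> nat \<Rightarrow> 'k::field" where
  "hat lam i = (if i = 0 then - of_nat (sum_list lam) else of_nat (part lam i))"

definition rho :: "'k::field \<Rightarrow> nat \<Rightarrow> 'k" where
  "rho \<delta> i = (if i = 0 then \<delta> else - of_nat i)"

definition perm_equiv :: "nat \<Rightarrow> (nat \<Rightarrow> 'k) \<Rightarrow> (nat \<Rightarrow> 'k) \<Rightarrow> bool" where
  "perm_equiv n x y \<longleftrightarrow> (\<exists>\<sigma>. \<sigma> permutes {0..n} \<and> (\<forall>i\<in>{0..n}. x i = y (\<sigma> i)))"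

end

theory Submission
  imports Defs
begin

text \<open>
  For an integer \<open>\<delta> = N\<close> the partition algebra acts on the \<open>n\<close>-th tensor power of the natural
  representation of the symmetric group on \<open>N\<close> colours, and it contains the action of the central
  element \<open>\<Sum>\<sigma>. T ^ cyc \<sigma> \<cdot> \<sigma>\<close>. Up to a common factor, the coefficients in the basis of diagrams are
  polynomials in \<open>N\<close> and \<open>T\<close> over the integers, so they define an element of the algebra for all
  \<open>\<delta>\<close> and \<open>T\<close> in \<open>k\<close>. It acts on the cell module of \<open>\<lambda>\<close> by the scalar
  \<open>F(T) = (\<Prod>|\<lambda>| < j \<le> n. T + \<delta> - j) (\<Prod>(r, c) \<in> \<lambda>. T - 1 + c - r)\<close>, with rows and columns counted
  from \<open>0\<close>. Hence \<open>F\<close> is constant on cell-blocks, and by telescoping \<open>F(T + 1) / F(T)\<close> determines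
  the multiset of the entries of the shifted weight of \<open>\<lambda>\<close>.
\<close>

section \<open>Closed orbits of finite relations\<close>

text \<open>The weight \<open>T ^ cyc \<sigma>\<close> is a class function. In the group algebra of
  a symmetric group the sum of all \<open>T ^ cyc \<sigma> \<cdot> \<sigma>\<close> is the product
  of \<open>T + J\<close> over the Jucys-Murphy elements \<open>J\<close>, whose eigenvalues are
  contents; this is the origin of the content product. In characteristic \<open>p\<close> Specht
  modules are neither simple nor separated by characters, so the scalar is computed directly on
  polytabloids, with all sign cancellations carried out in the integers. The passage from
  \<open>T\<close> to \<open>T - 1\<close> comes from an inclusion-exclusion that discards diagrams
  with fewer propagating blocks. Two divisions have to be kept harmless. The common factor, a
  product of terms \<open>T + j\<close>, may vanish in \<open>k\<close>; it is cancelled over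
  polynomials with integer coefficients, before specialization. The scalar \<open>F\<close> may
  vanish at some \<open>T\<close>; the telescoping is therefore stated as an identity of products,
  and \<open>F\<close> is cancelled as a nonzero polynomial. If two cell modules had different
  scalars, a linear combination of the element and the identity would annihilate one of them and fix
  the other pointwise, so the head of the second could not be a composition factor of the
  first.\<close>

definition closed_orbits :: "'a rel \<Rightarrow> 'a set set" where
  "closed_orbits g = {g\<^sup>+ `` {x} | x. (x, x) \<in> g\<^sup>+}"

lemma closed_orbitsI: "(x, x) \<in> g\<^sup>+ \<Longrightarrow> g\<^sup>+ `` {x} \<in> closed_orbits g"
  unfolding closed_orbits_def by auto

lemma closed_orbitsE:
  assumes "C \<in> closed_orbits g"
  obtains x where "(x, x) \<in> g\<^sup>+" "C = g\<^sup>+ `` {x}"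
  using assms unfolding closed_orbits_def by auto

text \<open>Open paths count for nothing. This makes the number of cycles meaningful for partial
  maps as well, and adding an edge changes it only when the edge closes a path.\<close>

definition cyc :: "'a rel \<Rightarrow> nat" where
  "cyc g = card (closed_orbits g)"

text \<open>A finite relation of this kind is a disjoint union of paths and cycles, that is, a piece
  of the graph of a permutation.\<close>

definition partial_inj :: "'a rel \<Rightarrow> bool" where
  "partial_inj g \<longleftrightarrow> single_valued g \<and> single_valued (g\<inverse>)"

lemma partial_injI:
  assumes "\<And>x y z. (x, y) \<in> g \<Longrightarrow> (x, z) \<in> g \<Longrightarrow> y = z"
    and "\<And>x y z. (x, z) \<in> g \<Longrightarrow> (y, z) \<in> g \<Longrightarrow> x = y"
  shows "partial_inj g"
  unfolding partial_inj_def single_valued_def using assms by blast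

lemma partial_injD:
  assumes "partial_inj g"
  shows "(x, y) \<in> g \<Longrightarrow> (x, z) \<in> g \<Longrightarrow> y = z" "(x, z) \<in> g \<Longrightarrow> (y, z) \<in> g \<Longrightarrow> x = y"
  using assms unfolding partial_inj_def single_valued_def by simp_all

lemma partial_inj_subset: "partial_inj g \<Longrightarrow> h \<subseteq> g \<Longrightarrow> partial_inj h"
  by (rule partial_injI) (blast dest: partial_injD)+

lemma partial_inj_insertI:
  assumes "partial_inj g" "a \<notin> Domain g" "b \<notin> Range g"
  shows "partial_inj (insert (a, b) g)"
proof (rule partial_injI)
  show "y = z" if "(x, y) \<in> insert (a, b) g" "(x, z) \<in> insert (a, b) g" for x y z
    using that assms(2) partial_injD(1)[OF assms(1), of x y z] by (auto dest: DomainI)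
  show "x = y" if "(x, z) \<in> insert (a, b) g" "(y, z) \<in> insert (a, b) g" for x y z
    using that assms(3) partial_injD(2)[OF assms(1), of x z y] by (auto dest: RangeI)
qed

text \<open>Successors are unique, so a walk that starts on a cycle can never leave it.\<close>

lemma single_valued_cycle_closed:
  assumes "single_valued g" "(x, x) \<in> g\<^sup>+" "(x, y) \<in> g\<^sup>*"
  shows "(y, x) \<in> g\<^sup>+"
  using assms(3)
proof (induction rule: rtrancl_induct)
  case base
  then show ?case by (fact assms(2))
next
  case (step y z)
  from \<open>(y, x) \<in> g\<^sup>+\<close> obtain z' where "(y, z') \<in> g" "(z', x) \<in> g\<^sup>*"
    by (meson tranclD)
  with step.hyps assms(1) have "(z, x) \<in> g\<^sup>*"
    by (metis single_valuedD)
  then show ?case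
    using assms(2) by (metis rtranclD)
qed

lemma closed_orbits_subset_Domain:
  assumes "single_valued g" "C \<in> closed_orbits g"
  shows "C \<subseteq> Domain g"
proof
  fix y assume "y \<in> C"
  with assms(2) obtain x where "(x, x) \<in> g\<^sup>+" "(x, y) \<in> g\<^sup>+"
    unfolding closed_orbits_def by auto
  then have "(y, x) \<in> g\<^sup>+"
    using single_valued_cycle_closed[OF assms(1)] by (meson trancl_into_rtrancl)
  then show "y \<in> Domain g" by (metis Domain.DomainI tranclD)
qed

lemma closed_orbit_nonempty: "C \<in> closed_orbits g \<Longrightarrow> C \<noteq> {}"
  unfolding closed_orbits_def by auto

lemma closed_orbit_eq:
  assumes "single_valued g" "C \<in> closed_orbits g" "y \<in> C"
  shows "C = g\<^sup>+ `` {y}" "(y, y) \<in> g\<^sup>+"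
proof -
  obtain x where x: "(x, x) \<in> g\<^sup>+" "C = g\<^sup>+ `` {x}" "(x, y) \<in> g\<^sup>+"
    using assms(2,3) unfolding closed_orbits_def by auto
  then have "(y, x) \<in> g\<^sup>+"
    using single_valued_cycle_closed[OF assms(1)] by (meson trancl_into_rtrancl)
  with x show "C = g\<^sup>+ `` {y}" "(y, y) \<in> g\<^sup>+"
    by (blast intro: trancl_trans)+
qed

lemma finite_closed_orbits: "finite g \<Longrightarrow> finite (closed_orbits g)"
proof -
  assume "finite g"
  then have "finite (Domain g)"
    by (simp add: finite_Domain)
  moreover have "closed_orbits g \<subseteq> (\<lambda>x. g\<^sup>+ `` {x}) ` Domain g"
    unfolding closed_orbits_def by (force dest: tranclD)
  ultimately show ?thesis
    by (meson finite_imageI finite_subset)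
qed

text \<open>As \<open>a\<close> has no successor in \<open>g\<close>, no old cycle passes through
  it, and the old cycles survive unchanged. A new cycle has to use the new edge, hence needs an old
  path from \<open>b\<close> back to \<open>a\<close>.\<close>

lemma closed_orbits_insert:
  assumes sv: "single_valued g" and a: "a \<notin> Domain g"
  shows "closed_orbits (insert (a, b) g) =
    (if (b, a) \<in> g\<^sup>* then insert (g\<^sup>* `` {b}) (closed_orbits g) else closed_orbits g)"
proof -
  let ?g = "insert (a, b) g"
  have no: "(x, a) \<notin> g\<^sup>*" if "(x, x) \<in> g\<^sup>+" for x
    using single_valued_cycle_closed[OF sv that] a by (metis DomainI tranclD)
  have tr: "?g\<^sup>+ = g\<^sup>+ \<union> {(p, q). (p, a) \<in> g\<^sup>* \<and> (b, q) \<in> g\<^sup>*}"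
    by (rule trancl_insert)
  have old: "?g\<^sup>+ `` {x} = g\<^sup>+ `` {x}" if "(x, x) \<in> g\<^sup>+" for x
    using no[OF that] unfolding tr by auto
  have new: "?g\<^sup>+ `` {x} = g\<^sup>* `` {b}" if "(x, a) \<in> g\<^sup>*" "(b, x) \<in> g\<^sup>*" for x
    using that unfolding tr by (auto intro: rtrancl_trans trancl_into_rtrancl)
  have refl: "(x, x) \<in> ?g\<^sup>+ \<longleftrightarrow> (x, x) \<in> g\<^sup>+ \<or> (x, a) \<in> g\<^sup>* \<and> (b, x) \<in> g\<^sup>*" for x
    unfolding tr by auto
  have 1: "C \<in> closed_orbits ?g" if "C \<in> closed_orbits g" for C
    using that 
  proof (rule closed_orbitsE)
    fix x assume x: "(x, x) \<in> g\<^sup>+" "C = g\<^sup>+ `` {x}"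
    then have "(x, x) \<in> ?g\<^sup>+" using refl by simp
    then show ?thesis using closed_orbitsI[of x ?g] x old by simp
  qed
  have 2: "C \<in> closed_orbits g \<or> (b, a) \<in> g\<^sup>* \<and> C = g\<^sup>* `` {b}" if "C \<in> closed_orbits ?g" for C
  proof -
    obtain x where x: "(x, x) \<in> ?g\<^sup>+" "C = ?g\<^sup>+ `` {x}"
      using \<open>C \<in> closed_orbits ?g\<close> by (auto elim: closed_orbitsE)
    show ?thesis
    proof (cases "(x, x) \<in> g\<^sup>+")
      case True
      then show ?thesis using x(2) old by (simp add: closed_orbitsI)
    next
      case False
      then have "(x, a) \<in> g\<^sup>*" "(b, x) \<in> g\<^sup>*" using refl x(1) by auto
      then show ?thesis using new x(2) by (meson rtrancl_trans)
    qed
  qed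
  have 3: "g\<^sup>* `` {b} \<in> closed_orbits ?g" if "(b, a) \<in> g\<^sup>*"
    using that new[of a] refl[of a] closed_orbitsI[of a ?g] by simp
  show ?thesis using 1 2 3 by auto
qed

lemma cyc_insert:
  assumes "finite g" "single_valued g" "a \<notin> Domain g"
  shows "cyc (insert (a, b) g) = cyc g + (if (b, a) \<in> g\<^sup>* then 1 else 0)"
proof -
  have "g\<^sup>* `` {b} \<notin> closed_orbits g" if "(b, a) \<in> g\<^sup>*"
    using closed_orbits_subset_Domain[OF assms(2)] that assms(3) by blast
  then show ?thesis
    unfolding cyc_def closed_orbits_insert[OF assms(2,3)]
    using finite_closed_orbits[OF assms(1)] by simp
qed

text \<open>Walking backwards from the end \<open>a\<close> of a path cannot run into a cycle, so it
  stops at a point without predecessor; predecessors are unique, so there is only one such point. It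
  is the only free target for an edge out of \<open>a\<close> that closes a cycle.\<close>

lemma path_start_unique:
  assumes "finite g" "partial_inj g" "a \<notin> Domain g"
  shows "\<exists>!b. b \<notin> Range g \<and> (b, a) \<in> g\<^sup>*"
proof (rule ex_ex1I)
  show "\<exists>b. b \<notin> Range g \<and> (b, a) \<in> g\<^sup>*"
    using assms
  proof (induction "card g" arbitrary: g a rule: less_induct)
    case less
    show ?case
    proof (cases "a \<in> Range g")
      case True
      then obtain a' where a': "(a', a) \<in> g" by auto
      let ?g = "g - {(a', a)}"
      have "a' \<notin> Domain ?g"
        using less.prems(2) a' unfolding partial_inj_def single_valued_def by auto
      moreover have "card ?g < card g"
        using a' less.prems(1) by (meson card_Diff1_less)
      ultimately obtain b where b: "b \<notin> Range ?g" "(b, a') \<in> ?g\<^sup>*"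
        using less.hyps[of ?g a'] less.prems by (meson Diff_subset finite_Diff partial_inj_subset)
      \<comment> \<open>The removed edge ends in \<open>a\<close>, so \<open>a\<close> itself is the
        one point that could wrongly look like a source after the removal.\<close>
      have "b \<noteq> a"
      proof
        assume "b = a"
        moreover have "a \<notin> Domain ?g" using less.prems(3) by auto
        ultimately have "a = a'" using b(2) by (metis DomainI converse_rtranclE)
        then show False using a' less.prems(3) by auto
      qed
      then have "b \<notin> Range g" using b(1) by auto
      moreover have "(b, a) \<in> g\<^sup>*"
        using b(2) a' by (meson Diff_subset rtrancl.rtrancl_into_rtrancl rtrancl_mono subsetD)
      ultimately show ?thesis by blast
    qed auto
  qed
next
  fix b b' assume b: "b \<notin> Range g \<and> (b, a) \<in> g\<^sup>*" and b': "b' \<notin> Range g \<and> (b', a) \<in> g\<^sup>*"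
  have "(b, b') \<in> g\<^sup>* \<or> (b', b) \<in> g\<^sup>*"
    using b b' single_valued_confluent[of "g\<inverse>"] assms(2) unfolding partial_inj_def
    by (metis converse_iff rtrancl_converse)
  then show "b = b'"
    using b b' by (metis Range.RangeI rtranclE)
qed

lemma cyc_image:
  assumes inj: "inj_on f (Field g)"
  shows "cyc (map_prod f f ` g) = cyc g"
proof -
  let ?g = "map_prod f f ` g"
  have F: "x \<in> Field g \<and> y \<in> Field g" if "(x, y) \<in> g\<^sup>+" for x y
    using that by (meson FieldI1 FieldI2 tranclD tranclD2)
  have fwd: "(f x, f y) \<in> ?g\<^sup>+" if "(x, y) \<in> g\<^sup>+" for x y
    using that by (induction rule: trancl_induct) (auto intro: trancl.intros)
  have bwd: "\<exists>x' y'. p = f x' \<and> q = f y' \<and> (x', y') \<in> g\<^sup>+" if "(p, q) \<in> ?g\<^sup>+" for p q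
    using that
  proof (induction rule: trancl_induct)
    case (step q r)
    then obtain x' y' y'' z' where *: "p = f x'" "q = f y'" "(x', y') \<in> g\<^sup>+" "q = f y''" "r = f z'" "(y'', z') \<in> g"
      by auto
    then have "y' = y''" using inj F by (metis FieldI1 inj_onD)
    with * show ?case by (metis trancl.trancl_into_trancl)
  qed auto
  have img: "?g\<^sup>+ `` {f x} = f ` (g\<^sup>+ `` {x})" if "x \<in> Field g" for x
  proof -
    have "y \<in> f ` (g\<^sup>+ `` {x})" if "(f x, y) \<in> ?g\<^sup>+" for y
      using bwd[OF that] inj F \<open>x \<in> Field g\<close> by (metis Image_singleton_iff imageI inj_onD)
    then show ?thesis using fwd by auto
  qed
  have refl: "(f x, f x) \<in> ?g\<^sup>+ \<longleftrightarrow> (x, x) \<in> g\<^sup>+" if "x \<in> Field g" for x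
    using bwd[of "f x" "f x"] fwd[of x x] inj F that by (metis inj_onD)
  have "closed_orbits ?g = (`) f ` closed_orbits g"
  proof (intro equalityI subsetI)
    fix C assume "C \<in> closed_orbits ?g"
    then obtain p where p: "(p, p) \<in> ?g\<^sup>+" "C = ?g\<^sup>+ `` {p}"
      using closed_orbitsE by blast
    then obtain x where x: "x \<in> Field g" "p = f x" using bwd F by meson
    then have "(x, x) \<in> g\<^sup>+" "C = f ` (g\<^sup>+ `` {x})" using p refl img by auto
    then show "C \<in> (`) f ` closed_orbits g" by (metis closed_orbitsI imageI)
  next
    fix C assume "C \<in> (`) f ` closed_orbits g"
    then obtain x where x: "(x, x) \<in> g\<^sup>+" "C = f ` (g\<^sup>+ `` {x})"
      by (auto elim: closed_orbitsE)
    then have "x \<in> Field g" using F by auto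
    then show "C \<in> closed_orbits ?g" 
      using x refl img[of x] closed_orbitsI[of "f x" ?g] by simp
  qed
  moreover have "inj_on ((`) f) (closed_orbits g)"
  proof (rule inj_on_subset)
    show "inj_on ((`) f) (Pow (Field g))"
      using inj by (rule inj_on_image_Pow)
    show "closed_orbits g \<subseteq> Pow (Field g)"
      using F by (auto elim!: closed_orbitsE)
  qed
  ultimately show ?thesis unfolding cyc_def by (simp add: card_image)
qed

lemma partial_inj_image:
  assumes "inj_on f (Field g)"
  shows "partial_inj (map_prod f f ` g) \<longleftrightarrow> partial_inj g"
proof -
  have F: "x \<in> Field g \<and> y \<in> Field g" if "(x, y) \<in> g" for x y
    using that by (meson FieldI1 FieldI2)
  have "partial_inj g" if "partial_inj (map_prod f f ` g)"
    unfolding partial_inj_def single_valued_def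
  proof (intro conjI allI impI)
    fix x y z assume "(x, y) \<in> g" "(x, z) \<in> g"
    then show "y = z" using that F assms unfolding partial_inj_def single_valued_def
      by (metis inj_onD map_prod_imageI)
  next
    fix x y z assume "(x, y) \<in> g\<inverse>" "(x, z) \<in> g\<inverse>"
    then show "y = z" using that F assms unfolding partial_inj_def single_valued_def
      by (metis converse_iff inj_onD map_prod_imageI)
  qed
  moreover have "partial_inj (map_prod f f ` g)" if "partial_inj g"
    unfolding partial_inj_def single_valued_def
  proof (intro conjI allI impI)
    fix x y z assume "(x, y) \<in> map_prod f f ` g" "(x, z) \<in> map_prod f f ` g"
    moreover obtain p q where "x = f p" "y = f q" "(p, q) \<in> g"
      using calculation(1) by auto
    moreover obtain p' r where "x = f p'" "z = f r" "(p', r) \<in> g"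
      using calculation(2) by auto
    ultimately have *: "x = f p" "y = f q" "x = f p'" "z = f r" "(p, q) \<in> g" "(p', r) \<in> g"
      by simp_all
    then have "p = p'" using F assms by (metis inj_onD)
    with * that show "y = z" unfolding partial_inj_def by (metis single_valuedD)
  next
    fix x y z assume "(x, y) \<in> (map_prod f f ` g)\<inverse>" "(x, z) \<in> (map_prod f f ` g)\<inverse>"
    moreover obtain p q where "x = f p" "y = f q" "(q, p) \<in> g"
      using calculation(1) by auto
    moreover obtain p' r where "x = f p'" "z = f r" "(r, p') \<in> g"
      using calculation(2) by auto
    ultimately have *: "x = f p" "y = f q" "x = f p'" "z = f r" "(q, p) \<in> g" "(r, p') \<in> g"
      by simp_all
    then have "p = p'" using F assms by (metis inj_onD)
    with * that show "y = z" unfolding partial_inj_def by (metis converse_iff single_valuedD)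
  qed
  ultimately show ?thesis by blast
qed

lemma inj_on_map_prod_Field:
  assumes "inj_on f (Field g)"
  shows "inj_on (map_prod f f) g"
proof (rule inj_onI)
  fix p q assume "p \<in> g" "q \<in> g" "map_prod f f p = map_prod f f q"
  then show "p = q"
    using assms by (cases p; cases q) (auto dest: inj_onD intro: FieldI1 FieldI2)
qed

lemma card_map_prod_image:
  "inj_on f (Field g) \<Longrightarrow> card (map_prod f f ` g) = card g"
  by (simp add: card_image inj_on_map_prod_Field)

text \<open>The restriction to \<open>X\<close> matters: fixed points inside \<open>X\<close> are
  loops and count as cycles, points outside do not.\<close>

definition perm_graph :: "'a set \<Rightarrow> ('a \<Rightarrow> 'a) \<Rightarrow> 'a rel" where
  "perm_graph X \<sigma> = (\<lambda>x. (x, \<sigma> x)) ` X"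

lemma finite_perm_graph [simp]: "finite X \<Longrightarrow> finite (perm_graph X \<sigma>)"
  by (simp add: perm_graph_def)

lemma Domain_perm_graph [simp]: "Domain (perm_graph X \<sigma>) = X"
  by (auto simp: perm_graph_def)

lemma Range_perm_graph [simp]: "Range (perm_graph X \<sigma>) = \<sigma> ` X"
  by (auto simp: perm_graph_def)

lemma single_valued_perm_graph [simp]: "single_valued (perm_graph X \<sigma>)"
  by (auto simp: perm_graph_def single_valued_def)

lemma partial_inj_card_Domain: "partial_inj g \<Longrightarrow> card (Domain g) = card g"
  unfolding Domain_fst by (rule card_image) (auto simp: inj_on_def dest: partial_injD)

lemma partial_inj_card_Range: "partial_inj g \<Longrightarrow> card (Range g) = card g"
  unfolding Range_snd by (rule card_image) (auto simp: inj_on_def dest: partial_injD)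

text \<open>The end of the extension process: when every point has its edge, nothing is left to
  choose.\<close>

lemma partial_inj_total:
  assumes fin: "finite X" and g: "partial_inj g" "g \<subseteq> X \<times> X" and dom: "Domain g = X"
  shows "\<exists>\<sigma>. {\<sigma>. \<sigma> permutes X \<and> (\<forall>(a, b)\<in>g. \<sigma> a = b)} = {\<sigma>} \<and> perm_graph X \<sigma> = g"
proof -
  define \<sigma> where "\<sigma> x = (if x \<in> X then THE y. (x, y) \<in> g else x)" for x
  have \<sigma>: "\<sigma> x = y" if "(x, y) \<in> g" for x y
    using that g partial_injD(1)[OF g(1)] unfolding \<sigma>_def by auto
  have ex: "(x, \<sigma> x) \<in> g" if "x \<in> X" for x
    using that dom \<sigma> by auto
  have "inj_on \<sigma> X"
    by (rule inj_onI) (metis ex partial_injD(2)[OF g(1)])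
  moreover have "\<sigma> ` X \<subseteq> X"
    using ex g(2) by auto
  ultimately have "bij_betw \<sigma> X X"
    using fin by (simp add: bij_betw_def endo_inj_surj)
  then have perm: "\<sigma> permutes X"
    by (rule bij_imp_permutes) (simp add: \<sigma>_def)
  have "\<tau> = \<sigma>" if "\<tau> permutes X" "\<forall>(a, b)\<in>g. \<tau> a = b" for \<tau>
  proof
    fix x show "\<tau> x = \<sigma> x"
      using that(2) ex[of x] permutes_not_in[OF that(1)] permutes_not_in[OF perm] by (cases "x \<in> X") auto
  qed
  then have "{\<sigma>. \<sigma> permutes X \<and> (\<forall>(a, b)\<in>g. \<sigma> a = b)} = {\<sigma>}"
    using perm \<sigma> by auto
  moreover have "perm_graph X \<sigma> = g"
    using ex \<sigma> g(2) dom unfolding perm_graph_def by (auto simp: image_iff)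
  ultimately show ?thesis by blast
qed

text \<open>The generating function of the number of cycles over all extensions of a partial injection:
  each further edge may be chosen in as many ways as there are targets left, exactly one of which
  closes a cycle.\<close>

lemma sum_cyc_extensions:
  fixes T :: "'r::comm_ring_1"
  assumes fin: "finite X"
  shows "partial_inj g \<Longrightarrow> g \<subseteq> X \<times> X \<Longrightarrow>
    (\<Sum>\<sigma> | \<sigma> permutes X \<and> (\<forall>(a, b)\<in>g. \<sigma> a = b). T ^ cyc (perm_graph X \<sigma>)) =
    T ^ cyc g * (\<Prod>j<card X - card g. T + of_nat j)"
proof (induction "card X - card g" arbitrary: g rule: less_induct)
  case less
  note g = less.prems
  have fing: "finite g" using g(2) fin by (meson finite_SigmaI finite_subset)
  have sv: "single_valued g" using g(1) by (simp add: partial_inj_def)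
  have DX: "Domain g \<subseteq> X" "Range g \<subseteq> X" using g(2) by auto
  let ?S = "\<lambda>g. {\<sigma>. \<sigma> permutes X \<and> (\<forall>(a, b)\<in>g. \<sigma> a = b)}"
  show ?case
  proof (cases "Domain g = X")
    case True
    obtain \<sigma> where "?S g = {\<sigma>}" "perm_graph X \<sigma> = g"
      using partial_inj_total[OF fin g True] by blast
    moreover have "card X = card g" using True partial_inj_card_Domain[OF g(1)] by simp
    ultimately show ?thesis by simp
  next
    case False
    then obtain a where a: "a \<in> X" "a \<notin> Domain g" using DX by auto
    define M where "M = card X - card g - 1"
    have "card (Domain g) < card X" using False DX(1) fin by (simp add: psubset_card_mono)
    then have M: "card X - card g = Suc M"
      using partial_inj_card_Domain[OF g(1)] by (simp add: M_def)
    have cR: "card (X - Range g) = Suc M"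
      using DX(2) fing fin partial_inj_card_Range[OF g(1)] M
      by (simp add: card_Diff_subset finite_Range)
    have finS: "finite (?S g)" by (rule finite_subset[OF _ finite_permutations[OF fin]]) auto
    have "(\<Sum>\<sigma>\<in>?S g. T ^ cyc (perm_graph X \<sigma>)) =
        (\<Sum>b\<in>X - Range g. \<Sum>\<sigma>\<in>{\<sigma>\<in>?S g. \<sigma> a = b}. T ^ cyc (perm_graph X \<sigma>))"
    proof (rule sum.group[symmetric, OF finS])
      show "finite (X - Range g)" using fin by simp
      have "\<sigma> a \<notin> Range g" if "\<sigma> permutes X" "\<forall>(a, b)\<in>g. \<sigma> a = b" for \<sigma>
      proof
        assume "\<sigma> a \<in> Range g"
        then obtain c where "(c, \<sigma> a) \<in> g" by auto
        moreover from this have "\<sigma> c = \<sigma> a" using that by auto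
        ultimately show False using a(2) permutes_inj[OF that(1)] by (auto dest: injD)
      qed
      then show "(\<lambda>\<sigma>. \<sigma> a) ` ?S g \<subseteq> X - Range g"
        using a(1) by (auto simp: permutes_in_image)
    qed
    also have "\<dots> = (\<Sum>b\<in>X - Range g. \<Sum>\<sigma>\<in>?S (insert (a, b) g). T ^ cyc (perm_graph X \<sigma>))"
      by (intro sum.cong refl) auto
    also have "\<dots> = (\<Sum>b\<in>X - Range g. T ^ cyc (insert (a, b) g) * (\<Prod>j<M. T + of_nat j))"
    proof (rule sum.cong[OF refl])
      fix b assume b: "b \<in> X - Range g"
      have "card (insert (a, b) g) = Suc (card g)" using a(2) fing by (auto simp: card_insert_if)
      then have "card X - card (insert (a, b) g) = M" using M by simp
      then show "(\<Sum>\<sigma>\<in>?S (insert (a, b) g). T ^ cyc (perm_graph X \<sigma>)) =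
          T ^ cyc (insert (a, b) g) * (\<Prod>j<M. T + of_nat j)"
        using less.hyps[of "insert (a, b) g"] M b a g
        by (simp add: partial_inj_insertI)
    qed
    also have "\<dots> = (\<Sum>b\<in>X - Range g. T ^ cyc (insert (a, b) g)) * (\<Prod>j<M. T + of_nat j)"
      by (simp add: sum_distrib_right)
    also have "(\<Sum>b\<in>X - Range g. T ^ cyc (insert (a, b) g)) = T ^ cyc g * (T + of_nat M)"
    proof -
      obtain b0 where b0: "b0 \<notin> Range g" "(b0, a) \<in> g\<^sup>*"
        and uniq: "\<And>b. b \<notin> Range g \<Longrightarrow> (b, a) \<in> g\<^sup>* \<Longrightarrow> b = b0"
        using path_start_unique[OF fing g(1) a(2)] by blast
      have b0X: "b0 \<in> X - Range g"
        using b0 a(1) DX(1) by (metis DiffI Domain.DomainI converse_rtranclE subsetD)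
      have "(\<Sum>b\<in>X - Range g. T ^ cyc (insert (a, b) g)) =
          T ^ cyc (insert (a, b0) g) + (\<Sum>b\<in>X - Range g - {b0}. T ^ cyc (insert (a, b) g))"
        using fin b0X by (simp add: sum.remove)
      also have "(\<Sum>b\<in>X - Range g - {b0}. T ^ cyc (insert (a, b) g)) =
          (\<Sum>b\<in>X - Range g - {b0}. T ^ cyc g)"
        using uniq by (intro sum.cong refl) (auto simp: cyc_insert[OF fing sv a(2)])
      also have "\<dots> = of_nat M * T ^ cyc g"
        using cR b0X fin by simp
      finally show ?thesis
        using b0(2) by (simp add: cyc_insert[OF fing sv a(2)] algebra_simps)
    qed
    finally show ?thesis unfolding M by (simp add: algebra_simps)
  qed
qed

section \<open>Inclusion-exclusion over the sources of edges\<close>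

lemma sum_Pow_power_card:
  fixes x :: "'r::comm_ring_1"
  assumes "finite A"
  shows "(\<Sum>S\<in>Pow A. x ^ card S) = (x + 1) ^ card A"
  using prod_add[OF assms, of "\<lambda>_. x" "\<lambda>_. 1"] by simp

lemma sum_Pow_sign:
  assumes "finite A"
  shows "(\<Sum>S\<in>Pow A. (- 1 :: 'r::comm_ring_1) ^ card S) = (if A = {} then 1 else 0)"
  using sum_Pow_power_card[OF assms, of "- 1 :: 'r"] assms by (simp add: power_0_left)

text \<open>Deleting the edges that leave \<open>A\<close> breaks every cycle through
  \<open>A\<close>. It creates none, because a cycle that remains already contains all edges leaving
  its points.\<close>

lemma closed_orbits_restrict:
  assumes sv: "single_valued g"
  shows "closed_orbits (g \<inter> (- A) \<times> UNIV) = {C \<in> closed_orbits g. C \<inter> A = {}}"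
proof -
  let ?h = "g \<inter> (- A) \<times> UNIV"
  have svh: "single_valued ?h" using sv by (auto simp: single_valued_def)
  have mono: "(x, y) \<in> g\<^sup>+" if "(x, y) \<in> ?h\<^sup>+" for x y
    using that by (rule trancl_mono) auto
  have 1: "?h\<^sup>+ `` {x} = g\<^sup>+ `` {x}" if x: "(x, x) \<in> ?h\<^sup>+" for x
  proof -
    have step: "(x, z) \<in> ?h\<^sup>+" if "(x, y) \<in> ?h\<^sup>*" "(y, z) \<in> g" for y z
    proof -
      have "(y, x) \<in> ?h\<^sup>+" using single_valued_cycle_closed[OF svh x that(1)] .
      then obtain z' where "(y, z') \<in> ?h" by (meson tranclD)
      moreover from this have "z' = z" using sv that(2) by (auto dest: single_valuedD)
      ultimately show ?thesis using that(1) by (meson rtrancl_into_trancl1)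
    qed
    have "(x, y) \<in> ?h\<^sup>+" if "(x, y) \<in> g\<^sup>+" for y
      using that
      by (induction rule: trancl_induct) (auto intro: step trancl_into_rtrancl)
    then show ?thesis using mono by auto
  qed
  have 2: "(x, y) \<in> ?h\<^sup>+" if x: "(x, x) \<in> g\<^sup>+" "g\<^sup>+ `` {x} \<inter> A = {}" and xy: "(x, y) \<in> g\<^sup>+" for x y
    using xy
  proof (induction rule: trancl_induct)
    case (base y)
    then show ?case using x by (intro trancl.r_into_trancl) auto
  next
    case (step y z)
    then have "(y, z) \<in> ?h" using x by auto
    with step.IH show ?case by (meson trancl.trancl_into_trancl)
  qed
  show ?thesis
  proof (intro equalityI subsetI)
    fix C assume C: "C \<in> closed_orbits ?h"
    then obtain x where x: "(x, x) \<in> ?h\<^sup>+" "C = ?h\<^sup>+ `` {x}" by (rule closed_orbitsE)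
    have "C \<subseteq> Domain ?h" using closed_orbits_subset_Domain[OF svh C] .
    then have "C \<inter> A = {}" by auto
    moreover have "C \<in> closed_orbits g"
      using x 1[OF x(1)] closed_orbitsI[OF mono[OF x(1)]] by simp
    ultimately show "C \<in> {C \<in> closed_orbits g. C \<inter> A = {}}" by simp
  next
    fix C assume "C \<in> {C \<in> closed_orbits g. C \<inter> A = {}}"
    then have C: "C \<in> closed_orbits g" "C \<inter> A = {}" by auto
    obtain x where x: "(x, x) \<in> g\<^sup>+" "C = g\<^sup>+ `` {x}" using C(1) by (rule closed_orbitsE)
    then have "(x, x) \<in> ?h\<^sup>+" using 2 C(2) by auto
    then show "C \<in> closed_orbits ?h" using 1 x(2) closed_orbitsI[of x ?h] by simp
  qed
qed

text \<open>Domain and range have equal size, so an inclusion between them is an equality. Then no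
  point is the start of an open path, and each component is a cycle.\<close>

lemma Union_closed_orbits:
  assumes fin: "finite g" and g: "partial_inj g"
  shows "Domain g \<subseteq> \<Union> (closed_orbits g) \<longleftrightarrow> Range g \<subseteq> Domain g"
proof
  have sv: "single_valued g" using g by (simp add: partial_inj_def)
  assume D: "Domain g \<subseteq> \<Union> (closed_orbits g)"
  show "Range g \<subseteq> Domain g"
  proof
    fix y assume "y \<in> Range g"
    then obtain x where xy: "(x, y) \<in> g" by auto
    then obtain C where C: "C \<in> closed_orbits g" "x \<in> C" using D by auto
    then have "y \<in> C" using closed_orbit_eq(1)[OF sv C] xy by auto
    then show "y \<in> Domain g" using closed_orbits_subset_Domain[OF sv C(1)] by auto
  qed
next
  assume R: "Range g \<subseteq> Domain g"
  then have RD: "Range g = Domain g"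
    using partial_inj_card_Domain[OF g] partial_inj_card_Range[OF g] fin
    by (simp add: card_subset_eq finite_Domain)
  show "Domain g \<subseteq> \<Union> (closed_orbits g)"
  proof
    fix a assume "a \<in> Domain g"
    then obtain b where ab: "(a, b) \<in> g" by auto
    let ?g = "g - {(a, b)}"
    have "a \<notin> Domain ?g" using ab partial_injD(1)[OF g] by auto
    then obtain b' where b': "b' \<notin> Range ?g" "(b', a) \<in> ?g\<^sup>*"
      using path_start_unique[of ?g a] fin partial_inj_subset[OF g, of ?g] by auto
    have "b' \<in> Domain g"
      using b'(2) \<open>a \<in> Domain g\<close> by (auto elim: converse_rtranclE)
    then have "b' \<in> Range g" using RD by simp
    with b'(1) have "b' = b" by auto
    then have "(b, a) \<in> g\<^sup>*" using b'(2) by (meson Diff_subset rtrancl_mono subsetD)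
    with ab have "(a, a) \<in> g\<^sup>+" by (meson rtrancl_into_trancl2)
    then show "a \<in> \<Union> (closed_orbits g)" using closed_orbitsI[of a g] by auto
  qed
qed

text \<open>The source of the shift from \<open>T\<close> to \<open>T - 1\<close>. Expanding
  \<open>((T - 1) + 1) ^ c\<close> over sets \<open>S\<close> of surviving cycles and exchanging the
  sums leaves, for each \<open>S\<close>, an alternating sum over the sets \<open>A\<close> of
  points not covered by \<open>S\<close>. It vanishes unless \<open>S\<close> covers the domain,
  which forces \<open>S\<close> to consist of all cycles and \<open>g\<close> to have no open
  path.\<close>

lemma signed_sum_cyc_restrict:
  fixes T :: "'r::comm_ring_1"
  assumes fin: "finite g" and g: "partial_inj g"
  shows "(\<Sum>A\<in>Pow (Domain g). (- 1) ^ card A * T ^ cyc (g \<inter> (- A) \<times> UNIV)) =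
    (if Range g \<subseteq> Domain g then (T - 1) ^ cyc g else 0)"
proof -
  let ?D = "Domain g" and ?O = "closed_orbits g"
  have sv: "single_valued g" using g by (simp add: partial_inj_def)
  have finO: "finite ?O" and finD: "finite ?D"
    using fin by (simp_all add: finite_closed_orbits finite_Domain)
  have "(\<Sum>A\<in>Pow ?D. (- 1) ^ card A * T ^ cyc (g \<inter> (- A) \<times> UNIV)) =
      (\<Sum>A\<in>Pow ?D. (- 1) ^ card A * (\<Sum>S\<in>Pow ?O. if \<Union>S \<inter> A = {} then (T - 1) ^ card S else 0))"
  proof (rule sum.cong[OF refl])
    fix A
    have "T ^ cyc (g \<inter> (- A) \<times> UNIV) = (\<Sum>S\<in>Pow {C \<in> ?O. C \<inter> A = {}}. (T - 1) ^ card S)"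
      using sum_Pow_power_card[of "{C \<in> ?O. C \<inter> A = {}}" "T - 1"] finO
      by (simp add: cyc_def closed_orbits_restrict[OF sv])
    also have "\<dots> = (\<Sum>S\<in>Pow ?O. if \<Union>S \<inter> A = {} then (T - 1) ^ card S else 0)"
      using finO by (intro sum.mono_neutral_cong_left) auto
    finally show "(- 1) ^ card A * T ^ cyc (g \<inter> (- A) \<times> UNIV) =
        (- 1) ^ card A * (\<Sum>S\<in>Pow ?O. if \<Union>S \<inter> A = {} then (T - 1) ^ card S else 0)"
      by simp
  qed
  also have "\<dots> = (\<Sum>S\<in>Pow ?O. (T - 1) ^ card S * (\<Sum>A\<in>Pow ?D. if \<Union>S \<inter> A = {} then (- 1) ^ card A else 0))"
    unfolding sum_distrib_left by (subst sum.swap) (intro sum.cong refl, auto)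
  also have "\<dots> = (\<Sum>S\<in>Pow ?O. (T - 1) ^ card S * (if ?D \<subseteq> \<Union>S then 1 else 0))"
  proof (rule sum.cong[OF refl])
    fix S
    have "(\<Sum>A\<in>Pow ?D. if \<Union>S \<inter> A = {} then (- 1 :: 'r) ^ card A else 0) = (\<Sum>A\<in>Pow (?D - \<Union>S). (- 1) ^ card A)"
      using finD by (intro sum.mono_neutral_cong_right) auto
    also have "\<dots> = (if ?D \<subseteq> \<Union>S then 1 else 0)"
      using finD by (subst sum_Pow_sign) auto
    finally show "(T - 1) ^ card S * (\<Sum>A\<in>Pow ?D. if \<Union>S \<inter> A = {} then (- 1) ^ card A else 0) =
        (T - 1) ^ card S * (if ?D \<subseteq> \<Union>S then 1 else 0)" by simp
  qed
  also have "\<dots> = (\<Sum>S\<in>Pow ?O. if S = ?O then (if ?D \<subseteq> \<Union>?O then (T - 1) ^ card S else 0) else 0)"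
  proof (rule sum.cong[OF refl])
    fix S assume S: "S \<in> Pow ?O"
    \<comment> \<open>Distinct cycles are disjoint, so the points of a cycle missing from
      \<open>S\<close> would remain uncovered.\<close>
    have "S = ?O" if D: "?D \<subseteq> \<Union>S"
    proof (rule ccontr)
      assume "S \<noteq> ?O"
      then obtain C where C: "C \<in> ?O" "C \<notin> S" using S by auto
      then obtain x where x: "x \<in> C" using closed_orbit_nonempty by blast
      then have "x \<in> \<Union>S" using D closed_orbits_subset_Domain[OF sv C(1)] by (meson subsetD)
      then obtain C' where "C' \<in> S" "x \<in> C'" by auto
      moreover have "C' \<in> ?O" using S \<open>C' \<in> S\<close> by (meson PowD subsetD)
      ultimately have "C' = C"
        using closed_orbit_eq(1)[OF sv, of C' x] closed_orbit_eq(1)[OF sv C(1) x] by (rule_tac trans) auto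
      then show False using C(2) \<open>C' \<in> S\<close> by simp
    qed
    note eq = this
    show "(T - 1) ^ card S * (if ?D \<subseteq> \<Union>S then 1 else 0) =
        (if S = ?O then (if ?D \<subseteq> \<Union>?O then (T - 1) ^ card S else 0) else 0)"
    proof (cases "S = ?O")
      case False
      then have "\<not> ?D \<subseteq> \<Union>S" using eq by metis
      with False show ?thesis by simp
    qed simp
  qed
  also have "\<dots> = (if ?D \<subseteq> \<Union>?O then (T - 1) ^ card ?O else 0)"
    using finO by (simp add: sum.delta)
  finally show ?thesis unfolding Union_closed_orbits[OF fin g] cyc_def .
qed

text \<open>Nothing leads into \<open>a\<close>, so the new edge lies on no cycle.\<close>

lemma cyc_insert_source:
  assumes "finite g" "single_valued g" "a \<notin> Domain g" "a \<notin> Range g" "b \<noteq> a"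
  shows "cyc (insert (a, b) g) = cyc g"
  using assms by (auto simp: cyc_insert elim: rtranclE)

lemma cyc_perm_graph_fixed:
  assumes "finite E" "\<pi> permutes E" "x \<notin> E"
  shows "cyc (perm_graph (insert x E) \<pi>) = Suc (cyc (perm_graph E \<pi>))"
proof -
  have "\<pi> x = x" using assms(2,3) by (rule permutes_not_in)
  then have "perm_graph (insert x E) \<pi> = insert (x, x) (perm_graph E \<pi>)"
    by (simp add: perm_graph_def)
  then show ?thesis using assms by (simp add: cyc_insert)
qed

text \<open>The new permutation sends \<open>u\<close> to \<open>x\<close> and \<open>x\<close> to
  \<open>\<pi> u\<close>: the point \<open>x\<close> is spliced into the cycle of
  \<open>u\<close>.\<close>

lemma cyc_perm_graph_transpose:
  assumes fin: "finite E" and \<pi>: "\<pi> permutes E" and x: "x \<notin> E" and u: "u \<in> E"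
  shows "cyc (perm_graph (insert x E) (\<pi> \<circ> transpose x u)) = cyc (perm_graph E \<pi>)"
proof -
  let ?g = "perm_graph (E - {u}) \<pi>"
  have \<pi>u: "\<pi> u \<in> E" using \<pi> u by (simp add: permutes_in_image)
  have \<pi>x: "\<pi> x = x" using \<pi> x by (rule permutes_not_in)
  have R: "x \<notin> Range ?g" using \<pi> x by (auto simp: permutes_in_image)
  have 1: "perm_graph E \<pi> = insert (u, \<pi> u) ?g"
    using u by (auto simp: perm_graph_def)
  have 2: "perm_graph (insert x E) (\<pi> \<circ> transpose x u) = insert (u, x) (insert (x, \<pi> u) ?g)"
  proof -
    have "insert x E = insert u (insert x (E - {u}))" using u by auto
    moreover have "(\<lambda>y. (y, (\<pi> \<circ> transpose x u) y)) ` (E - {u}) = ?g"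
      unfolding perm_graph_def using x by (intro image_cong refl) (auto simp: transpose_def)
    ultimately show ?thesis using \<pi>x unfolding perm_graph_def by simp
  qed
  have c1: "cyc (insert (x, \<pi> u) ?g) = cyc ?g"
    using fin x R \<pi>u by (intro cyc_insert_source) auto
  have "(x, u) \<in> (insert (x, \<pi> u) ?g)\<^sup>* \<longleftrightarrow> (\<pi> u, u) \<in> ?g\<^sup>*"
  proof -
    have "(x, u) \<notin> ?g\<^sup>*" using x u by (auto elim!: converse_rtranclE simp: perm_graph_def)
    then show ?thesis by (auto simp: rtrancl_insert)
  qed
  moreover have "single_valued (insert (x, \<pi> u) ?g)"
    using x by (auto simp: single_valued_def perm_graph_def)
  moreover have "u \<notin> Domain (insert (x, \<pi> u) ?g)" using x u by auto
  ultimately show ?thesis unfolding 1 2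
    using fin c1 by (simp add: cyc_insert)
qed

lemma cyc_perm_graph_conj:
  assumes "\<tau> permutes X" "\<pi> permutes X"
  shows "cyc (perm_graph X (\<tau> \<circ> \<pi> \<circ> inv_into UNIV \<tau>)) = cyc (perm_graph X \<pi>)"
proof -
  have "inv_into UNIV \<tau> (\<tau> x) = x" for x using assms(1) by (simp add: permutes_inverses)
  then have "perm_graph X (\<tau> \<circ> \<pi> \<circ> inv_into UNIV \<tau>) = map_prod \<tau> \<tau> ` perm_graph X \<pi>"
    unfolding perm_graph_def image_image
    by (subst permutes_image[OF assms(1), symmetric]) (simp add: image_image)
  then show ?thesis
    using permutes_inj_on[OF assms(1)] by (simp add: cyc_image)
qed

section \<open>Row and column permutations\<close>

text \<open>The Young subgroup of the fibres of \<open>f\<close>: the row stabilizer of a tableau if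
  \<open>f\<close> gives rows, the column stabilizer if \<open>f\<close> gives columns.\<close>

definition fibre_perms :: "('a \<Rightarrow> 'b) \<Rightarrow> 'a set \<Rightarrow> ('a \<Rightarrow> 'a) set" where
  "fibre_perms f E = {\<rho>. \<rho> permutes E \<and> (\<forall>x. f (\<rho> x) = f x)}"

text \<open>A Young diagram is carried by its set of entries with two coordinate functions, rather
  than by a set of boxes, so that permutations of entries act without translation. The second clause
  says that the set of boxes is closed downwards.\<close>

definition young :: "'a set \<Rightarrow> ('a \<Rightarrow> nat) \<Rightarrow> ('a \<Rightarrow> nat) \<Rightarrow> bool" where
  "young E row col \<longleftrightarrow> inj_on (\<lambda>x. (row x, col x)) E \<and>
     (\<forall>x\<in>E. \<forall>i\<le>row x. \<forall>j\<le>col x. \<exists>y\<in>E. row y = i \<and> col y = j)"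

lemma fibre_permsD:
  assumes "\<rho> \<in> fibre_perms f E"
  shows "\<rho> permutes E" "f (\<rho> x) = f x" "f (inv_into UNIV \<rho> x) = f x"
proof -
  show 1: "\<rho> permutes E" and 2: "f (\<rho> x) = f x" for x
    using assms by (auto simp: fibre_perms_def)
  show "f (inv_into UNIV \<rho> x) = f x"
    using 2[of "inv_into UNIV \<rho> x"] permutes_inverses(1)[OF 1] by simp
qed

lemma finite_fibre_perms [simp]: "finite E \<Longrightarrow> finite (fibre_perms f E)"
  by (rule finite_subset[OF _ finite_permutations[of E]]) (auto simp: fibre_perms_def)

lemma fibre_perms_comp:
  "\<rho> \<in> fibre_perms f E \<Longrightarrow> \<sigma> \<in> fibre_perms f E \<Longrightarrow> \<rho> \<circ> \<sigma> \<in> fibre_perms f E"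
  by (auto simp: fibre_perms_def permutes_compose)

lemma fibre_perms_inv: "\<rho> \<in> fibre_perms f E \<Longrightarrow> inv_into UNIV \<rho> \<in> fibre_perms f E"
proof -
  assume "\<rho> \<in> fibre_perms f E"
  from fibre_permsD(1,3)[OF this] show ?thesis by (simp add: fibre_perms_def permutes_inv)
qed

lemma transpose_fibre_perms:
  "a \<in> E \<Longrightarrow> b \<in> E \<Longrightarrow> f a = f b \<Longrightarrow> transpose a b \<in> fibre_perms f E"
  by (auto simp: fibre_perms_def permutes_swap_id transpose_def)

lemma fibre_perms_mono: "E \<subseteq> E' \<Longrightarrow> \<rho> \<in> fibre_perms f E \<Longrightarrow> \<rho> \<in> fibre_perms f E'"
  by (auto simp: fibre_perms_def intro: permutes_subset)

lemma transpose_comp_permutes: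
  assumes "\<pi> permutes E"
  shows "transpose a b \<circ> \<pi> = \<pi> \<circ> transpose (inv_into UNIV \<pi> a) (inv_into UNIV \<pi> b)"
  using permutes_bij[OF assms] by (rule transpose_comp_eq)

lemma sign_comp_transpose:
  assumes "finite E" "\<pi> permutes E"
  shows "sign (\<pi> \<circ> transpose a b) = (if a = b then sign \<pi> else - sign \<pi>)"
  using permutes_imp_permutation[OF assms]
  by (simp add: sign_compose permutation_swap_id sign_swap_id)

text \<open>Coset decomposition: a permutation is given by the image \<open>z\<close> of
  \<open>x\<close>, which lies in the fibre of \<open>x\<close>, together with a permutation that
  fixes \<open>x\<close>.\<close>

lemma sum_fibre_perms_insert_left:
  assumes x: "x \<notin> E"
  shows "sum h (fibre_perms f (insert x E)) =
    (\<Sum>z\<in>insert x {z \<in> E. f z = f x}. \<Sum>\<rho>\<in>fibre_perms f E. h (transpose x z \<circ> \<rho>))"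
proof -
  let ?Z = "insert x {z \<in> E. f z = f x}"
  have "bij_betw (\<lambda>(z, \<rho>). transpose x z \<circ> \<rho>) (?Z \<times> fibre_perms f E) (fibre_perms f (insert x E))"
  proof (rule bij_betwI')
    fix p q assume p: "p \<in> ?Z \<times> fibre_perms f E" and q: "q \<in> ?Z \<times> fibre_perms f E"
    obtain z \<rho> z' \<rho>' where pq: "p = (z, \<rho>)" "q = (z', \<rho>')" by (cases p, cases q)
    have "\<rho> x = x" "\<rho>' x = x"
      using p q x pq by (auto dest!: fibre_permsD(1) simp: permutes_not_in)
    then have "z = z'" if "transpose x z \<circ> \<rho> = transpose x z' \<circ> \<rho>'"
      using fun_cong[OF that, of x] by simp
    moreover have "\<rho> = \<rho>'" if "transpose x z \<circ> \<rho> = transpose x z \<circ> \<rho>'"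
    proof -
      have "transpose x z \<circ> (transpose x z \<circ> \<rho>) = transpose x z \<circ> (transpose x z \<circ> \<rho>')"
        using that by simp
      then show ?thesis by (simp add: o_assoc)
    qed
    ultimately show "((case p of (z, \<rho>) \<Rightarrow> transpose x z \<circ> \<rho>) = (case q of (z, \<rho>) \<Rightarrow> transpose x z \<circ> \<rho>)) \<longleftrightarrow> p = q"
      using pq by auto
  next
    fix p assume p: "p \<in> ?Z \<times> fibre_perms f E"
    obtain z \<rho> where pq: "p = (z, \<rho>)" by (cases p)
    have "transpose x z \<in> fibre_perms f (insert x E)"
      using p pq by (intro transpose_fibre_perms) auto
    moreover have "\<rho> \<in> fibre_perms f (insert x E)"
      using p pq by (auto intro: fibre_perms_mono[of E])
    ultimately show "(case p of (z, \<rho>) \<Rightarrow> transpose x z \<circ> \<rho>) \<in> fibre_perms f (insert x E)"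
      using pq by (simp add: fibre_perms_comp)
  next
    fix \<rho> assume \<rho>: "\<rho> \<in> fibre_perms f (insert x E)"
    have z: "\<rho> x \<in> ?Z"
      using fibre_permsD[OF \<rho>] permutes_in_image[of \<rho> "insert x E" x] by auto
    have "transpose x (\<rho> x) \<in> fibre_perms f (insert x E)"
      using z by (intro transpose_fibre_perms) auto
    then have "transpose x (\<rho> x) \<circ> \<rho> \<in> fibre_perms f (insert x E)"
      using \<rho> by (rule fibre_perms_comp)
    then have "transpose x (\<rho> x) \<circ> \<rho> \<in> fibre_perms f E"
      using permutes_insert_lemma[OF fibre_permsD(1)[OF \<rho>]] by (simp add: fibre_perms_def)
    moreover have "transpose x (\<rho> x) \<circ> (transpose x (\<rho> x) \<circ> \<rho>) = \<rho>"
      by (simp add: o_assoc)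
    ultimately show "\<exists>p\<in>?Z \<times> fibre_perms f E. \<rho> = (case p of (z, \<rho>) \<Rightarrow> transpose x z \<circ> \<rho>)"
      using z by (intro bexI[of _ "(\<rho> x, transpose x (\<rho> x) \<circ> \<rho>)"]) auto
  qed
  from sum.reindex_bij_betw[OF this, of h] show ?thesis
    by (simp add: sum.cartesian_product case_prod_unfold)
qed

lemma sum_fibre_perms_inv:
  "(\<Sum>\<sigma>\<in>fibre_perms f E. h (inv_into UNIV \<sigma>)) = sum h (fibre_perms f E)"
proof (rule sum.reindex_bij_betw)
  show "bij_betw (inv_into UNIV) (fibre_perms f E) (fibre_perms f E)"
    by (rule bij_betw_byWitness[where f' = "inv_into UNIV"])
      (auto intro: fibre_perms_inv dest: fibre_permsD(1) simp: permutes_inv_inv)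
qed

text \<open>Inversion turns left cosets into right cosets.\<close>

lemma sum_fibre_perms_insert_right:
  assumes x: "x \<notin> E"
  shows "sum h (fibre_perms f (insert x E)) =
    (\<Sum>z\<in>insert x {z \<in> E. f z = f x}. \<Sum>\<rho>\<in>fibre_perms f E. h (\<rho> \<circ> transpose x z))"
proof -
  have "sum h (fibre_perms f (insert x E)) =
      (\<Sum>z\<in>insert x {z \<in> E. f z = f x}. \<Sum>\<rho>\<in>fibre_perms f E. h (inv_into UNIV (transpose x z \<circ> \<rho>)))"
    unfolding sum_fibre_perms_inv[of h, symmetric] by (rule sum_fibre_perms_insert_left[OF x])
  also have "\<dots> = (\<Sum>z\<in>insert x {z \<in> E. f z = f x}. \<Sum>\<rho>\<in>fibre_perms f E. h (inv_into UNIV \<rho> \<circ> transpose x z))"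
    by (intro sum.cong refl) (auto dest!: fibre_permsD(1) simp: o_inv_distrib permutes_bij)
  also have "\<dots> = (\<Sum>z\<in>insert x {z \<in> E. f z = f x}. \<Sum>\<rho>\<in>fibre_perms f E. h (\<rho> \<circ> transpose x z))"
    by (intro sum.cong refl sum_fibre_perms_inv)
  finally show ?thesis .
qed

text \<open>On each level set of \<open>F\<close> the bijection shows that the sum of the signs
  equals its own negative. The signs are integers, so this sum is zero before it is mapped into the
  ring; the conclusion therefore holds in characteristic 2 too, and \<open>\<phi>\<close> may have
  fixed values of \<open>F\<close> without being an involution.\<close>

lemma sum_sign_reversing:
  fixes F :: "'b \<Rightarrow> 'r::comm_ring_1" and s :: "'b \<Rightarrow> int"
  assumes fin: "finite A" and bij: "bij_betw \<phi> A A"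
    and s: "\<And>x. x \<in> A \<Longrightarrow> s (\<phi> x) = - s x" and F: "\<And>x. x \<in> A \<Longrightarrow> F (\<phi> x) = F x"
  shows "(\<Sum>x\<in>A. of_int (s x) * F x) = 0"
proof -
  have "(\<Sum>x\<in>A. of_int (s x) * F x) = (\<Sum>v\<in>F ` A. \<Sum>x\<in>{x \<in> A. F x = v}. of_int (s x) * F x)"
    using sum.group[OF fin finite_imageI[OF fin] subset_refl] by (rule sym)
  also have "\<dots> = (\<Sum>v\<in>F ` A. of_int (\<Sum>x\<in>{x \<in> A. F x = v}. s x) * v)"
    by (intro sum.cong refl) (simp add: sum_distrib_right)
  also have "\<dots> = 0"
  proof (rule sum.neutral, rule ballI)
    fix v
    have "bij_betw \<phi> {x \<in> A. F x = v} {x \<in> A. F x = v}"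
    proof (rule bij_betw_imageI)
      show "inj_on \<phi> {x \<in> A. F x = v}"
        using bij by (auto simp: bij_betw_def inj_on_def)
      have "\<phi> ` {x \<in> A. F x = v} \<subseteq> {x \<in> A. F x = v}"
        using bij F by (auto simp: bij_betw_def)
      then show "\<phi> ` {x \<in> A. F x = v} = {x \<in> A. F x = v}"
        using fin \<open>inj_on \<phi> {x \<in> A. F x = v}\<close> by (intro endo_inj_surj) auto
    qed
    then have "(\<Sum>x\<in>{x \<in> A. F x = v}. s x) = (\<Sum>x\<in>{x \<in> A. F x = v}. s (\<phi> x))"
      by (rule sum.reindex_bij_betw[symmetric])
    also have "\<dots> = (\<Sum>x\<in>{x \<in> A. F x = v}. - s x)"
      using s by (intro sum.cong) auto
    finally have "(\<Sum>x\<in>{x \<in> A. F x = v}. s x) = 0" by (simp add: sum_negf)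
    then show "of_int (\<Sum>x\<in>{x \<in> A. F x = v}. s x) * v = 0" by (simp del: of_int_sum)
  qed
  finally show ?thesis .
qed

text \<open>The corner is the last box of the last row. Counting from 0, its coordinates are the
  numbers of remaining boxes in its row and in its column; these become the multiplicities in the
  recursion for the content product.\<close>

lemma young_remove_corner:
  assumes fin: "finite E" and y: "young E row col" and ne: "E \<noteq> {}"
  obtains x where "x \<in> E" "young (E - {x}) row col"
    "\<And>z. z \<in> E \<Longrightarrow> row z \<le> row x" "\<And>z. z \<in> E \<Longrightarrow> row z = row x \<Longrightarrow> col z \<le> col x"
    "card {z \<in> E - {x}. row z = row x} = col x" "card {z \<in> E - {x}. col z = col x} = row x"
proof -
  define m where "m = Max (row ` E)"
  define c where "c = Max (col ` {x \<in> E. row x = m})"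
  have "m \<in> row ` E" unfolding m_def using fin ne by simp
  then have "c \<in> col ` {x \<in> E. row x = m}"
    unfolding c_def using fin by (intro Max_in) auto
  then obtain x where x: "x \<in> E" "row x = m" "col x = c" by auto
  have m: "row z \<le> m" if "z \<in> E" for z unfolding m_def using fin that by simp
  have c: "col z \<le> c" if "z \<in> E" "row z = m" for z unfolding c_def using fin that by simp
  have inj: "z = z'" if "z \<in> E" "z' \<in> E" "row z = row z'" "col z = col z'" for z z'
    using y that unfolding young_def inj_on_def by simp
  have ex: "\<exists>z\<in>E. row z = i \<and> col z = j" if "w \<in> E" "i \<le> row w" "j \<le> col w" for w i j
    using y that unfolding young_def by simp
  show ?thesis
  proof (rule that[OF x(1)])
    show "row z \<le> row x" if "z \<in> E" for z using m that x by simp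
    show "col z \<le> col x" if "z \<in> E" "row z = row x" for z using c that x by simp
    show "young (E - {x}) row col"
      unfolding young_def
    proof (intro conjI ballI allI impI)
      show "inj_on (\<lambda>x. (row x, col x)) (E - {x})" using inj by (auto simp: inj_on_def)
      fix w i j assume w: "w \<in> E - {x}" "i \<le> row w" "j \<le> col w"
      then obtain z where z: "z \<in> E" "row z = i" "col z = j" using ex by blast
      \<comment> \<open>If the removed box were to the upper left of \<open>w\<close>, then
        \<open>w\<close> would be in the last row and at its end, hence equal to
        \<open>x\<close>.\<close>
      have "z \<noteq> x"
      proof
        assume "z = x"
        then have "m \<le> row w" "c \<le> col w" using w z x by auto
        then have "row w = m" "col w = c" using m[of w] c[of w] w(1) by auto
        then show False using inj[of w x] w(1) x by auto
      qed
      then show "\<exists>y\<in>E - {x}. row y = i \<and> col y = j" using z by auto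
    qed
    have "bij_betw col {z \<in> E - {x}. row z = row x} {..<col x}"
    proof (rule bij_betw_imageI)
      show "inj_on col {z \<in> E - {x}. row z = row x}" using inj by (auto simp: inj_on_def)
      show "col ` {z \<in> E - {x}. row z = row x} = {..<col x}"
      proof (intro equalityI subsetI)
        fix j assume "j \<in> col ` {z \<in> E - {x}. row z = row x}"
        then obtain z where z: "z \<in> E" "z \<noteq> x" "row z = row x" "j = col z" by auto
        then have "col z \<noteq> c" using inj[of z x] x by auto
        then show "j \<in> {..<col x}" using c[of z] z x by auto
      next
        fix j assume j: "j \<in> {..<col x}"
        then obtain z where "z \<in> E" "row z = row x" "col z = j" using ex[of x "row x" j] x by auto
        then show "j \<in> col ` {z \<in> E - {x}. row z = row x}" using j by auto
      qed
    qed
    from bij_betw_same_card[OF this] show "card {z \<in> E - {x}. row z = row x} = col x" by simp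
    have "bij_betw row {z \<in> E - {x}. col z = col x} {..<row x}"
    proof (rule bij_betw_imageI)
      show "inj_on row {z \<in> E - {x}. col z = col x}" using inj by (auto simp: inj_on_def)
      show "row ` {z \<in> E - {x}. col z = col x} = {..<row x}"
      proof (intro equalityI subsetI)
        fix j assume "j \<in> row ` {z \<in> E - {x}. col z = col x}"
        then obtain z where z: "z \<in> E" "z \<noteq> x" "col z = col x" "j = row z" by auto
        then have "row z \<noteq> m" using inj[of z x] x by auto
        then show "j \<in> {..<row x}" using m[of z] z x by auto
      next
        fix j assume j: "j \<in> {..<row x}"
        then obtain z where "z \<in> E" "row z = j" "col z = col x" using ex[of x j "col x"] x by auto
        then show "j \<in> row ` {z \<in> E - {x}. col z = col x}" using j by auto
      qed
    qed
    from bij_betw_same_card[OF this] show "card {z \<in> E - {x}. col z = col x} = row x" by simp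
  qed
qed

text \<open>The two transpositions conjugate the middle one into itself, since \<open>w\<close> is the third corner
  of the rectangle spanned by \<open>y\<close> and \<open>z\<close>; this is what makes the mixed terms cancel.\<close>

lemma sum_rectangle_vanishes:
  fixes U :: "'r::comm_ring_1"
  assumes fin: "finite E" and w: "w \<in> E" "y \<in> E" "z \<in> E" "w \<noteq> y" "w \<noteq> z" "y \<noteq> z"
    and col: "col z = col w" and row: "row y = row w"
  shows "(\<Sum>\<sigma>\<in>fibre_perms col E. \<Sum>\<rho>\<in>fibre_perms row E.
     of_int (sign \<sigma>) * U ^ cyc (perm_graph E (\<sigma> \<circ> transpose y z \<circ> \<rho>))) = 0"
proof -
  let ?A = "fibre_perms col E \<times> fibre_perms row E"
  let ?\<phi> = "\<lambda>(\<sigma>, \<rho>). (\<sigma> \<circ> transpose z w, transpose y w \<circ> \<rho>)"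
  have tc: "transpose z w \<in> fibre_perms col E" and tr: "transpose y w \<in> fibre_perms row E"
    using w col row by (auto intro: transpose_fibre_perms)
  have mid: "transpose z w \<circ> transpose y z \<circ> transpose y w = transpose y z"
    using w by (auto simp: fun_eq_iff transpose_def)
  have "(\<Sum>p\<in>?A. of_int (sign (fst p)) * U ^ cyc (perm_graph E (fst p \<circ> transpose y z \<circ> snd p))) = 0"
  proof (rule sum_sign_reversing[where \<phi> = ?\<phi>])
    show "finite ?A" using fin by simp
    show "bij_betw ?\<phi> ?A ?A"
      by (rule bij_betw_byWitness[where f' = ?\<phi>])
        (auto simp: comp_assoc o_assoc[of "transpose y w"] intro: fibre_perms_comp tc tr)
    fix p assume "p \<in> ?A"
    then obtain \<sigma> \<rho> where p: "p = (\<sigma>, \<rho>)" "\<sigma> permutes E" by (auto dest: fibre_permsD(1))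
    show "sign (fst (?\<phi> p)) = - sign (fst p)"
      using p w sign_comp_transpose[OF fin p(2), of z w] by simp
    have "\<sigma> \<circ> transpose z w \<circ> transpose y z \<circ> (transpose y w \<circ> \<rho>) =
        \<sigma> \<circ> (transpose z w \<circ> transpose y z \<circ> transpose y w) \<circ> \<rho>"
      by (simp add: o_assoc)
    then show "U ^ cyc (perm_graph E (fst (?\<phi> p) \<circ> transpose y z \<circ> snd (?\<phi> p))) =
        U ^ cyc (perm_graph E (fst p \<circ> transpose y z \<circ> snd p))"
      using p mid by simp
  qed
  then show ?thesis by (simp add: sum.cartesian_product case_prod_unfold)
qed

text \<open>Remove a corner \<open>x\<close>, writing the column permutation as
  \<open>\<sigma> \<circ> transpose x y\<close> and the row permutation as
  \<open>transpose x z \<circ> \<rho>\<close>. If \<open>y = z = x\<close>, then \<open>x\<close> is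
  a new fixed point and contributes \<open>U\<close>. If only \<open>z\<close> moves,
  \<open>x\<close> is spliced into a cycle, once for each of the \<open>col x\<close> choices; if
  only \<open>y\<close> moves, the same happens with a sign, once for each of the
  \<open>row x\<close> choices. The terms in which both move cancel. The corner thus contributes the
  factor \<open>U + col x - row x\<close>.\<close>

lemma sum_row_column_perms:
  fixes U :: "'r::comm_ring_1"
  assumes "finite E" "young E row col"
  shows "(\<Sum>\<sigma>\<in>fibre_perms col E. \<Sum>\<rho>\<in>fibre_perms row E.
      of_int (sign \<sigma>) * U ^ cyc (perm_graph E (\<sigma> \<circ> \<rho>))) =
    (\<Prod>x\<in>E. U + of_nat (col x) - of_nat (row x))"
  using assms
proof (induction "card E" arbitrary: E)
  case 0
  then have "E = {}" by simp
  moreover have "fibre_perms f {} = {id}" for f :: "'a \<Rightarrow> nat"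
    by (auto simp: fibre_perms_def)
  ultimately show ?case by (simp add: cyc_def closed_orbits_def perm_graph_def)
next
  case (Suc n)
  then have "E \<noteq> {}" by auto
  obtain x where x: "x \<in> E" "young (E - {x}) row col"
    and corner: "\<And>z. z \<in> E \<Longrightarrow> row z \<le> row x" "\<And>z. z \<in> E \<Longrightarrow> row z = row x \<Longrightarrow> col z \<le> col x"
    and cards: "card {z \<in> E - {x}. row z = row x} = col x" "card {z \<in> E - {x}. col z = col x} = row x"
    by (rule young_remove_corner[OF Suc.prems \<open>E \<noteq> {}\<close>]) (rule that; simp)
  define E' where "E' = E - {x}"
  define S where "S = (\<Sum>\<sigma>\<in>fibre_perms col E'. \<Sum>\<rho>\<in>fibre_perms row E'.
      of_int (sign \<sigma>) * U ^ cyc (perm_graph E' (\<sigma> \<circ> \<rho>)))"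
  have E: "E = insert x E'" and xE: "x \<notin> E'" and finE: "finite E'"
    using x(1) Suc.prems(1) by (auto simp: E'_def)
  have IH: "S = (\<Prod>x\<in>E'. U + of_nat (col x) - of_nat (row x))"
    unfolding S_def using Suc x(1,2) by (simp add: E'_def)
  define G where "G y z = (\<Sum>\<sigma>\<in>fibre_perms col E'. \<Sum>\<rho>\<in>fibre_perms row E'.
      of_int (sign (\<sigma> \<circ> transpose x y)) *
        U ^ cyc (perm_graph E (\<sigma> \<circ> transpose x y \<circ> (transpose x z \<circ> \<rho>))))" for y z
  let ?C = "{y \<in> E'. col y = col x}" and ?R = "{z \<in> E'. row z = row x}"
  have "(\<Sum>\<sigma>\<in>fibre_perms col E. \<Sum>\<rho>\<in>fibre_perms row E.
      of_int (sign \<sigma>) * U ^ cyc (perm_graph E (\<sigma> \<circ> \<rho>))) =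
    (\<Sum>y\<in>insert x ?C. \<Sum>\<sigma>\<in>fibre_perms col E'. \<Sum>z\<in>insert x ?R. \<Sum>\<rho>\<in>fibre_perms row E'.
      of_int (sign (\<sigma> \<circ> transpose x y)) *
        U ^ cyc (perm_graph E (\<sigma> \<circ> transpose x y \<circ> (transpose x z \<circ> \<rho>))))"
    unfolding E sum_fibre_perms_insert_right[OF xE, of _ col]
      sum_fibre_perms_insert_left[OF xE, of _ row] ..
  also have "\<dots> = (\<Sum>y\<in>insert x ?C. \<Sum>z\<in>insert x ?R. G y z)"
    unfolding G_def by (intro sum.cong refl, subst sum.swap) (rule refl)
  also have "\<dots> = G x x + (\<Sum>z\<in>?R. G x z) + (\<Sum>y\<in>?C. G y x) + (\<Sum>y\<in>?C. \<Sum>z\<in>?R. G y z)"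
    using xE finE by (simp add: sum.distrib)
  also have "G x x = U * S"
    unfolding G_def S_def sum_distrib_left
  proof (intro sum.cong refl)
    fix \<sigma> \<rho> assume "\<sigma> \<in> fibre_perms col E'" "\<rho> \<in> fibre_perms row E'"
    then have "\<sigma> \<circ> \<rho> permutes E'" by (auto dest!: fibre_permsD(1) intro: permutes_compose)
    then show "of_int (sign (\<sigma> \<circ> transpose x x)) *
        U ^ cyc (perm_graph E (\<sigma> \<circ> transpose x x \<circ> (transpose x x \<circ> \<rho>))) =
        U * (of_int (sign \<sigma>) * U ^ cyc (perm_graph E' (\<sigma> \<circ> \<rho>)))"
      unfolding E using xE finE by (simp add: cyc_perm_graph_fixed)
  qed
  also have "G x z = S" if z: "z \<in> ?R" for z
    unfolding G_def S_def
  proof (intro sum.cong refl)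
    fix \<sigma> \<rho> assume *: "\<sigma> \<in> fibre_perms col E'" "\<rho> \<in> fibre_perms row E'"
    have \<rho>: "\<rho> permutes E'" and "\<sigma> \<circ> \<rho> permutes E'"
      using * by (auto dest!: fibre_permsD(1) intro: permutes_compose)
    moreover have "inv_into UNIV \<rho> x = x" "inv_into UNIV \<rho> z \<in> E'"
      using permutes_inv[OF \<rho>] xE z by (auto simp: permutes_not_in permutes_in_image)
    moreover have "\<sigma> \<circ> transpose x x \<circ> (transpose x z \<circ> \<rho>) = \<sigma> \<circ> \<rho> \<circ> transpose (inv_into UNIV \<rho> x) (inv_into UNIV \<rho> z)"
      by (simp add: transpose_comp_permutes[OF \<rho>] o_assoc)
    ultimately show "of_int (sign (\<sigma> \<circ> transpose x x)) *
        U ^ cyc (perm_graph E (\<sigma> \<circ> transpose x x \<circ> (transpose x z \<circ> \<rho>))) =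
        of_int (sign \<sigma>) * U ^ cyc (perm_graph E' (\<sigma> \<circ> \<rho>))"
      unfolding E using xE finE by (simp add: cyc_perm_graph_transpose)
  qed
  then have "(\<Sum>z\<in>?R. G x z) = of_nat (col x) * S"
    using cards(1) by (simp add: E'_def)
  also have "G y x = - S" if y: "y \<in> ?C" for y
    unfolding G_def S_def sum_negf[symmetric]
  proof (intro sum.cong refl)
    fix \<sigma> \<rho> assume *: "\<sigma> \<in> fibre_perms col E'" "\<rho> \<in> fibre_perms row E'"
    have \<rho>: "\<rho> permutes E'" and \<sigma>: "\<sigma> permutes E'" and "\<sigma> \<circ> \<rho> permutes E'"
      using * by (auto dest!: fibre_permsD(1) intro: permutes_compose)
    moreover have "inv_into UNIV \<rho> x = x" "inv_into UNIV \<rho> y \<in> E'"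
      using permutes_inv[OF \<rho>] xE y by (auto simp: permutes_not_in permutes_in_image)
    moreover have "\<sigma> \<circ> transpose x y \<circ> (transpose x x \<circ> \<rho>) = \<sigma> \<circ> \<rho> \<circ> transpose (inv_into UNIV \<rho> x) (inv_into UNIV \<rho> y)"
      by (simp add: transpose_comp_permutes[OF \<rho>, symmetric] comp_assoc)
    moreover have "x \<noteq> y" using xE y by auto
    ultimately show "of_int (sign (\<sigma> \<circ> transpose x y)) *
        U ^ cyc (perm_graph E (\<sigma> \<circ> transpose x y \<circ> (transpose x x \<circ> \<rho>))) =
        - (of_int (sign \<sigma>) * U ^ cyc (perm_graph E' (\<sigma> \<circ> \<rho>)))"
      unfolding E using xE finE by (simp add: cyc_perm_graph_transpose sign_comp_transpose[OF finE \<sigma>])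
  qed
  then have "(\<Sum>y\<in>?C. G y x) = - (of_nat (row x) * S)"
    using cards(2) by (simp add: E'_def)
  also have "G y z = 0" if y: "y \<in> ?C" and z: "z \<in> ?R" for y z
  proof -
    have ne: "x \<noteq> y" "x \<noteq> z" using y z xE by auto
    have inj: "a = b" if "a \<in> E" "b \<in> E" "row a = row b" "col a = col b" for a b
      using Suc.prems(2) that unfolding young_def inj_on_def by simp
    have ryx: "row y \<noteq> row x" "col z \<noteq> col x" using inj[of y x] inj[of z x] y z ne E by auto
    then have yz: "y \<noteq> z" using y z by auto
    have "row y \<le> row x" "col z \<le> col x" using corner y z E by auto
    \<comment> \<open>The box in the row of \<open>y\<close> and the column of \<open>z\<close> lies
      weakly to the upper left of \<open>x\<close>, so it belongs to the diagram; it differs from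
      \<open>x\<close> and completes the rectangle.\<close>
    then obtain w where w: "w \<in> E" "row w = row y" "col w = col z"
      using Suc.prems(2) x(1) unfolding young_def by blast
    have "G y z = (\<Sum>\<sigma>\<in>fibre_perms col E'. \<Sum>\<rho>\<in>fibre_perms row E'.
        - (of_int (sign \<sigma>) * U ^ cyc (perm_graph E' (\<sigma> \<circ> transpose y z \<circ> \<rho>))))"
      unfolding G_def
    proof (intro sum.cong refl)
      fix \<sigma> \<rho> assume *: "\<sigma> \<in> fibre_perms col E'" "\<rho> \<in> fibre_perms row E'"
      have \<rho>: "\<rho> permutes E'" and \<sigma>: "\<sigma> permutes E'"
        using * by (auto dest!: fibre_permsD(1))
      have yzE: "transpose y z permutes E'" using y z by (auto intro: permutes_swap_id)
      have p: "\<sigma> \<circ> transpose y z \<circ> \<rho> permutes E'"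
        using \<rho> \<sigma> yzE by (intro permutes_compose)
      have i: "inv_into UNIV \<rho> x = x" "inv_into UNIV \<rho> y \<in> E'"
        using permutes_inv[OF \<rho>] xE y by (auto simp: permutes_not_in permutes_in_image)
      \<comment> \<open>Rewriting the product moves \<open>x\<close> into a transposition on the
        right, where it is spliced into a cycle and disappears. What remains in the middle is
        \<open>transpose y z\<close>, for which the rectangle argument applies.\<close>
      have "transpose x y \<circ> transpose x z = transpose y z \<circ> transpose x y"
        using ne yz by (auto simp: fun_eq_iff transpose_def)
      then have "\<sigma> \<circ> transpose x y \<circ> (transpose x z \<circ> \<rho>) = \<sigma> \<circ> transpose y z \<circ> (transpose x y \<circ> \<rho>)"
        by (metis comp_assoc)
      also have "\<dots> = \<sigma> \<circ> transpose y z \<circ> \<rho> \<circ> transpose x (inv_into UNIV \<rho> y)"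
        using transpose_comp_permutes[OF \<rho>, of x y] i(1) by (simp add: comp_assoc)
      finally show "of_int (sign (\<sigma> \<circ> transpose x y)) *
          U ^ cyc (perm_graph E (\<sigma> \<circ> transpose x y \<circ> (transpose x z \<circ> \<rho>))) =
          - (of_int (sign \<sigma>) * U ^ cyc (perm_graph E' (\<sigma> \<circ> transpose y z \<circ> \<rho>)))"
        unfolding E using xE finE ne i p
        by (simp add: cyc_perm_graph_transpose sign_comp_transpose[OF finE \<sigma>])
    qed
    also have "\<dots> = - (\<Sum>\<sigma>\<in>fibre_perms col E'. \<Sum>\<rho>\<in>fibre_perms row E'.
        of_int (sign \<sigma>) * U ^ cyc (perm_graph E' (\<sigma> \<circ> transpose y z \<circ> \<rho>)))"
      by (simp add: sum_negf)
    also have "\<dots> = 0"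
      using w y z E ryx yz by (subst sum_rectangle_vanishes[OF finE, of w]) auto
    finally show ?thesis .
  qed
  then have "(\<Sum>y\<in>?C. \<Sum>z\<in>?R. G y z) = 0" by simp
  also have "U * S + of_nat (col x) * S + - (of_nat (row x) * S) + 0 =
      (\<Prod>x\<in>E. U + of_nat (col x) - of_nat (row x))"
    unfolding E using xE finE IH by (simp add: algebra_simps)
  finally show ?case .
qed

text \<open>Suppose a column has an entry with \<open>row' = i\<close> but no box in row
  \<open>i\<close>. All its boxes then lie in rows above \<open>i\<close>, and by induction each of
  these rows is also a value of \<open>row'\<close> on the column. As \<open>row'\<close> is
  injective on the column, these values use up all its entries, and none is left for the value
  \<open>i\<close>.\<close>

lemma row_sets_determined:
  assumes fin: "finite E" and y: "young E row col" and inj: "inj_on (\<lambda>e. (row' e, col e)) E"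
    and cards: "\<And>i. card {e \<in> E. row' e = i} = card {e \<in> E. row e = i}"
  shows "col ` {e \<in> E. row' e = i} = col ` {e \<in> E. row e = i}"
proof (induction i rule: less_induct)
  case (less i)
  have injr: "inj_on row {e \<in> E. col e = j}" and injr': "inj_on row' {e \<in> E. col e = j}" for j
    using y inj unfolding young_def inj_on_def by simp_all
  have injc: "inj_on col {e \<in> E. row e = i}" and injc': "inj_on col {e \<in> E. row' e = i}"
    using y inj unfolding young_def inj_on_def by simp_all
  have "col ` {e \<in> E. row' e = i} \<subseteq> col ` {e \<in> E. row e = i}"
  proof
    fix j assume "j \<in> col ` {e \<in> E. row' e = i}"
    then obtain e where e: "e \<in> E" "row' e = i" "col e = j" by auto
    let ?C = "{e \<in> E. col e = j}"
    show "j \<in> col ` {e \<in> E. row e = i}"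
    proof (rule ccontr)
      assume no: "j \<notin> col ` {e \<in> E. row e = i}"
      have lt: "row d < i" if "d \<in> ?C" for d
      proof (rule ccontr)
        assume "\<not> row d < i"
        moreover have "\<forall>i\<le>row d. \<forall>j\<le>col d. \<exists>d'\<in>E. row d' = i \<and> col d' = j"
          using y that unfolding young_def by blast
        ultimately have "\<exists>d'\<in>E. row d' = i \<and> col d' = j" using that by simp
        then show False using no by auto
      qed
      have "row ` ?C \<subseteq> row' ` ?C"
      proof
        fix r assume "r \<in> row ` ?C"
        then obtain d where d: "d \<in> ?C" "r = row d" by auto
        have "j \<in> col ` {e \<in> E. row e = r}" using d by auto
        then have "j \<in> col ` {e \<in> E. row' e = r}" using less.IH[of r] lt[OF d(1)] d(2) by simp
        then show "r \<in> row' ` ?C" by auto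
      qed
      moreover have "card (row ` ?C) = card (row' ` ?C)"
        using injr injr' by (simp add: card_image)
      ultimately have "row ` ?C = row' ` ?C"
        using fin by (intro card_subset_eq) auto
      moreover have "i \<in> row' ` ?C" using e by auto
      ultimately have "i \<in> row ` ?C" by simp
      then obtain d where "d \<in> ?C" "row d = i" by auto
      then show False using lt[of d] by simp
    qed
  qed
  moreover have "card (col ` {e \<in> E. row' e = i}) = card (col ` {e \<in> E. row e = i})"
    using injc injc' cards by (simp add: card_image)
  ultimately show ?case using fin by (intro card_subset_eq) auto
qed

text \<open>The classical combinatorial lemma on tableaux: if no two entries share a row of the
  permuted tableau and a column of the original one, the permutation is a column permutation after a
  row permutation.\<close>

lemma column_row_factorization:
  assumes fin: "finite E" and y: "young E row col" and \<pi>: "\<pi> permutes E"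
    and inj: "inj_on (\<lambda>e. (row (inv_into UNIV \<pi> e), col e)) E"
  shows "\<exists>\<sigma>\<in>fibre_perms col E. \<exists>\<rho>\<in>fibre_perms row E. \<pi> = \<sigma> \<circ> \<rho>"
proof -
  let ?row = "\<lambda>e. row (inv_into UNIV \<pi> e)"
  have cards: "card {e \<in> E. ?row e = i} = card {e \<in> E. row e = i}" for i
  proof (rule bij_betw_same_card)
    show "bij_betw (inv_into UNIV \<pi>) {e \<in> E. ?row e = i} {e \<in> E. row e = i}"
      using permutes_inv[OF \<pi>] \<pi>
      by (intro bij_betw_byWitness[where f' = \<pi>])
        (auto simp: permutes_inverses permutes_in_image)
  qed
  have ex: "\<exists>e'\<in>E. ?row e' = row e \<and> col e' = col e" if "e \<in> E" for e
  proof -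
    have "col e \<in> col ` {e' \<in> E. row e' = row e}" using that by auto
    then have "col e \<in> col ` {e' \<in> E. ?row e' = row e}"
      using row_sets_determined[OF fin y inj cards] by simp
    then show ?thesis by auto
  qed
  \<comment> \<open>Within each column, \<open>e\<close> is sent to the entry that the permuted
    tableau has in the row of \<open>e\<close>; the row sets agree, so there is one.\<close>
  define \<sigma> where "\<sigma> e = (if e \<in> E then SOME e'. e' \<in> E \<and> ?row e' = row e \<and> col e' = col e else e)" for e
  have \<sigma>: "\<sigma> e \<in> E \<and> ?row (\<sigma> e) = row e \<and> col (\<sigma> e) = col e" if "e \<in> E" for e
    using someI_ex[of "\<lambda>e'. e' \<in> E \<and> ?row e' = row e \<and> col e' = col e"] ex[OF that] that
    unfolding \<sigma>_def by auto
  have "inj_on \<sigma> E"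
  proof (rule inj_onI)
    fix a b assume ab: "a \<in> E" "b \<in> E" "\<sigma> a = \<sigma> b"
    then have "row a = row b" "col a = col b" using \<sigma>[of a] \<sigma>[of b] by auto
    then show "a = b" using y ab unfolding young_def inj_on_def by simp
  qed
  moreover have "\<sigma> ` E \<subseteq> E" using \<sigma> by auto
  ultimately have "bij_betw \<sigma> E E" using fin by (simp add: bij_betw_def endo_inj_surj)
  then have perm: "\<sigma> permutes E" by (rule bij_imp_permutes) (simp add: \<sigma>_def)
  have "col (\<sigma> x) = col x" for x
    using \<sigma>[of x] by (cases "x \<in> E") (auto simp: \<sigma>_def)
  then have \<sigma>C: "\<sigma> \<in> fibre_perms col E"
    using perm by (simp add: fibre_perms_def)
  define \<rho> where "\<rho> = inv_into UNIV \<sigma> \<circ> \<pi>"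
  have \<sigma>\<rho>: "\<sigma> (\<rho> x) = \<pi> x" for x
    using permutes_inverses(1)[OF perm] by (simp add: \<rho>_def)
  have \<rho>: "\<rho> permutes E"
    unfolding \<rho>_def by (rule permutes_compose[OF \<pi> permutes_inv[OF perm]])
  have "row (\<rho> x) = row x" for x
  proof (cases "x \<in> E")
    case True
    then have "\<rho> x \<in> E" using \<rho> by (simp add: permutes_in_image)
    then show ?thesis
      using \<sigma>[of "\<rho> x"] permutes_inverses(2)[OF \<pi>] by (simp add: \<sigma>\<rho>)
  next
    case False
    then show ?thesis using permutes_not_in[OF \<rho>] by simp
  qed
  then have "\<rho> \<in> fibre_perms row E" using \<rho> by (simp add: fibre_perms_def)
  moreover have "\<pi> = \<sigma> \<circ> \<rho>" using \<sigma>\<rho> by (simp add: fun_eq_iff)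
  ultimately show ?thesis using \<sigma>C by blast
qed

text \<open>The function \<open>h\<close> is integer-valued because \<open>h \<pi> = - h \<pi>\<close> would not give \<open>h \<pi> = 0\<close> in
  characteristic \<open>2\<close>.\<close>

lemma sum_cyc_equivariant:
  fixes U :: "'r::comm_ring_1" and h :: "('a \<Rightarrow> 'a) \<Rightarrow> int"
  assumes fin: "finite E" and y: "young E row col"
    and col: "\<And>\<sigma> \<pi>. \<sigma> \<in> fibre_perms col E \<Longrightarrow> \<pi> permutes E \<Longrightarrow> h (\<sigma> \<circ> \<pi>) = sign \<sigma> * h \<pi>"
    and row: "\<And>\<rho> \<pi>. \<rho> \<in> fibre_perms row E \<Longrightarrow> \<pi> permutes E \<Longrightarrow> h (\<pi> \<circ> \<rho>) = h \<pi>"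
  shows "(\<Sum>\<pi> | \<pi> permutes E. U ^ cyc (perm_graph E \<pi>) * of_int (h \<pi>)) =
    (\<Prod>x\<in>E. U + of_nat (col x) - of_nat (row x)) * of_int (h id)"
proof -
  let ?C = "fibre_perms col E" and ?R = "fibre_perms row E"
  let ?m = "\<lambda>(\<sigma>, \<rho>). \<sigma> \<circ> \<rho>"
  have injE: "a = b" if "a \<in> E" "b \<in> E" "row a = row b" "col a = col b" for a b
    using y that unfolding young_def inj_on_def by simp
  \<comment> \<open>If \<open>\<pi>\<close> does not factor, two entries share a row of the permuted
    tableau and a column. Their transposition on the left changes the sign of
    \<open>h \<pi>\<close>, but it equals a row transposition on the right, which leaves
    \<open>h \<pi>\<close> unchanged.\<close>
  have vanish: "h \<pi> = 0" if \<pi>: "\<pi> permutes E" and no: "\<pi> \<notin> ?m ` (?C \<times> ?R)" for \<pi>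
  proof -
    have "\<not> inj_on (\<lambda>e. (row (inv_into UNIV \<pi> e), col e)) E"
    proof
      assume "inj_on (\<lambda>e. (row (inv_into UNIV \<pi> e), col e)) E"
      from column_row_factorization[OF fin y \<pi> this] show False using no by auto
    qed
    then obtain a b where ab: "a \<in> E" "b \<in> E" "a \<noteq> b" "col a = col b"
      "row (inv_into UNIV \<pi> a) = row (inv_into UNIV \<pi> b)"
      by (auto simp: inj_on_def)
    let ?t = "transpose a b" and ?t' = "transpose (inv_into UNIV \<pi> a) (inv_into UNIV \<pi> b)"
    have "?t \<in> ?C" using ab by (intro transpose_fibre_perms) auto
    then have "h (?t \<circ> \<pi>) = - h \<pi>" using col \<pi> ab(3) by (simp add: sign_swap_id)
    moreover have "?t' \<in> ?R"
      using ab permutes_inv[OF \<pi>] by (intro transpose_fibre_perms) (auto simp: permutes_in_image)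
    then have "h (\<pi> \<circ> ?t') = h \<pi>" using row \<pi> by simp
    ultimately show ?thesis by (simp add: transpose_comp_permutes[OF \<pi>])
  qed
  have id: "id permutes E" by (rule permutes_id)
  have perm: "\<pi> permutes E" if "\<pi> \<in> ?m ` (?C \<times> ?R)" for \<pi>
    using that by (auto dest!: fibre_permsD(1) intro: permutes_compose)
  \<comment> \<open>Factorizations are unique: row and column of \<open>\<rho> x\<close> are both
    determined by the product, and together they determine the entry.\<close>
  have inj: "inj_on ?m (?C \<times> ?R)"
  proof (rule inj_onI)
    fix p q assume p: "p \<in> ?C \<times> ?R" and q: "q \<in> ?C \<times> ?R" and eq: "?m p = ?m q"
    obtain \<sigma> \<rho> \<sigma>' \<rho>' where pq: "p = (\<sigma>, \<rho>)" "q = (\<sigma>', \<rho>')" by (cases p, cases q)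
    have c: "\<sigma> \<in> ?C" "\<sigma>' \<in> ?C" "\<rho> \<in> ?R" "\<rho>' \<in> ?R" using p q pq by auto
    have "\<rho> x = \<rho>' x" for x
    proof (cases "x \<in> E")
      case True
      have "\<sigma> (\<rho> x) = \<sigma>' (\<rho>' x)" using eq pq by (simp add: fun_eq_iff)
      then have "col (\<rho> x) = col (\<rho>' x)"
        using fibre_permsD(2)[OF c(1), of "\<rho> x"] fibre_permsD(2)[OF c(2), of "\<rho>' x"] by simp
      moreover have "row (\<rho> x) = row (\<rho>' x)"
        using fibre_permsD(2)[OF c(3), of x] fibre_permsD(2)[OF c(4), of x] by simp
      ultimately show ?thesis
        using True fibre_permsD(1)[OF c(3)] fibre_permsD(1)[OF c(4)]
        by (intro injE) (simp_all add: permutes_in_image)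
    next
      case False
      then show ?thesis
        using permutes_not_in[OF fibre_permsD(1)[OF c(3)]] permutes_not_in[OF fibre_permsD(1)[OF c(4)]]
        by simp
    qed
    then have \<rho>: "\<rho> = \<rho>'" by (simp add: fun_eq_iff)
    have "\<sigma> x = \<sigma>' x" for x
    proof -
      have "\<sigma> (\<rho> (inv_into UNIV \<rho> x)) = \<sigma>' (\<rho> (inv_into UNIV \<rho> x))"
        using eq pq \<rho> by (simp add: fun_eq_iff)
      then show ?thesis using permutes_inverses(1)[OF fibre_permsD(1)[OF c(3)]] by simp
    qed
    with \<rho> pq show "p = q" by (simp add: fun_eq_iff)
  qed
  have "(\<Sum>\<pi> | \<pi> permutes E. U ^ cyc (perm_graph E \<pi>) * of_int (h \<pi>)) =
      (\<Sum>\<pi>\<in>?m ` (?C \<times> ?R). U ^ cyc (perm_graph E \<pi>) * of_int (h \<pi>))"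
    using fin perm vanish by (intro sum.mono_neutral_right) (auto simp: finite_permutations)
  also have "\<dots> = (\<Sum>(\<sigma>, \<rho>)\<in>?C \<times> ?R. U ^ cyc (perm_graph E (\<sigma> \<circ> \<rho>)) * of_int (h (\<sigma> \<circ> \<rho>)))"
    by (subst sum.reindex[OF inj]) (simp add: case_prod_unfold)
  also have "\<dots> = (\<Sum>(\<sigma>, \<rho>)\<in>?C \<times> ?R. of_int (sign \<sigma>) * U ^ cyc (perm_graph E (\<sigma> \<circ> \<rho>)) * of_int (h id))"
  proof (intro sum.cong refl, clarify)
    fix \<sigma> \<rho> assume *: "\<sigma> \<in> ?C" "\<rho> \<in> ?R"
    have "h (\<sigma> \<circ> \<rho>) = sign \<sigma> * h id"
      using row[OF *(2) fibre_permsD(1)[OF *(1)]] col[OF *(1) id] by simp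
    then show "U ^ cyc (perm_graph E (\<sigma> \<circ> \<rho>)) * of_int (h (\<sigma> \<circ> \<rho>)) =
        of_int (sign \<sigma>) * U ^ cyc (perm_graph E (\<sigma> \<circ> \<rho>)) * of_int (h id)"
      by (simp add: algebra_simps)
  qed
  also have "\<dots> = (\<Sum>\<sigma>\<in>?C. \<Sum>\<rho>\<in>?R. of_int (sign \<sigma>) * U ^ cyc (perm_graph E (\<sigma> \<circ> \<rho>))) * of_int (h id)"
    by (simp add: sum.cartesian_product sum_distrib_right case_prod_unfold)
  finally show ?thesis unfolding sum_row_column_perms[OF fin y] .
qed

section \<open>Colourings of diagrams\<close>

text \<open>In the action on tensor space the matrix entry of a diagram is 1 if the colouring of its
  northern and southern nodes is constant on blocks, and 0 otherwise. Colourings thus serve as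
  matrix indices, and this predicate as the matrix entry.\<close>

definition const_on :: "'a set set \<Rightarrow> ('a \<Rightarrow> 'c) \<Rightarrow> bool" where
  "const_on d c \<longleftrightarrow> (\<forall>B\<in>d. \<forall>x\<in>B. \<forall>y\<in>B. c x = c y)"

definition finer :: "'a set set \<Rightarrow> 'a set set \<Rightarrow> bool" where
  "finer d d' \<longleftrightarrow> (\<forall>B\<in>d. \<exists>B'\<in>d'. B \<subseteq> B')"

text \<open>Used also as a colouring whose colours are node sets: for a partition it is the most
  general colouring that is constant on blocks.\<close>

definition block_of :: "'a set set \<Rightarrow> 'a \<Rightarrow> 'a set" where
  "block_of d x = \<Union>{B \<in> d. x \<in> B}"

lemma const_onD: "const_on d c \<Longrightarrow> B \<in> d \<Longrightarrow> x \<in> B \<Longrightarrow> y \<in> B \<Longrightarrow> c x = c y"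
  unfolding const_on_def by blast

lemma const_onI: "(\<And>B x y. B \<in> d \<Longrightarrow> x \<in> B \<Longrightarrow> y \<in> B \<Longrightarrow> c x = c y) \<Longrightarrow> const_on d c"
  unfolding const_on_def by blast

lemma const_on_cong:
  assumes "\<And>x. x \<in> \<Union>d \<Longrightarrow> c x = c' x"
  shows "const_on d c \<longleftrightarrow> const_on d c'"
  unfolding const_on_def using assms by (metis UnionI)

lemma const_on_const [simp]: "const_on d (\<lambda>_. c)"
  by (simp add: const_on_def)

lemma const_on_image: "const_on ((`) f ` d) c \<longleftrightarrow> const_on d (c \<circ> f)"
  by (simp add: const_on_def)

lemma const_on_Un: "const_on (d \<union> d') c \<longleftrightarrow> const_on d c \<and> const_on d' c"
  by (auto simp: const_on_def)

lemma const_on_inj: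
  assumes "inj_on f (c ` \<Union>d)"
  shows "const_on d (f \<circ> c) \<longleftrightarrow> const_on d c"
  unfolding const_on_def
proof (intro ball_cong refl)
  fix B x y assume "B \<in> d" "x \<in> B" "y \<in> B"
  then show "(f \<circ> c) x = (f \<circ> c) y \<longleftrightarrow> c x = c y"
    using inj_on_eq_iff[OF assms, of "c x" "c y"] by auto
qed

lemma block_of_eq:
  assumes "partition_on A d" "B \<in> d" "x \<in> B"
  shows "block_of d x = B"
proof -
  have "B' = B" if "B' \<in> d" "x \<in> B'" for B'
    using disjointD[OF partition_onD2[OF assms(1)] that(1) assms(2)] that(2) assms(3) by auto
  then have "{B' \<in> d. x \<in> B'} = {B}" using assms(2,3) by blast
  then show ?thesis by (simp add: block_of_def)
qed

lemma block_of_in: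
  assumes "partition_on A d" "x \<in> A"
  shows "block_of d x \<in> d" "x \<in> block_of d x"
proof -
  obtain B where B: "B \<in> d" "x \<in> B" using assms partition_onD1 by blast
  with block_of_eq[OF assms(1) this] show "block_of d x \<in> d" "x \<in> block_of d x" by auto
qed

lemma const_on_block_of: "partition_on A d \<Longrightarrow> const_on d (block_of d)"
  by (simp add: const_on_def block_of_eq)

lemma finer_iff_const_on:
  assumes d: "partition_on A d" and d': "partition_on A d'"
  shows "finer d d' \<longleftrightarrow> const_on d (block_of d')"
proof
  assume R: "finer d d'"
  show "const_on d (block_of d')"
    unfolding const_on_def
  proof (intro ballI)
    fix B x y assume "B \<in> d" "x \<in> B" "y \<in> B"
    moreover from this obtain B' where "B' \<in> d'" "B \<subseteq> B'" using R unfolding finer_def by auto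
    ultimately show "block_of d' x = block_of d' y" using block_of_eq[OF d'] by (metis subsetD)
  qed
next
  assume c: "const_on d (block_of d')"
  show "finer d d'"
    unfolding finer_def
  proof
    fix B assume B: "B \<in> d"
    then obtain x where x: "x \<in> B" using partition_onD3[OF d] by (metis ex_in_conv)
    have BA: "B \<subseteq> A" using partition_onD1[OF d] B by auto
    have "B \<subseteq> block_of d' x"
    proof
      fix y assume "y \<in> B"
      then have "block_of d' x = block_of d' y" using const_onD[OF c B x] by simp
      then show "y \<in> block_of d' x" using block_of_in(2)[OF d', of y] \<open>y \<in> B\<close> BA by auto
    qed
    moreover have "block_of d' x \<in> d'" using block_of_in(1)[OF d'] x BA by auto
    ultimately show "\<exists>B'\<in>d'. B \<subseteq> B'" by blast
  qed
qed

lemma finer_refl: "finer d d"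
  by (auto simp: finer_def)

lemma finer_trans: "finer d e \<Longrightarrow> finer e f \<Longrightarrow> finer d f"
  unfolding finer_def by (meson subset_trans)

lemma finer_antisym_subset:
  assumes d: "partition_on A d" and d': "partition_on A d'"
    and "finer d d'" "finer d' d"
  shows "d \<subseteq> d'"
proof
  fix B assume B: "B \<in> d"
  obtain B' where B': "B' \<in> d'" "B \<subseteq> B'" using assms(3) B unfolding finer_def by auto
  obtain B'' where B'': "B'' \<in> d" "B' \<subseteq> B''" using assms(4) B' unfolding finer_def by auto
  obtain x where "x \<in> B" using B partition_onD3[OF d] by (metis ex_in_conv)
  then have "B = B''" using block_of_eq[OF d B, of x] block_of_eq[OF d B''(1), of x] B' B'' by auto
  then show "B \<in> d'" using B' B'' by auto
qed

lemma finer_antisym: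
  "partition_on A d \<Longrightarrow> partition_on A d' \<Longrightarrow> finer d d' \<Longrightarrow> finer d' d \<Longrightarrow> d = d'"
  by (meson finer_antisym_subset subset_antisym)

text \<open>Two colours suffice: the colouring that singles out one block of \<open>d'\<close> is
  constant on the blocks of \<open>d'\<close>, hence on those of \<open>d\<close>, which therefore
  do not cross it.\<close>

lemma finerI_const_on_bool:
  assumes d: "partition_on A d" and d': "partition_on A d'"
    and c: "\<And>c :: 'a \<Rightarrow> bool. const_on d' c \<Longrightarrow> const_on d c"
  shows "finer d d'"
  unfolding finer_iff_const_on[OF d d'] const_on_def
proof (intro ballI)
  fix B x y assume B: "B \<in> d" "x \<in> B" "y \<in> B"
  have xA: "x \<in> A" "y \<in> A" using B partition_onD1[OF d] by auto
  let ?c = "\<lambda>z. block_of d' z = block_of d' x"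
  have "const_on d' ?c" using const_on_block_of[OF d'] unfolding const_on_def by metis
  then have "const_on d ?c" by (rule c)
  then have "?c x = ?c y" using B unfolding const_on_def by blast
  then show "block_of d' x = block_of d' y" by simp
qed

lemma partition_eqI_const_on_bool:
  assumes "partition_on A d" "partition_on A d'"
    and "\<And>c :: 'a \<Rightarrow> bool. const_on d c \<longleftrightarrow> const_on d' c"
  shows "d = d'"
  using assms by (intro finer_antisym[OF assms(1,2)] finerI_const_on_bool[of A]) auto

text \<open>A colouring that is constant on blocks is a choice of one colour for each block. Blocks
  that meet \<open>Out\<close> have their colour prescribed, consistently or not; the others are
  free.\<close>

lemma card_extensions:
  fixes X :: "'c set"
  assumes P: "partition_on U P" and U: "finite U" and X: "finite X"
    and k: "\<And>x. x \<in> U \<Longrightarrow> x \<in> Out \<Longrightarrow> k x \<in> X"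
  shows "card {c \<in> PiE U (\<lambda>_. X). const_on P c \<and> (\<forall>x\<in>U \<inter> Out. c x = k x)} =
    (if \<forall>C\<in>P. \<forall>x\<in>C \<inter> Out. \<forall>y\<in>C \<inter> Out. k x = k y then card X ^ card {C \<in> P. C \<inter> Out = {}} else 0)"
    (is "card ?S = (if ?Q then _ else 0)")
proof (cases ?Q)
  case False
  then obtain C x y where C: "C \<in> P" "x \<in> C \<inter> Out" "y \<in> C \<inter> Out" "k x \<noteq> k y" by blast
  have "C \<subseteq> U" using C(1) partition_onD1[OF P] by auto
  have "c \<notin> ?S" for c
  proof
    assume "c \<in> ?S"
    then have c: "const_on P c" "\<forall>x\<in>U \<inter> Out. c x = k x" by auto
    have "c x = c y" using const_onD[OF c(1) C(1)] C(2,3) by blast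
    moreover have "c x = k x" "c y = k y" using c(2) C(2,3) \<open>C \<subseteq> U\<close> by auto
    ultimately show False using C(4) by simp
  qed
  then have "?S = {}" by blast
  then show ?thesis using False by (simp only: card.empty if_False)
next
  case True
  \<comment> \<open>The colours allowed for a block: all of \<open>X\<close> if it is free,
    otherwise the one colour prescribed on its outer nodes.\<close>
  define Y where "Y C = (if C \<inter> Out = {} then X else {k (SOME x. x \<in> C \<inter> Out)})" for C
  have finP: "finite P" using P U by (metis finite_UnionD partition_onD1)
  have blk: "block_of P x \<in> P" "x \<in> block_of P x" if "x \<in> U" for x
    using block_of_in[OF P that] by auto
  have PU: "C \<subseteq> U" if "C \<in> P" for C using that partition_onD1[OF P] by auto
  have ne: "\<exists>x. x \<in> C" if "C \<in> P" for C using that partition_onD3[OF P] by (metis ex_in_conv)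
  have some: "(SOME x. x \<in> C \<inter> Out) \<in> C \<inter> Out" if "C \<inter> Out \<noteq> {}" for C
    using that by (intro someI_ex[of "\<lambda>x. x \<in> C \<inter> Out"]) blast
  have kY: "k x = k (SOME x. x \<in> C \<inter> Out)" if "C \<in> P" "x \<in> C \<inter> Out" for C x
  proof -
    have "(SOME x. x \<in> C \<inter> Out) \<in> C \<inter> Out" using that(2) by (intro some) blast
    with True[THEN bspec, OF that(1), THEN bspec, OF that(2)] show ?thesis by (rule bspec)
  qed
  have "bij_betw (\<lambda>\<phi>. \<lambda>x\<in>U. \<phi> (block_of P x)) (PiE P Y) ?S"
  proof (rule bij_betw_imageI)
    show "inj_on (\<lambda>\<phi>. \<lambda>x\<in>U. \<phi> (block_of P x)) (PiE P Y)"
    proof (rule inj_onI)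
      fix \<phi> \<psi> assume \<phi>: "\<phi> \<in> PiE P Y" "\<psi> \<in> PiE P Y"
        and eq: "(\<lambda>x\<in>U. \<phi> (block_of P x)) = (\<lambda>x\<in>U. \<psi> (block_of P x))"
      show "\<phi> = \<psi>"
      proof (rule PiE_ext[OF \<phi>])
        fix C assume C: "C \<in> P"
        then obtain x where x: "x \<in> C" using ne by auto
        then have "x \<in> U" "block_of P x = C" using PU C block_of_eq[OF P C x] by auto
        then show "\<phi> C = \<psi> C" using fun_cong[OF eq, of x] by simp
      qed
    qed
    show "(\<lambda>\<phi>. \<lambda>x\<in>U. \<phi> (block_of P x)) ` PiE P Y = ?S"
    proof (intro equalityI subsetI)
      fix c assume "c \<in> (\<lambda>\<phi>. \<lambda>x\<in>U. \<phi> (block_of P x)) ` PiE P Y"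
      then obtain \<phi> where \<phi>: "\<phi> \<in> PiE P Y" and c: "c = (\<lambda>x\<in>U. \<phi> (block_of P x))" by auto
      have YX: "Y C \<subseteq> X" if "C \<in> P" for C
        using some[of C] k PU[OF that] by (auto simp: Y_def)
      have "c \<in> PiE U (\<lambda>_. X)"
      proof (rule PiE_I)
        fix x assume x: "x \<in> U"
        show "c x \<in> X"
          using subsetD[OF YX[OF blk(1)[OF x]] PiE_mem[OF \<phi> blk(1)[OF x]]] x by (simp add: c)
      qed (simp add: c)
      moreover have "const_on P c"
      proof (rule const_onI)
        fix B x y assume B: "B \<in> P" "x \<in> B" "y \<in> B"
        then have "x \<in> U" "y \<in> U" using PU by auto
        then show "c x = c y"
          using block_of_eq[OF P B(1,2)] block_of_eq[OF P B(1,3)] by (simp add: c)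
      qed
      moreover have "c x = k x" if "x \<in> U \<inter> Out" for x
      proof -
        have x: "block_of P x \<in> P" "x \<in> block_of P x \<inter> Out" using blk that by auto
        then have "\<phi> (block_of P x) = k (SOME z. z \<in> block_of P x \<inter> Out)"
        proof -
          have "block_of P x \<inter> Out \<noteq> {}" using x(2) by blast
          then show ?thesis using PiE_mem[OF \<phi> x(1)] by (simp only: Y_def if_False singleton_iff)
        qed
        then show ?thesis using kY[OF x] that by (simp add: c)
      qed
      ultimately show "c \<in> ?S" by simp
    next
      fix c assume "c \<in> ?S"
      then have c: "c \<in> PiE U (\<lambda>_. X)" "const_on P c" "\<forall>x\<in>U \<inter> Out. c x = k x" by auto
      define \<phi> where "\<phi> = (\<lambda>C\<in>P. c (SOME x. x \<in> C))"
      have \<phi>c: "\<phi> C = c x" if "C \<in> P" "x \<in> C" for C x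
        using const_onD[OF c(2) that(1) someI[of "\<lambda>x. x \<in> C", OF that(2)] that(2)] that(1)
        by (simp add: \<phi>_def)
      have "\<phi> C \<in> Y C" if C: "C \<in> P" for C
      proof (cases "C \<inter> Out = {}")
        case True
        obtain x where "x \<in> C" using ne[OF C] by auto
        then show ?thesis using True \<phi>c[OF C] PiE_mem[OF c(1)] PU[OF C] by (auto simp: Y_def)
      next
        case False
        from some[OF this] show ?thesis using False \<phi>c[OF C] c(3) PU[OF C] by (auto simp: Y_def)
      qed
      then have "\<phi> \<in> PiE P Y" by (auto simp: \<phi>_def)
      moreover have "c = (\<lambda>x\<in>U. \<phi> (block_of P x))"
      proof
        fix x show "c x = (\<lambda>x\<in>U. \<phi> (block_of P x)) x"
          using \<phi>c[OF blk, of x] PiE_arb[OF c(1), of x] by (cases "x \<in> U") auto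
      qed
      ultimately show "c \<in> (\<lambda>\<phi>. \<lambda>x\<in>U. \<phi> (block_of P x)) ` PiE P Y" by blast
    qed
  qed
  then have "card ?S = card (PiE P Y)" by (rule bij_betw_same_card[symmetric])
  also have "\<dots> = (\<Prod>C\<in>P. card (Y C))" using finP by (rule card_PiE)
  also have "\<dots> = (\<Prod>C\<in>P. if C \<inter> Out = {} then card X else 1)"
    by (intro prod.cong refl) (auto simp: Y_def)
  also have "\<dots> = card X ^ card {C \<in> P. C \<inter> Out = {}}"
    using finP by (simp add: prod.If_cases Int_def)
  finally have "card ?S = card X ^ card {C \<in> P. C \<inter> Out = {}}" .
  then show ?thesis by (subst if_P[OF True])
qed

section \<open>Concatenation of diagrams as multiplication of matrices indexed by colourings\<close>

abbreviation nodes :: "nat \<Rightarrow> node set" where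
  "nodes n \<equiv> {1..n} <+> {1..n}"

abbreviation stacked_nodes :: "nat \<Rightarrow> (nat + node) set" where
  "stacked_nodes n \<equiv> {1..n} <+> nodes n"

lemma diagramsD: "d \<in> diagrams n \<Longrightarrow> partition_on (nodes n) d"
  by (simp add: diagrams_def)

lemma finite_diagrams [simp]: "finite (diagrams n)"
proof (rule finite_subset)
  show "diagrams n \<subseteq> Pow (Pow (nodes n))"
    by (auto simp: diagrams_def partition_on_def)
qed simp

lemma partition_on_stacked_components:
  assumes x: "x \<in> diagrams n" and y: "y \<in> diagrams n"
  shows "partition_on (stacked_nodes n) (stacked_components x y)"
proof -
  let ?U = "\<Union> (stacked_blocks x y)" and ?r = "\<Union>B\<in>stacked_blocks x y. B \<times> B"
  have ux: "\<Union>x = nodes n" "\<Union>y = nodes n"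
    using partition_onD1[OF diagramsD[OF x]] partition_onD1[OF diagramsD[OF y]] by auto
  have "?U = map_sum id Inl ` \<Union>x \<union> Inr ` \<Union>y"
    unfolding stacked_blocks_def by blast
  also have "\<dots> = stacked_nodes n"
    unfolding ux Plus_def image_Un image_image by auto
  finally have U: "?U = stacked_nodes n" .
  have "equiv ?U (?r\<^sup>+)"
  proof (rule equivI)
    have "?r \<subseteq> ?U \<times> ?U" by auto
    then show "?r\<^sup>+ \<subseteq> ?U \<times> ?U" by (rule trancl_subset_Sigma)
    \<comment> \<open>The transitive closure is reflexive on the nodes because each of them lies in
      some block.\<close>
    show "refl_on ?U (?r\<^sup>+)" by (auto simp: refl_on_def)
    have "sym ?r" by (auto simp: sym_def)
    then show "sym (?r\<^sup>+)" by (rule sym_trancl)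
    show "trans (?r\<^sup>+)" by (rule trans_trancl)
  qed
  then show ?thesis unfolding stacked_components_def U[symmetric] by (rule partition_on_quotient)
qed

lemma const_on_stacked_components:
  "const_on (stacked_components x y) c \<longleftrightarrow> const_on (stacked_blocks x y) c"
proof
  let ?r = "\<Union>B\<in>stacked_blocks x y. B \<times> B"
  assume c: "const_on (stacked_components x y) c"
  show "const_on (stacked_blocks x y) c"
    unfolding const_on_def
  proof (intro ballI)
    fix B p q assume B: "B \<in> stacked_blocks x y" "p \<in> B" "q \<in> B"
    then have "(p, q) \<in> ?r\<^sup>+" "(p, p) \<in> ?r\<^sup>+" by (auto intro!: r_into_trancl)
    moreover have "?r\<^sup>+ `` {p} \<in> stacked_components x y"
      unfolding stacked_components_def using B by (auto intro: quotientI)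
    ultimately show "c p = c q" using c unfolding const_on_def by blast
  qed
next
  let ?r = "\<Union>B\<in>stacked_blocks x y. B \<times> B"
  assume c: "const_on (stacked_blocks x y) c"
  have *: "c p = c q" if "(p, q) \<in> ?r\<^sup>+" for p q
    using that
  proof (induction rule: trancl_induct)
    case (base q)
    then show ?case using c unfolding const_on_def by blast
  next
    case (step q r)
    then have "c q = c r" using c unfolding const_on_def by blast
    with step.IH show ?case by simp
  qed
  show "const_on (stacked_components x y) c"
    unfolding const_on_def
  proof (intro ballI)
    fix C p q assume "C \<in> stacked_components x y" "p \<in> C" "q \<in> C"
    then obtain z where "(z, p) \<in> ?r\<^sup>+" "(z, q) \<in> ?r\<^sup>+"
      unfolding stacked_components_def by (auto elim: quotientE)
    then show "c p = c q" using *[of z p] *[of z q] by simp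
  qed
qed

lemma const_on_stacked_blocks:
  "const_on (stacked_blocks x y) (case_sum i (case_sum l j)) \<longleftrightarrow>
    const_on x (case_sum i l) \<and> const_on y (case_sum l j)"
proof -
  have "case_sum i (case_sum l j) \<circ> map_sum id Inl = case_sum i l"
    by (auto simp: fun_eq_iff split: sum.split)
  moreover have "case_sum i (case_sum l j) \<circ> Inr = case_sum l j"
    by (auto simp: fun_eq_iff)
  ultimately show ?thesis
    unfolding stacked_blocks_def const_on_Un const_on_image by simp
qed

lemma concat_diagram_in:
  assumes "x \<in> diagrams n" "y \<in> diagrams n"
  shows "concat_diagram x y \<in> diagrams n"
proof -
  have "outer_nodes ` stacked_components x y = (-`) (map_sum id Inr) ` stacked_components x y"
    by (auto simp: outer_nodes_def)
  then have "partition_on (map_sum id Inr -` stacked_nodes n) (concat_diagram x y)"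
    using partition_on_vimage[OF partition_on_stacked_components[OF assms], of "map_sum id Inr"]
    by (simp add: concat_diagram_def)
  moreover have "map_sum id Inr -` stacked_nodes n = nodes n"
  proof (rule Set.set_eqI)
    fix z :: node
    show "z \<in> map_sum id Inr -` stacked_nodes n \<longleftrightarrow> z \<in> nodes n" by (cases z) auto
  qed
  ultimately show ?thesis by (simp add: diagrams_def)
qed

text \<open>Only outer nodes are compared on the right-hand side, so the colouring \<open>l\<close>
  of the middle row is a dummy.\<close>

lemma const_on_concat_diagram:
  "const_on (concat_diagram x y) (case_sum i j) \<longleftrightarrow>
    (\<forall>C\<in>stacked_components x y. \<forall>p\<in>C \<inter> range (map_sum id Inr). \<forall>q\<in>C \<inter> range (map_sum id Inr).
      case_sum i (case_sum l j) p = case_sum i (case_sum l j) q)"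
proof -
  have "case_sum i (case_sum l j) (map_sum id Inr z) = case_sum i j z" for z
    by (cases z) auto
  note k = this
  show ?thesis
  proof
    assume c: "const_on (concat_diagram x y) (case_sum i j)"
    show "\<forall>C\<in>stacked_components x y. \<forall>p\<in>C \<inter> range (map_sum id Inr). \<forall>q\<in>C \<inter> range (map_sum id Inr).
      case_sum i (case_sum l j) p = case_sum i (case_sum l j) q"
    proof (intro ballI)
      fix C p q assume C: "C \<in> stacked_components x y"
        and "p \<in> C \<inter> range (map_sum id Inr)" "q \<in> C \<inter> range (map_sum id Inr)"
      then obtain p' q' where pq: "p = map_sum id Inr p'" "q = map_sum id Inr q'"
        "p' \<in> outer_nodes C" "q' \<in> outer_nodes C"
        by (auto simp: outer_nodes_def)
      then have "outer_nodes C \<in> concat_diagram x y" using C by (auto simp: concat_diagram_def)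
      from const_onD[OF c this pq(3,4)]
      show "case_sum i (case_sum l j) p = case_sum i (case_sum l j) q" by (simp only: pq k)
    qed
  next
    assume c: "\<forall>C\<in>stacked_components x y. \<forall>p\<in>C \<inter> range (map_sum id Inr). \<forall>q\<in>C \<inter> range (map_sum id Inr).
      case_sum i (case_sum l j) p = case_sum i (case_sum l j) q"
    show "const_on (concat_diagram x y) (case_sum i j)"
    proof (rule const_onI)
      fix B p q assume "B \<in> concat_diagram x y" and pq: "p \<in> B" "q \<in> B"
      then obtain C where C: "C \<in> stacked_components x y" "B = outer_nodes C"
        by (auto simp: concat_diagram_def)
      with pq have "map_sum id Inr p \<in> C" "map_sum id Inr q \<in> C" by (auto simp: outer_nodes_def)
      then have "case_sum i (case_sum l j) (map_sum id Inr p) = case_sum i (case_sum l j) (map_sum id Inr q)"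
        using c C(1) by blast
      then show "case_sum i j p = case_sum i j q" by (simp only: k)
    qed
  qed
qed

lemma const_on_diagram_cong:
  assumes d: "d \<in> diagrams n"
    and "\<And>a. a \<in> {1..n} \<Longrightarrow> i a = i' a" "\<And>a. a \<in> {1..n} \<Longrightarrow> j a = j' a"
  shows "const_on d (case_sum i j) \<longleftrightarrow> const_on d (case_sum i' j')"
proof (rule const_on_cong)
  fix p assume "p \<in> \<Union>d"
  then have "p \<in> nodes n" using partition_onD1[OF diagramsD[OF d]] by simp
  then show "case_sum i j p = case_sum i' j' p" using assms(2,3) by auto
qed

text \<open>The product of the matrices of \<open>x\<close> and \<open>y\<close>: summing over the
  colours of the middle row leaves one free colour for each component without outer nodes. With
  \<open>card X\<close> colours, the multiplication of the algebra with parameter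
  \<open>card X\<close> is therefore matrix multiplication.\<close>

lemma card_middle_colourings:
  fixes X :: "'c set"
  assumes x: "x \<in> diagrams n" and y: "y \<in> diagrams n" and X: "finite X"
    and i: "\<And>a. a \<in> {1..n} \<Longrightarrow> i a \<in> X" and j: "\<And>a. a \<in> {1..n} \<Longrightarrow> j a \<in> X"
  shows "card {l \<in> PiE {1..n} (\<lambda>_. X). const_on x (case_sum i l) \<and> const_on y (case_sum l j)} =
    (if const_on (concat_diagram x y) (case_sum i j) then card X ^ num_removed x y else 0)"
proof -
  let ?U = "stacked_nodes n" and ?P = "stacked_components x y"
  let ?Out = "range (map_sum id Inr :: node \<Rightarrow> nat + node)"
  let ?k = "case_sum i (case_sum (\<lambda>_. undefined) j)"
  let ?L = "{l \<in> PiE {1..n} (\<lambda>_. X). const_on x (case_sum i l) \<and> const_on y (case_sum l j)}"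
  let ?S = "{c \<in> PiE ?U (\<lambda>_. X). const_on ?P c \<and> (\<forall>p\<in>?U \<inter> ?Out. c p = ?k p)}"
  have P: "partition_on ?U ?P" by (rule partition_on_stacked_components[OF x y])
  have restr: "const_on ?P (restrict c ?U) \<longleftrightarrow> const_on ?P c" for c :: "nat + node \<Rightarrow> 'c"
    using partition_onD1[OF P] by (intro const_on_cong) simp
  have out: "Inl a \<in> ?Out" "Inr (Inr a) \<in> ?Out" "Inr (Inl a) \<notin> ?Out" for a
  proof -
    show "Inl a \<in> ?Out" by (rule range_eqI[where x = "Inl a"]) simp
    show "Inr (Inr a) \<in> ?Out" by (rule range_eqI[where x = "Inr a"]) simp
    show "Inr (Inl a) \<notin> ?Out"
    proof
      assume "Inr (Inl a) \<in> ?Out"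
      then obtain z :: node where "Inr (Inl a) = map_sum id Inr z" by (rule rangeE)
      then show False by (cases z) simp_all
    qed
  qed
  have "bij_betw (\<lambda>l. restrict (case_sum i (case_sum l j)) ?U) ?L ?S"
  proof (rule bij_betw_imageI)
    show "inj_on (\<lambda>l. restrict (case_sum i (case_sum l j)) ?U) ?L"
    proof (rule inj_onI)
      fix l l' assume l: "l \<in> ?L" "l' \<in> ?L"
        and eq: "restrict (case_sum i (case_sum l j)) ?U = restrict (case_sum i (case_sum l' j)) ?U"
      show "l = l'"
      proof (rule PiE_ext[of _ "{1..n}" "\<lambda>_. X"])
        show "l a = l' a" if "a \<in> {1..n}" for a
          using fun_cong[OF eq, of "Inr (Inl a)"] that by (simp add: InlI InrI)
      qed (use l in auto)
    qed
    show "(\<lambda>l. restrict (case_sum i (case_sum l j)) ?U) ` ?L = ?S"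
    proof (intro equalityI subsetI)
      fix c assume "c \<in> (\<lambda>l. restrict (case_sum i (case_sum l j)) ?U) ` ?L"
      then obtain l where l: "l \<in> ?L" and c: "c = restrict (case_sum i (case_sum l j)) ?U" by auto
      have "c \<in> PiE ?U (\<lambda>_. X)" unfolding c using l i j by auto
      moreover have "const_on ?P c"
        unfolding c restr using l by (simp add: const_on_stacked_components const_on_stacked_blocks)
      moreover have "c p = ?k p" if "p \<in> ?U \<inter> ?Out" for p
      proof -
        have "p \<noteq> Inr (Inl a)" for a using that out(3) by (metis IntD2)
        then show ?thesis using IntD1[OF that] by (auto simp: c split: sum.split)
      qed
      ultimately show "c \<in> ?S" by simp
    next
      fix c assume c: "c \<in> ?S"
      define l where "l = (\<lambda>a\<in>{1..n}. c (Inr (Inl a)))"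
      have ceq: "c = restrict (case_sum i (case_sum l j)) ?U"
      proof
        fix p
        show "c p = restrict (case_sum i (case_sum l j)) ?U p"
        proof (cases "p \<in> ?U")
          case False
          then show ?thesis using c by (simp add: PiE_def extensional_def)
        next
          case True
          have k: "c q = ?k q" if "q \<in> ?U" "q \<in> ?Out" for q
            using c that by blast
          from True consider a where "p = Inl a" | a where "p = Inr (Inl a)" "a \<in> {1..n}" | a where "p = Inr (Inr a)"
            by blast
          then show ?thesis
          proof cases
            case (1 a)
            then show ?thesis using k[OF True] out(1) True by simp
          next
            case (2 a)
            then show ?thesis using True by (simp add: l_def)
          next
            case (3 a)
            then show ?thesis using k[OF True] out(2) True by simp
          qed
        qed
      qed
      have "const_on ?P c" using c by blast
      then have "const_on ?P (case_sum i (case_sum l j))" by (subst (asm) ceq) (simp only: restr)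
      moreover have "l \<in> PiE {1..n} (\<lambda>_. X)" 
      proof (rule PiE_I)
        fix a assume a: "a \<in> {1..n}"
        have "c \<in> PiE ?U (\<lambda>_. X)" using c by blast
        from PiE_mem[OF this, of "Inr (Inl a)"] show "l a \<in> X" using a by (simp add: l_def InlI InrI)
      qed (auto simp: l_def)
      ultimately have "l \<in> ?L" by (simp add: const_on_stacked_components const_on_stacked_blocks)
      then show "c \<in> (\<lambda>l. restrict (case_sum i (case_sum l j)) ?U) ` ?L" using ceq by blast
    qed
  qed
  then have "card ?L = card ?S" by (rule bij_betw_same_card)
  also have "\<dots> = (if \<forall>C\<in>?P. \<forall>p\<in>C \<inter> ?Out. \<forall>q\<in>C \<inter> ?Out. ?k p = ?k q
      then card X ^ card {C \<in> ?P. C \<inter> ?Out = {}} else 0)"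
  proof (rule card_extensions[OF P _ X])
    fix p assume p: "p \<in> ?U" "p \<in> ?Out"
    then consider a where "p = Inl a" "a \<in> {1..n}" | a where "p = Inr (Inl a)" | a where "p = Inr (Inr a)" "a \<in> {1..n}"
      by blast
    then show "?k p \<in> X"
    proof cases
      case (2 a)
      then show ?thesis using p(2) out(3) by metis
    qed (use i j in auto)
  qed simp
  also have "{C \<in> ?P. C \<inter> ?Out = {}} = {C \<in> ?P. outer_nodes C = {}}"
    unfolding outer_nodes_def by auto
  finally show ?thesis
    unfolding const_on_concat_diagram[of x y i j "\<lambda>_. undefined"] num_removed_def .
qed

text \<open>With two colours the number of middle colourings is 0 or a power of 2, so it is nonzero
  exactly when the concatenation admits the outer colouring.\<close>

lemma const_on_concat_diagram_iff_ex:
  fixes i j :: "nat \<Rightarrow> bool"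
  assumes x: "x \<in> diagrams n" and y: "y \<in> diagrams n"
  shows "const_on (concat_diagram x y) (case_sum i j) \<longleftrightarrow>
    (\<exists>l. const_on x (case_sum i l) \<and> const_on y (case_sum l j))"
proof -
  let ?L = "{l \<in> PiE {1..n} (\<lambda>_. UNIV :: bool set). const_on x (case_sum i l) \<and> const_on y (case_sum l j)}"
  have "finite ?L" by (simp add: finite_PiE)
  then have "const_on (concat_diagram x y) (case_sum i j) \<longleftrightarrow> ?L \<noteq> {}"
    using card_middle_colourings[OF x y, of "UNIV :: bool set" i j] card_eq_0_iff[of ?L]
    by (auto split: if_splits)
  also have "\<dots> \<longleftrightarrow> (\<exists>l. const_on x (case_sum i l) \<and> const_on y (case_sum l j))"
  proof
    assume "\<exists>l. const_on x (case_sum i l) \<and> const_on y (case_sum l j)"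
    then obtain l where l: "const_on x (case_sum i l)" "const_on y (case_sum l j)" by auto
    have "const_on x (case_sum i (restrict l {1..n}))"
      using l(1) const_on_diagram_cong[OF x, of i i "restrict l {1..n}" l] by simp
    moreover have "const_on y (case_sum (restrict l {1..n}) j)"
      using l(2) const_on_diagram_cong[OF y, of "restrict l {1..n}" l j j] by simp
    ultimately have "restrict l {1..n} \<in> ?L" by simp
    then show "?L \<noteq> {}" by blast
  qed auto
  finally show ?thesis .
qed

text \<open>With all outer nodes coloured alike, the number of two-coloured middle rows is 2 to the
  number of removed components, and can be read back from it.\<close>

lemma num_removed_eqI:
  assumes "x \<in> diagrams n" "y \<in> diagrams n" "y' \<in> diagrams n"
    and eq: "\<And>l. const_on y (case_sum l (\<lambda>_. True)) \<longleftrightarrow> const_on y' (case_sum l (\<lambda>_. True))"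
  shows "num_removed x y = num_removed x y'"
proof -
  have "(2::nat) ^ num_removed x y = 2 ^ num_removed x y'"
    using card_middle_colourings[OF assms(1,2), of "UNIV :: bool set" "\<lambda>_. True" "\<lambda>_. True"]
      card_middle_colourings[OF assms(1,3), of "UNIV :: bool set" "\<lambda>_. True" "\<lambda>_. True"]
    by (simp add: eq card_UNIV_bool)
  then show ?thesis by (simp add: power_inject_exp)
qed

lemma case_sum_collapse: "case_sum (c \<circ> Inl) (c \<circ> Inr) = c"
  by (auto simp: fun_eq_iff split: sum.split)

lemma diagrams_eqI:
  assumes "d \<in> diagrams n" "d' \<in> diagrams n"
    and "\<And>i j :: nat \<Rightarrow> bool. const_on d (case_sum i j) \<longleftrightarrow> const_on d' (case_sum i j)"
  shows "d = d'"
  using assms(3)[of "c \<circ> Inl" "c \<circ> Inr" for c]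
  by (intro partition_eqI_const_on_bool[OF diagramsD[OF assms(1)] diagramsD[OF assms(2)]])
    (simp add: case_sum_collapse)

lemma id_diagram_in: "id_diagram n \<in> diagrams n"
  unfolding diagrams_def id_diagram_def partition_on_def disjoint_def by auto

lemma const_on_id_diagram:
  "const_on (id_diagram n) (case_sum i l) \<longleftrightarrow> (\<forall>a\<in>{1..n}. i a = l a)"
  unfolding const_on_def id_diagram_def by auto

lemma concat_id_diagram:
  assumes v: "v \<in> diagrams n"
  shows "concat_diagram (id_diagram n) v = v" "num_removed (id_diagram n) v = 0"
proof -
  note id = id_diagram_in[of n]
  have uv: "\<Union>v = nodes n" using partition_onD1[OF diagramsD[OF v]] by simp
  show "concat_diagram (id_diagram n) v = v"
  proof (rule diagrams_eqI[OF concat_diagram_in[OF id v] v])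
    fix i j :: "nat \<Rightarrow> bool"
    have "const_on v (case_sum l j) \<longleftrightarrow> const_on v (case_sum i j)" if "\<forall>a\<in>{1..n}. i a = l a" for l
      using that by (intro const_on_cong) (auto simp: uv)
    then show "const_on (concat_diagram (id_diagram n) v) (case_sum i j) = const_on v (case_sum i j)"
      unfolding const_on_concat_diagram_iff_ex[OF id v] const_on_id_diagram by blast
  qed
  have "{l \<in> PiE {1..n} (\<lambda>_. UNIV :: bool set). const_on (id_diagram n) (case_sum (\<lambda>_. True) l)
      \<and> const_on v (case_sum l (\<lambda>_. True))} \<subseteq> {\<lambda>a\<in>{1..n}. True}"
    by (auto simp: const_on_id_diagram fun_eq_iff PiE_def extensional_def)
  then have "card {l \<in> PiE {1..n} (\<lambda>_. UNIV :: bool set). const_on (id_diagram n) (case_sum (\<lambda>_. True) l)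
      \<and> const_on v (case_sum l (\<lambda>_. True))} \<le> 1"
    by (metis (no_types, lifting) card_mono card.empty card_insert_disjoint empty_iff finite.emptyI finite_insert One_nat_def)
  then have "(2::nat) ^ num_removed (id_diagram n) v \<le> 1"
    using card_middle_colourings[OF id v, of "UNIV :: bool set" "\<lambda>_. True" "\<lambda>_. True"]
    by (simp add: card_UNIV_bool)
  then show "num_removed (id_diagram n) v = 0"
    using less_exp[of "num_removed (id_diagram n) v"] by linarith
qed

section \<open>Half diagrams\<close>

text \<open>A pigeonhole argument: the first \<open>n - m\<close> southern nodes are singletons, so
  the \<open>m\<close> propagating blocks have to share the other \<open>m\<close> southern nodes,
  and each gets exactly one. This turns the global count into a condition on each node.\<close>

lemma half_diagrams_iff:
  assumes v: "v \<in> diagrams n" and m: "m \<le> n" and single: "\<And>a. a \<in> {1..n - m} \<Longrightarrow> {Inr a} \<in> v"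
  shows "v \<in> half_diagrams n m \<longleftrightarrow> (\<forall>a\<in>{1..m}. (\<exists>c. Inl c \<in> block_of v (Inr (n - m + a))) \<and>
    (\<forall>b. Inr b \<in> block_of v (Inr (n - m + a)) \<longrightarrow> b = n - m + a))"
proof -
  note P = diagramsD[OF v]
  let ?PB = "{B \<in> v. propagating B}"
  let ?b = "\<lambda>a. block_of v (Inr (n - m + a))"
  have finv: "finite v" using P by (metis finite_UnionD finite_Plus finite_atLeastAtMost partition_onD1)
  have node: "Inr (n - m + a) \<in> nodes n" if "a \<in> {1..m}" for a using that m by auto
  have south: "\<exists>a\<in>{1..m}. b = n - m + a" if "B \<in> ?PB" "Inr b \<in> B" for B b
  proof -
    have "b \<in> {1..n}" using that partition_onD1[OF P] by auto
    moreover have "b \<notin> {1..n - m}"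
    proof
      assume "b \<in> {1..n - m}"
      from block_of_eq[OF P single[OF this], of "Inr b"] block_of_eq[OF P _ that(2)] that(1)
      have "B = {Inr b}" by simp
      then show False using that(1) by (auto simp: propagating_def)
    qed
    ultimately show ?thesis by (intro bexI[of _ "b - (n - m)"]) auto
  qed
  show ?thesis (is "_ \<longleftrightarrow> ?R")
  proof
    assume "v \<in> half_diagrams n m"
    then have cm: "card ?PB = m" by (simp add: half_diagrams_def num_propagating_def)
    define s where "s B = (SOME a. a \<in> {1..m} \<and> Inr (n - m + a) \<in> B)" for B :: "node set"
    have s: "s B \<in> {1..m} \<and> Inr (n - m + s B) \<in> B" if B: "B \<in> ?PB" for B
    proof -
      obtain b where "Inr b \<in> B" using B by (auto simp: propagating_def)
      with south[OF B this] have "\<exists>a. a \<in> {1..m} \<and> Inr (n - m + a) \<in> B" by blast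
      then show ?thesis unfolding s_def by (rule someI_ex)
    qed
    have inj: "inj_on s ?PB"
    proof (rule inj_onI)
      fix B B' assume B: "B \<in> ?PB" "B' \<in> ?PB" "s B = s B'"
      then show "B = B'"
        using s[OF B(1)] s[OF B(2)] block_of_eq[OF P, of B] block_of_eq[OF P, of B'] by auto
    qed
    have "s ` ?PB = {1..m}"
    proof (rule card_subset_eq)
      show "s ` ?PB \<subseteq> {1..m}" using s by blast
      show "card (s ` ?PB) = card {1..m}" using cm inj by (simp add: card_image)
    qed simp
    then have ex: "\<exists>B\<in>?PB. s B = a \<and> ?b a = B" if "a \<in> {1..m}" for a
    proof -
      have "a \<in> s ` ?PB" using that \<open>s ` ?PB = {1..m}\<close> by simp
      then obtain B where B: "B \<in> ?PB" "a = s B" by blast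
      then have "?b a = B" using s[OF B(1)] block_of_eq[OF P, of B] by simp
      then show ?thesis using B by (intro bexI[OF _ B(1)]) simp
    qed
    show ?R
    proof (intro ballI conjI allI impI)
      fix a assume a: "a \<in> {1..m}"
      obtain B where B: "B \<in> ?PB" "s B = a" "?b a = B" using ex[OF a] by blast
      show "\<exists>c. Inl c \<in> ?b a" using B by (auto simp: propagating_def)
      fix b assume "Inr b \<in> ?b a"
      then have b: "Inr b \<in> B" using B(3) by simp
      obtain a' where a': "a' \<in> {1..m}" "b = n - m + a'" using south[OF B(1) b] by blast
      obtain B' where B': "B' \<in> ?PB" "s B' = a'" "?b a' = B'" using ex[OF a'(1)] by blast
      have "?b a' = B" using block_of_eq[OF P _ b] B(1) a'(2) by simp
      then have "a' = a" using B B' by metis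
      then show "b = n - m + a" using a'(2) by simp
    qed
  next
    assume R: ?R
    have PB: "?PB = ?b ` {1..m}"
    proof (intro equalityI subsetI)
      fix B assume B: "B \<in> ?PB"
      then obtain b where b: "Inr b \<in> B" by (auto simp: propagating_def)
      obtain a where a: "a \<in> {1..m}" "b = n - m + a" using south[OF B b] by blast
      then have "?b a = B" using block_of_eq[OF P _ b] B by simp
      then show "B \<in> ?b ` {1..m}" using a by blast
    next
      fix B assume "B \<in> ?b ` {1..m}"
      then obtain a where a: "a \<in> {1..m}" "B = ?b a" by blast
      have "B \<in> v" "Inr (n - m + a) \<in> B" using block_of_in[OF P node[OF a(1)]] a(2) by auto
      moreover have "\<exists>c. Inl c \<in> B" using R a by blast
      ultimately show "B \<in> ?PB" by (auto simp: propagating_def)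
    qed
    have "inj_on ?b {1..m}"
    proof (rule inj_onI)
      fix a a' assume a: "a \<in> {1..m}" "a' \<in> {1..m}" "?b a = ?b a'"
      then have "Inr (n - m + a) \<in> ?b a'" using block_of_in(2)[OF P node[OF a(1)]] by simp
      then have "n - m + a = n - m + a'" using R a(2) by blast
      then show "a = a'" by simp
    qed
    then have "card ?PB = m" unfolding PB by (simp add: card_image)
    then show "v \<in> half_diagrams n m"
      using v single by (simp add: half_diagrams_def num_propagating_def)
  qed
qed

lemma half_diagramsD:
  assumes "v \<in> half_diagrams n m"
  shows "v \<in> diagrams n" "\<And>a. a \<in> {1..n - m} \<Longrightarrow> {Inr a} \<in> v"
  using assms by (auto simp: half_diagrams_def)

lemma finite_half_diagrams [simp]: "finite (half_diagrams n m)"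
  by (rule finite_subset[OF _ finite_diagrams[of n]]) (auto simp: half_diagrams_def)

lemma half_diagrams_block:
  assumes v: "v \<in> half_diagrams n m" and m: "m \<le> n" and a: "a \<in> {1..m}"
  shows "\<exists>c. Inl c \<in> block_of v (Inr (n - m + a))"
    "Inr b \<in> block_of v (Inr (n - m + a)) \<Longrightarrow> b = n - m + a"
  using half_diagrams_iff[OF half_diagramsD(1)[OF v] m half_diagramsD(2)[OF v]] v a by blast+

text \<open>The choice within the block is immaterial for colourings that are constant on the
  northern parts of the blocks.\<close>

definition marked_north :: "nat \<Rightarrow> nat \<Rightarrow> diagram \<Rightarrow> nat \<Rightarrow> nat" where
  "marked_north n m v a = (SOME c. Inl c \<in> block_of v (Inr (n - m + a)))"

lemma marked_north:
  assumes v: "v \<in> half_diagrams n m" and m: "m \<le> n" and a: "a \<in> {1..m}"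
  shows "Inl (marked_north n m v a) \<in> block_of v (Inr (n - m + a))" "marked_north n m v a \<in> {1..n}"
proof -
  show 1: "Inl (marked_north n m v a) \<in> block_of v (Inr (n - m + a))"
    unfolding marked_north_def using half_diagrams_block(1)[OF assms] by (rule someI_ex)
  note P = diagramsD[OF half_diagramsD(1)[OF v]]
  have "block_of v (Inr (n - m + a)) \<in> v" using a m by (intro block_of_in[OF P]) auto
  then show "marked_north n m v a \<in> {1..n}" using 1 partition_onD1[OF P] by blast
qed

text \<open>Every block has at most one southern node. The northern parts thus carry one condition,
  each of the last \<open>m\<close> southern nodes copies the colour of its marked northern node,
  and the first \<open>n - m\<close> southern nodes are free.\<close>

lemma const_on_half_diagram:
  assumes v: "v \<in> half_diagrams n m" and m: "m \<le> n"
  shows "const_on v (case_sum i k) \<longleftrightarrow>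
    const_on ((\<lambda>B. Inl -` B) ` v) i \<and> (\<forall>a\<in>{1..m}. k (n - m + a) = i (marked_north n m v a))"
    (is "_ \<longleftrightarrow> ?N \<and> ?M")
proof
  note P = diagramsD[OF half_diagramsD(1)[OF v]]
  assume c: "const_on v (case_sum i k)"
  have ?N
  proof (rule const_onI)
    fix B x y assume "B \<in> (\<lambda>B. Inl -` B) ` v" "x \<in> B" "y \<in> B"
    then obtain B' where "B' \<in> v" "Inl x \<in> B'" "Inl y \<in> B'" by auto
    from const_onD[OF c this] show "i x = i y" by simp
  qed
  moreover have ?M
  proof
    fix a assume a: "a \<in> {1..m}"
    have "Inr (n - m + a) \<in> nodes n" using a m by auto
    from const_onD[OF c block_of_in[OF P this] marked_north(1)[OF v m a]]
    show "k (n - m + a) = i (marked_north n m v a)" by simp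
  qed
  ultimately show "?N \<and> ?M" ..
next
  note P = diagramsD[OF half_diagramsD(1)[OF v]]
  assume "?N \<and> ?M"
  then have N: ?N and M: ?M by auto
  have ll: "i x = i y" if "B \<in> v" "Inl x \<in> B" "Inl y \<in> B" for B x y
    using const_onD[OF N, of "Inl -` B" x y] that by simp
  have lr: "i x = k b \<and> (\<forall>b'. Inr b' \<in> B \<longrightarrow> b' = b)" if B: "B \<in> v" "Inr b \<in> B" "Inl x \<in> B" for B b x
  proof -
    have "b \<in> {1..n}" using B partition_onD1[OF P] by auto
    moreover have "b \<notin> {1..n - m}"
    proof
      assume "b \<in> {1..n - m}"
      from block_of_eq[OF P half_diagramsD(2)[OF v this], of "Inr b"] block_of_eq[OF P B(1,2)]
      show False using B(3) by simp
    qed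
    ultimately have a: "b - (n - m) \<in> {1..m}" "b = n - m + (b - (n - m))" by auto
    have Bb: "block_of v (Inr (n - m + (b - (n - m)))) = B"
      using block_of_eq[OF P B(1,2)] a(2) by simp
    have "Inl (marked_north n m v (b - (n - m))) \<in> B"
      using marked_north(1)[OF v m a(1)] Bb by simp
    from ll[OF B(1,3) this] M a show ?thesis
      using half_diagrams_block(2)[OF v m a(1)] Bb by metis
  qed
  have rr: "b = b'" if B: "B \<in> v" "Inr b \<in> B" "Inr b' \<in> B" for B b b'
  proof (cases "\<exists>x. Inl x \<in> B")
    case True
    then show ?thesis using lr B by metis
  next
    case False
    have "b \<in> {1..n}" using B partition_onD1[OF P] by auto
    then consider "b \<in> {1..n - m}" | "b - (n - m) \<in> {1..m}" "b = n - m + (b - (n - m))" using m by force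
    then show ?thesis
    proof cases
      case 1
      from block_of_eq[OF P half_diagramsD(2)[OF v 1], of "Inr b"] block_of_eq[OF P B(1,2)]
      show ?thesis using B(3) by simp
    next
      case 2
      have "block_of v (Inr (n - m + (b - (n - m)))) = B"
        using block_of_eq[OF P B(1,2)] 2(2) by simp
      then have False using marked_north(1)[OF v m 2(1)] False by blast
      then show ?thesis ..
    qed
  qed
  show "const_on v (case_sum i k)"
  proof (rule const_onI)
    fix B p q assume B: "B \<in> v" "p \<in> B" "q \<in> B"
    show "case_sum i k p = case_sum i k q"
    proof (cases p; cases q)
      fix x y assume "p = Inl x" "q = Inl y"
      then show ?thesis using ll[of B x y] B by simp
    next
      fix x y assume "p = Inl x" "q = Inr y"
      then show ?thesis using conjunct1[OF lr[of B y x]] B by simp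
    next
      fix x y assume "p = Inr x" "q = Inl y"
      then show ?thesis using conjunct1[OF lr[of B x y]] B by simp
    next
      fix x y assume "p = Inr x" "q = Inr y"
      then show ?thesis using rr[of B x y] B by simp
    qed
  qed
qed

text \<open>Passing to a finer diagram cannot join two southern nodes. A propagating block could be
  lost only by cutting its southern node off from the north, which would make that node a
  singleton.\<close>

lemma half_diagrams_if_finer:
  assumes w: "w \<in> half_diagrams n m" and m: "m \<le> n" and u: "u \<in> diagrams n"
    and single: "\<And>a. a \<in> {1..n - m} \<Longrightarrow> {Inr a} \<in> u"
    and R: "finer u w" and ne: "\<And>a. a \<in> {1..m} \<Longrightarrow> {Inr (n - m + a)} \<notin> u"
  shows "u \<in> half_diagrams n m"
proof -
  note Pu = diagramsD[OF u] and Pw = diagramsD[OF half_diagramsD(1)[OF w]]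
  show ?thesis
  proof (rule iffD2[OF half_diagrams_iff[OF u m]], goal_cases)
    case (1 a)
    then show ?case by (rule single)
  next
    case 2
    show ?case
  proof (intro ballI conjI allI impI)
    fix a assume a: "a \<in> {1..m}"
    let ?p = "Inr (n - m + a) :: node"
    have p: "?p \<in> nodes n" using a m by auto
    note B = block_of_in[OF Pu p]
    obtain B' where B': "B' \<in> w" "block_of u ?p \<subseteq> B'" using R B(1) unfolding finer_def by blast
    then have "block_of w ?p = B'" using B(2) block_of_eq[OF Pw B'(1), of ?p] by blast
    then have sub: "block_of u ?p \<subseteq> block_of w ?p" using B' by simp
    show s: "b = n - m + a" if "Inr b \<in> block_of u ?p" for b
      using that sub half_diagrams_block(2)[OF w m a] by blast
    have "block_of u ?p \<noteq> {?p}" using ne[OF a] B(1) by metis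
    then obtain q where "q \<in> block_of u ?p" "q \<noteq> ?p" using B(2) by blast
    then show "\<exists>c. Inl c \<in> block_of u ?p" using s by (cases q) auto
  qed
  qed
qed

section \<open>The right action of the symmetric group on half diagrams\<close>

definition shift_perm :: "nat \<Rightarrow> nat \<Rightarrow> (nat \<Rightarrow> nat) \<Rightarrow> nat \<Rightarrow> nat" where
  "shift_perm n m \<tau> j = (if j \<le> n - m then j else n - m + \<tau> (j - (n - m)))"

lemma perm_half_diagram_eq:
  "perm_half_diagram n m v \<sigma> = (`) (map_sum id (shift_perm n m (inv_into UNIV \<sigma>))) ` v"
  unfolding perm_half_diagram_def shift_perm_def[abs_def] ..

lemma shift_perm_comp:
  assumes "\<tau> permutes {1..m}"
  shows "shift_perm n m \<tau>' (shift_perm n m \<tau> j) = shift_perm n m (\<tau>' \<circ> \<tau>) j"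
proof (cases "j \<le> n - m")
  case False
  then have "j - (n - m) \<noteq> 0" by simp
  \<comment> \<open>The value 0 would land on the node \<open>n - m\<close>, which belongs to the
    fixed nodes; a permutation of the positive range avoids it.\<close>
  then have "\<tau> (j - (n - m)) \<noteq> 0"
    using permutes_not_in[OF assms, of 0] permutes_inj[OF assms] by (metis atLeastAtMost_iff injD not_one_le_zero)
  then show ?thesis using False by (simp add: shift_perm_def)
qed (simp add: shift_perm_def)

lemma bij_shift_perm:
  assumes \<tau>: "\<tau> permutes {1..m}" and m: "m \<le> n"
  shows "bij_betw (shift_perm n m \<tau>) {1..n} {1..n}" "inj (shift_perm n m \<tau>)"
proof -
  have in1: "shift_perm n m \<sigma> j \<in> {1..n}" if "\<sigma> permutes {1..m}" "j \<in> {1..n}" for \<sigma> j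
  proof (cases "j \<le> n - m")
    case False
    then have "j - (n - m) \<in> {1..m}" using that(2) m by auto
    then have "\<sigma> (j - (n - m)) \<in> {1..m}" using that(1) by (simp only: permutes_in_image)
    then show ?thesis using False m by (auto simp: shift_perm_def)
  qed (use that in \<open>auto simp: shift_perm_def\<close>)
  have id: "shift_perm n m id j = j" for j by (simp add: shift_perm_def)
  have i1: "shift_perm n m (inv_into UNIV \<tau>) (shift_perm n m \<tau> j) = j" for j
    using shift_perm_comp[OF \<tau>, of n "inv_into UNIV \<tau>" j] permutes_inv_o(2)[OF \<tau>] id by simp
  have i2: "shift_perm n m \<tau> (shift_perm n m (inv_into UNIV \<tau>) j) = j" for j
    using shift_perm_comp[OF permutes_inv[OF \<tau>], of n \<tau> j] permutes_inv_o(1)[OF \<tau>] id by simp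
  show "inj (shift_perm n m \<tau>)" using i1 by (metis injI)
  show "bij_betw (shift_perm n m \<tau>) {1..n} {1..n}"
    using i1 i2 in1[OF \<tau>] in1[OF permutes_inv[OF \<tau>]]
    by (intro bij_betw_byWitness[where f' = "shift_perm n m (inv_into UNIV \<tau>)"]) blast+
qed

lemma perm_half_diagram_in_diagrams:
  assumes v: "v \<in> diagrams n" and \<sigma>: "\<sigma> permutes {1..m}" and m: "m \<le> n"
  shows "perm_half_diagram n m v \<sigma> \<in> diagrams n"
proof -
  let ?s = "shift_perm n m (inv_into UNIV \<sigma>)"
  note b = bij_shift_perm[OF permutes_inv[OF \<sigma>] m]
  have "inj (map_sum id ?s :: node \<Rightarrow> node)" using b(2) by (simp add: sum.inj_map)
  then have "inj_on (map_sum id ?s) (nodes n)" by (rule inj_on_subset) simp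
  then have "partition_on (map_sum id ?s ` nodes n) (perm_half_diagram n m v \<sigma>)"
    unfolding perm_half_diagram_eq
    using partition_on_inj_image[OF diagramsD[OF v]] partition_onD3[OF diagramsD[OF v]]
    by (metis (no_types, lifting) Diff_empty Diff_insert0 image_iff image_is_empty)
  moreover have "map_sum id ?s ` nodes n = {1..n} <+> ?s ` {1..n}"
    by (auto simp: image_iff Plus_def image_Un image_image)
  ultimately show ?thesis using b(1) by (simp add: diagrams_def bij_betw_def)
qed

lemma const_on_perm_half_diagram:
  "const_on (perm_half_diagram n m v \<sigma>) (case_sum i j) \<longleftrightarrow>
    const_on v (case_sum i (j \<circ> shift_perm n m (inv_into UNIV \<sigma>)))"
proof -
  have "case_sum i j \<circ> map_sum id s = case_sum i (j \<circ> s)" for s :: "nat \<Rightarrow> nat"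
    by (auto simp: fun_eq_iff split: sum.split)
  then show ?thesis unfolding perm_half_diagram_eq const_on_image by simp
qed

lemma num_propagating_perm_half_diagram:
  assumes \<sigma>: "\<sigma> permutes {1..m}" and m: "m \<le> n"
  shows "num_propagating (perm_half_diagram n m v \<sigma>) = num_propagating v"
proof -
  let ?s = "shift_perm n m (inv_into UNIV \<sigma>)"
  let ?f = "map_sum id ?s :: node \<Rightarrow> node"
  have inj: "inj ?f" using bij_shift_perm(2)[OF permutes_inv[OF \<sigma>] m] by (simp add: sum.inj_map)
  have p: "propagating (?f ` B) \<longleftrightarrow> propagating B" for B
  proof -
    have "(\<exists>i. Inl i \<in> ?f ` B) \<longleftrightarrow> (\<exists>i. Inl i \<in> B)"
    proof
      assume "\<exists>i. Inl i \<in> ?f ` B"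
      then obtain i q where "Inl i = ?f q" "q \<in> B" by auto
      then show "\<exists>i. Inl i \<in> B" by (cases q) auto
    qed force
    moreover have "(\<exists>i. Inr i \<in> ?f ` B) \<longleftrightarrow> (\<exists>i. Inr i \<in> B)"
    proof
      assume "\<exists>i. Inr i \<in> ?f ` B"
      then obtain i q where "Inr i = ?f q" "q \<in> B" by auto
      then show "\<exists>i. Inr i \<in> B" by (cases q) auto
    qed force
    ultimately show ?thesis by (simp add: propagating_def)
  qed
  have "{B \<in> perm_half_diagram n m v \<sigma>. propagating B} = (`) ?f ` {B \<in> v. propagating B}"
    unfolding perm_half_diagram_eq using p by blast
  moreover have "inj_on ((`) ?f) {B \<in> v. propagating B}"
    using inj by (simp add: inj_on_def inj_image_eq_iff)
  ultimately show ?thesis by (simp add: num_propagating_def card_image)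
qed

lemma perm_half_diagram_in:
  assumes v: "v \<in> half_diagrams n m" and \<sigma>: "\<sigma> permutes {1..m}" and m: "m \<le> n"
  shows "perm_half_diagram n m v \<sigma> \<in> half_diagrams n m"
proof -
  have "{Inr a} \<in> perm_half_diagram n m v \<sigma>" if "a \<in> {1..n - m}" for a
  proof -
    have "{Inr a} = map_sum id (shift_perm n m (inv_into UNIV \<sigma>)) ` {Inr a :: node}"
      using that by (simp add: shift_perm_def)
    then show ?thesis
      unfolding perm_half_diagram_eq using half_diagramsD(2)[OF v that] by (rule image_eqI)
  qed
  then show ?thesis
    using v perm_half_diagram_in_diagrams[OF half_diagramsD(1)[OF v] \<sigma> m]
      num_propagating_perm_half_diagram[OF \<sigma> m, of v]
    by (simp add: half_diagrams_def)
qed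

text \<open>Relabelling the southern nodes of the lower diagram does not affect what happens in the
  middle row: the left and right actions commute, and the same components are removed.\<close>

lemma concat_perm_half_diagram:
  assumes x: "x \<in> diagrams n" and v: "v \<in> diagrams n" and \<sigma>: "\<sigma> permutes {1..m}" and m: "m \<le> n"
  shows "concat_diagram x (perm_half_diagram n m v \<sigma>) = perm_half_diagram n m (concat_diagram x v) \<sigma>"
    "num_removed x (perm_half_diagram n m v \<sigma>) = num_removed x v"
proof -
  note v' = perm_half_diagram_in_diagrams[OF v \<sigma> m]
  show "concat_diagram x (perm_half_diagram n m v \<sigma>) = perm_half_diagram n m (concat_diagram x v) \<sigma>"
    by (rule diagrams_eqI[OF concat_diagram_in[OF x v'] perm_half_diagram_in_diagrams[OF concat_diagram_in[OF x v] \<sigma> m]])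
      (simp add: const_on_perm_half_diagram const_on_concat_diagram_iff_ex[OF x v] const_on_concat_diagram_iff_ex[OF x v'])
  show "num_removed x (perm_half_diagram n m v \<sigma>) = num_removed x v"
    by (rule num_removed_eqI[OF x v' v]) (simp add: const_on_perm_half_diagram comp_def)
qed

lemma concat_singleton:
  assumes x: "x \<in> diagrams n" and v: "v \<in> diagrams n" and s: "{Inr a} \<in> v"
  shows "{Inr a} \<in> concat_diagram x v"
proof -
  note P = diagramsD[OF concat_diagram_in[OF x v]]
  have Pv: "partition_on (nodes n) v" by (rule diagramsD[OF v])
  have a: "Inr a \<in> nodes n" using s partition_onD1[OF Pv] by blast
  \<comment> \<open>The test colouring singles out the southern node \<open>a\<close>. With a
    uniformly coloured middle row it is compatible with both diagrams, so no other node can share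
    the block of \<open>a\<close> in the concatenation.\<close>
  have "const_on v (case_sum (\<lambda>_. False) (\<lambda>b. b = a))"
  proof (rule const_onI)
    fix B p q assume B: "B \<in> v" "p \<in> B" "q \<in> B"
    show "case_sum (\<lambda>_. False) (\<lambda>b. b = a) p = case_sum (\<lambda>_. False) (\<lambda>b. b = a) q"
    proof (cases "Inr a \<in> B")
      case True
      then have "B = {Inr a}" using block_of_eq[OF Pv B(1)] block_of_eq[OF Pv s] by (metis singletonI)
      then show ?thesis using B by simp
    next
      case False
      then have "p \<noteq> Inr a" "q \<noteq> Inr a" using B by auto
      then show ?thesis by (auto split: sum.split)
    qed
  qed
  moreover have "const_on x (case_sum (\<lambda>_. False) (\<lambda>_. False))" by simp
  ultimately have c: "const_on (concat_diagram x v) (case_sum (\<lambda>_. False) (\<lambda>b. b = a))"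
    unfolding const_on_concat_diagram_iff_ex[OF x v] by blast
  note B = block_of_in[OF P a]
  have "q = Inr a" if "q \<in> block_of (concat_diagram x v) (Inr a)" for q
    using const_onD[OF c B that] by (cases q) auto
  then have "block_of (concat_diagram x v) (Inr a) = {Inr a}" using B(2) by blast
  then show ?thesis using B(1) by simp
qed

lemma concat_half_diagram:
  assumes "x \<in> diagrams n" "v \<in> half_diagrams n m"
  shows "concat_diagram x v \<in> half_diagrams n m \<longleftrightarrow> num_propagating (concat_diagram x v) = m"
  using concat_diagram_in[OF assms(1) half_diagramsD(1)[OF assms(2)]]
    concat_singleton[OF assms(1) half_diagramsD[OF assms(2)]]
  by (simp add: half_diagrams_def)

text \<open>Moebius inversion without the Moebius function: the system is triangular with ones on
  the diagonal, so it can be solved in any abelian group, with no division. The induction is on the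
  number of elements below \<open>d\<close>.\<close>

lemma exists_sum_below:
  fixes w :: "'a \<Rightarrow> 'r::ab_group_add"
  assumes fin: "finite S" and below_refl: "\<And>d. below d d"
    and below_trans: "\<And>d e f. below d e \<Longrightarrow> below e f \<Longrightarrow> below d f"
    and below_antisym: "\<And>d e. d \<in> S \<Longrightarrow> e \<in> S \<Longrightarrow> below d e \<Longrightarrow> below e d \<Longrightarrow> d = e"
  shows "\<exists>z. \<forall>d\<in>S. (\<Sum>e\<in>{e \<in> S. below e d}. z e) = w d"
proof -
  let ?down = "\<lambda>d. card {e \<in> S. below e d}"
  have less: "?down e < ?down d" if "d \<in> S" "e \<in> S" "below e d" "e \<noteq> d" for d e
  proof (rule psubset_card_mono)
    have "d \<notin> {f \<in> S. below f e}" using below_antisym[OF that(1,2)] that by blast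
    moreover have "{f \<in> S. below f e} \<subseteq> {f \<in> S. below f d}" using below_trans that by blast
    ultimately show "{f \<in> S. below f e} \<subset> {f \<in> S. below f d}" using that below_refl by blast
  qed (use fin in simp)
  have "\<exists>z. \<forall>d\<in>S. ?down d \<le> n \<longrightarrow> (\<Sum>e\<in>{e \<in> S. below e d}. z e) = w d" for n
  proof (induction n)
    case 0
    have "?down d \<noteq> 0" if "d \<in> S" for d using that below_refl fin by auto
    then have False if "d \<in> S" "?down d \<le> 0" for d using that by (metis le_zero_eq)
    then show ?case by blast
  next
    case (Suc n)
    then obtain z where z: "\<And>d. d \<in> S \<Longrightarrow> ?down d \<le> n \<Longrightarrow> (\<Sum>e\<in>{e \<in> S. below e d}. z e) = w d" by blast
    define z' where "z' d = (if ?down d = Suc n then w d - (\<Sum>e\<in>{e \<in> S. below e d} - {d}. z e) else z d)" for d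
    have "(\<Sum>e\<in>{e \<in> S. below e d}. z' e) = w d" if d: "d \<in> S" "?down d \<le> Suc n" for d
    proof -
      have z'z: "z' e = z e" if "e \<in> {e \<in> S. below e d} - {d}" for e
        using less[OF d(1), of e] that d(2) by (auto simp: z'_def)
      have "(\<Sum>e\<in>{e \<in> S. below e d}. z' e) = z' d + (\<Sum>e\<in>{e \<in> S. below e d} - {d}. z e)"
        using sum.cong[OF refl z'z] fin d(1) below_refl z'z by (simp add: sum.remove[of _ d])
      also have "\<dots> = w d"
      proof (cases "?down d = Suc n")
        case False
        then have "z' d + (\<Sum>e\<in>{e \<in> S. below e d} - {d}. z e) = (\<Sum>e\<in>{e \<in> S. below e d}. z e)"
          using fin d(1) below_refl by (simp add: sum.remove[of _ d] z'_def)
        then show ?thesis using z[OF d(1)] d(2) False by simp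
      qed (simp add: z'_def)
      finally show ?thesis .
    qed
    then show ?case by blast
  qed
  from this[of "card S"] obtain z where
    "\<forall>d\<in>S. ?down d \<le> card S \<longrightarrow> (\<Sum>e\<in>{e \<in> S. below e d}. z e) = w d" ..
  moreover have "?down d \<le> card S" for d using fin by (intro card_mono) auto
  ultimately show ?thesis by blast
qed

text \<open>The uniqueness half of the same triangular system.\<close>

lemma sum_below_determines:
  fixes a b :: "'a \<Rightarrow> 'r::ab_group_add"
  assumes fin: "finite S" and below_refl: "\<And>d. below d d"
    and below_trans: "\<And>d e f. below d e \<Longrightarrow> below e f \<Longrightarrow> below d f"
    and below_antisym: "\<And>d e. d \<in> S \<Longrightarrow> e \<in> S \<Longrightarrow> below d e \<Longrightarrow> below e d \<Longrightarrow> d = e"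
    and eq: "\<And>d. d \<in> S \<Longrightarrow> (\<Sum>e\<in>{e \<in> S. below e d}. a e) = (\<Sum>e\<in>{e \<in> S. below e d}. b e)"
  shows "d \<in> S \<Longrightarrow> a d = b d"
proof (induction "card {e \<in> S. below e d}" arbitrary: d rule: less_induct)
  case less
  note d = less.prems
  have "a e = b e" if e: "e \<in> {e \<in> S. below e d} - {d}" for e
  proof (rule less.hyps)
    show "e \<in> S" using e by simp
    show "card {f \<in> S. below f e} < card {f \<in> S. below f d}"
    proof (rule psubset_card_mono)
      have "d \<notin> {f \<in> S. below f e}" using below_antisym[OF d, of e] e by blast
      moreover have "{f \<in> S. below f e} \<subseteq> {f \<in> S. below f d}" using below_trans e by blast
      ultimately show "{f \<in> S. below f e} \<subset> {f \<in> S. below f d}" using d below_refl by blast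
    qed (use fin in simp)
  qed
  then have "(\<Sum>e\<in>{e \<in> S. below e d} - {d}. a e) = (\<Sum>e\<in>{e \<in> S. below e d} - {d}. b e)"
    by (rule sum.cong[OF refl])
  then show ?case
    using eq[OF d] fin d below_refl by (simp add: sum.remove[of _ d])
qed

section \<open>The sum of all permutations of the colours\<close>

definition colour_rel :: "nat \<Rightarrow> (node \<Rightarrow> 'c) \<Rightarrow> 'c rel" where
  "colour_rel n c = (\<lambda>a. (c (Inr a), c (Inl a))) ` {1..n}"

text \<open>Up to normalization, the probability that a random permutation \<open>\<sigma>\<close> of \<open>\<delta>\<close> colours, of
  weight \<open>T ^ cyc \<sigma>\<close>, maps the colour of each southern node to the one of the opposite northern
  node.\<close>

definition diag_weight :: "nat \<Rightarrow> 'r::comm_ring_1 \<Rightarrow> 'r \<Rightarrow> (node \<Rightarrow> 'c) \<Rightarrow> 'r" where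
  "diag_weight n \<delta> T c =
    (let g = colour_rel n c in
     if partial_inj g then T ^ cyc g * (\<Prod>j\<in>{card g<..n}. T + \<delta> - of_nat j) else 0)"

lemma finite_colour_rel [simp]: "finite (colour_rel n c)"
  by (simp add: colour_rel_def)

lemma card_colour_rel_le: "card (colour_rel n c) \<le> n"
  unfolding colour_rel_def using card_image_le[of "{1..n}"] by (metis card_atLeastAtMost diff_Suc_1 finite_atLeastAtMost)

lemma colour_rel_cong:
  "(\<And>p. p \<in> nodes n \<Longrightarrow> c p = c' p) \<Longrightarrow> colour_rel n c = colour_rel n c'"
  unfolding colour_rel_def by (intro image_cong) (simp_all add: InlI InrI)

lemma diag_weight_cong:
  "(\<And>p. p \<in> nodes n \<Longrightarrow> c p = c' p) \<Longrightarrow> diag_weight n \<delta> T c = diag_weight n \<delta> T c'"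
  unfolding diag_weight_def using colour_rel_cong[of n c c'] by simp

lemma diag_weight_comp:
  assumes "inj_on f (c ` nodes n)"
  shows "diag_weight n \<delta> T (f \<circ> c) = diag_weight n \<delta> T c"
proof -
  have g: "colour_rel n (f \<circ> c) = map_prod f f ` colour_rel n c"
    by (simp add: colour_rel_def image_image)
  have "Field (colour_rel n c) \<subseteq> c ` nodes n"
    unfolding colour_rel_def Field_def by auto
  then have "inj_on f (Field (colour_rel n c))" using assms by (rule inj_on_subset[rotated])
  then show ?thesis
    unfolding diag_weight_def g by (simp add: Let_def partial_inj_image cyc_image card_map_prod_image)
qed

text \<open>The weight of a colouring depends only on which nodes have equal colours. It therefore
  suffices that \<open>z\<close> solves the system for the colourings \<open>block_of d\<close>, one
  for each such pattern; finite sets of weights thus describe colourings in any number of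
  colours.\<close>

lemma diag_weight_eq_sum:
  assumes z: "\<And>d. d \<in> diagrams n \<Longrightarrow>
      (\<Sum>e\<in>{e \<in> diagrams n. finer e d}. z e) = diag_weight n \<delta> T (block_of d)"
  shows "diag_weight n \<delta> T c = (\<Sum>e\<in>{e \<in> diagrams n. const_on e c}. z e)"
proof -
  \<comment> \<open>Naming each colour by its set of nodes gives the pattern \<open>d\<close> of the
    colouring \<open>c\<close>.\<close>
  define h where "h x = {q \<in> nodes n. c q = x}" for x
  define d where "d = (\<lambda>p. h (c p)) ` nodes n"
  have d: "partition_on (nodes n) d"
    unfolding d_def h_def partition_on_def disjoint_def by auto
  then have dd: "d \<in> diagrams n" by (simp add: diagrams_def)
  have inj: "inj_on h (c ` nodes n)"
    by (rule inj_onI) (auto simp: h_def)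
  have blk: "block_of d p = (h \<circ> c) p" if "p \<in> nodes n" for p
    using that by (simp, intro block_of_eq[OF d]) (auto simp: d_def h_def)
  have "diag_weight n \<delta> T c = diag_weight n \<delta> T (block_of d)"
    using diag_weight_comp[OF inj, where \<delta> = \<delta> and T = T] diag_weight_cong[of n "block_of d" "h \<circ> c", OF blk, where \<delta> = \<delta> and T = T] by simp
  also have "\<dots> = (\<Sum>e\<in>{e \<in> diagrams n. finer e d}. z e)"
    by (rule z[OF dd, symmetric])
  also have "{e \<in> diagrams n. finer e d} = {e \<in> diagrams n. const_on e c}"
  proof -
    have "finer e d \<longleftrightarrow> const_on e c" if e: "e \<in> diagrams n" for e
    proof -
      have ue: "\<Union>e = nodes n" using partition_onD1[OF diagramsD[OF e]] by simp
      have "finer e d \<longleftrightarrow> const_on e (block_of d)"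
        by (rule finer_iff_const_on[OF diagramsD[OF e] d])
      also have "\<dots> \<longleftrightarrow> const_on e (h \<circ> c)"
        using blk ue by (intro const_on_cong) auto
      also have "\<dots> \<longleftrightarrow> const_on e c" using inj ue by (intro const_on_inj) simp
      finally show ?thesis .
    qed
    then show ?thesis by blast
  qed
  finally show ?thesis .
qed

text \<open>The origin of the product in \<open>diag_weight\<close>: extending a partial injection
  with \<open>k\<close> edges to \<open>N\<close> points gives the left-hand side. Its first part is
  common to all \<open>k \<le> n\<close> and depends on the range of the index, whereas the second
  is polynomial in \<open>T\<close> and in \<open>N\<close>.\<close>

lemma prod_add_of_nat_split:
  fixes T :: "'r::comm_ring_1"
  assumes "k \<le> n" "n \<le> N"
  shows "(\<Prod>j<N - k. T + of_nat j) = (\<Prod>j<N - n. T + of_nat j) * (\<Prod>j\<in>{k<..n}. T + of_nat N - of_nat j)"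
proof -
  have "{..<N - k} = {..<N - n} \<union> (\<lambda>j. N - j) ` {k<..n}"
  proof (intro equalityI subsetI)
    fix x assume x: "x \<in> {..<N - k}"
    show "x \<in> {..<N - n} \<union> (\<lambda>j. N - j) ` {k<..n}"
    proof (cases "x < N - n")
      case False
      then have "x = N - (N - x)" "N - x \<in> {k<..n}" using x assms by auto
      then show ?thesis by blast
    qed simp
  qed (use assms in auto)
  moreover have "{..<N - n} \<inter> (\<lambda>j. N - j) ` {k<..n} = {}" using assms by auto
  ultimately have "(\<Prod>j<N - k. T + of_nat j) =
      (\<Prod>j<N - n. T + of_nat j) * (\<Prod>j\<in>(\<lambda>j. N - j) ` {k<..n}. T + of_nat j)"
    by (simp add: prod.union_disjoint)
  also have "(\<Prod>j\<in>(\<lambda>j. N - j) ` {k<..n}. T + of_nat j) = (\<Prod>j\<in>{k<..n}. T + of_nat (N - j))"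
    using assms by (intro prod.reindex_cong[where l = "\<lambda>j. N - j"]) (auto simp: inj_on_def)
  also have "\<dots> = (\<Prod>j\<in>{k<..n}. T + of_nat N - of_nat j)"
    using assms by (intro prod.cong refl) (auto simp: of_nat_diff)
  finally show ?thesis .
qed

text \<open>The permutations counted are the extensions of the relation from southern to northern
  colours; if this relation is no partial injection, there are none.\<close>

lemma sum_cyc_matching:
  fixes T :: "'r::comm_ring_1"
  assumes X: "finite X" and N: "n \<le> card X"
    and i: "\<And>a. a \<in> {1..n} \<Longrightarrow> i a \<in> X" and l: "\<And>a. a \<in> {1..n} \<Longrightarrow> l a \<in> X"
  shows "(\<Sum>\<sigma> | \<sigma> permutes X \<and> (\<forall>a\<in>{1..n}. \<sigma> (l a) = i a). T ^ cyc (perm_graph X \<sigma>)) =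
    (\<Prod>j<card X - n. T + of_nat j) * diag_weight n (of_nat (card X)) T (case_sum i l)"
proof -
  let ?g = "colour_rel n (case_sum i l)"
  have S: "{\<sigma>. \<sigma> permutes X \<and> (\<forall>a\<in>{1..n}. \<sigma> (l a) = i a)} = {\<sigma>. \<sigma> permutes X \<and> (\<forall>(a, b)\<in>?g. \<sigma> a = b)}"
    by (auto simp: colour_rel_def)
  show ?thesis
  proof (cases "partial_inj ?g")
    case True
    have "?g \<subseteq> X \<times> X" using i l by (auto simp: colour_rel_def)
    from sum_cyc_extensions[OF X True this, of T] show ?thesis
      unfolding S diag_weight_def prod_add_of_nat_split[OF card_colour_rel_le N, of T "case_sum i l"]
      using True by (simp add: Let_def algebra_simps)
  next
    case False
    have "partial_inj ?g" if \<sigma>: "\<sigma> permutes X" "\<forall>(a, b)\<in>?g. \<sigma> a = b" for \<sigma>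
    proof (rule partial_injI)
      show "y = z" if "(x, y) \<in> ?g" "(x, z) \<in> ?g" for x y z
        using bspec[OF \<sigma>(2) that(1)] bspec[OF \<sigma>(2) that(2)] by simp
      show "x = y" if "(x, z) \<in> ?g" "(y, z) \<in> ?g" for x y z
      proof -
        have "\<sigma> x = \<sigma> y" using bspec[OF \<sigma>(2) that(1)] bspec[OF \<sigma>(2) that(2)] by simp
        then show ?thesis using permutes_inj[OF \<sigma>(1)] by (auto dest: injD)
      qed
    qed
    then have "{\<sigma>. \<sigma> permutes X \<and> (\<forall>(a, b)\<in>?g. \<sigma> a = b)} = {}" using False by blast
    then have "(\<Sum>\<sigma> | \<sigma> permutes X \<and> (\<forall>(a, b)\<in>?g. \<sigma> a = b). T ^ cyc (perm_graph X \<sigma>)) = 0"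
      by (simp only: sum.empty)
    then show ?thesis unfolding S diag_weight_def using False by (simp only: Let_def if_False mult_zero_right)
  qed
qed

section \<open>Alternating sums over marked southern nodes\<close>

lemma sum_Pow_toggle:
  fixes F :: "'a set \<Rightarrow> 'r::comm_ring_1"
  assumes fin: "finite M" and b: "b \<in> M" and F: "\<And>A. A \<subseteq> M - {b} \<Longrightarrow> F (insert b A) = F A"
  shows "(\<Sum>A\<in>Pow M. (- 1) ^ card A * F A) = 0"
proof -
  let ?M = "M - {b}"
  have "insert b ?M = M" using b by auto
  then have M: "Pow M = Pow ?M \<union> insert b ` Pow ?M" using Pow_insert[of b ?M] by simp
  have "(\<Sum>A\<in>Pow M. (- 1) ^ card A * F A) =
      (\<Sum>A\<in>Pow ?M. (- 1) ^ card A * F A) + (\<Sum>A\<in>insert b ` Pow ?M. (- 1) ^ card A * F A)"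
    unfolding M using fin by (subst sum.union_disjoint) auto
  also have "(\<Sum>A\<in>insert b ` Pow ?M. (- 1) ^ card A * F A) =
      (\<Sum>A\<in>Pow ?M. (- 1) ^ card (insert b A) * F (insert b A))"
    by (rule sum.reindex_cong[where l = "insert b"]) (auto simp: inj_on_def)
  also have "\<dots> = (\<Sum>A\<in>Pow ?M. - ((- 1) ^ card A * F A))"
  proof (intro sum.cong refl)
    fix A assume A: "A \<in> Pow ?M"
    then have "finite A" "b \<notin> A" using fin by (auto intro: finite_subset)
    then show "(- 1) ^ card (insert b A) * F (insert b A) = - ((- 1) ^ card A * F A)"
      using F[of A] A by simp
  qed
  finally show ?thesis by (simp add: sum_negf)
qed

lemma cyc_add_sources:
  assumes fin: "finite A" and g: "finite g" "single_valued g"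
  shows "inj_on s A \<Longrightarrow> s ` A \<inter> Field g = {} \<Longrightarrow> s ` A \<inter> t ` A = {} \<Longrightarrow>
    cyc (g \<union> (\<lambda>a. (s a, t a)) ` A) = cyc g \<and> single_valued (g \<union> (\<lambda>a. (s a, t a)) ` A)"
  using fin
proof (induction A rule: finite_induct)
  case (insert a A)
  let ?g = "g \<union> (\<lambda>a. (s a, t a)) ` A"
  have IH: "cyc ?g = cyc g" "single_valued ?g" using insert by auto
  have s: "s a \<notin> Domain ?g" "s a \<notin> Range ?g" "t a \<noteq> s a"
  proof -
    have 1: "s a \<notin> Field g" "\<And>b. b \<in> insert a A \<Longrightarrow> s a \<noteq> t b" using insert.prems(2,3) by auto
    have 2: "s a \<noteq> s b" if "b \<in> A" for b
      using inj_onD[OF insert.prems(1), of a b] insert.hyps(2) that by auto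
    show "s a \<notin> Domain ?g" using 1(1) 2 by (auto simp: Field_def)
    show "s a \<notin> Range ?g" using 1 by (auto simp: Field_def)
    show "t a \<noteq> s a" using 1(2)[of a] by simp
  qed
  have eq: "g \<union> (\<lambda>a. (s a, t a)) ` insert a A = insert (s a, t a) ?g" by auto
  have "single_valued (insert (s a, t a) ?g)"
    unfolding single_valued_def
  proof (intro allI impI)
    fix x y z assume xyz: "(x, y) \<in> insert (s a, t a) ?g" "(x, z) \<in> insert (s a, t a) ?g"
    show "y = z"
    proof (cases "x = s a")
      case True
      then have "(x, w) \<notin> ?g" for w using s(1) by (metis DomainI)
      then show ?thesis using xyz by blast
    next
      case False
      then have "(x, y) \<in> ?g" "(x, z) \<in> ?g" using xyz by blast+
      then show ?thesis by (rule single_valuedD[OF IH(2)])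
    qed
  qed
  moreover have "cyc (insert (s a, t a) ?g) = cyc ?g"
    using s IH(2) g(1) insert.hyps by (intro cyc_insert_source) auto
  ultimately show ?case unfolding eq using IH(1) by simp
qed (use g in simp)

text \<open>As \<open>J\<close> is injective, there is at most one such \<open>\<rho>\<close>, and
  \<open>J\<close> carries its graph to the edges from \<open>J a\<close> to
  \<open>J (\<rho> a) = t a\<close>.\<close>

lemma sum_perms_prescribed:
  fixes U :: "'r::comm_ring_1"
  assumes I: "finite I" and J: "inj_on J I"
  shows "(\<Sum>\<rho> | \<rho> permutes I \<and> (\<forall>a\<in>I. J (\<rho> a) = t a). U ^ cyc (perm_graph I \<rho>)) =
    (if inj_on t I \<and> t ` I \<subseteq> J ` I then U ^ cyc ((\<lambda>a. (J a, t a)) ` I) else 0)"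
proof (cases "inj_on t I \<and> t ` I \<subseteq> J ` I")
  case True
  define \<rho> where "\<rho> a = (if a \<in> I then inv_into I J (t a) else a)" for a
  have J\<rho>: "J (\<rho> a) = t a" "\<rho> a \<in> I" if "a \<in> I" for a
  proof -
    have "t a \<in> J ` I" using True that by auto
    then show "J (\<rho> a) = t a" "\<rho> a \<in> I"
      using that by (simp_all add: \<rho>_def f_inv_into_f inv_into_into)
  qed
  have "inj_on \<rho> I"
  proof (rule inj_onI)
    fix a b assume ab: "a \<in> I" "b \<in> I" "\<rho> a = \<rho> b"
    then have "t a = t b" using J\<rho>(1)[of a] J\<rho>(1)[of b] by simp
    then show "a = b" using True ab by (meson inj_onD)
  qed
  moreover have "\<rho> ` I \<subseteq> I" using J\<rho>(2) by auto
  ultimately have "bij_betw \<rho> I I" using I by (simp add: bij_betw_def endo_inj_surj)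
  then have perm: "\<rho> permutes I" by (rule bij_imp_permutes) (simp add: \<rho>_def)
  have "\<rho>' = \<rho>" if \<rho>': "\<rho>' permutes I" "\<forall>a\<in>I. J (\<rho>' a) = t a" for \<rho>'
  proof
    fix a show "\<rho>' a = \<rho> a"
    proof (cases "a \<in> I")
      case True
      have "\<rho>' a \<in> I" using \<rho>'(1) True by (simp only: permutes_in_image)
      moreover have "J (\<rho>' a) = J (\<rho> a)" using \<rho>'(2) J\<rho>(1) True by simp
      ultimately show ?thesis using J J\<rho>(2)[OF True] by (meson inj_onD)
    qed (use permutes_not_in[OF \<rho>'(1)] permutes_not_in[OF perm] in simp)
  qed
  then have "{\<rho>. \<rho> permutes I \<and> (\<forall>a\<in>I. J (\<rho> a) = t a)} = {\<rho>}"
    using perm J\<rho>(1) by blast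
  moreover have "(\<lambda>a. (J a, t a)) ` I = map_prod J J ` perm_graph I \<rho>"
    unfolding perm_graph_def image_image using J\<rho>(1) by (intro image_cong) auto
  moreover have "Field (perm_graph I \<rho>) \<subseteq> I"
    using J\<rho>(2) by (auto simp: Field_def)
  ultimately show ?thesis
    using True J by (simp add: cyc_image inj_on_subset)
next
  case False
  have "inj_on t I \<and> t ` I \<subseteq> J ` I" if \<rho>: "\<rho> permutes I" "\<forall>a\<in>I. J (\<rho> a) = t a" for \<rho>
  proof
    have in\<rho>: "\<rho> a \<in> I" if "a \<in> I" for a using \<rho>(1) that by (simp only: permutes_in_image)
    show "inj_on t I"
    proof (rule inj_onI)
      fix a b assume ab: "a \<in> I" "b \<in> I" "t a = t b"
      then have "J (\<rho> a) = J (\<rho> b)" using \<rho>(2) by simp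
      then have "\<rho> a = \<rho> b" using J in\<rho> ab by (meson inj_onD)
      then show "a = b" using permutes_inj[OF \<rho>(1)] by (auto dest: injD)
    qed
    show "t ` I \<subseteq> J ` I" using \<rho>(2) in\<rho> by (metis image_iff image_subsetI)
  qed
  then have "{\<rho>. \<rho> permutes I \<and> (\<forall>a\<in>I. J (\<rho> a) = t a)} = {}" using False by blast
  then show ?thesis by (simp only: sum.empty if_not_P[OF False])
qed

lemma partial_inj_pairs:
  assumes "inj_on k I" "inj_on t I"
  shows "partial_inj ((\<lambda>a. (k a, t a)) ` I)"
  by (rule partial_injI) (use assms in \<open>auto dest: inj_onD\<close>)

text \<open>An edge that starts in a fresh point lies on no cycle, so moving the source of an edge
  to \<open>s a\<close> has the same effect on \<open>cyc\<close> as deleting the edge. This reduces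
  the sum to \<open>signed_sum_cyc_restrict\<close>.\<close>

lemma signed_sum_fresh_sources:
  fixes T :: "'r::comm_ring_1"
  assumes I: "finite I" and J: "inj_on J I" and t: "inj_on t I" and s: "inj_on s I"
    and fresh: "s ` I \<inter> (J ` I \<union> t ` I) = {}"
  shows "(\<Sum>A\<in>Pow I. (- 1) ^ card A * T ^ cyc ((\<lambda>a. (if a \<in> A then s a else J a, t a)) ` I)) =
    (if t ` I \<subseteq> J ` I then (T - 1) ^ cyc ((\<lambda>a. (J a, t a)) ` I) else 0)"
proof -
  let ?g = "(\<lambda>a. (J a, t a)) ` I"
  have pg: "partial_inj ?g"
    using J t by (rule partial_inj_pairs)
  have D: "Domain ?g = J ` I" "Range ?g = t ` I" by auto
  have "(\<Sum>A\<in>Pow I. (- 1) ^ card A * T ^ cyc ((\<lambda>a. (if a \<in> A then s a else J a, t a)) ` I)) =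
      (\<Sum>A\<in>Pow I. (- 1) ^ card (J ` A) * T ^ cyc (?g \<inter> (- (J ` A)) \<times> UNIV))"
  proof (intro sum.cong refl)
    fix A assume "A \<in> Pow I"
    then have A: "A \<subseteq> I" by simp
    let ?h = "?g \<inter> (- (J ` A)) \<times> UNIV"
    have h: "?h = (\<lambda>a. (J a, t a)) ` (I - A)"
      using A J by (auto dest: inj_onD)
    have "(\<lambda>a. (if a \<in> A then s a else J a, t a)) ` I = ?h \<union> (\<lambda>a. (s a, t a)) ` A"
    proof -
      let ?f = "\<lambda>a. (if a \<in> A then s a else J a, t a)"
      have "I = (I - A) \<union> A" using A by blast
      then have "?f ` I = ?f ` (I - A) \<union> ?f ` A" by (metis image_Un)
      moreover have "?f ` (I - A) = ?h" unfolding h by (intro image_cong) auto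
      moreover have "?f ` A = (\<lambda>a. (s a, t a)) ` A" by (intro image_cong) auto
      ultimately show ?thesis by simp
    qed
    moreover have "cyc (?h \<union> (\<lambda>a. (s a, t a)) ` A) = cyc ?h"
    proof (rule conjunct1[OF cyc_add_sources])
      show "finite A" using A I by (rule finite_subset)
      show "finite ?h" using I by simp
      show "single_valued ?h" using partial_inj_subset[OF pg, of ?h] by (simp add: partial_inj_def)
      show "inj_on s A" using s A by (rule inj_on_subset)
      show "s ` A \<inter> Field ?h = {}" using fresh A unfolding Field_def by auto
      show "s ` A \<inter> t ` A = {}" using fresh A by blast
    qed
    moreover have "card (J ` A) = card A" using J A by (simp add: card_image inj_on_subset)
    ultimately show "(- 1) ^ card A * T ^ cyc ((\<lambda>a. (if a \<in> A then s a else J a, t a)) ` I) =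
        (- 1) ^ card (J ` A) * T ^ cyc ?h" by simp
  qed
  also have "\<dots> = (\<Sum>A\<in>Pow (J ` I). (- 1) ^ card A * T ^ cyc (?g \<inter> (- A) \<times> UNIV))"
    by (rule sum.reindex_cong[where l = "(`) J", symmetric])
      (use J in \<open>auto simp: inj_on_image_Pow image_Pow_surj\<close>)
  also have "\<dots> = (if t ` I \<subseteq> J ` I then (T - 1) ^ cyc ?g else 0)"
    using signed_sum_cyc_restrict[of ?g T] I pg by (simp add: D)
  finally show ?thesis .
qed

lemma const_on_cong_off_singleton:
  assumes P: "partition_on A u" and s: "{p} \<in> u" and c: "\<And>q. q \<noteq> p \<Longrightarrow> c q = c' q"
  shows "const_on u c \<longleftrightarrow> const_on u c'"
proof -
  have *: "const_on u c'" if "const_on u c" and c: "\<And>q. q \<noteq> p \<Longrightarrow> c q = c' q" for c c' :: "'a \<Rightarrow> 'b"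
  proof (rule const_onI)
    fix B x y assume B: "B \<in> u" "x \<in> B" "y \<in> B"
    show "c' x = c' y"
    proof (cases "p \<in> B")
      case True
      then have "B = {p}" using block_of_eq[OF P B(1)] block_of_eq[OF P s] by (metis singletonI)
      then show ?thesis using B by simp
    next
      case False
      then have "x \<noteq> p" "y \<noteq> p" using B by auto
      then show ?thesis using const_onD[OF that(1) B] c by simp
    qed
  qed
  show ?thesis using *[of c c'] *[of c' c] c by metis
qed

lemma sum_over_fibres:
  assumes "finite A" "finite B"
  shows "(\<Sum>b\<in>B. \<Sum>x\<in>{x \<in> A. g x = b}. f x) = (\<Sum>x\<in>{x \<in> A. g x \<in> B}. f x)"
proof -
  have "(\<Sum>x\<in>{x \<in> A. g x \<in> B}. f x) = (\<Sum>b\<in>B. \<Sum>x\<in>{x \<in> {x \<in> A. g x \<in> B}. g x = b}. f x)"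
    using assms by (intro sum.group[symmetric]) auto
  also have "\<dots> = (\<Sum>b\<in>B. \<Sum>x\<in>{x \<in> A. g x = b}. f x)"
    by (intro sum.cong refl) auto
  finally show ?thesis by simp
qed

text \<open>The colours \<open>2 * n + b\<close> are fresh, as those of \<open>j\<close> are below \<open>2 * n\<close>.\<close>

definition mark :: "nat \<Rightarrow> nat \<Rightarrow> (nat \<Rightarrow> nat) \<Rightarrow> nat set \<Rightarrow> nat \<Rightarrow> nat" where
  "mark n m j A b = (if n - m < b \<and> b - (n - m) \<in> A then 2 * n + b else j b)"

lemma mark_shift: "a \<in> {1..m} \<Longrightarrow> mark n m j A (n - m + a) = (if a \<in> A then 2 * n + (n - m + a) else j (n - m + a))"
  by (auto simp: mark_def)

lemma mark_empty: "mark n m j {} = j"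
  by (auto simp: mark_def)

text \<open>If one of the last \<open>m\<close> southern nodes is a singleton of \<open>u\<close>,
  marking it makes no difference and the terms cancel in pairs. Otherwise a marked node shares its
  block with a node of another colour, so only the empty set of marks contributes. The alternating
  sum thus detects half diagrams with the full number of propagating blocks.\<close>

lemma signed_sum_marks:
  assumes w: "w \<in> half_diagrams n m" and m: "m \<le> n" and u: "u \<in> diagrams n"
    and single: "\<And>a. a \<in> {1..n - m} \<Longrightarrow> {Inr a} \<in> u"
    and i: "\<And>a. a \<in> {1..n} \<Longrightarrow> i a < 2 * n" and j: "\<And>a. a \<in> {1..n} \<Longrightarrow> j a < 2 * n"
    and ij: "const_on u (case_sum i j) \<longleftrightarrow> finer u w"
  shows "(\<Sum>A\<in>Pow {1..m}. (- 1) ^ card A * (if const_on u (case_sum i (mark n m j A)) then 1 else 0 :: 'r::comm_ring_1)) =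
    (if u \<in> half_diagrams n m \<and> finer u w then 1 else 0)"
proof (cases "\<exists>a\<in>{1..m}. {Inr (n - m + a)} \<in> u")
  case True
  then obtain a where a: "a \<in> {1..m}" "{Inr (n - m + a)} \<in> u" by blast
  note P = diagramsD[OF u]
  have "u \<notin> half_diagrams n m"
  proof
    assume "u \<in> half_diagrams n m"
    from half_diagrams_block(1)[OF this m a(1)] block_of_eq[OF P a(2)] show False by auto
  qed
  moreover have "(\<Sum>A\<in>Pow {1..m}. (- 1) ^ card A * (if const_on u (case_sum i (mark n m j A)) then 1 else 0 :: 'r)) = 0"
  proof (rule sum_Pow_toggle[OF _ a(1)])
    fix A
    have "const_on u (case_sum i (mark n m j (insert a A))) \<longleftrightarrow> const_on u (case_sum i (mark n m j A))"
    proof (rule const_on_cong_off_singleton[OF P a(2)])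
      fix q :: node assume "q \<noteq> Inr (n - m + a)"
      then show "case_sum i (mark n m j (insert a A)) q = case_sum i (mark n m j A) q"
        by (cases q) (auto simp: mark_def)
    qed
    then show "(if const_on u (case_sum i (mark n m j (insert a A))) then 1 else 0 :: 'r) =
        (if const_on u (case_sum i (mark n m j A)) then 1 else 0)" by simp
  qed simp
  ultimately show ?thesis by simp
next
  case False
  note P = diagramsD[OF u]
  have not: "\<not> const_on u (case_sum i (mark n m j A))" if A: "A \<subseteq> {1..m}" "a \<in> A" for A a
  proof
    assume c: "const_on u (case_sum i (mark n m j A))"
    have a: "a \<in> {1..m}" using A by auto
    let ?p = "Inr (n - m + a) :: node"
    have p: "?p \<in> nodes n" using a m by auto
    note B = block_of_in[OF P p]
    have "block_of u ?p \<noteq> {?p}" using False a B(1) by metis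
    then obtain q where q: "q \<in> block_of u ?p" "q \<noteq> ?p" using B(2) by blast
    have "q \<in> nodes n" using q(1) B(1) partition_onD1[OF P] by blast
    moreover have "case_sum i (mark n m j A) q = 2 * n + (n - m + a)"
      using const_onD[OF c B(1) q(1) B(2)] A(2) mark_shift[OF a, of n j A] by simp
    ultimately show False using q(2) i j
    proof (cases q)
      case (Inr b)
      then have "mark n m j A b = 2 * n + (n - m + a)" "b \<in> {1..n}" "b \<noteq> n - m + a"
        using \<open>case_sum i (mark n m j A) q = _\<close> \<open>q \<in> nodes n\<close> q(2) by auto
      then show ?thesis using j[of b] by (auto simp: mark_def split: if_splits)
    next
      case (Inl b)
      then have "i b = 2 * n + (n - m + a)" "b \<in> {1..n}"
        using \<open>case_sum i (mark n m j A) q = _\<close> \<open>q \<in> nodes n\<close> by auto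
      then show ?thesis using i[of b] by simp
    qed
  qed
  have "(\<Sum>A\<in>Pow {1..m}. (- 1) ^ card A * (if const_on u (case_sum i (mark n m j A)) then 1 else 0 :: 'r)) =
      (\<Sum>A\<in>{{}}. (- 1) ^ card A * (if const_on u (case_sum i (mark n m j A)) then 1 else 0))"
  proof (rule sum.mono_neutral_right)
    show "\<forall>A\<in>Pow {1..m} - {{}}. (- 1) ^ card A * (if const_on u (case_sum i (mark n m j A)) then 1 else 0 :: 'r) = 0"
    proof
      fix A assume A: "A \<in> Pow {1..m} - {{}}"
      then obtain a where "a \<in> A" by blast
      with A have "\<not> const_on u (case_sum i (mark n m j A))" by (intro not) auto
      then show "(- 1) ^ card A * (if const_on u (case_sum i (mark n m j A)) then 1 else 0 :: 'r) = 0" by simp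
    qed
  qed auto
  also have "\<dots> = (if finer u w then 1 else 0)" using ij by (simp add: mark_empty)
  also have "\<dots> = (if u \<in> half_diagrams n m \<and> finer u w then 1 else 0)"
    using half_diagrams_if_finer[OF w m u single] False by auto
  finally show ?thesis .
qed

text \<open>The blocks are numbered, and there are at most as many of them as the
  \<open>2 * n\<close> nodes.\<close>

lemma exists_block_colouring:
  assumes w: "w \<in> diagrams n"
  shows "\<exists>i j :: nat \<Rightarrow> nat. (\<forall>a\<in>{1..n}. i a < 2 * n \<and> j a < 2 * n) \<and>
    (\<forall>p\<in>nodes n. \<forall>q\<in>nodes n. case_sum i j p = case_sum i j q \<longleftrightarrow> block_of w p = block_of w q) \<and>
    (\<forall>u\<in>diagrams n. const_on u (case_sum i j) \<longleftrightarrow> finer u w)"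
proof -
  note P = diagramsD[OF w]
  have finw: "finite w" using P by (metis finite_UnionD finite_Plus finite_atLeastAtMost partition_onD1)
  obtain f :: "node set \<Rightarrow> nat" where f: "f ` w = {..<card w}" "inj_on f w"
    using finite_imp_inj_to_nat_seg[OF finw] finw by (metis atLeast0LessThan card_image card_atLeastLessThan lessThan_def card_lessThan)
  have bw: "block_of w ` nodes n = w"
  proof (intro equalityI subsetI)
    fix B assume B: "B \<in> w"
    then obtain x where x: "x \<in> B" using partition_onD3[OF P] by (metis ex_in_conv)
    then have "x \<in> nodes n" using partition_onD1[OF P] B by auto
    then show "B \<in> block_of w ` nodes n" using block_of_eq[OF P B x] by blast
  qed (use block_of_in(1)[OF P] in blast)
  then have "card w \<le> card (nodes n)" by (metis card_image_le finite_Plus finite_atLeastAtMost)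
  then have cw: "card w \<le> 2 * n" by (simp add: card_Plus)
  have lt: "f (block_of w p) < 2 * n" if "p \<in> nodes n" for p
  proof -
    have "f (block_of w p) \<in> f ` w" using block_of_in(1)[OF P that] by blast
    then show ?thesis using f(1) cw by auto
  qed
  define i where "i a = f (block_of w (Inl a))" for a
  define j where "j a = f (block_of w (Inr a))" for a
  have ij: "case_sum i j = f \<circ> block_of w"
    by (auto simp: fun_eq_iff i_def j_def split: sum.split)
  show ?thesis
  proof (intro exI conjI ballI)
    fix a assume "a \<in> {1..n}"
    then show "i a < 2 * n" "j a < 2 * n" using lt by (simp_all add: i_def j_def InlI InrI)
  next
    fix p q assume "p \<in> nodes n" "q \<in> nodes n"
    then show "case_sum i j p = case_sum i j q \<longleftrightarrow> block_of w p = block_of w q"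
      unfolding ij using inj_on_eq_iff[OF f(2)] block_of_in(1)[OF P] by simp
  next
    fix u assume u: "u \<in> diagrams n"
    have "const_on u (f \<circ> block_of w) \<longleftrightarrow> const_on u (block_of w)"
      using partition_onD1[OF diagramsD[OF u]] bw f(2) by (intro const_on_inj) simp
    then show "const_on u (case_sum i j) \<longleftrightarrow> finer u w"
      unfolding ij using finer_iff_const_on[OF diagramsD[OF u] P] by simp
  qed
qed

text \<open>Up to the factor \<open>\<Prod>j<N - n. T + j\<close>, \<open>z\<close> acts as the sum of all \<open>T ^ cyc \<sigma> \<cdot> \<sigma>\<close>, which commutes
  with \<open>v\<close>. Both sides are evaluated at an alternating sum of colourings that is killed by all diagrams
  with fewer propagating blocks.\<close>

lemma half_diagram_sum_below:
  fixes T :: "'r::idom"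
  assumes m: "m \<le> n" and v: "v \<in> half_diagrams n m" and w: "w \<in> half_diagrams n m"
    and N: "3 * n < N" and K: "(\<Prod>j<N - n. T + of_nat j) \<noteq> 0"
    and z: "\<And>d. d \<in> diagrams n \<Longrightarrow>
      (\<Sum>e\<in>{e \<in> diagrams n. finer e d}. z e) = diag_weight n (of_nat N) T (block_of d)"
  shows "(\<Sum>e\<in>{e \<in> diagrams n. concat_diagram e v \<in> {w' \<in> half_diagrams n m. finer w' w}}.
      z e * of_nat N ^ num_removed e v) =
    (\<Prod>j\<in>{m<..n}. T + of_nat N - of_nat j) *
    (\<Sum>\<pi>\<in>{\<pi>. \<pi> permutes {1..m} \<and> finer (perm_half_diagram n m v \<pi>) w}.
      (T - 1) ^ cyc (perm_graph {1..m} (inv_into UNIV \<pi>)))"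
proof -
  note vd = half_diagramsD(1)[OF v] and wd = half_diagramsD(1)[OF w]
  obtain i j :: "nat \<Rightarrow> nat" where
    ijlt: "\<And>a. a \<in> {1..n} \<Longrightarrow> i a < 2 * n" "\<And>a. a \<in> {1..n} \<Longrightarrow> j a < 2 * n"
    and ijeq: "\<And>p q. p \<in> nodes n \<Longrightarrow> q \<in> nodes n \<Longrightarrow>
      case_sum i j p = case_sum i j q \<longleftrightarrow> block_of w p = block_of w q"
    and ijref: "\<And>u. u \<in> diagrams n \<Longrightarrow> const_on u (case_sum i j) \<longleftrightarrow> finer u w"
    using exists_block_colouring[OF wd] by blast
  \<comment> \<open>Ordinary colours are below \<open>2 * n\<close>, and the marks
    \<open>2 * n + b\<close> with \<open>b \<le> n\<close> are at most \<open>3 * n\<close>; the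
    hypothesis on \<open>N\<close> makes room for both.\<close>
  define X where "X = {..<N}"
  have X: "finite X" "card X = N" by (simp_all add: X_def)
  have iX: "i a \<in> X" if "a \<in> {1..n}" for a using ijlt(1)[OF that] N by (simp add: X_def)
  have markX: "mark n m j A b \<in> X" if "b \<in> {1..n}" for A b
    using ijlt(2)[OF that] that N by (auto simp: X_def mark_def)
  let ?I = "{1..m}"
  let ?L = "PiE {1..n} (\<lambda>_. X)"
  let ?W = "\<lambda>l. diag_weight n (of_nat N) T (case_sum i l)"
  \<comment> \<open>The alternating sum of the matrix entries of the product with \<open>v\<close>,
    in the row \<open>i\<close> and in the columns given by the marked versions of
    \<open>j\<close>.\<close>
  define \<Phi> where "\<Phi> = (\<Sum>A\<in>Pow ?I. (- 1) ^ card A *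
      (\<Sum>l\<in>?L. (if const_on v (case_sum l (mark n m j A)) then 1 else 0) * ?W l))"
  have finL: "finite ?L" using X by (simp add: finite_PiE)
  have left: "\<Phi> = (\<Sum>e\<in>{e \<in> diagrams n. concat_diagram e v \<in> {w' \<in> half_diagrams n m. finer w' w}}.
      z e * of_nat N ^ num_removed e v)"
  proof -
    have "\<Phi> = (\<Sum>A\<in>Pow ?I. (- 1) ^ card A * (\<Sum>e\<in>diagrams n. z e *
        (if const_on (concat_diagram e v) (case_sum i (mark n m j A)) then of_nat N ^ num_removed e v else 0)))"
      unfolding \<Phi>_def
    proof (intro sum.cong refl arg_cong2[of _ _ _ _ "(*)"])
      fix A
      have "(\<Sum>l\<in>?L. (if const_on v (case_sum l (mark n m j A)) then 1 else 0) * ?W l) =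
          (\<Sum>l\<in>?L. \<Sum>e\<in>diagrams n. z e *
            (if const_on e (case_sum i l) \<and> const_on v (case_sum l (mark n m j A)) then 1 else 0))"
      proof (rule sum.cong[OF refl])
        fix l
        have "?W l = (\<Sum>e\<in>{e \<in> diagrams n. const_on e (case_sum i l)}. z e)"
          by (rule diag_weight_eq_sum[OF z])
        also have "\<dots> = (\<Sum>e\<in>diagrams n. z e * (if const_on e (case_sum i l) then 1 else 0))"
          by (intro sum.mono_neutral_cong_left) auto
        finally show "(if const_on v (case_sum l (mark n m j A)) then 1 else 0) * ?W l =
            (\<Sum>e\<in>diagrams n. z e * (if const_on e (case_sum i l) \<and> const_on v (case_sum l (mark n m j A)) then 1 else 0))"
          by simp
      qed
      also have "\<dots> = (\<Sum>e\<in>diagrams n. z e * (\<Sum>l\<in>?L.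
            (if const_on e (case_sum i l) \<and> const_on v (case_sum l (mark n m j A)) then 1 else 0)))"
        unfolding sum_distrib_left by (rule sum.swap)
      also have "\<dots> = (\<Sum>e\<in>diagrams n. z e *
        (if const_on (concat_diagram e v) (case_sum i (mark n m j A)) then of_nat N ^ num_removed e v else 0))"
      proof (intro sum.cong refl arg_cong2[of _ _ _ _ "(*)"])
        fix e assume e: "e \<in> diagrams n"
        have "(\<Sum>l\<in>?L. (if const_on e (case_sum i l) \<and> const_on v (case_sum l (mark n m j A)) then 1 else 0)) =
            (of_nat (card {l \<in> ?L. const_on e (case_sum i l) \<and> const_on v (case_sum l (mark n m j A))}) :: 'r)"
          using finL by (simp add: sum.If_cases Int_def)
        also have "\<dots> = (if const_on (concat_diagram e v) (case_sum i (mark n m j A)) then of_nat N ^ num_removed e v else 0)"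
          by (subst card_middle_colourings[OF e vd X(1) iX markX]) (simp_all add: X(2))
        finally show "(\<Sum>l\<in>?L. (if const_on e (case_sum i l) \<and> const_on v (case_sum l (mark n m j A)) then 1 else 0)) =
          (if const_on (concat_diagram e v) (case_sum i (mark n m j A)) then of_nat N ^ num_removed e v else 0 :: 'r)" .
      qed
      finally show "(\<Sum>l\<in>?L. (if const_on v (case_sum l (mark n m j A)) then 1 else 0) * ?W l) =
        (\<Sum>e\<in>diagrams n. z e *
        (if const_on (concat_diagram e v) (case_sum i (mark n m j A)) then of_nat N ^ num_removed e v else 0))" .
    qed
    also have "\<dots> = (\<Sum>e\<in>diagrams n. z e * of_nat N ^ num_removed e v *
        (\<Sum>A\<in>Pow ?I. (- 1) ^ card A * (if const_on (concat_diagram e v) (case_sum i (mark n m j A)) then 1 else 0)))"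
      unfolding sum_distrib_left by (subst sum.swap) (intro sum.cong refl, simp add: algebra_simps)
    also have "\<dots> = (\<Sum>e\<in>diagrams n. z e * of_nat N ^ num_removed e v *
        (if concat_diagram e v \<in> half_diagrams n m \<and> finer (concat_diagram e v) w then 1 else 0))"
    proof (intro sum.cong refl arg_cong2[of _ _ _ _ "(*)"])
      fix e assume e: "e \<in> diagrams n"
      show "(\<Sum>A\<in>Pow ?I. (- 1) ^ card A * (if const_on (concat_diagram e v) (case_sum i (mark n m j A)) then 1 else 0)) =
          (if concat_diagram e v \<in> half_diagrams n m \<and> finer (concat_diagram e v) w then 1 else 0 :: 'r)"
        using concat_diagram_in[OF e vd] concat_singleton[OF e vd half_diagramsD(2)[OF v]] ijlt ijref
        by (intro signed_sum_marks[OF w m]) auto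
    qed
    also have "\<dots> = (\<Sum>e\<in>{e \<in> diagrams n. concat_diagram e v \<in> {w' \<in> half_diagrams n m. finer w' w}}.
        z e * of_nat N ^ num_removed e v)"
      by (intro sum.mono_neutral_cong_right) auto
    finally show ?thesis .
  qed
  \<comment> \<open>The total weight of the extensions of an open path system with \<open>k\<close>
    edges. Both sides carry \<open>P n\<close> as a common factor, and the ratio of
    \<open>P m\<close> to \<open>P n\<close> is the product in the claim.\<close>
  define P where "P k = (\<Prod>j<N - k. T + of_nat j)" for k
  define north where "north \<longleftrightarrow> const_on ((\<lambda>B. Inl -` B) ` v) i"
  define t where "t a = i (marked_north n m v a)" for a
  define J where "J a = j (n - m + a)" for a
  define s where "s a = 2 * n + (n - m + a)" for a
  have tlt: "t a < 2 * n" if "a \<in> ?I" for a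
    using ijlt(1) marked_north(2)[OF v m that] by (simp add: t_def)
  have Jlt: "J a < 2 * n" if "a \<in> ?I" for a
  proof -
    have "n - m + a \<in> {1..n}" using m that by auto
    from ijlt(2)[OF this] show ?thesis by (simp only: J_def)
  qed
  have injJ: "inj_on J ?I"
  proof (rule inj_onI)
    fix a b assume ab: "a \<in> ?I" "b \<in> ?I" "J a = J b"
    have nd: "Inr (n - m + a) \<in> nodes n" "Inr (n - m + b) \<in> nodes n" using ab m by auto
    have "block_of w (Inr (n - m + a)) = block_of w (Inr (n - m + b))"
      using ijeq[OF nd] ab(3) by (simp add: J_def)
    then have "Inr (n - m + a) \<in> block_of w (Inr (n - m + b))"
      using block_of_in(2)[OF diagramsD[OF wd] nd(1)] by simp
    from half_diagrams_block(2)[OF w m ab(2) this] show "a = b" by simp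
  qed
  have injs: "inj_on s ?I" by (auto simp: inj_on_def s_def)
  \<comment> \<open>By \<open>sum_cyc_matching\<close>, \<open>P n * ?W l\<close> is a sum over the
    permutations that send \<open>l\<close> to \<open>i\<close>. Such a permutation determines
    \<open>l\<close>, so the sum over \<open>l\<close> becomes a sum over all permutations of the
    colours.\<close>
  have inner: "P n * (\<Sum>l\<in>?L. (if const_on v (case_sum l (mark n m j A)) then 1 else 0) * ?W l) =
      (if north then (\<Sum>\<sigma> | \<sigma> permutes X \<and> (\<forall>a\<in>?I. \<sigma> (if a \<in> A then s a else J a) = t a). T ^ cyc (perm_graph X \<sigma>)) else 0)"
    for A
  proof -
    let ?S = "{\<sigma>. \<sigma> permutes X}"
    let ?C = "\<lambda>l. const_on v (case_sum l (mark n m j A))"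
    let ?l = "\<lambda>\<sigma>. \<lambda>a\<in>{1..n}. inv_into UNIV \<sigma> (i a)"
    have finS: "finite ?S" using X(1) by (rule finite_permutations)
    have "P n * (\<Sum>l\<in>?L. (if ?C l then 1 else 0) * ?W l) =
        (\<Sum>l\<in>?L. (if ?C l then 1 else 0) * (P n * ?W l))"
      by (simp add: sum_distrib_left algebra_simps)
    also have "\<dots> = (\<Sum>l\<in>?L. \<Sum>\<sigma>\<in>?S. if l = ?l \<sigma> then (if ?C l then T ^ cyc (perm_graph X \<sigma>) else 0) else 0)"
    proof (rule sum.cong[OF refl])
      fix l assume l: "l \<in> ?L"
      have "P n * ?W l = (\<Sum>\<sigma> | \<sigma> permutes X \<and> (\<forall>a\<in>{1..n}. \<sigma> (l a) = i a). T ^ cyc (perm_graph X \<sigma>))"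
        using sum_cyc_matching[OF X(1), of n i l T] X(2) N iX PiE_mem[OF l] by (simp add: P_def)
      also have "\<dots> = (\<Sum>\<sigma>\<in>?S. if l = ?l \<sigma> then T ^ cyc (perm_graph X \<sigma>) else 0)"
      proof (intro sum.mono_neutral_cong_left finS)
        have eq: "l = ?l \<sigma> \<longleftrightarrow> (\<forall>a\<in>{1..n}. \<sigma> (l a) = i a)" if \<sigma>: "\<sigma> permutes X" for \<sigma>
        proof
          assume "l = ?l \<sigma>"
          then show "\<forall>a\<in>{1..n}. \<sigma> (l a) = i a"
            using permutes_inverses(1)[OF \<sigma>] by simp
        next
          assume h: "\<forall>a\<in>{1..n}. \<sigma> (l a) = i a"
          show "l = ?l \<sigma>"
          proof
            fix a show "l a = ?l \<sigma> a"
            proof (cases "a \<in> {1..n}")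
              case True
              then have "inv_into UNIV \<sigma> (\<sigma> (l a)) = inv_into UNIV \<sigma> (i a)" using h by simp
              then show ?thesis using True permutes_inverses(2)[OF \<sigma>] by simp
            qed (use PiE_arb[OF l] in auto)
          qed
        qed
        show "\<forall>\<sigma>\<in>?S - {\<sigma>. \<sigma> permutes X \<and> (\<forall>a\<in>{1..n}. \<sigma> (l a) = i a)}.
            (if l = ?l \<sigma> then T ^ cyc (perm_graph X \<sigma>) else 0) = 0"
          using eq by (intro ballI if_not_P) blast
        show "T ^ cyc (perm_graph X \<sigma>) = (if l = ?l \<sigma> then T ^ cyc (perm_graph X \<sigma>) else 0)"
          if "\<sigma> \<in> {\<sigma>. \<sigma> permutes X \<and> (\<forall>a\<in>{1..n}. \<sigma> (l a) = i a)}" for \<sigma>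
          using eq[of \<sigma>] that by (intro if_P[symmetric]) blast
      qed blast
      finally show "(if ?C l then 1 else 0) * (P n * ?W l) =
          (\<Sum>\<sigma>\<in>?S. if l = ?l \<sigma> then (if ?C l then T ^ cyc (perm_graph X \<sigma>) else 0) else 0)"
        by (cases "?C l") (simp_all only: if_True if_False mult_1_left mult_zero_left if_cancel sum.neutral_const)
    qed
    also have "\<dots> = (\<Sum>\<sigma>\<in>?S. \<Sum>l\<in>?L. if l = ?l \<sigma> then (if ?C l then T ^ cyc (perm_graph X \<sigma>) else 0) else 0)"
      by (rule sum.swap)
    also have "\<dots> = (\<Sum>\<sigma>\<in>?S. if ?C (?l \<sigma>) then T ^ cyc (perm_graph X \<sigma>) else 0)"
    proof (rule sum.cong[OF refl])
      fix \<sigma> assume "\<sigma> \<in> ?S"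
      then have "inv_into UNIV \<sigma> permutes X" by (simp add: permutes_inv)
      then have "?l \<sigma> \<in> ?L" using iX by (auto simp: permutes_in_image)
      then show "(\<Sum>l\<in>?L. if l = ?l \<sigma> then (if ?C l then T ^ cyc (perm_graph X \<sigma>) else 0) else 0) =
          (if ?C (?l \<sigma>) then T ^ cyc (perm_graph X \<sigma>) else 0)"
        using finL by (simp only: sum.delta if_True)
    qed
    also have "\<dots> = (\<Sum>\<sigma>\<in>?S. if north \<and> (\<forall>a\<in>?I. \<sigma> (if a \<in> A then s a else J a) = t a) then T ^ cyc (perm_graph X \<sigma>) else 0)"
    proof (rule sum.cong[OF refl])
      fix \<sigma> assume "\<sigma> \<in> ?S"
      then have \<sigma>: "\<sigma> permutes X" by simp
      have "?C (?l \<sigma>) \<longleftrightarrow> const_on v (case_sum (inv_into UNIV \<sigma> \<circ> i) (mark n m j A))"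
        by (rule const_on_diagram_cong[OF vd]) auto
      \<comment> \<open>The point where permutations of colours commute with diagrams: recolouring
        all nodes by \<open>\<sigma>\<close> respects constancy on blocks and moves the permutation
        from the northern to the southern colours.\<close>
      also have "\<dots> \<longleftrightarrow> const_on v (\<sigma> \<circ> case_sum (inv_into UNIV \<sigma> \<circ> i) (mark n m j A))"
        using permutes_inj_on[OF \<sigma>] by (intro const_on_inj[symmetric])
      also have "\<sigma> \<circ> case_sum (inv_into UNIV \<sigma> \<circ> i) (mark n m j A) = case_sum i (\<sigma> \<circ> mark n m j A)"
        using permutes_inverses(1)[OF \<sigma>] by (auto simp: fun_eq_iff split: sum.split)
      also have "const_on v \<dots> \<longleftrightarrow> north \<and> (\<forall>a\<in>?I. \<sigma> (if a \<in> A then s a else J a) = t a)"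
        unfolding const_on_half_diagram[OF v m] north_def t_def
        by (intro arg_cong2[of _ _ _ _ "(\<and>)"] refl ball_cong)
          (simp only: comp_apply mark_shift s_def J_def)
      finally show "(if ?C (?l \<sigma>) then T ^ cyc (perm_graph X \<sigma>) else 0) =
          (if north \<and> (\<forall>a\<in>?I. \<sigma> (if a \<in> A then s a else J a) = t a) then T ^ cyc (perm_graph X \<sigma>) else 0)"
        by (simp only:)
    qed
    also have "\<dots> = (if north then (\<Sum>\<sigma> | \<sigma> permutes X \<and> (\<forall>a\<in>?I. \<sigma> (if a \<in> A then s a else J a) = t a). T ^ cyc (perm_graph X \<sigma>)) else 0)"
    proof (cases north)
      case True
      then show ?thesis using finS by (simp only: simp_thms if_True) (intro sum.mono_neutral_cong_right, auto)
    qed (simp only: simp_thms if_False sum.neutral_const)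
    finally show ?thesis .
  qed
  have ext: "(\<Sum>\<sigma> | \<sigma> permutes X \<and> (\<forall>a\<in>?I. \<sigma> (if a \<in> A then s a else J a) = t a). T ^ cyc (perm_graph X \<sigma>)) =
      (if inj_on t ?I then T ^ cyc ((\<lambda>a. (if a \<in> A then s a else J a, t a)) ` ?I) * P m else 0)" for A
  proof -
    let ?k = "\<lambda>a. if a \<in> A then s a else J a"
    let ?g = "(\<lambda>a. (?k a, t a)) ` ?I"
    have injk: "inj_on ?k ?I"
    proof (rule inj_onI)
      fix a b assume ab: "a \<in> ?I" "b \<in> ?I" "?k a = ?k b"
      have "2 * n \<le> s c" for c by (simp add: s_def)
      then have "(a \<in> A) = (b \<in> A)" using ab(3) Jlt[OF ab(1)] Jlt[OF ab(2)]
        by (metis not_le)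
      then show "a = b" using inj_onD[OF injJ _ ab(1,2)] inj_onD[OF injs _ ab(1,2)] ab(3)
        by (cases "a \<in> A") simp_all
    qed
    have S: "{\<sigma>. \<sigma> permutes X \<and> (\<forall>a\<in>?I. \<sigma> (?k a) = t a)} = {\<sigma>. \<sigma> permutes X \<and> (\<forall>(a, b)\<in>?g. \<sigma> a = b)}"
      by (simp only: ball_simps prod.case)
    show ?thesis
    proof (cases "inj_on t ?I")
      case True
      have pg: "partial_inj ?g"
        using injk True by (rule partial_inj_pairs)
      have "inj_on (\<lambda>a. (?k a, t a)) ?I"
        by (rule inj_onI) (use inj_onD[OF True] in \<open>simp only: prod.inject\<close>)
      then have cg: "card ?g = m" by (simp add: card_image)
      have "?g \<subseteq> X \<times> X"
      proof
        fix q assume "q \<in> ?g"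
        then obtain a where a: "a \<in> ?I" "q = (?k a, t a)" by blast
        then show "q \<in> X \<times> X" using tlt[OF a(1)] Jlt[OF a(1)] N m by (auto simp: X_def s_def)
      qed
      from sum_cyc_extensions[OF X(1) pg this, of T] show ?thesis
        unfolding S cg X(2) P_def using True by simp
    next
      case False
      then obtain a b where ab: "a \<in> ?I" "b \<in> ?I" "a \<noteq> b" "t a = t b" by (auto simp: inj_on_def)
      have "\<not> (\<forall>a\<in>?I. \<sigma> (?k a) = t a)" if "\<sigma> permutes X" for \<sigma>
      proof
        assume "\<forall>a\<in>?I. \<sigma> (?k a) = t a"
        then have "\<sigma> (?k a) = \<sigma> (?k b)" using ab by (simp only:)
        then have "?k a = ?k b" by (rule injD[OF permutes_inj[OF that]])
        then show False using inj_onD[OF injk] ab by blast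
      qed
      then have "{\<sigma>. \<sigma> permutes X \<and> (\<forall>a\<in>?I. \<sigma> (?k a) = t a)} = {}" by blast
      then show ?thesis using False by (simp only: sum.empty if_False)
    qed
  qed
  have right: "P n * \<Phi> = P m * (if north \<and> inj_on t ?I \<and> t ` ?I \<subseteq> J ` ?I
      then (T - 1) ^ cyc ((\<lambda>a. (J a, t a)) ` ?I) else 0)"
  proof -
    have "P n * \<Phi> = (\<Sum>A\<in>Pow ?I. (- 1) ^ card A *
        (P n * (\<Sum>l\<in>?L. (if const_on v (case_sum l (mark n m j A)) then 1 else 0) * ?W l)))"
      unfolding \<Phi>_def by (subst sum_distrib_left) (intro sum.cong refl mult.left_commute)
    also have "\<dots> = (\<Sum>A\<in>Pow ?I. (- 1) ^ card A *
        (if north \<and> inj_on t ?I then T ^ cyc ((\<lambda>a. (if a \<in> A then s a else J a, t a)) ` ?I) * P m else 0))"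
      unfolding inner ext by (intro sum.cong refl) simp
    also have "\<dots> = P m * (if north \<and> inj_on t ?I \<and> t ` ?I \<subseteq> J ` ?I
      then (T - 1) ^ cyc ((\<lambda>a. (J a, t a)) ` ?I) else 0)"
    proof (cases "north \<and> inj_on t ?I")
      case True
      have "s a \<noteq> J b" "s a \<noteq> t b" if "a \<in> ?I" "b \<in> ?I" for a b
        using Jlt[OF that(2)] tlt[OF that(2)] by (simp_all add: s_def)
      then have fresh: "s ` ?I \<inter> (J ` ?I \<union> t ` ?I) = {}" by blast
      have "(\<Sum>A\<in>Pow ?I. (- 1) ^ card A * (T ^ cyc ((\<lambda>a. (if a \<in> A then s a else J a, t a)) ` ?I) * P m)) =
          P m * (\<Sum>A\<in>Pow ?I. (- 1) ^ card A * T ^ cyc ((\<lambda>a. (if a \<in> A then s a else J a, t a)) ` ?I))"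
        unfolding sum_distrib_left by (intro sum.cong refl) (simp add: mult_ac)
      also have "\<dots> = P m * (if t ` ?I \<subseteq> J ` ?I then (T - 1) ^ cyc ((\<lambda>a. (J a, t a)) ` ?I) else 0)"
        using True by (subst signed_sum_fresh_sources[OF _ injJ _ injs fresh]) simp_all
      finally show ?thesis using True by simp
    next
      case False
      then show ?thesis by auto
    qed
    finally show ?thesis .
  qed
  \<comment> \<open>The inverse stems from the convention for the right action: the southern node
    \<open>n - m + a\<close> of the permuted diagram takes its place according to the inverse of
    \<open>\<pi>\<close>.\<close>
  have cond: "finer (perm_half_diagram n m v \<pi>) w \<longleftrightarrow> north \<and> (\<forall>a\<in>?I. J (inv_into UNIV \<pi> a) = t a)"
    if \<pi>: "\<pi> permutes ?I" for \<pi>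
  proof -
    have "finer (perm_half_diagram n m v \<pi>) w \<longleftrightarrow> const_on (perm_half_diagram n m v \<pi>) (case_sum i j)"
      by (rule ijref[OF perm_half_diagram_in_diagrams[OF vd \<pi> m], symmetric])
    also have "\<dots> \<longleftrightarrow> north \<and> (\<forall>a\<in>?I. J (inv_into UNIV \<pi> a) = t a)"
      unfolding const_on_perm_half_diagram const_on_half_diagram[OF v m] north_def t_def
      by (intro arg_cong2[of _ _ _ _ "(\<and>)"] refl ball_cong) (auto simp: shift_perm_def J_def)
    finally show ?thesis .
  qed
  have "(\<Sum>\<pi>\<in>{\<pi>. \<pi> permutes ?I \<and> finer (perm_half_diagram n m v \<pi>) w}.
      (T - 1) ^ cyc (perm_graph ?I (inv_into UNIV \<pi>))) =
    (\<Sum>\<rho>\<in>{\<rho>. \<rho> permutes ?I \<and> (north \<and> (\<forall>a\<in>?I. J (\<rho> a) = t a))}. (T - 1) ^ cyc (perm_graph ?I \<rho>))"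
  proof (rule sum.reindex_bij_witness[where i = "inv_into UNIV" and j = "inv_into UNIV"])
  qed (auto simp: cond permutes_inv permutes_inv_inv)
  also have "\<dots> = (if north \<and> inj_on t ?I \<and> t ` ?I \<subseteq> J ` ?I
      then (T - 1) ^ cyc ((\<lambda>a. (J a, t a)) ` ?I) else 0)"
    using sum_perms_prescribed[OF _ injJ, of "T - 1" t] by (cases north) simp_all
  finally have "P n * \<Phi> = P m * (\<Sum>\<pi>\<in>{\<pi>. \<pi> permutes ?I \<and> finer (perm_half_diagram n m v \<pi>) w}.
      (T - 1) ^ cyc (perm_graph ?I (inv_into UNIV \<pi>)))"
    using right by simp
  moreover have "P m = P n * (\<Prod>j\<in>{m<..n}. T + of_nat N - of_nat j)"
    unfolding P_def using N by (intro prod_add_of_nat_split[OF m]) simp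
  moreover have "P n \<noteq> 0" using K by (simp add: P_def)
  ultimately show ?thesis unfolding left[symmetric] by simp
qed

text \<open>The test colourings for \<open>w\<close> only give sums over all half diagrams finer
  than \<open>w\<close>; the triangularity of this order separates the individual
  coefficients.\<close>

lemma half_diagram_coefficient:
  fixes T :: "'r::idom"
  assumes m: "m \<le> n" and v: "v \<in> half_diagrams n m" and w: "w \<in> half_diagrams n m"
    and N: "3 * n < N" and K: "(\<Prod>j<N - n. T + of_nat j) \<noteq> 0"
    and z: "\<And>d. d \<in> diagrams n \<Longrightarrow>
      (\<Sum>e\<in>{e \<in> diagrams n. finer e d}. z e) = diag_weight n (of_nat N) T (block_of d)"
  shows "(\<Sum>e\<in>{e \<in> diagrams n. concat_diagram e v = w}. z e * of_nat N ^ num_removed e v) =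
    (\<Prod>j\<in>{m<..n}. T + of_nat N - of_nat j) *
    (\<Sum>\<pi>\<in>{\<pi>. \<pi> permutes {1..m} \<and> perm_half_diagram n m v \<pi> = w}.
      (T - 1) ^ cyc (perm_graph {1..m} (inv_into UNIV \<pi>)))"
    (is "?a w = ?D * ?b w")
proof (rule sum_below_determines[where below = finer and S = "half_diagrams n m" and a = ?a and b = "\<lambda>w. ?D * ?b w", OF _ _ _ _ _ w])
  fix w assume w: "w \<in> half_diagrams n m"
  let ?B = "{w' \<in> half_diagrams n m. finer w' w}"
  have "(\<Sum>w'\<in>?B. ?a w') = (\<Sum>e\<in>{e \<in> diagrams n. concat_diagram e v \<in> ?B}. z e * of_nat N ^ num_removed e v)"
    by (rule sum_over_fibres) simp_all
  also have "\<dots> = ?D * (\<Sum>\<pi>\<in>{\<pi>. \<pi> permutes {1..m} \<and> finer (perm_half_diagram n m v \<pi>) w}.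
      (T - 1) ^ cyc (perm_graph {1..m} (inv_into UNIV \<pi>)))"
    by (rule half_diagram_sum_below[OF m v w N K z])
  also have "{\<pi>. \<pi> permutes {1..m} \<and> finer (perm_half_diagram n m v \<pi>) w} =
      {\<pi> \<in> {\<pi>. \<pi> permutes {1..m}}. perm_half_diagram n m v \<pi> \<in> ?B}"
    using perm_half_diagram_in[OF v _ m] by blast
  also have "(\<Sum>\<pi>\<in>\<dots>. (T - 1) ^ cyc (perm_graph {1..m} (inv_into UNIV \<pi>))) =
      (\<Sum>w'\<in>?B. \<Sum>\<pi>\<in>{\<pi> \<in> {\<pi>. \<pi> permutes {1..m}}. perm_half_diagram n m v \<pi> = w'}.
        (T - 1) ^ cyc (perm_graph {1..m} (inv_into UNIV \<pi>)))"
    by (rule sum_over_fibres[symmetric]) (simp_all add: finite_permutations)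
  finally show "(\<Sum>w'\<in>?B. ?a w') = (\<Sum>w'\<in>?B. ?D * ?b w')"
    by (simp add: sum_distrib_left)
next
  fix d e assume "d \<in> half_diagrams n m" "e \<in> half_diagrams n m" "finer d e" "finer e d"
  then show "d = e" by (meson finer_antisym diagramsD half_diagramsD(1))
qed (simp_all add: finer_refl, rule finer_trans)

section \<open>Specialization of the parameters\<close>

definition ring_morphism :: "('a::comm_ring_1 \<Rightarrow> 'b::comm_ring_1) \<Rightarrow> bool" where
  "ring_morphism h \<longleftrightarrow> h 1 = 1 \<and> (\<forall>a b. h (a + b) = h a + h b) \<and> (\<forall>a b. h (a * b) = h a * h b)"

lemma ring_morphismD:
  assumes "ring_morphism h"
  shows "h 1 = 1" "h (a + b) = h a + h b" "h (a * b) = h a * h b" "h 0 = 0"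
proof -
  show "h 1 = 1" "h (a + b) = h a + h b" "h (a * b) = h a * h b"
    using assms by (auto simp: ring_morphism_def)
  have "h (0 + 0) = h 0 + h 0" using assms by (auto simp: ring_morphism_def simp del: add_0_left add_0_right)
  then show "h 0 = 0" by simp
qed

lemma ring_morphism_minus: "ring_morphism h \<Longrightarrow> h (a - b) = h a - h b"
  using ring_morphismD(2)[of h "a - b" b] by simp

lemma ring_morphism_power: "ring_morphism h \<Longrightarrow> h (a ^ n) = h a ^ n"
  by (induction n) (simp_all add: ring_morphismD)

lemma ring_morphism_of_nat: "ring_morphism h \<Longrightarrow> h (of_nat n) = of_nat n"
  by (induction n) (simp_all add: ring_morphismD)

lemma ring_morphism_sum: "ring_morphism h \<Longrightarrow> h (\<Sum>x\<in>A. f x) = (\<Sum>x\<in>A. h (f x))"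
  by (induction A rule: infinite_finite_induct) (simp_all add: ring_morphismD)

lemma ring_morphism_prod: "ring_morphism h \<Longrightarrow> h (\<Prod>x\<in>A. f x) = (\<Prod>x\<in>A. h (f x))"
  by (induction A rule: infinite_finite_induct) (simp_all add: ring_morphismD)

lemma ring_morphism_poly: "ring_morphism (\<lambda>q. poly q x)"
  by (simp add: ring_morphism_def)

text \<open>Evaluation after a change of coefficients. Applied twice, it specializes integer
  polynomials in two variables to a field of any characteristic.\<close>

lemma ring_morphism_poly_map_poly:
  assumes h: "ring_morphism h"
  shows "ring_morphism (\<lambda>q. poly (map_poly h q) x)"
proof -
  let ?E = "\<lambda>q. poly (map_poly h q) x"
  note h0 = ring_morphismD(4)[OF h]
  have E: "?E (pCons a q) = h a + x * ?E q" for a q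
    by (simp add: map_poly_pCons h0)
  have add: "?E (p + q) = ?E p + ?E q" for p q
    by (induction p q rule: poly_induct2) (simp_all add: E ring_morphismD[OF h] algebra_simps del: map_poly_pCons)
  have smult: "?E (smult a q) = h a * ?E q" for a q
    by (induction q) (simp_all add: E ring_morphismD[OF h] algebra_simps del: map_poly_pCons)
  have mult: "?E (p * q) = ?E p * ?E q" for p q
    by (induction p) (simp_all add: E add smult h0 algebra_simps del: map_poly_pCons)
  show ?thesis
    unfolding ring_morphism_def using add mult ring_morphismD[OF h] by (simp add: map_poly_1')
qed

lemma ring_morphism_of_int: "ring_morphism (of_int :: int \<Rightarrow> 'a::comm_ring_1)"
  by (simp add: ring_morphism_def)

lemma ring_morphism_diag_weight:
  assumes h: "ring_morphism h"
  shows "h (diag_weight n \<delta> T c) = diag_weight n (h \<delta>) (h T) c"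
  by (simp add: diag_weight_def Let_def ring_morphismD[OF h] ring_morphism_power[OF h]
      ring_morphism_prod[OF h] ring_morphism_minus[OF h] ring_morphism_of_nat[OF h])

lemma poly_eqI_of_nat:
  fixes p q :: "'a::{idom,ring_char_0} poly"
  assumes "\<And>N. N > N0 \<Longrightarrow> poly p (of_nat N) = poly q (of_nat N)"
  shows "p = q"
proof (rule ccontr)
  assume "p \<noteq> q"
  then have "finite {x. poly (p - q) x = 0}" by (intro poly_roots_finite) simp
  moreover have "of_nat ` {N0<..} \<subseteq> {x. poly (p - q) x = 0}" using assms by auto
  ultimately have "finite ((of_nat :: nat \<Rightarrow> 'a) ` {N0<..})" by (rule finite_subset[rotated])
  moreover have "inj_on (of_nat :: nat \<Rightarrow> 'a) {N0<..}" by (simp add: inj_on_def)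
  ultimately have "finite {N0<..}" by (rule finite_imageD)
  then show False using infinite_Ioi by blast
qed

text \<open>The identity for integers \<open>\<delta>\<close> is one of polynomials in \<open>\<delta>\<close> and \<open>T\<close> with integer
  coefficients, so it holds over every field.\<close>

lemma exists_scalar_element:
  fixes \<delta> T :: "'k::field"
  shows "\<exists>z :: diagram \<Rightarrow> 'k. (\<forall>d. d \<notin> diagrams n \<longrightarrow> z d = 0) \<and>
    (\<forall>m v w. m \<le> n \<longrightarrow> v \<in> half_diagrams n m \<longrightarrow> w \<in> half_diagrams n m \<longrightarrow>
      (\<Sum>e\<in>{e \<in> diagrams n. concat_diagram e v = w}. z e * \<delta> ^ num_removed e v) =
      (\<Prod>j\<in>{m<..n}. T + \<delta> - of_nat j) *
      (\<Sum>\<pi>\<in>{\<pi>. \<pi> permutes {1..m} \<and> perm_half_diagram n m v \<pi> = w}.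
        (T - 1) ^ cyc (perm_graph {1..m} (inv_into UNIV \<pi>))))"
proof -
  \<comment> \<open>The inner variable stands for \<open>T\<close> and the outer one for
    \<open>\<delta>\<close>, so that \<open>\<delta>\<close> can be set to an integer while
    \<open>T\<close> remains an indeterminate.\<close>
  define X :: "int poly" where "X = [:0, 1:]"
  define Y :: "int poly poly" where "Y = [:0, 1:]"
  \<comment> \<open>Solving the triangular system needs no denominators, so the coefficients are
    integer polynomials.\<close>
  have "\<exists>q. \<forall>d\<in>diagrams n. (\<Sum>e\<in>{e \<in> diagrams n. finer e d}. q e) = diag_weight n Y [:X:] (block_of d)"
    by (rule exists_sum_below[OF finite_diagrams finer_refl finer_trans finer_antisym[OF diagramsD diagramsD]])
  then obtain q :: "diagram \<Rightarrow> int poly poly" where q: "\<And>d. d \<in> diagrams n \<Longrightarrow>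
      (\<Sum>e\<in>{e \<in> diagrams n. finer e d}. q e) = diag_weight n Y [:X:] (block_of d)" by blast
  define h1 where "h1 = (\<lambda>c :: int poly. poly (map_poly of_int c) T)"
  define h where "h = (\<lambda>c :: int poly poly. poly (map_poly h1 c) \<delta>)"
  have h1: "ring_morphism h1" unfolding h1_def by (rule ring_morphism_poly_map_poly[OF ring_morphism_of_int])
  have h: "ring_morphism h" unfolding h_def by (rule ring_morphism_poly_map_poly[OF h1])
  have hXY: "h Y = \<delta>" "h [:X:] = T"
    by (simp_all add: h_def h1_def X_def Y_def map_poly_pCons ring_morphismD[OF h1, unfolded h1_def])
  have id: "(\<Sum>e\<in>{e \<in> diagrams n. concat_diagram e v = w}. q e * Y ^ num_removed e v) =
      (\<Prod>j\<in>{m<..n}. [:X:] + Y - of_nat j) *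
      (\<Sum>\<pi>\<in>{\<pi>. \<pi> permutes {1..m} \<and> perm_half_diagram n m v \<pi> = w}.
        ([:X:] - 1) ^ cyc (perm_graph {1..m} (inv_into UNIV \<pi>)))"
    if m: "m \<le> n" and v: "v \<in> half_diagrams n m" and w: "w \<in> half_diagrams n m" for m v w
  proof (rule poly_eqI_of_nat[of "3 * n"])
    fix N assume N: "N > 3 * n"
    let ?h = "\<lambda>c :: int poly poly. poly c (of_nat N)"
    have hh: "ring_morphism ?h" by (rule ring_morphism_poly)
    have e: "?h Y = of_nat N" "?h [:X:] = X" by (simp_all add: Y_def)
    \<comment> \<open>This is the factor that has to be cancelled. It is nonzero for an
      indeterminate \<open>X\<close>, whereas its values in a field of characteristic
      \<open>p\<close> may vanish.\<close>
    have "(\<Prod>j<N - n. X + of_nat j) \<noteq> 0"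
      by (simp add: prod_zero_iff X_def of_nat_poly)
    moreover have "(\<Sum>e\<in>{e \<in> diagrams n. finer e d}. ?h (q e)) = diag_weight n (of_nat N) X (block_of d)"
      if "d \<in> diagrams n" for d
      using arg_cong[OF q[OF that], of ?h]
      unfolding ring_morphism_sum[OF hh] ring_morphism_diag_weight[OF hh] e .
    ultimately have "(\<Sum>e\<in>{e \<in> diagrams n. concat_diagram e v = w}. ?h (q e) * of_nat N ^ num_removed e v) =
      (\<Prod>j\<in>{m<..n}. X + of_nat N - of_nat j) *
      (\<Sum>\<pi>\<in>{\<pi>. \<pi> permutes {1..m} \<and> perm_half_diagram n m v \<pi> = w}.
        (X - 1) ^ cyc (perm_graph {1..m} (inv_into UNIV \<pi>)))"
      by (rule half_diagram_coefficient[OF m v w N])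
    then show "?h (\<Sum>e\<in>{e \<in> diagrams n. concat_diagram e v = w}. q e * Y ^ num_removed e v) =
      ?h ((\<Prod>j\<in>{m<..n}. [:X:] + Y - of_nat j) *
      (\<Sum>\<pi>\<in>{\<pi>. \<pi> permutes {1..m} \<and> perm_half_diagram n m v \<pi> = w}.
        ([:X:] - 1) ^ cyc (perm_graph {1..m} (inv_into UNIV \<pi>))))"
      by (simp only: ring_morphism_sum[OF hh] ring_morphism_prod[OF hh] ring_morphismD[OF hh]
          ring_morphism_power[OF hh] ring_morphism_minus[OF hh] ring_morphism_of_nat[OF hh] e)
  qed
  show ?thesis
  proof (intro exI[of _ "\<lambda>d. if d \<in> diagrams n then h (q d) else 0"] conjI allI impI)
    fix m v w assume a: "m \<le> n" "v \<in> half_diagrams n m" "w \<in> half_diagrams n m"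
    have "(\<Sum>e\<in>{e \<in> diagrams n. concat_diagram e v = w}. (if e \<in> diagrams n then h (q e) else 0) * \<delta> ^ num_removed e v) =
        (\<Sum>e\<in>{e \<in> diagrams n. concat_diagram e v = w}. h (q e) * \<delta> ^ num_removed e v)"
      by (intro sum.cong refl) simp
    also have "\<dots> = (\<Prod>j\<in>{m<..n}. T + \<delta> - of_nat j) *
      (\<Sum>\<pi>\<in>{\<pi>. \<pi> permutes {1..m} \<and> perm_half_diagram n m v \<pi> = w}.
        (T - 1) ^ cyc (perm_graph {1..m} (inv_into UNIV \<pi>)))"
      using arg_cong[OF id[OF a], of h]
      by (simp only: ring_morphism_sum[OF h] ring_morphism_prod[OF h] ring_morphismD[OF h]
          ring_morphism_power[OF h] ring_morphism_minus[OF h] ring_morphism_of_nat[OF h] hXY)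
    finally show "(\<Sum>e\<in>{e \<in> diagrams n. concat_diagram e v = w}. (if e \<in> diagrams n then h (q e) else 0) * \<delta> ^ num_removed e v) =
      (\<Prod>j\<in>{m<..n}. T + \<delta> - of_nat j) *
      (\<Sum>\<pi>\<in>{\<pi>. \<pi> permutes {1..m} \<and> perm_half_diagram n m v \<pi> = w}.
        (T - 1) ^ cyc (perm_graph {1..m} (inv_into UNIV \<pi>)))" .
  qed simp
qed

text \<open>Running through a cycle backwards visits the same points.\<close>

lemma closed_orbits_converse:
  assumes "partial_inj g"
  shows "closed_orbits (g\<inverse>) = closed_orbits g"
proof -
  have sub: "closed_orbits (g\<inverse>) \<subseteq> closed_orbits g" if g: "partial_inj g" for g :: "'a rel"
  proof
    fix C assume "C \<in> closed_orbits (g\<inverse>)"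
    then obtain x where x: "(x, x) \<in> (g\<inverse>)\<^sup>+" "C = (g\<inverse>)\<^sup>+ `` {x}" by (rule closed_orbitsE)
    then have xx: "(x, x) \<in> g\<^sup>+" by (simp add: trancl_converse)
    have sv: "single_valued g" "single_valued (g\<inverse>)" using g by (simp_all add: partial_inj_def)
    have "(x, y) \<in> (g\<inverse>)\<^sup>+ \<longleftrightarrow> (x, y) \<in> g\<^sup>+" for y
    proof
      assume "(x, y) \<in> (g\<inverse>)\<^sup>+"
      then have "(y, x) \<in> (g\<inverse>)\<^sup>+"
        by (intro single_valued_cycle_closed[OF sv(2) x(1)] trancl_into_rtrancl)
      then show "(x, y) \<in> g\<^sup>+" by (simp add: trancl_converse)
    next
      assume "(x, y) \<in> g\<^sup>+"
      then have "(y, x) \<in> g\<^sup>+"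
        by (intro single_valued_cycle_closed[OF sv(1) xx] trancl_into_rtrancl)
      then show "(x, y) \<in> (g\<inverse>)\<^sup>+" by (simp add: trancl_converse)
    qed
    then have "C = g\<^sup>+ `` {x}" unfolding x(2) by blast
    then show "C \<in> closed_orbits g" using closed_orbitsI[OF xx] by simp
  qed
  have "partial_inj (g\<inverse>)" using assms by (auto simp: partial_inj_def)
  from sub[OF this] sub[OF assms] show ?thesis by auto
qed

lemma cyc_perm_graph_inv:
  assumes "\<pi> permutes X"
  shows "cyc (perm_graph X (inv_into UNIV \<pi>)) = cyc (perm_graph X \<pi>)"
proof -
  have "perm_graph X (inv_into UNIV \<pi>) = (perm_graph X \<pi>)\<inverse>"
    using assms permutes_inv[OF assms]
    by (auto simp: perm_graph_def image_iff permutes_inverses permutes_in_image)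
  moreover have "partial_inj (perm_graph X \<pi>)"
    unfolding perm_graph_def using permutes_inj_on[OF assms] by (intro partial_inj_pairs) auto
  ultimately show ?thesis by (simp add: cyc_def closed_orbits_converse)
qed

section \<open>Specht modules\<close>

lemma vector_space_fun: "vector_space (\<lambda>c (s :: 'a \<Rightarrow> 'k::field) x. c * s x)"
  by unfold_locales (simp_all add: fun_eq_iff algebra_simps)

lemma vector_space_fun2: "vector_space (\<lambda>c (f :: 'a \<Rightarrow> 'b \<Rightarrow> 'k::field) v x. c * f v x)"
  by unfold_locales (simp_all add: fun_eq_iff algebra_simps)

definition content_product :: "nat list \<Rightarrow> 'k::field \<Rightarrow> 'k" where
  "content_product lam U = (\<Prod>r<length lam. \<Prod>c<lam ! r. U + of_nat c - of_nat r)"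

section \<open>Tableaux as Young diagrams labelled by their entries\<close>

abbreviation boxes :: "nat list \<Rightarrow> (nat \<times> nat) set" where
  "boxes lam \<equiv> (SIGMA r:{..<length lam}. {..<lam ! r})"

abbreviation position :: "nat list \<Rightarrow> tableau \<Rightarrow> nat \<Rightarrow> nat \<times> nat" where
  "position lam t \<equiv> inv_into (boxes lam) (\<lambda>(r, c). t ! r ! c)"

context
  fixes lam :: "nat list" and t :: tableau and m :: nat
  assumes lam: "lam \<in> partitions m" and t: "t \<in> tableaux lam"
begin

private abbreviation "E \<equiv> {1..m}"
private abbreviation "row x \<equiv> fst (position lam t x)"
private abbreviation "col x \<equiv> snd (position lam t x)"

lemma sum_list_shape: "sum_list lam = m"
  using lam by (simp add: partitions_def)

lemma tableau_lengths: "length t = length lam" "r < length lam \<Longrightarrow> length (t ! r) = lam ! r"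
proof -
  have "map length t = lam" using t by (simp add: tableaux_def)
  then show "length t = length lam" "r < length lam \<Longrightarrow> length (t ! r) = lam ! r" by auto
qed

lemma bij_betw_boxes: "bij_betw (\<lambda>(r, c). t ! r ! c) (boxes lam) E"
proof -
  let ?f = "\<lambda>(r, c). t ! r ! c"
  have img: "?f ` boxes lam = E"
  proof -
    have "set (concat t) = E" using t sum_list_shape by (simp add: tableaux_def)
    moreover have "set (concat t) = ?f ` boxes lam"
    proof (intro equalityI subsetI)
      fix x assume "x \<in> set (concat t)"
      then obtain ys where "ys \<in> set t" "x \<in> set ys" by auto
      then obtain r c where "r < length t" "ys = t ! r" "c < length ys" "x = ys ! c"
        by (metis in_set_conv_nth)
      then show "x \<in> ?f ` boxes lam" using tableau_lengths by (intro image_eqI[of _ _ "(r, c)"]) auto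
    next
      fix x assume "x \<in> ?f ` boxes lam"
      then obtain r c where "r < length lam" "c < lam ! r" "x = t ! r ! c" by auto
      then show "x \<in> set (concat t)" using tableau_lengths by (auto intro!: bexI[of _ "t ! r"])
    qed
    ultimately show ?thesis by simp
  qed
  have "card (boxes lam) = (\<Sum>r<length lam. lam ! r)" by simp
  also have "\<dots> = m" using sum_list_shape by (simp add: sum_list_sum_nth atLeast0LessThan)
  finally have "inj_on ?f (boxes lam)" using img by (intro eq_card_imp_inj_on) simp_all
  with img show ?thesis by (simp add: bij_betw_def)
qed

lemma position:
  assumes "x \<in> E"
  shows "row x < length lam" "col x < lam ! row x" "t ! row x ! col x = x"
proof -
  have x: "x \<in> (\<lambda>(r, c). t ! r ! c) ` boxes lam"
    using assms bij_betw_boxes by (simp add: bij_betw_def)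
  have "position lam t x \<in> boxes lam" using x by (rule inv_into_into)
  then show "row x < length lam" "col x < lam ! row x" by (cases "position lam t x"; simp)+
  show "t ! row x ! col x = x" using f_inv_into_f[OF x] by (simp add: case_prod_unfold)
qed

lemma position_eq:
  assumes "r < length lam" "c < lam ! r"
  shows "t ! r ! c \<in> E" "row (t ! r ! c) = r" "col (t ! r ! c) = c"
proof -
  have rc: "(r, c) \<in> boxes lam" using assms by simp
  have "(\<lambda>(r, c). t ! r ! c) (r, c) \<in> E" using bij_betw_boxes rc by (rule bij_betwE[THEN bspec])
  then show "t ! r ! c \<in> E" by simp
  have "position lam t ((\<lambda>(r, c). t ! r ! c) (r, c)) = (r, c)"
    using bij_betw_boxes rc by (intro inv_into_f_f) (simp add: bij_betw_def)
  then show "row (t ! r ! c) = r" "col (t ! r ! c) = c" by simp_all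
qed

text \<open>Rows get weakly shorter downwards, so every position to the upper left of a box is a
  box.\<close>

lemma young_tableau: "young E (\<lambda>x. row x) (\<lambda>x. col x)"
  unfolding young_def
proof (intro conjI ballI allI impI)
  show "inj_on (\<lambda>x. (row x, col x)) E"
    by (rule inj_onI) (metis position(3) prod.inject)
  fix x i j assume x: "x \<in> E" "i \<le> row x" "j \<le> col x"
  have "sorted_wrt (\<ge>) lam" using lam by (simp add: partitions_def)
  then have "lam ! row x \<le> lam ! i"
    using sorted_wrt_nth_less[of "(\<ge>)" lam i "row x"] x(2) position(1)[OF x(1)] by (cases "i = row x") auto
  then have "i < length lam" "j < lam ! i" using position(1,2)[OF x(1)] x by auto
  from position_eq[OF this] show "\<exists>y\<in>E. row y = i \<and> col y = j" by blast
qed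

lemma prod_boxes: "(\<Prod>x\<in>E. U + of_nat (col x) - of_nat (row x)) = content_product lam U"
proof -
  have "(\<Prod>x\<in>E. U + of_nat (col x) - of_nat (row x)) =
      (\<Prod>p\<in>boxes lam. U + of_nat (snd p) - of_nat (fst p))"
    by (rule prod.reindex_bij_betw[OF bij_betw_inv_into[OF bij_betw_boxes]])
  also have "\<dots> = content_product lam U"
    unfolding content_product_def by (simp add: prod.Sigma case_prod_unfold)
  finally show ?thesis .
qed

lemma set_row: "r < length lam \<Longrightarrow> set (t ! r) = {x \<in> E. row x = r}"
proof (intro equalityI subsetI)
  fix x assume r: "r < length lam" and "x \<in> set (t ! r)"
  then obtain c where "c < lam ! r" "x = t ! r ! c" using tableau_lengths by (metis in_set_conv_nth)
  with position_eq[OF r this(1)] show "x \<in> {x \<in> E. row x = r}" by simp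
next
  fix x assume "r < length lam" "x \<in> {x \<in> E. row x = r}"
  with position[of x] show "x \<in> set (t ! r)" using tableau_lengths(2)[of r] by (metis (mono_tags) mem_Collect_eq nth_mem)
qed

lemma column_eq: "column t j = {x \<in> E. col x = j}"
proof (intro equalityI subsetI)
  fix x assume "x \<in> column t j"
  then obtain r where "r < length lam" "j < lam ! r" "x = t ! r ! j"
    unfolding column_def using tableau_lengths by (auto simp: in_set_conv_nth)
  with position_eq[OF this(1,2)] show "x \<in> {x \<in> E. col x = j}" by simp
next
  fix x assume "x \<in> {x \<in> E. col x = j}"
  with position[of x] show "x \<in> column t j"
    unfolding column_def using tableau_lengths(1) tableau_lengths(2)[of "row x"]
    by (intro CollectI exI[of _ "t ! row x"]) auto
qed

lemma column_stabilizer_eq: "column_stabilizer lam t = fibre_perms (\<lambda>x. col x) E"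
proof (intro equalityI subsetI)
  fix \<sigma> assume "\<sigma> \<in> column_stabilizer lam t"
  then have \<sigma>: "\<sigma> permutes E" "\<And>j. \<sigma> ` column t j = column t j"
    using sum_list_shape by (auto simp: column_stabilizer_def)
  have "col (\<sigma> x) = col x" for x
  proof (cases "x \<in> E")
    case True
    then have "x \<in> column t (col x)" by (simp add: column_eq)
    then have "\<sigma> x \<in> column t (col x)" using \<sigma>(2) by blast
    then show ?thesis by (simp add: column_eq)
  qed (use permutes_not_in[OF \<sigma>(1)] in simp)
  then show "\<sigma> \<in> fibre_perms (\<lambda>x. col x) E" using \<sigma>(1) by (simp add: fibre_perms_def)
next
  fix \<sigma> assume "\<sigma> \<in> fibre_perms (\<lambda>x. col x) E"
  note \<sigma> = fibre_permsD[OF this]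
  have "\<sigma> ` column t j = column t j" for j
  proof (rule endo_inj_surj)
    show "\<sigma> ` column t j \<subseteq> column t j"
      using \<sigma>(1,2) permutes_in_image[OF \<sigma>(1)] by (auto simp: column_eq)
    show "inj_on \<sigma> (column t j)" using permutes_inj_on[OF \<sigma>(1)] .
  qed (simp add: column_eq)
  then show "\<sigma> \<in> column_stabilizer lam t" using \<sigma>(1) sum_list_shape by (simp add: column_stabilizer_def)
qed

lemma perm_tabloid_row_perm:
  assumes "\<rho> \<in> fibre_perms (\<lambda>x. row x) E"
  shows "perm_tabloid \<rho> (tabloid_of t) = tabloid_of t"
proof -
  note \<rho> = fibre_permsD[OF assms]
  have "\<rho> ` set (t ! r) = set (t ! r)" if "r < length lam" for r
  proof (rule endo_inj_surj)
    show "\<rho> ` set (t ! r) \<subseteq> set (t ! r)"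
      unfolding set_row[OF that] using \<rho>(1,2) permutes_in_image[OF \<rho>(1)] by auto
    show "inj_on \<rho> (set (t ! r))" using permutes_inj_on[OF \<rho>(1)] .
  qed simp
  then show ?thesis
    unfolding perm_tabloid_def tabloid_of_def map_map
    by (intro nth_equalityI) (auto simp: tableau_lengths(1))
qed

end

section \<open>The scalar of the class function on Specht modules\<close>

lemma perm_tabloid_comp: "perm_tabloid \<sigma> (perm_tabloid \<tau> T) = perm_tabloid (\<sigma> \<circ> \<tau>) T"
  by (simp add: perm_tabloid_def image_comp)

lemma perm_tabloid_id: "perm_tabloid id T = T"
  by (simp add: perm_tabloid_def)

lemma perm_tabloid_inv_eq_iff:
  assumes "\<pi> permutes E"
  shows "perm_tabloid (inv_into UNIV \<pi>) T = T' \<longleftrightarrow> T = perm_tabloid \<pi> T'"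
  using permutes_inv_o[OF assms] by (metis perm_tabloid_comp perm_tabloid_id)

lemma perm_specht_polytabloid:
  assumes "\<pi> permutes E"
  shows "perm_specht \<pi> (polytabloid lam t :: tabloid \<Rightarrow> 'k::field) T =
    (\<Sum>\<sigma>\<in>column_stabilizer lam t. if T = perm_tabloid (\<pi> \<circ> \<sigma>) (tabloid_of t) then of_int (sign \<sigma>) else 0)"
  unfolding perm_specht_def polytabloid_def perm_tabloid_inv_eq_iff[OF assms] perm_tabloid_comp ..

text \<open>The coefficient of \<open>T\<close> in the sum becomes a sum of \<open>U ^ cyc\<close>
  against an integer function \<open>h\<close> on permutations. Signed summation over the column
  stabilizer makes \<open>h\<close> alternating on the left, and tabloids ignore row permutations,
  which makes \<open>h\<close> invariant on the right. The general evaluation of such sums then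
  applies over any field, whether or not the Specht module is simple.\<close>

lemma polytabloid_scalar:
  fixes U :: "'k::field"
  assumes lam: "lam \<in> partitions m" and t: "t \<in> tableaux lam"
  shows "(\<Sum>\<pi> | \<pi> permutes {1..m}. U ^ cyc (perm_graph {1..m} \<pi>) * perm_specht \<pi> (polytabloid lam t) T) =
    content_product lam U * polytabloid lam t T"
proof -
  let ?E = "{1..m}"
  let ?row = "\<lambda>x. fst (position lam t x)" and ?col = "\<lambda>x. snd (position lam t x)"
  let ?C = "fibre_perms ?col ?E" and ?t = "tabloid_of t"
  define h where "h \<pi> = (\<Sum>\<sigma>\<in>?C. if T = perm_tabloid \<sigma> (perm_tabloid \<pi> ?t) then sign \<sigma> else 0)" for \<pi>
  have finC: "finite ?C" by simp
  have bij_comp: "bij_betw (\<lambda>\<sigma>. \<sigma> \<circ> \<sigma>0) ?C ?C" if \<sigma>0: "\<sigma>0 \<in> ?C" for \<sigma>0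
  proof (rule bij_betw_byWitness[where f' = "\<lambda>\<sigma>. \<sigma> \<circ> inv_into UNIV \<sigma>0"])
    note i = permutes_inv_o[OF fibre_permsD(1)[OF \<sigma>0]]
    show "\<forall>\<sigma>\<in>?C. (\<sigma> \<circ> \<sigma>0) \<circ> inv_into UNIV \<sigma>0 = \<sigma>" "\<forall>\<sigma>\<in>?C. (\<sigma> \<circ> inv_into UNIV \<sigma>0) \<circ> \<sigma>0 = \<sigma>"
      by (simp_all add: comp_assoc i)
    show "(\<lambda>\<sigma>. \<sigma> \<circ> \<sigma>0) ` ?C \<subseteq> ?C" "(\<lambda>\<sigma>. \<sigma> \<circ> inv_into UNIV \<sigma>0) ` ?C \<subseteq> ?C"
      using fibre_perms_comp[OF _ \<sigma>0] fibre_perms_comp[OF _ fibre_perms_inv[OF \<sigma>0]] by blast+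
  qed
  have "(\<Sum>\<pi> | \<pi> permutes ?E. U ^ cyc (perm_graph ?E \<pi>) * perm_specht \<pi> (polytabloid lam t) T) =
      (\<Sum>\<pi> | \<pi> permutes ?E. \<Sum>\<sigma>\<in>?C. U ^ cyc (perm_graph ?E \<pi>) *
        (if T = perm_tabloid (\<pi> \<circ> \<sigma>) ?t then of_int (sign \<sigma>) else 0))"
  proof (rule sum.cong[OF refl])
    fix \<pi> assume "\<pi> \<in> {\<pi>. \<pi> permutes ?E}"
    then have "\<pi> permutes ?E" by simp
    show "U ^ cyc (perm_graph ?E \<pi>) * perm_specht \<pi> (polytabloid lam t) T =
        (\<Sum>\<sigma>\<in>?C. U ^ cyc (perm_graph ?E \<pi>) * (if T = perm_tabloid (\<pi> \<circ> \<sigma>) ?t then of_int (sign \<sigma>) else 0))"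
      unfolding perm_specht_polytabloid[OF \<open>\<pi> permutes ?E\<close>] column_stabilizer_eq[OF lam t]
        sum_distrib_left ..
  qed
  also have "\<dots> = (\<Sum>\<sigma>\<in>?C. \<Sum>\<pi> | \<pi> permutes ?E. U ^ cyc (perm_graph ?E \<pi>) *
        (if T = perm_tabloid (\<pi> \<circ> \<sigma>) ?t then of_int (sign \<sigma>) else 0))"
    by (rule sum.swap)
  \<comment> \<open>Conjugation by \<open>\<sigma>\<close> preserves cycle numbers, so
    \<open>\<sigma>\<close> may be moved from the right of \<open>\<pi>\<close> to the left. There
    it makes the sum alternating under column permutations.\<close>
  also have "\<dots> = (\<Sum>\<sigma>\<in>?C. \<Sum>\<pi> | \<pi> permutes ?E. U ^ cyc (perm_graph ?E \<pi>) *
        (if T = perm_tabloid (\<sigma> \<circ> \<pi>) ?t then of_int (sign \<sigma>) else 0))"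
  proof (rule sum.cong[OF refl])
    fix \<sigma> assume "\<sigma> \<in> ?C"
    then have \<sigma>: "\<sigma> permutes ?E" by (rule fibre_permsD(1))
    let ?\<sigma>' = "inv_into UNIV \<sigma>"
    note \<sigma>' = permutes_inv[OF \<sigma>] and i = permutes_inv_o[OF \<sigma>]
    show "(\<Sum>\<pi> | \<pi> permutes ?E. U ^ cyc (perm_graph ?E \<pi>) *
        (if T = perm_tabloid (\<pi> \<circ> \<sigma>) ?t then of_int (sign \<sigma>) else 0)) =
      (\<Sum>\<pi> | \<pi> permutes ?E. U ^ cyc (perm_graph ?E \<pi>) *
        (if T = perm_tabloid (\<sigma> \<circ> \<pi>) ?t then of_int (sign \<sigma>) else 0))"
    proof (rule sum.reindex_bij_witness[where i = "\<lambda>\<pi>. \<sigma> \<circ> \<pi> \<circ> ?\<sigma>'" and j = "\<lambda>\<pi>. ?\<sigma>' \<circ> \<pi> \<circ> \<sigma>"])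
      fix \<pi> assume "\<pi> \<in> {\<pi>. \<pi> permutes ?E}"
      then have \<pi>: "\<pi> permutes ?E" by simp
      show e: "\<sigma> \<circ> (?\<sigma>' \<circ> \<pi> \<circ> \<sigma>) \<circ> ?\<sigma>' = \<pi>"
        using permutes_inverses[OF \<sigma>] by (simp add: fun_eq_iff)
      show "?\<sigma>' \<circ> (\<sigma> \<circ> \<pi> \<circ> ?\<sigma>') \<circ> \<sigma> = \<pi>"
        using permutes_inverses[OF \<sigma>] by (simp add: fun_eq_iff)
      show "?\<sigma>' \<circ> \<pi> \<circ> \<sigma> \<in> {\<pi>. \<pi> permutes ?E}" "\<sigma> \<circ> \<pi> \<circ> ?\<sigma>' \<in> {\<pi>. \<pi> permutes ?E}"
        using \<sigma> \<sigma>' \<pi> by (simp_all add: permutes_compose)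
      have p: "?\<sigma>' \<circ> \<pi> \<circ> \<sigma> permutes ?E" using \<sigma> \<sigma>' \<pi> by (simp add: permutes_compose)
      have "cyc (perm_graph ?E \<pi>) = cyc (perm_graph ?E (?\<sigma>' \<circ> \<pi> \<circ> \<sigma>))"
        using cyc_perm_graph_conj[OF \<sigma> p] unfolding e .
      moreover have "\<sigma> \<circ> (?\<sigma>' \<circ> \<pi> \<circ> \<sigma>) = \<pi> \<circ> \<sigma>"
        using permutes_inverses[OF \<sigma>] by (simp add: fun_eq_iff)
      ultimately show "U ^ cyc (perm_graph ?E (?\<sigma>' \<circ> \<pi> \<circ> \<sigma>)) *
          (if T = perm_tabloid (\<sigma> \<circ> (?\<sigma>' \<circ> \<pi> \<circ> \<sigma>)) ?t then of_int (sign \<sigma>) else 0) =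
          U ^ cyc (perm_graph ?E \<pi>) * (if T = perm_tabloid (\<pi> \<circ> \<sigma>) ?t then of_int (sign \<sigma>) else 0)"
        by (simp only:)
    qed
  qed
  also have "\<dots> = (\<Sum>\<pi> | \<pi> permutes ?E. \<Sum>\<sigma>\<in>?C. U ^ cyc (perm_graph ?E \<pi>) *
        (if T = perm_tabloid (\<sigma> \<circ> \<pi>) ?t then of_int (sign \<sigma>) else 0))"
    by (rule sum.swap)
  also have "\<dots> = (\<Sum>\<pi> | \<pi> permutes ?E. U ^ cyc (perm_graph ?E \<pi>) * of_int (h \<pi>))"
  proof (rule sum.cong[OF refl])
    fix \<pi>
    have "of_int (h \<pi>) = (\<Sum>\<sigma>\<in>?C. if T = perm_tabloid (\<sigma> \<circ> \<pi>) ?t then of_int (sign \<sigma>) else 0 :: 'k)"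
      unfolding h_def perm_tabloid_comp of_int_sum by (intro sum.cong refl) simp
    then show "(\<Sum>\<sigma>\<in>?C. U ^ cyc (perm_graph ?E \<pi>) * (if T = perm_tabloid (\<sigma> \<circ> \<pi>) ?t then of_int (sign \<sigma>) else 0)) =
        U ^ cyc (perm_graph ?E \<pi>) * of_int (h \<pi>)"
      by (simp only: sum_distrib_left)
  qed
  also have "\<dots> = (\<Prod>x\<in>?E. U + of_nat (?col x) - of_nat (?row x)) * of_int (h id)"
  proof (rule sum_cyc_equivariant[OF _ young_tableau[OF lam t]])
    fix \<sigma>0 \<pi> assume \<sigma>0: "\<sigma>0 \<in> ?C" and \<pi>: "\<pi> permutes ?E"
    have perm: "permutation \<sigma>" if "\<sigma> \<in> ?C" for \<sigma>
      using permutes_imp_permutation[OF _ fibre_permsD(1)[OF that]] by simp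
    have "h \<pi> = (\<Sum>\<sigma>\<in>?C. if T = perm_tabloid (\<sigma> \<circ> \<sigma>0) (perm_tabloid \<pi> ?t) then sign (\<sigma> \<circ> \<sigma>0) else 0)"
      unfolding h_def by (rule sum.reindex_bij_betw[OF bij_comp[OF \<sigma>0], symmetric])
    also have "\<dots> = (\<Sum>\<sigma>\<in>?C. sign \<sigma>0 * (if T = perm_tabloid \<sigma> (perm_tabloid (\<sigma>0 \<circ> \<pi>) ?t) then sign \<sigma> else 0))"
      using perm \<sigma>0 by (intro sum.cong refl) (auto simp: perm_tabloid_comp comp_assoc sign_compose)
    also have "\<dots> = sign \<sigma>0 * h (\<sigma>0 \<circ> \<pi>)" unfolding h_def by (simp only: sum_distrib_left)
    finally have "sign \<sigma>0 * h \<pi> = (sign \<sigma>0 * sign \<sigma>0) * h (\<sigma>0 \<circ> \<pi>)" by (simp only: mult.assoc)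
    then show "h (\<sigma>0 \<circ> \<pi>) = sign \<sigma>0 * h \<pi>" by simp
  next
    fix \<rho> \<pi> assume "\<rho> \<in> fibre_perms ?row ?E"
    from perm_tabloid_row_perm[OF lam t this] show "h (\<pi> \<circ> \<rho>) = h \<pi>"
      unfolding h_def perm_tabloid_comp[symmetric] by (simp only:)
  qed simp
  also have "\<dots> = content_product lam U * polytabloid lam t T"
    unfolding prod_boxes[OF lam t]
    by (simp add: h_def perm_tabloid_id polytabloid_def column_stabilizer_eq[OF lam t] of_int_sum if_distrib cong: if_cong)
  finally show ?thesis .
qed

lemma span_induct_fun:
  fixes S :: "('a \<Rightarrow> 'k::field) set"
  assumes s: "s \<in> Modules.module.span (\<lambda>c s x. c * s x) S"
    and zero: "P (\<lambda>x. 0)" and add: "\<And>f g. P f \<Longrightarrow> P g \<Longrightarrow> P (\<lambda>x. f x + g x)"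
    and scale: "\<And>c f. P f \<Longrightarrow> P (\<lambda>x. c * f x)" and base: "\<And>f. f \<in> S \<Longrightarrow> P f"
  shows "P s"
proof -
  interpret vs: vector_space "\<lambda>c (s :: 'a \<Rightarrow> 'k) x. c * s x" by (rule vector_space_fun)
  have "vs.subspace (Collect P)"
    unfolding vs.subspace_def using zero add scale by (auto simp: zero_fun_def plus_fun_def)
  then have "vs.span S \<subseteq> Collect P" using base by (intro vs.span_minimal) auto
  then show ?thesis using s by auto
qed

lemma specht_closed:
  fixes s s' :: "tabloid \<Rightarrow> 'k::field"
  shows "(\<lambda>T. 0) \<in> (specht lam :: (tabloid \<Rightarrow> 'k) set)"
    and "s \<in> specht lam \<Longrightarrow> s' \<in> specht lam \<Longrightarrow> (\<lambda>T. s T + s' T) \<in> specht lam"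
    and "s \<in> specht lam \<Longrightarrow> (\<lambda>T. c * s T) \<in> specht lam"
    and "t \<in> tableaux lam \<Longrightarrow> polytabloid lam t \<in> (specht lam :: (tabloid \<Rightarrow> 'k) set)"
proof -
  interpret vs: vector_space "\<lambda>c (s :: tabloid \<Rightarrow> 'k) x. c * s x" by (rule vector_space_fun)
  show "(\<lambda>T. 0) \<in> (specht lam :: (tabloid \<Rightarrow> 'k) set)"
    unfolding specht_def using vs.span_zero by (simp add: zero_fun_def)
  show "s \<in> specht lam \<Longrightarrow> s' \<in> specht lam \<Longrightarrow> (\<lambda>T. s T + s' T) \<in> specht lam"
    unfolding specht_def using vs.span_add[of s _ s'] by (simp add: plus_fun_def)
  show "s \<in> specht lam \<Longrightarrow> (\<lambda>T. c * s T) \<in> specht lam"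
    unfolding specht_def by (rule vs.span_scale)
  show "t \<in> tableaux lam \<Longrightarrow> polytabloid lam t \<in> (specht lam :: (tabloid \<Rightarrow> 'k) set)"
    unfolding specht_def by (intro vs.span_base) simp
qed

lemma specht_sum:
  fixes s :: "'i \<Rightarrow> tabloid \<Rightarrow> 'k::field"
  shows "(\<And>i. i \<in> I \<Longrightarrow> s i \<in> specht lam) \<Longrightarrow> (\<lambda>T. \<Sum>i\<in>I. s i T) \<in> specht lam"
  by (induction I rule: infinite_finite_induct) (simp_all add: specht_closed(1,2))

lemma specht_scalar:
  fixes U :: "'k::field"
  assumes lam: "lam \<in> partitions m" and s: "s \<in> specht lam"
  shows "(\<Sum>\<pi> | \<pi> permutes {1..m}. U ^ cyc (perm_graph {1..m} \<pi>) * perm_specht \<pi> s T) =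
    content_product lam U * s T"
proof -
  have "\<forall>T. (\<Sum>\<pi> | \<pi> permutes {1..m}. U ^ cyc (perm_graph {1..m} \<pi>) * perm_specht \<pi> s T) =
    content_product lam U * s T"
    using s unfolding specht_def
  proof (rule span_induct_fun)
    fix f g :: "tabloid \<Rightarrow> 'k"
    assume "\<forall>T. (\<Sum>\<pi> | \<pi> permutes {1..m}. U ^ cyc (perm_graph {1..m} \<pi>) * perm_specht \<pi> f T) = content_product lam U * f T"
      "\<forall>T. (\<Sum>\<pi> | \<pi> permutes {1..m}. U ^ cyc (perm_graph {1..m} \<pi>) * perm_specht \<pi> g T) = content_product lam U * g T"
    then show "\<forall>T. (\<Sum>\<pi> | \<pi> permutes {1..m}. U ^ cyc (perm_graph {1..m} \<pi>) * perm_specht \<pi> (\<lambda>x. f x + g x) T) = content_product lam U * (f T + g T)"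
      by (simp add: perm_specht_def distrib_left sum.distrib)
  next
    fix c and f :: "tabloid \<Rightarrow> 'k"
    assume f: "\<forall>T. (\<Sum>\<pi> | \<pi> permutes {1..m}. U ^ cyc (perm_graph {1..m} \<pi>) * perm_specht \<pi> f T) = content_product lam U * f T"
    show "\<forall>T. (\<Sum>\<pi> | \<pi> permutes {1..m}. U ^ cyc (perm_graph {1..m} \<pi>) * perm_specht \<pi> (\<lambda>x. c * f x) T) = content_product lam U * (c * f T)"
      using f by (simp add: perm_specht_def mult.left_commute[of _ c] sum_distrib_left[symmetric])
  next
    fix f :: "tabloid \<Rightarrow> 'k" assume "f \<in> polytabloid lam ` tableaux lam"
    then show "\<forall>T. (\<Sum>\<pi> | \<pi> permutes {1..m}. U ^ cyc (perm_graph {1..m} \<pi>) * perm_specht \<pi> f T) = content_product lam U * f T"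
      using polytabloid_scalar[OF lam] by blast
  qed (simp add: perm_specht_def)
  then show ?thesis by blast
qed

lemma tableaux_perm:
  assumes lam: "lam \<in> partitions m" and t: "t \<in> tableaux lam" and \<pi>: "\<pi> permutes {1..m}"
  shows "map (map \<pi>) t \<in> tableaux lam"
proof -
  have m: "sum_list lam = m" using lam by (simp add: partitions_def)
  have c: "concat (map (map \<pi>) t) = map \<pi> (concat t)" by (simp add: map_concat)
  have "map length (map (map \<pi>) t) = map length t" by simp
  moreover have "set (concat t) = {1..m}" using t m by (simp only: tableaux_def mem_Collect_eq)
  then have "set (map \<pi> (concat t)) = {1..m}" using permutes_image[OF \<pi>] by (simp only: set_map)
  moreover have "distinct (map \<pi> (concat t))"
    using t permutes_inj_on[OF \<pi>] by (simp only: tableaux_def distinct_map mem_Collect_eq)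
  ultimately show ?thesis
    using t unfolding tableaux_def mem_Collect_eq c m by simp
qed

lemma perm_specht_in:
  fixes s :: "tabloid \<Rightarrow> 'k::field"
  assumes lam: "lam \<in> partitions m" and s: "s \<in> specht lam" and \<pi>: "\<pi> permutes {1..m}"
  shows "perm_specht \<pi> s \<in> specht lam"
  using s unfolding specht_def[of lam]
proof (rule span_induct_fun, fold specht_def)
  show "perm_specht \<pi> (\<lambda>x. 0 :: 'k) \<in> specht lam"
    by (simp add: perm_specht_def specht_closed(1))
next
  fix f g :: "tabloid \<Rightarrow> 'k" assume "perm_specht \<pi> f \<in> specht lam" "perm_specht \<pi> g \<in> specht lam"
  from specht_closed(2)[OF this] show "perm_specht \<pi> (\<lambda>x. f x + g x) \<in> specht lam"
    by (simp add: perm_specht_def)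
next
  fix c and f :: "tabloid \<Rightarrow> 'k" assume "perm_specht \<pi> f \<in> specht lam"
  from specht_closed(3)[OF this] show "perm_specht \<pi> (\<lambda>x. c * f x) \<in> specht lam"
    by (simp add: perm_specht_def)
next
  fix f :: "tabloid \<Rightarrow> 'k" assume "f \<in> polytabloid lam ` tableaux lam"
  then obtain t where t: "t \<in> tableaux lam" and f: "f = polytabloid lam t" by blast
  let ?t = "map (map \<pi>) t" and ?\<pi>' = "inv_into UNIV \<pi>"
  have m: "sum_list lam = m" using lam by (simp add: partitions_def)
  have t': "tabloid_of ?t = perm_tabloid \<pi> (tabloid_of t)"
    by (simp add: tabloid_of_def perm_tabloid_def)
  have col: "column ?t j = \<pi> ` column t j" for j
  proof (intro equalityI subsetI)
    fix x assume "x \<in> column ?t j"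
    then obtain r where "r \<in> set t" "x = map \<pi> r ! j" "j < length r" by (auto simp: column_def)
    then show "x \<in> \<pi> ` column t j"
      by (intro image_eqI[of _ _ "r ! j"]) (auto simp: column_def)
  next
    fix x assume "x \<in> \<pi> ` column t j"
    then obtain r where "r \<in> set t" "x = \<pi> (r ! j)" "j < length r" by (auto simp: column_def)
    then show "x \<in> column ?t j"
      unfolding column_def by (intro CollectI exI[of _ "map \<pi> r"]) auto
  qed
  have conj: "\<pi> \<circ> \<sigma> \<circ> ?\<pi>' \<in> column_stabilizer lam ?t" if "\<sigma> \<in> column_stabilizer lam t" for \<sigma>
  proof -
    have "(\<pi> \<circ> \<sigma> \<circ> ?\<pi>') ` \<pi> ` column t j = \<pi> ` column t j" for j
    proof -
      have "(\<pi> \<circ> \<sigma> \<circ> ?\<pi>') ` \<pi> ` column t j = \<pi> ` \<sigma> ` (?\<pi>' \<circ> \<pi>) ` column t j"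
        by (simp only: image_comp comp_assoc)
      then show ?thesis using that by (simp add: permutes_inv_o[OF \<pi>] column_stabilizer_def)
    qed
    then show ?thesis
      using that \<pi> permutes_inv[OF \<pi>] unfolding column_stabilizer_def col m
      by (simp add: permutes_compose)
  qed
  have conj': "?\<pi>' \<circ> \<sigma> \<circ> \<pi> \<in> column_stabilizer lam t" if "\<sigma> \<in> column_stabilizer lam ?t" for \<sigma>
  proof -
    have "(?\<pi>' \<circ> \<sigma> \<circ> \<pi>) ` column t j = column t j" for j
    proof -
      have "(?\<pi>' \<circ> \<sigma> \<circ> \<pi>) ` column t j = ?\<pi>' ` \<sigma> ` \<pi> ` column t j"
        by (simp only: image_comp comp_assoc)
      also have "\<dots> = (?\<pi>' \<circ> \<pi>) ` column t j"
        using that by (simp add: column_stabilizer_def col image_comp)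
      finally show ?thesis by (simp add: permutes_inv_o[OF \<pi>])
    qed
    then show ?thesis
      using that \<pi> permutes_inv[OF \<pi>] unfolding column_stabilizer_def m
      by (simp add: permutes_compose)
  qed
  \<comment> \<open>The image of a polytabloid is the polytabloid of the permuted tableau:
    conjugation by \<open>\<pi>\<close> identifies the two column stabilizers and preserves
    signs.\<close>
  have "perm_specht \<pi> f = polytabloid lam ?t"
  proof
    fix T
    have "perm_specht \<pi> f T =
        (\<Sum>\<sigma>\<in>column_stabilizer lam t. if T = perm_tabloid (\<pi> \<circ> \<sigma>) (tabloid_of t) then of_int (sign \<sigma>) else 0)"
      unfolding f by (rule perm_specht_polytabloid[OF \<pi>])
    also have "\<dots> = (\<Sum>\<sigma>\<in>column_stabilizer lam ?t. if T = perm_tabloid \<sigma> (tabloid_of ?t) then of_int (sign \<sigma>) else 0)"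
    proof (rule sum.reindex_bij_witness[where i = "\<lambda>\<sigma>. ?\<pi>' \<circ> \<sigma> \<circ> \<pi>" and j = "\<lambda>\<sigma>. \<pi> \<circ> \<sigma> \<circ> ?\<pi>'"])
      fix \<sigma> assume \<sigma>: "\<sigma> \<in> column_stabilizer lam t"
      show "?\<pi>' \<circ> (\<pi> \<circ> \<sigma> \<circ> ?\<pi>') \<circ> \<pi> = \<sigma>"
        using permutes_inverses[OF \<pi>] by (simp add: fun_eq_iff)
      show "\<pi> \<circ> \<sigma> \<circ> ?\<pi>' \<in> column_stabilizer lam ?t" using \<sigma> by (rule conj)
      have "perm_tabloid (\<pi> \<circ> \<sigma> \<circ> ?\<pi>') (tabloid_of ?t) = perm_tabloid (\<pi> \<circ> \<sigma>) (tabloid_of t)"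
        unfolding t' perm_tabloid_comp comp_assoc permutes_inv_o[OF \<pi>] by simp
      moreover have "\<sigma> permutes {1..m}" using \<sigma> m by (simp add: column_stabilizer_def)
      then have "sign (\<pi> \<circ> \<sigma> \<circ> ?\<pi>') = sign \<sigma>"
        using permutes_imp_permutation[OF _ \<pi>] permutes_imp_permutation[of "{1..m}" \<sigma>]
          permutes_imp_permutation[OF _ permutes_inv[OF \<pi>]]
        by (simp add: sign_compose sign_inverse permutation_compose mult.commute mult.left_commute)
      ultimately show "(if T = perm_tabloid (\<pi> \<circ> \<sigma> \<circ> ?\<pi>') (tabloid_of ?t) then of_int (sign (\<pi> \<circ> \<sigma> \<circ> ?\<pi>')) else 0) =
          (if T = perm_tabloid (\<pi> \<circ> \<sigma>) (tabloid_of t) then of_int (sign \<sigma>) else 0)"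
        by (simp only:)
    next
      fix \<sigma> assume "\<sigma> \<in> column_stabilizer lam ?t"
      then show "?\<pi>' \<circ> \<sigma> \<circ> \<pi> \<in> column_stabilizer lam t" by (rule conj')
      show "\<pi> \<circ> (?\<pi>' \<circ> \<sigma> \<circ> \<pi>) \<circ> ?\<pi>' = \<sigma>"
        using permutes_inverses[OF \<pi>] by (simp add: fun_eq_iff)
    qed
    finally show "perm_specht \<pi> f T = polytabloid lam ?t T" unfolding polytabloid_def .
  qed
  then show "perm_specht \<pi> f \<in> specht lam"
    using specht_closed(4)[OF tableaux_perm[OF lam t \<pi>]] by simp
qed

text \<open>A finite set that contains all tabloids of the shape, chosen coarse enough to be visibly
  finite; it bounds the dimension.\<close>

definition shape_tabloids :: "nat list \<Rightarrow> tabloid set" where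
  "shape_tabloids lam = {T. set T \<subseteq> Pow {1..sum_list lam} \<and> length T = length lam}"

lemma finite_shape_tabloids: "finite (shape_tabloids lam)"
  unfolding shape_tabloids_def by (rule finite_lists_length_eq) simp

lemma specht_support:
  fixes s :: "tabloid \<Rightarrow> 'k::field"
  assumes "s \<in> specht lam" "T \<notin> shape_tabloids lam"
  shows "s T = 0"
  using assms(1) unfolding specht_def
proof (rule span_induct_fun)
  fix f :: "tabloid \<Rightarrow> 'k" assume "f \<in> polytabloid lam ` tableaux lam"
  then obtain t where t: "t \<in> tableaux lam" and f: "f = polytabloid lam t" by blast
  have "T \<noteq> perm_tabloid \<sigma> (tabloid_of t)" if \<sigma>: "\<sigma> \<in> column_stabilizer lam t" for \<sigma>
  proof
    assume T: "T = perm_tabloid \<sigma> (tabloid_of t)"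
    have p: "\<sigma> permutes {1..sum_list lam}" using \<sigma> by (simp add: column_stabilizer_def)
    have l: "length t = length lam" using t by (auto simp: tableaux_def)
    have "set r \<subseteq> {1..sum_list lam}" if "r \<in> set t" for r
    proof -
      have "set (concat t) = {1..sum_list lam}" using t by (simp add: tableaux_def)
      then show ?thesis using that by auto
    qed
    then have "\<sigma> ` set r \<subseteq> {1..sum_list lam}" if "r \<in> set t" for r
      using that permutes_image[OF p] by blast
    then have "T \<in> shape_tabloids lam"
      unfolding T using l by (auto simp: shape_tabloids_def perm_tabloid_def tabloid_of_def)
    then show False using assms(2) by simp
  qed
  then show "f T = 0" unfolding f polytabloid_def by (simp add: sum.neutral)
qed simp_all

section \<open>Cell modules\<close>

text \<open>The matrix entry of \<open>a\<close> on the span of the diagrams: the coefficient of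
  \<open>w\<close> in the product of \<open>a\<close> and \<open>v\<close>.\<close>

definition coefficient :: "nat \<Rightarrow> 'k::field \<Rightarrow> (diagram \<Rightarrow> 'k) \<Rightarrow> diagram \<Rightarrow> diagram \<Rightarrow> 'k" where
  "coefficient n \<delta> a v w = (\<Sum>e\<in>{e \<in> diagrams n. concat_diagram e v = w}. a e * \<delta> ^ num_removed e v)"

lemma cell_tensor_simps:
  "carrier (cell_tensor n \<delta> lam) = {f. (\<forall>v\<in>half_diagrams n (sum_list lam). f v \<in> specht lam) \<and>
     (\<forall>v. v \<notin> half_diagrams n (sum_list lam) \<longrightarrow> f v = (\<lambda>T. 0))}"
  "\<zero>\<^bsub>cell_tensor n \<delta> lam\<^esub> = (\<lambda>v T. 0)"
  "f \<oplus>\<^bsub>cell_tensor n \<delta> lam\<^esub> g = (\<lambda>v T. f v T + g v T)"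
  by (auto simp: cell_tensor_def)

text \<open>The action in matrix form. The defining condition counts propagating blocks, the new one
  asks for a half diagram; they agree on every concatenation with a half diagram, because its
  southern singletons persist.\<close>

lemma cell_tensor_smult:
  "a \<odot>\<^bsub>cell_tensor n \<delta> lam\<^esub> f = (\<lambda>w T. if w \<in> half_diagrams n (sum_list lam)
     then \<Sum>v\<in>half_diagrams n (sum_list lam). coefficient n \<delta> a v w * f v T else 0)"
proof (intro ext)
  fix w T
  let ?m = "sum_list lam"
  let ?H = "half_diagrams n ?m"
  let ?S = "{(x, v) \<in> diagrams n \<times> ?H. concat_diagram x v = w}"
  have sm: "(a \<odot>\<^bsub>cell_tensor n \<delta> lam\<^esub> f) w T =
      (if num_propagating w = ?m then \<Sum>(x, v)\<in>?S. a x * \<delta> ^ num_removed x v * f v T else 0)"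
    by (simp add: cell_tensor_def)
  show "(a \<odot>\<^bsub>cell_tensor n \<delta> lam\<^esub> f) w T =
      (if w \<in> ?H then \<Sum>v\<in>?H. coefficient n \<delta> a v w * f v T else 0)"
  proof (cases "w \<in> ?H")
    case True
    then have "num_propagating w = ?m" by (simp add: half_diagrams_def)
    moreover have "(\<Sum>(x, v)\<in>?S. a x * \<delta> ^ num_removed x v * f v T) =
        (\<Sum>v\<in>?H. \<Sum>x\<in>{x \<in> diagrams n. concat_diagram x v = w}. a x * \<delta> ^ num_removed x v * f v T)"
      by (subst sum.Sigma) (auto intro!: sum.reindex_bij_witness[where i = prod.swap and j = prod.swap])
    ultimately show ?thesis unfolding sm using True by (simp add: coefficient_def sum_distrib_right)
  next
    case False
    have "?S = {}" if "num_propagating w = ?m"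
    proof -
      have "concat_diagram x v \<noteq> w" if "x \<in> diagrams n" "v \<in> ?H" for x v
        using concat_half_diagram[OF that] False \<open>num_propagating w = ?m\<close> by metis
      then show ?thesis by blast
    qed
    then show ?thesis
      unfolding sm using False by (cases "num_propagating w = ?m") (simp_all only: if_False if_True sum.empty simp_thms)
  qed
qed

lemma cell_tensor_smult_linear:
  "(\<lambda>d. \<alpha> * a d + \<beta> * b d) \<odot>\<^bsub>cell_tensor n \<delta> lam\<^esub> f =
    (\<lambda>v T. \<alpha> * (a \<odot>\<^bsub>cell_tensor n \<delta> lam\<^esub> f) v T + \<beta> * (b \<odot>\<^bsub>cell_tensor n \<delta> lam\<^esub> f) v T)"
proof -
  have c: "coefficient n \<delta> (\<lambda>d. \<alpha> * a d + \<beta> * b d) v w = \<alpha> * coefficient n \<delta> a v w + \<beta> * coefficient n \<delta> b v w" for v w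
    by (simp add: coefficient_def sum_distrib_left sum.distrib algebra_simps)
  show ?thesis
    by (intro ext) (simp add: cell_tensor_smult c sum_distrib_left sum.distrib algebra_simps)
qed

lemma coefficient_id:
  assumes v: "v \<in> diagrams n"
  shows "coefficient n \<delta> (\<lambda>d. if d = id_diagram n then c else 0) v w = (if v = w then c else 0)"
proof -
  have "coefficient n \<delta> (\<lambda>d. if d = id_diagram n then c else 0) v w =
      (\<Sum>e\<in>{e \<in> diagrams n. concat_diagram e v = w}. if e = id_diagram n then c * \<delta> ^ num_removed e v else 0)"
    unfolding coefficient_def by (intro sum.cong refl) simp
  also have "\<dots> = (if id_diagram n \<in> {e \<in> diagrams n. concat_diagram e v = w} then c * \<delta> ^ num_removed (id_diagram n) v else 0)"
    by (rule sum.delta) simp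
  also have "\<dots> = (if v = w then c else 0)"
    by (simp only: concat_id_diagram[OF v] mem_Collect_eq id_diagram_in simp_thms power_0 mult_1_right)
  finally show ?thesis .
qed

text \<open>Field scalars act through multiples of the identity diagram, so submodules are subspaces
  although the module record knows only the algebra.\<close>

lemma cell_tensor_smult_id:
  assumes f: "f \<in> carrier (cell_tensor n \<delta> lam)"
  shows "(\<lambda>d. if d = id_diagram n then c else 0) \<odot>\<^bsub>cell_tensor n \<delta> lam\<^esub> f = (\<lambda>v T. c * f v T)"
proof (intro ext)
  fix w T
  let ?H = "half_diagrams n (sum_list lam)"
  show "((\<lambda>d. if d = id_diagram n then c else 0) \<odot>\<^bsub>cell_tensor n \<delta> lam\<^esub> f) w T = c * f w T"
  proof (cases "w \<in> ?H")
    case True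
    have "(\<Sum>v\<in>?H. coefficient n \<delta> (\<lambda>d. if d = id_diagram n then c else 0) v w * f v T) =
        (\<Sum>v\<in>?H. if v = w then c * f w T else 0)"
      using half_diagramsD(1) by (intro sum.cong refl) (auto simp: coefficient_id)
    then show ?thesis using True by (simp add: cell_tensor_smult)
  next
    case False
    then show ?thesis using f by (simp add: cell_tensor_smult cell_tensor_simps)
  qed
qed

section \<open>The balancing relations and their stability under the algebra\<close>

lemma balancing_closed:
  fixes f g :: "diagram \<Rightarrow> tabloid \<Rightarrow> 'k::field"
  shows "(\<lambda>v T. 0) \<in> (balancing_relations n lam :: (diagram \<Rightarrow> tabloid \<Rightarrow> 'k) set)"
    and "f \<in> balancing_relations n lam \<Longrightarrow> g \<in> balancing_relations n lam \<Longrightarrow>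
      (\<lambda>v T. f v T + g v T) \<in> balancing_relations n lam"
    and "f \<in> balancing_relations n lam \<Longrightarrow> (\<lambda>v T. c * f v T) \<in> balancing_relations n lam"
    and "v \<in> half_diagrams n (sum_list lam) \<Longrightarrow> \<sigma> permutes {1..sum_list lam} \<Longrightarrow> s \<in> specht lam \<Longrightarrow>
      (\<lambda>w T. pure_tensor (perm_half_diagram n (sum_list lam) v \<sigma>) s w T - pure_tensor v (perm_specht \<sigma> s) w T)
        \<in> (balancing_relations n lam :: (diagram \<Rightarrow> tabloid \<Rightarrow> 'k) set)"
proof -
  interpret vs: vector_space "\<lambda>c (f :: diagram \<Rightarrow> tabloid \<Rightarrow> 'k) v x. c * f v x" by (rule vector_space_fun2)
  show "(\<lambda>v T. 0) \<in> (balancing_relations n lam :: (diagram \<Rightarrow> tabloid \<Rightarrow> 'k) set)"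
    unfolding balancing_relations_def using vs.span_zero by (simp add: zero_fun_def)
  show "f \<in> balancing_relations n lam \<Longrightarrow> g \<in> balancing_relations n lam \<Longrightarrow>
      (\<lambda>v T. f v T + g v T) \<in> balancing_relations n lam"
    unfolding balancing_relations_def using vs.span_add[of f _ g] by (simp add: plus_fun_def)
  show "f \<in> balancing_relations n lam \<Longrightarrow> (\<lambda>v T. c * f v T) \<in> balancing_relations n lam"
    unfolding balancing_relations_def by (rule vs.span_scale)
  assume a: "v \<in> half_diagrams n (sum_list lam)" "\<sigma> permutes {1..sum_list lam}" "s \<in> specht lam"
  have "pure_tensor (perm_half_diagram n (sum_list lam) v \<sigma>) s - pure_tensor v (perm_specht \<sigma> s) \<in> balancing_relations n lam"
    unfolding balancing_relations_def by (rule vs.span_base) (use a in blast)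
  then show "(\<lambda>w T. pure_tensor (perm_half_diagram n (sum_list lam) v \<sigma>) s w T - pure_tensor v (perm_specht \<sigma> s) w T)
        \<in> balancing_relations n lam"
    by (simp add: fun_diff_def)
qed

lemma balancing_sum:
  fixes f :: "'i \<Rightarrow> diagram \<Rightarrow> tabloid \<Rightarrow> 'k::field"
  shows "(\<And>i. i \<in> I \<Longrightarrow> f i \<in> balancing_relations n lam) \<Longrightarrow>
    (\<lambda>v T. \<Sum>i\<in>I. f i v T) \<in> balancing_relations n lam"
  by (induction I rule: infinite_finite_induct) (simp_all add: balancing_closed(1,2))

lemma balancing_induct:
  fixes f :: "diagram \<Rightarrow> tabloid \<Rightarrow> 'k::field"
  assumes f: "f \<in> balancing_relations n lam"
    and zero: "P (\<lambda>v T. 0)" and add: "\<And>f g. P f \<Longrightarrow> P g \<Longrightarrow> P (\<lambda>v T. f v T + g v T)"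
    and scale: "\<And>c f. P f \<Longrightarrow> P (\<lambda>v T. c * f v T)"
    and base: "\<And>v \<sigma> s. v \<in> half_diagrams n (sum_list lam) \<Longrightarrow> \<sigma> permutes {1..sum_list lam} \<Longrightarrow> s \<in> specht lam \<Longrightarrow>
      P (\<lambda>w T. pure_tensor (perm_half_diagram n (sum_list lam) v \<sigma>) s w T - pure_tensor v (perm_specht \<sigma> s) w T)"
  shows "P f"
proof -
  interpret vs: vector_space "\<lambda>c (f :: diagram \<Rightarrow> tabloid \<Rightarrow> 'k) v x. c * f v x" by (rule vector_space_fun2)
  have "vs.subspace (Collect P)"
    unfolding vs.subspace_def using zero add scale by (auto simp: zero_fun_def plus_fun_def)
  then have "balancing_relations n lam \<subseteq> Collect P"
    unfolding balancing_relations_def using base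
    by (intro vs.span_minimal) (auto simp: fun_diff_def)
  then show ?thesis using f by auto
qed

lemma cell_tensor_smult_pure:
  assumes v: "v \<in> half_diagrams n (sum_list lam)"
  shows "a \<odot>\<^bsub>cell_tensor n \<delta> lam\<^esub> pure_tensor v s =
    (\<lambda>w T. \<Sum>e\<in>{e \<in> diagrams n. concat_diagram e v \<in> half_diagrams n (sum_list lam)}.
      a e * \<delta> ^ num_removed e v * pure_tensor (concat_diagram e v) s w T)"
proof (intro ext)
  fix w T
  let ?H = "half_diagrams n (sum_list lam)"
  let ?D = "{e \<in> diagrams n. concat_diagram e v \<in> ?H}"
  show "(a \<odot>\<^bsub>cell_tensor n \<delta> lam\<^esub> pure_tensor v s) w T =
      (\<Sum>e\<in>?D. a e * \<delta> ^ num_removed e v * pure_tensor (concat_diagram e v) s w T)"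
  proof (cases "w \<in> ?H")
    case True
    have "(\<Sum>u\<in>?H. coefficient n \<delta> a u w * pure_tensor v s u T) =
        (\<Sum>u\<in>?H. if u = v then coefficient n \<delta> a v w * s T else 0)"
      by (intro sum.cong refl) (simp add: pure_tensor_def)
    also have "\<dots> = coefficient n \<delta> a v w * s T" using v by simp
    also have "\<dots> = (\<Sum>e\<in>{e \<in> diagrams n. concat_diagram e v = w}. a e * \<delta> ^ num_removed e v * s T)"
      by (simp add: coefficient_def sum_distrib_right)
    also have "\<dots> = (\<Sum>e\<in>?D. a e * \<delta> ^ num_removed e v * pure_tensor (concat_diagram e v) s w T)"
      using True by (intro sum.mono_neutral_cong_left) (auto simp: pure_tensor_def)
    finally show ?thesis using True by (simp add: cell_tensor_smult)
  next
    case False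
    then have "pure_tensor (concat_diagram e v) s w T = 0" if "e \<in> ?D" for e
      using that by (auto simp: pure_tensor_def)
    then have "(\<Sum>e\<in>?D. a e * \<delta> ^ num_removed e v * pure_tensor (concat_diagram e v) s w T) = 0"
      by (intro sum.neutral ballI) simp
    then show ?thesis using False by (simp add: cell_tensor_smult)
  qed
qed

lemma cell_tensor_smult_add:
  "a \<odot>\<^bsub>cell_tensor n \<delta> lam\<^esub> (\<lambda>v T. f v T + g v T) =
    (\<lambda>v T. (a \<odot>\<^bsub>cell_tensor n \<delta> lam\<^esub> f) v T + (a \<odot>\<^bsub>cell_tensor n \<delta> lam\<^esub> g) v T)"
  by (intro ext) (simp add: cell_tensor_smult sum.distrib distrib_left)

lemma cell_tensor_smult_scale:
  "a \<odot>\<^bsub>cell_tensor n \<delta> lam\<^esub> (\<lambda>v T. c * f v T) = (\<lambda>v T. c * (a \<odot>\<^bsub>cell_tensor n \<delta> lam\<^esub> f) v T)"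
  by (intro ext) (simp add: cell_tensor_smult sum_distrib_left mult.left_commute)

lemma cell_tensor_smult_diff:
  "a \<odot>\<^bsub>cell_tensor n \<delta> lam\<^esub> (\<lambda>v T. f v T - g v T) =
    (\<lambda>v T. (a \<odot>\<^bsub>cell_tensor n \<delta> lam\<^esub> f) v T - (a \<odot>\<^bsub>cell_tensor n \<delta> lam\<^esub> g) v T)"
  by (intro ext) (simp add: cell_tensor_smult sum_subtractf right_diff_distrib)

text \<open>Concatenation from above commutes with the right action, including the number of removed
  components, so a generator goes to a combination of generators.\<close>

lemma smult_balancing:
  fixes f :: "diagram \<Rightarrow> tabloid \<Rightarrow> 'k::field"
  assumes m: "sum_list lam \<le> n" and f: "f \<in> balancing_relations n lam"
  shows "a \<odot>\<^bsub>cell_tensor n \<delta> lam\<^esub> f \<in> balancing_relations n lam"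
  using f
proof (rule balancing_induct)
  show "a \<odot>\<^bsub>cell_tensor n \<delta> lam\<^esub> (\<lambda>v T. 0) \<in> balancing_relations n lam"
    by (simp add: cell_tensor_smult balancing_closed(1) cong: if_cong)
next
  fix f g :: "diagram \<Rightarrow> tabloid \<Rightarrow> 'k"
  assume "a \<odot>\<^bsub>cell_tensor n \<delta> lam\<^esub> f \<in> balancing_relations n lam" "a \<odot>\<^bsub>cell_tensor n \<delta> lam\<^esub> g \<in> balancing_relations n lam"
  then show "a \<odot>\<^bsub>cell_tensor n \<delta> lam\<^esub> (\<lambda>v T. f v T + g v T) \<in> balancing_relations n lam"
    unfolding cell_tensor_smult_add by (rule balancing_closed(2))
next
  fix c and f :: "diagram \<Rightarrow> tabloid \<Rightarrow> 'k"
  assume "a \<odot>\<^bsub>cell_tensor n \<delta> lam\<^esub> f \<in> balancing_relations n lam"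
  then show "a \<odot>\<^bsub>cell_tensor n \<delta> lam\<^esub> (\<lambda>v T. c * f v T) \<in> balancing_relations n lam"
    unfolding cell_tensor_smult_scale by (rule balancing_closed(3))
next
  fix v \<sigma> and s :: "tabloid \<Rightarrow> 'k"
  let ?m = "sum_list lam"
  let ?H = "half_diagrams n ?m"
  let ?p = "\<lambda>v. perm_half_diagram n ?m v \<sigma>"
  assume v: "v \<in> ?H" and \<sigma>: "\<sigma> permutes {1..?m}" and s: "s \<in> specht lam"
  note vd = half_diagramsD(1)[OF v]
  have iff: "concat_diagram e (?p v) \<in> ?H \<longleftrightarrow> concat_diagram e v \<in> ?H" if e: "e \<in> diagrams n" for e
  proof -
    have "concat_diagram e (?p v) \<in> ?H \<longleftrightarrow> num_propagating (concat_diagram e (?p v)) = ?m"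
      by (rule concat_half_diagram[OF e perm_half_diagram_in[OF v \<sigma> m]])
    then show ?thesis
      unfolding concat_half_diagram[OF e v] concat_perm_half_diagram(1)[OF e vd \<sigma> m]
        num_propagating_perm_half_diagram[OF \<sigma> m] .
  qed
  let ?D = "{e \<in> diagrams n. concat_diagram e v \<in> ?H}"
  have D: "{e \<in> diagrams n. concat_diagram e (?p v) \<in> ?H} = ?D" using iff by blast
  have "a \<odot>\<^bsub>cell_tensor n \<delta> lam\<^esub> (\<lambda>w T. pure_tensor (?p v) s w T - pure_tensor v (perm_specht \<sigma> s) w T) =
      (\<lambda>w T. \<Sum>e\<in>?D. a e * \<delta> ^ num_removed e v *
        (pure_tensor (?p (concat_diagram e v)) s w T - pure_tensor (concat_diagram e v) (perm_specht \<sigma> s) w T))"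
    unfolding cell_tensor_smult_diff cell_tensor_smult_pure[OF v] cell_tensor_smult_pure[OF perm_half_diagram_in[OF v \<sigma> m]] D
      sum_subtractf[symmetric]
    by (intro ext sum.cong refl) (simp add: concat_perm_half_diagram[OF _ vd \<sigma> m] right_diff_distrib)
  also have "\<dots> \<in> balancing_relations n lam"
    by (intro balancing_sum balancing_closed(3) balancing_closed(4)[OF _ \<sigma> s]) simp
  finally show "a \<odot>\<^bsub>cell_tensor n \<delta> lam\<^esub> (\<lambda>w T. pure_tensor (?p v) s w T - pure_tensor v (perm_specht \<sigma> s) w T)
      \<in> balancing_relations n lam" .
qed

lemma balancing_subset:
  assumes lam: "lam \<in> partitions m" and m: "m \<le> n"
  shows "balancing_relations n lam \<subseteq> carrier (cell_tensor n \<delta> lam)"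
proof
  fix f :: "diagram \<Rightarrow> tabloid \<Rightarrow> 'a" assume "f \<in> balancing_relations n lam"
  have sm: "sum_list lam = m" using lam by (simp add: partitions_def)
  from \<open>f \<in> balancing_relations n lam\<close> show "f \<in> carrier (cell_tensor n \<delta> lam)"
  proof (rule balancing_induct)
    fix v \<sigma> and s :: "tabloid \<Rightarrow> 'a"
    assume v: "v \<in> half_diagrams n (sum_list lam)" and \<sigma>: "\<sigma> permutes {1..sum_list lam}" and s: "s \<in> specht lam"
    have p: "perm_half_diagram n m v \<sigma> \<in> half_diagrams n m"
      using perm_half_diagram_in[OF v \<sigma>] m sm by simp
    have s': "(\<lambda>T. - 1 * perm_specht \<sigma> s T) \<in> specht lam" "(\<lambda>T. s T + - 1 * perm_specht \<sigma> s T) \<in> specht lam"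
      using specht_closed(2)[OF s] specht_closed(3) perm_specht_in[OF lam s] \<sigma> sm by blast+
    show "(\<lambda>w T. pure_tensor (perm_half_diagram n (sum_list lam) v \<sigma>) s w T - pure_tensor v (perm_specht \<sigma> s) w T)
        \<in> carrier (cell_tensor n \<delta> lam)"
      unfolding cell_tensor_simps sm
    proof (intro CollectI conjI ballI allI impI)
      fix w
      show "(\<lambda>T. pure_tensor (perm_half_diagram n m v \<sigma>) s w T - pure_tensor v (perm_specht \<sigma> s) w T) \<in> specht lam"
        using s' s specht_closed(1)
        by (cases "w = perm_half_diagram n m v \<sigma>"; cases "w = v") (simp_all add: pure_tensor_def)
    qed (use p v sm in \<open>auto simp: pure_tensor_def\<close>)
  qed (auto simp: cell_tensor_simps specht_closed)
qed

text \<open>On half diagrams, \<open>z\<close> acts as a multiple of the sum of all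
  \<open>(T0 - 1) ^ cyc \<pi>\<close> times the right action of \<open>\<pi>\<close>. The balancing
  relations move this sum to the Specht module, where it is the scalar
  \<open>content_product lam (T0 - 1)\<close>.\<close>

lemma scalar_element_acts:
  fixes T0 \<delta> :: "'k::field"
  obtains z :: "diagram \<Rightarrow> 'k" where "z \<in> carrier (partition_algebra n \<delta>)"
    "\<And>lam m f. lam \<in> partitions m \<Longrightarrow> m \<le> n \<Longrightarrow> f \<in> carrier (cell_tensor n \<delta> lam) \<Longrightarrow>
      (\<lambda>v T. (z \<odot>\<^bsub>cell_tensor n \<delta> lam\<^esub> f) v T -
        (\<Prod>j\<in>{m<..n}. T0 + \<delta> - of_nat j) * content_product lam (T0 - 1) * f v T) \<in> balancing_relations n lam"
proof -
  obtain z :: "diagram \<Rightarrow> 'k" where z0: "\<forall>d. d \<notin> diagrams n \<longrightarrow> z d = 0"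
    and z: "\<forall>m v w. m \<le> n \<longrightarrow> v \<in> half_diagrams n m \<longrightarrow> w \<in> half_diagrams n m \<longrightarrow>
      (\<Sum>e\<in>{e \<in> diagrams n. concat_diagram e v = w}. z e * \<delta> ^ num_removed e v) =
      (\<Prod>j\<in>{m<..n}. T0 + \<delta> - of_nat j) *
      (\<Sum>\<pi>\<in>{\<pi>. \<pi> permutes {1..m} \<and> perm_half_diagram n m v \<pi> = w}.
        (T0 - 1) ^ cyc (perm_graph {1..m} (inv_into UNIV \<pi>)))"
    using exists_scalar_element[of n \<delta> T0] by blast
  note z = z[rule_format]
  show ?thesis
  proof (rule that)
    show "z \<in> carrier (partition_algebra n \<delta>)" using z0 by (simp add: partition_algebra_def)
    fix lam m and f :: "diagram \<Rightarrow> tabloid \<Rightarrow> 'k"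
    assume lam: "lam \<in> partitions m" and m: "m \<le> n" and f: "f \<in> carrier (cell_tensor n \<delta> lam)"
    let ?H = "half_diagrams n m" and ?S = "{\<pi>. \<pi> permutes {1..m}}"
    let ?U = "T0 - 1" and ?D = "\<Prod>j\<in>{m<..n}. T0 + \<delta> - of_nat j"
    let ?c = "\<lambda>\<pi>. cyc (perm_graph {1..m} \<pi>)"
    have sm: "sum_list lam = m" using lam by (simp add: partitions_def)
    have finS: "finite ?S" by (rule finite_permutations) simp
    have fs: "f v \<in> specht lam" if "v \<in> ?H" for v using f that by (simp add: cell_tensor_simps sm)
    have zf: "(z \<odot>\<^bsub>cell_tensor n \<delta> lam\<^esub> f) w T =
        (\<Sum>v\<in>?H. \<Sum>\<pi>\<in>?S. ?D * ?U ^ ?c \<pi> * pure_tensor (perm_half_diagram n m v \<pi>) (f v) w T)" for w T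
    proof (cases "w \<in> ?H")
      case True
      have "(z \<odot>\<^bsub>cell_tensor n \<delta> lam\<^esub> f) w T = (\<Sum>v\<in>?H. coefficient n \<delta> z v w * f v T)"
        using True by (simp add: cell_tensor_smult sm)
      also have "\<dots> = (\<Sum>v\<in>?H. \<Sum>\<pi>\<in>?S. ?D * ?U ^ ?c \<pi> * pure_tensor (perm_half_diagram n m v \<pi>) (f v) w T)"
      proof (rule sum.cong[OF refl])
        fix v assume v: "v \<in> ?H"
        have "coefficient n \<delta> z v w * f v T =
            (\<Sum>\<pi>\<in>{\<pi>. \<pi> permutes {1..m} \<and> perm_half_diagram n m v \<pi> = w}. ?D * ?U ^ ?c (inv_into UNIV \<pi>) * f v T)"
          unfolding coefficient_def z[OF m v True] by (simp add: sum_distrib_left sum_distrib_right)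
        also have "\<dots> = (\<Sum>\<pi>\<in>?S. ?D * ?U ^ ?c \<pi> * pure_tensor (perm_half_diagram n m v \<pi>) (f v) w T)"
          using finS by (intro sum.mono_neutral_cong_left) (auto simp: pure_tensor_def cyc_perm_graph_inv)
        finally show "coefficient n \<delta> z v w * f v T = \<dots>" .
      qed
      finally show ?thesis .
    next
      case False
      then have "pure_tensor (perm_half_diagram n m v \<pi>) (f v) w T = 0" if "v \<in> ?H" "\<pi> \<in> ?S" for v \<pi>
        using perm_half_diagram_in[OF that(1) _ m, of \<pi>] that by (auto simp: pure_tensor_def)
      then have "(\<Sum>v\<in>?H. \<Sum>\<pi>\<in>?S. ?D * ?U ^ ?c \<pi> * pure_tensor (perm_half_diagram n m v \<pi>) (f v) w T) = 0"
        by (intro sum.neutral ballI) simp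
      then show ?thesis using False by (simp add: cell_tensor_smult sm)
    qed
    have cf: "?D * content_product lam ?U * f w T =
        (\<Sum>v\<in>?H. \<Sum>\<pi>\<in>?S. ?D * ?U ^ ?c \<pi> * pure_tensor v (perm_specht \<pi> (f v)) w T)" for w T
    proof -
      have "(\<Sum>v\<in>?H. \<Sum>\<pi>\<in>?S. ?D * ?U ^ ?c \<pi> * pure_tensor v (perm_specht \<pi> (f v)) w T) =
          (\<Sum>v\<in>?H. if v = w then ?D * (\<Sum>\<pi>\<in>?S. ?U ^ ?c \<pi> * perm_specht \<pi> (f v) T) else 0)"
        by (intro sum.cong refl) (auto simp: pure_tensor_def sum_distrib_left mult.assoc)
      also have "\<dots> = (\<Sum>v\<in>?H. if v = w then ?D * (content_product lam ?U * f w T) else 0)"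
        using specht_scalar[OF lam fs] by (intro sum.cong refl) auto
      also have "\<dots> = ?D * content_product lam ?U * f w T"
        using f by (auto simp: cell_tensor_simps sm mult.assoc)
      finally show ?thesis by simp
    qed
    have "(\<lambda>v T. (z \<odot>\<^bsub>cell_tensor n \<delta> lam\<^esub> f) v T - ?D * content_product lam ?U * f v T) =
        (\<lambda>w T. \<Sum>v\<in>?H. \<Sum>\<pi>\<in>?S. ?D * ?U ^ ?c \<pi> *
          (pure_tensor (perm_half_diagram n m v \<pi>) (f v) w T - pure_tensor v (perm_specht \<pi> (f v)) w T))"
      unfolding zf cf by (simp add: right_diff_distrib sum_subtractf)
    also have "\<dots> \<in> balancing_relations n lam"
    proof (intro balancing_sum balancing_closed(3))
      fix v \<pi> assume "v \<in> ?H" "\<pi> \<in> ?S"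
      then show "(\<lambda>w T. pure_tensor (perm_half_diagram n m v \<pi>) (f v) w T - pure_tensor v (perm_specht \<pi> (f v)) w T)
          \<in> balancing_relations n lam"
        using fs by (intro balancing_closed(4)[of _ n lam, unfolded sm]) simp_all
    qed
    finally show "(\<lambda>v T. (z \<odot>\<^bsub>cell_tensor n \<delta> lam\<^esub> f) v T - ?D * content_product lam ?U * f v T)
        \<in> balancing_relations n lam" .
  qed
qed

section \<open>Composition series\<close>

text \<open>A group with operators: each ring element acts as an endomorphism of the additive group.
  Submodules, quotients and simplicity depend on this structure alone.\<close>

definition lmodule :: "('a, 'c) ring_scheme \<Rightarrow> ('a, 'b) module \<Rightarrow> bool" where
  "lmodule R M \<longleftrightarrow> abelian_group M \<and>
     (\<forall>a\<in>carrier R. \<forall>x\<in>carrier M. a \<odot>\<^bsub>M\<^esub> x \<in> carrier M) \<and>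
     (\<forall>a\<in>carrier R. \<forall>x\<in>carrier M. \<forall>y\<in>carrier M. a \<odot>\<^bsub>M\<^esub> (x \<oplus>\<^bsub>M\<^esub> y) = a \<odot>\<^bsub>M\<^esub> x \<oplus>\<^bsub>M\<^esub> a \<odot>\<^bsub>M\<^esub> y)"

lemma submodule_iff:
  "submodule N R M \<longleftrightarrow> subgroup N (add_monoid M) \<and> (\<forall>a\<in>carrier R. \<forall>x\<in>N. a \<odot>\<^bsub>M\<^esub> x \<in> N)"
  by (auto simp: submodule_def submodule_axioms_def)

lemma lmoduleD:
  assumes "lmodule R M"
  shows "abelian_group M"
    "a \<in> carrier R \<Longrightarrow> x \<in> carrier M \<Longrightarrow> a \<odot>\<^bsub>M\<^esub> x \<in> carrier M"
    "a \<in> carrier R \<Longrightarrow> x \<in> carrier M \<Longrightarrow> y \<in> carrier M \<Longrightarrow>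
      a \<odot>\<^bsub>M\<^esub> (x \<oplus>\<^bsub>M\<^esub> y) = a \<odot>\<^bsub>M\<^esub> x \<oplus>\<^bsub>M\<^esub> a \<odot>\<^bsub>M\<^esub> y"
  using assms by (simp_all add: lmodule_def)

lemma submodule_abelian_subgroup:
  assumes "lmodule R M" "submodule N R M"
  shows "abelian_subgroup N M"
  using assms by (intro abelian_subgroupI3 additive_subgroupI lmoduleD(1)) (simp_all add: submodule_iff)

lemma submoduleD:
  assumes "submodule N R M"
  shows "N \<subseteq> carrier M" "\<zero>\<^bsub>M\<^esub> \<in> N" "x \<in> N \<Longrightarrow> y \<in> N \<Longrightarrow> x \<oplus>\<^bsub>M\<^esub> y \<in> N"
    "a \<in> carrier R \<Longrightarrow> x \<in> N \<Longrightarrow> a \<odot>\<^bsub>M\<^esub> x \<in> N" "subgroup N (add_monoid M)"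
proof -
  show s: "subgroup N (add_monoid M)" and "a \<in> carrier R \<Longrightarrow> x \<in> N \<Longrightarrow> a \<odot>\<^bsub>M\<^esub> x \<in> N"
    using assms by (auto simp: submodule_iff)
  show "N \<subseteq> carrier M" "\<zero>\<^bsub>M\<^esub> \<in> N" "x \<in> N \<Longrightarrow> y \<in> N \<Longrightarrow> x \<oplus>\<^bsub>M\<^esub> y \<in> N"
    using subgroup.subset[OF s] subgroup.one_closed[OF s] subgroup.m_closed[OF s] by simp_all
qed

lemma submoduleI:
  assumes M: "lmodule R M" and "N \<subseteq> carrier M" "\<zero>\<^bsub>M\<^esub> \<in> N"
    and "\<And>x y. x \<in> N \<Longrightarrow> y \<in> N \<Longrightarrow> x \<oplus>\<^bsub>M\<^esub> y \<in> N" "\<And>x. x \<in> N \<Longrightarrow> \<ominus>\<^bsub>M\<^esub> x \<in> N"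
    and "\<And>a x. a \<in> carrier R \<Longrightarrow> x \<in> N \<Longrightarrow> a \<odot>\<^bsub>M\<^esub> x \<in> N"
  shows "submodule N R M"
proof -
  have "subgroup N (add_monoid M)"
  proof
    show "inv\<^bsub>add_monoid M\<^esub> x \<in> N" if "x \<in> N" for x using assms(5)[OF that] by (simp add: a_inv_def)
  qed (use assms in auto)
  then show ?thesis using assms(6) by (simp add: submodule_iff)
qed

lemma submodule_minus_closed: "submodule N R M \<Longrightarrow> x \<in> N \<Longrightarrow> \<ominus>\<^bsub>M\<^esub> x \<in> N"
  using subgroup.m_inv_closed[OF submoduleD(5)] by (simp add: a_inv_def)

lemma lmodule_restrict:
  assumes M: "lmodule R M" and N: "submodule N R M"
  shows "lmodule R (M\<lparr>carrier := N\<rparr>)"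
proof -
  interpret abelian_group M by (rule lmoduleD(1)[OF M])
  have sub: "N \<subseteq> carrier M" by (rule submoduleD(1)[OF N])
  have "abelian_group (M\<lparr>carrier := N\<rparr>)"
  proof (rule abelian_groupI)
    fix x assume "x \<in> carrier (M\<lparr>carrier := N\<rparr>)"
    then have x: "x \<in> N" by simp
    then show "\<exists>y\<in>carrier (M\<lparr>carrier := N\<rparr>). y \<oplus>\<^bsub>M\<lparr>carrier := N\<rparr>\<^esub> x = \<zero>\<^bsub>M\<lparr>carrier := N\<rparr>\<^esub>"
      using submodule_minus_closed[OF N x] sub by (intro bexI[of _ "\<ominus>\<^bsub>M\<^esub> x"]) (auto simp: l_neg)
  qed (use submoduleD(2,3)[OF N] sub in \<open>auto simp: a_ac subset_iff\<close>)
  then show ?thesis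
    using submoduleD(4)[OF N] lmoduleD(3)[OF M] sub by (simp add: lmodule_def subset_iff)
qed

lemma submodule_restrict_iff:
  assumes M: "lmodule R M" and N: "submodule N R M" and U: "U \<subseteq> N"
  shows "submodule U R (M\<lparr>carrier := N\<rparr>) \<longleftrightarrow> submodule U R M"
proof
  interpret M: abelian_group M by (rule lmoduleD(1)[OF M])
  let ?N = "M\<lparr>carrier := N\<rparr>"
  interpret N: abelian_group ?N by (rule lmoduleD(1)[OF lmodule_restrict[OF M N]])
  \<comment> \<open>The additive inverse is defined by a choice inside the carrier, so it has to be
    shown not to change when the carrier shrinks.\<close>
  have minus: "\<ominus>\<^bsub>?N\<^esub> x = \<ominus>\<^bsub>M\<^esub> x" if "x \<in> N" for x
  proof -
    have "\<ominus>\<^bsub>?N\<^esub> x \<in> N" "\<ominus>\<^bsub>?N\<^esub> x \<oplus>\<^bsub>M\<^esub> x = \<zero>\<^bsub>M\<^esub>"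
      using N.a_inv_closed[of x] N.l_neg[of x] that by simp_all
    moreover from this have "x \<in> carrier M" "\<ominus>\<^bsub>?N\<^esub> x \<in> carrier M"
      using submoduleD(1)[OF N] that by blast+
    ultimately show ?thesis using M.minus_equality[of "\<ominus>\<^bsub>?N\<^esub> x" x] by simp
  qed
  {
    assume s: "submodule U R ?N"
    show "submodule U R M"
    proof (rule submoduleI[OF M])
      show "U \<subseteq> carrier M" using U submoduleD(1)[OF N] by simp
      show "\<ominus>\<^bsub>M\<^esub> x \<in> U" if "x \<in> U" for x
        using submodule_minus_closed[OF s that] minus[of x] U that by auto
    qed (use submoduleD[OF s] in auto)
  }
  {
    assume s: "submodule U R M"
    show "submodule U R ?N"
    proof (rule submoduleI[OF lmodule_restrict[OF M N]])
      show "U \<subseteq> carrier ?N" using U by simp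
      show "\<ominus>\<^bsub>?N\<^esub> x \<in> U" if "x \<in> U" for x
        using submodule_minus_closed[OF s that] minus[of x] U that by auto
    qed (use submoduleD[OF s] in auto)
  }
qed

section \<open>Quotient modules and the correspondence of submodules\<close>

lemma quot_module_simps:
  "carrier (quot_module M N) = a_rcosets\<^bsub>M\<^esub> N" "\<zero>\<^bsub>quot_module M N\<^esub> = N"
  "x \<oplus>\<^bsub>quot_module M N\<^esub> y = set_add M x y"
  "a \<odot>\<^bsub>quot_module M N\<^esub> X = (\<Union>x\<in>X. N +>\<^bsub>M\<^esub> (a \<odot>\<^bsub>M\<^esub> x))"
  by (simp_all add: quot_module_def)

lemma quot_moduleE:
  assumes "X \<in> carrier (quot_module M N)"
  obtains x where "x \<in> carrier M" "X = N +>\<^bsub>M\<^esub> x"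
  using assms unfolding quot_module_simps A_RCOSETS_def' by blast

lemma mem_coset_iff: "y \<in> N +>\<^bsub>M\<^esub> x \<longleftrightarrow> (\<exists>h\<in>N. y = h \<oplus>\<^bsub>M\<^esub> x)"
  by (auto simp: a_r_coset_def')

lemma coset_in_quot_module:
  "x \<in> carrier M \<Longrightarrow> N +>\<^bsub>M\<^esub> x \<in> carrier (quot_module M N)"
  unfolding quot_module_simps A_RCOSETS_def' by blast

lemma quot_module_coset_eq:
  assumes M: "lmodule R M" and N: "submodule N R M"
    and X: "X \<in> carrier (quot_module M N)" and x: "x \<in> X"
  shows "x \<in> carrier M" "X = N +>\<^bsub>M\<^esub> x"
proof -
  interpret abelian_subgroup N M by (rule submodule_abelian_subgroup[OF M N])
  obtain y where y: "y \<in> carrier M" "X = N +>\<^bsub>M\<^esub> y" using X by (rule quot_moduleE)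
  then show "x \<in> carrier M" using x submoduleD(1)[OF N] by (auto simp: mem_coset_iff)
  show "X = N +>\<^bsub>M\<^esub> x" using a_repr_independence[of x N y] y x submoduleD(5)[OF N] by simp
qed

lemma quot_module_smult:
  assumes M: "lmodule R M" and N: "submodule N R M" and a: "a \<in> carrier R" and x: "x \<in> carrier M"
  shows "a \<odot>\<^bsub>quot_module M N\<^esub> (N +>\<^bsub>M\<^esub> x) = N +>\<^bsub>M\<^esub> (a \<odot>\<^bsub>M\<^esub> x)"
proof -
  interpret abelian_subgroup N M by (rule submodule_abelian_subgroup[OF M N])
  have eq: "N +>\<^bsub>M\<^esub> (a \<odot>\<^bsub>M\<^esub> y) = N +>\<^bsub>M\<^esub> (a \<odot>\<^bsub>M\<^esub> x)" if y: "y \<in> N +>\<^bsub>M\<^esub> x" for y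
  proof -
    obtain h where h: "h \<in> N" "y = h \<oplus>\<^bsub>M\<^esub> x" using y by (auto simp: mem_coset_iff)
    then have "a \<odot>\<^bsub>M\<^esub> y = a \<odot>\<^bsub>M\<^esub> h \<oplus>\<^bsub>M\<^esub> a \<odot>\<^bsub>M\<^esub> x"
      using lmoduleD(3)[OF M a _ x] submoduleD(1)[OF N] by auto
    then have "a \<odot>\<^bsub>M\<^esub> y \<in> N +>\<^bsub>M\<^esub> (a \<odot>\<^bsub>M\<^esub> x)"
      using submoduleD(4)[OF N a h(1)] by (auto simp: mem_coset_iff)
    then show ?thesis
      using a_repr_independence[of "a \<odot>\<^bsub>M\<^esub> y" N "a \<odot>\<^bsub>M\<^esub> x"] lmoduleD(2)[OF M a x] submoduleD(5)[OF N] by simp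
  qed
  have "x \<in> N +>\<^bsub>M\<^esub> x" by (rule a_rcos_self[OF x])
  then show ?thesis unfolding quot_module_simps using eq by blast
qed

lemma lmodule_quot_module:
  assumes M: "lmodule R M" and N: "submodule N R M"
  shows "lmodule R (quot_module M N)"
proof -
  interpret abelian_subgroup N M by (rule submodule_abelian_subgroup[OF M N])
  let ?Q = "quot_module M N"
  have sum: "(N +>\<^bsub>M\<^esub> u) \<oplus>\<^bsub>?Q\<^esub> (N +>\<^bsub>M\<^esub> v) = N +>\<^bsub>M\<^esub> (u \<oplus>\<^bsub>M\<^esub> v)"
    if "u \<in> carrier M" "v \<in> carrier M" for u v
    unfolding quot_module_simps using that by (rule a_rcos_sum)
  have zero: "\<zero>\<^bsub>?Q\<^esub> = N +>\<^bsub>M\<^esub> \<zero>\<^bsub>M\<^esub>"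
    using a_coset_join2[OF zero_closed submoduleD(5)[OF N] submoduleD(2)[OF N]] by (simp add: quot_module_simps)
  have ab: "abelian_group ?Q"
  proof (rule abelian_groupI)
    show "\<zero>\<^bsub>?Q\<^esub> \<in> carrier ?Q" unfolding zero by (rule coset_in_quot_module[OF zero_closed])
    fix X assume "X \<in> carrier ?Q"
    then obtain x where x: "x \<in> carrier M" "X = N +>\<^bsub>M\<^esub> x" by (rule quot_moduleE)
    show "\<zero>\<^bsub>?Q\<^esub> \<oplus>\<^bsub>?Q\<^esub> X = X" unfolding zero x(2) using x(1) by (simp add: sum)
    have "(N +>\<^bsub>M\<^esub> \<ominus>\<^bsub>M\<^esub> x) \<oplus>\<^bsub>?Q\<^esub> X = \<zero>\<^bsub>?Q\<^esub>" unfolding zero x(2) using x(1) by (simp add: sum l_neg)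
    then show "\<exists>Y\<in>carrier ?Q. Y \<oplus>\<^bsub>?Q\<^esub> X = \<zero>\<^bsub>?Q\<^esub>"
      using coset_in_quot_module[OF a_inv_closed[OF x(1)]] by blast
    fix Y assume "Y \<in> carrier ?Q"
    then obtain y where y: "y \<in> carrier M" "Y = N +>\<^bsub>M\<^esub> y" by (rule quot_moduleE)
    show "X \<oplus>\<^bsub>?Q\<^esub> Y \<in> carrier ?Q"
      unfolding x(2) y(2) sum[OF x(1) y(1)] by (rule coset_in_quot_module[OF a_closed[OF x(1) y(1)]])
    show "X \<oplus>\<^bsub>?Q\<^esub> Y = Y \<oplus>\<^bsub>?Q\<^esub> X"
      unfolding x(2) y(2) using x(1) y(1) by (simp add: sum a_comm)
    fix Z assume "Z \<in> carrier ?Q"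
    then obtain z where z: "z \<in> carrier M" "Z = N +>\<^bsub>M\<^esub> z" by (rule quot_moduleE)
    show "X \<oplus>\<^bsub>?Q\<^esub> Y \<oplus>\<^bsub>?Q\<^esub> Z = X \<oplus>\<^bsub>?Q\<^esub> (Y \<oplus>\<^bsub>?Q\<^esub> Z)"
      unfolding x(2) y(2) z(2) using x(1) y(1) z(1) by (simp add: sum a_assoc)
  qed
  show ?thesis
    unfolding lmodule_def
  proof (intro conjI ballI ab)
    fix a X assume a: "a \<in> carrier R" and X: "X \<in> carrier ?Q"
    obtain x where x: "x \<in> carrier M" "X = N +>\<^bsub>M\<^esub> x" using X by (rule quot_moduleE)
    show "a \<odot>\<^bsub>?Q\<^esub> X \<in> carrier ?Q"
      unfolding x(2) quot_module_smult[OF M N a x(1)] by (rule coset_in_quot_module[OF lmoduleD(2)[OF M a x(1)]])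
    fix Y assume Y: "Y \<in> carrier ?Q"
    obtain y where y: "y \<in> carrier M" "Y = N +>\<^bsub>M\<^esub> y" using Y by (rule quot_moduleE)
    show "a \<odot>\<^bsub>?Q\<^esub> (X \<oplus>\<^bsub>?Q\<^esub> Y) = a \<odot>\<^bsub>?Q\<^esub> X \<oplus>\<^bsub>?Q\<^esub> a \<odot>\<^bsub>?Q\<^esub> Y"
      unfolding x(2) y(2) sum[OF x(1) y(1)] quot_module_smult[OF M N a a_closed[OF x(1) y(1)]]
        quot_module_smult[OF M N a x(1)] quot_module_smult[OF M N a y(1)]
        sum[OF lmoduleD(2)[OF M a x(1)] lmoduleD(2)[OF M a y(1)]] lmoduleD(3)[OF M a x(1) y(1)] ..
  qed
qed

text \<open>The correspondence theorem: a submodule of the quotient is a set of cosets, and its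
  union is the preimage under the projection.\<close>

lemma Union_submodule_quot_module:
  assumes M: "lmodule R M" and N: "submodule N R M" and S: "submodule S R (quot_module M N)"
  shows "submodule (\<Union>S) R M" "N \<subseteq> \<Union>S" "x \<in> carrier M \<Longrightarrow> N +>\<^bsub>M\<^esub> x \<in> S \<longleftrightarrow> x \<in> \<Union>S"
proof -
  interpret abelian_subgroup N M by (rule submodule_abelian_subgroup[OF M N])
  let ?Q = "quot_module M N"
  have SQ: "S \<subseteq> carrier ?Q" by (rule submoduleD(1)[OF S])
  have X: "x \<in> carrier M" "X = N +>\<^bsub>M\<^esub> x" if "X \<in> S" "x \<in> X" for X x
    using quot_module_coset_eq[OF M N subsetD[OF SQ that(1)] that(2)] by auto
  show iff: "N +>\<^bsub>M\<^esub> x \<in> S \<longleftrightarrow> x \<in> \<Union>S" if "x \<in> carrier M" for x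
  proof
    assume "N +>\<^bsub>M\<^esub> x \<in> S"
    then show "x \<in> \<Union>S" using a_rcos_self[OF that] by blast
  next
    assume "x \<in> \<Union>S"
    then obtain Y where "Y \<in> S" "x \<in> Y" by blast
    with X[OF this] show "N +>\<^bsub>M\<^esub> x \<in> S" by simp
  qed
  have cos: "N +>\<^bsub>M\<^esub> x \<in> S" "x \<in> carrier M" if x: "x \<in> \<Union>S" for x
  proof -
    obtain Y where "Y \<in> S" "x \<in> Y" using x by blast
    with X[OF this] show "N +>\<^bsub>M\<^esub> x \<in> S" "x \<in> carrier M" by simp_all
  qed
  have NS: "N \<in> S" using submoduleD(2)[OF S] by (simp add: quot_module_simps)
  then show "N \<subseteq> \<Union>S" by blast
  have sum: "x \<oplus>\<^bsub>M\<^esub> y \<in> \<Union>S" if x: "x \<in> \<Union>S" and y: "y \<in> \<Union>S" for x y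
  proof -
    have "(N +>\<^bsub>M\<^esub> x) \<oplus>\<^bsub>?Q\<^esub> (N +>\<^bsub>M\<^esub> y) \<in> S" by (rule submoduleD(3)[OF S cos(1)[OF x] cos(1)[OF y]])
    then have "N +>\<^bsub>M\<^esub> (x \<oplus>\<^bsub>M\<^esub> y) \<in> S" using cos(2)[OF x] cos(2)[OF y] by (simp add: quot_module_simps a_rcos_sum)
    then show ?thesis using iff[of "x \<oplus>\<^bsub>M\<^esub> y"] cos(2)[OF x] cos(2)[OF y] by simp
  qed
  show "submodule (\<Union>S) R M"
  proof (rule submoduleI[OF M])
    show "\<Union>S \<subseteq> carrier M" using cos(2) by blast
    show "\<zero>\<^bsub>M\<^esub> \<in> \<Union>S" using NS submoduleD(2)[OF N] by blast
    show "x \<oplus>\<^bsub>M\<^esub> y \<in> \<Union>S" if "x \<in> \<Union>S" "y \<in> \<Union>S" for x y using that by (rule sum)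
    show "a \<odot>\<^bsub>M\<^esub> x \<in> \<Union>S" if a: "a \<in> carrier R" and x: "x \<in> \<Union>S" for a x
    proof -
      have "a \<odot>\<^bsub>?Q\<^esub> (N +>\<^bsub>M\<^esub> x) \<in> S" by (rule submoduleD(4)[OF S a cos(1)[OF x]])
      then have "N +>\<^bsub>M\<^esub> (a \<odot>\<^bsub>M\<^esub> x) \<in> S" by (simp only: quot_module_smult[OF M N a cos(2)[OF x]])
      then show ?thesis using iff[OF lmoduleD(2)[OF M a cos(2)[OF x]]] by simp
    qed
    \<comment> \<open>A representative \<open>y\<close> of the negative coset satisfies
      \<open>x + y \<in> N\<close>, and \<open>- x = - (x + y) + y\<close> is a sum of two elements
      of the union.\<close>
    show "\<ominus>\<^bsub>M\<^esub> x \<in> \<Union>S" if x: "x \<in> \<Union>S" for x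
    proof -
      interpret Q: abelian_group ?Q by (rule lmoduleD(1)[OF lmodule_quot_module[OF M N]])
      let ?X = "N +>\<^bsub>M\<^esub> x"
      have XS: "?X \<in> S" by (rule cos(1)[OF x])
      have Y: "\<ominus>\<^bsub>?Q\<^esub> ?X \<in> S" by (rule submodule_minus_closed[OF S XS])
      then obtain y where y: "y \<in> carrier M" "\<ominus>\<^bsub>?Q\<^esub> ?X = N +>\<^bsub>M\<^esub> y" using SQ by (meson quot_moduleE subsetD)
      have "?X \<oplus>\<^bsub>?Q\<^esub> (N +>\<^bsub>M\<^esub> y) = N"
        using Q.r_neg[OF subsetD[OF SQ XS]] y(2) by (simp add: quot_module_simps)
      then have "N +>\<^bsub>M\<^esub> (x \<oplus>\<^bsub>M\<^esub> y) = N" using cos(2)[OF x] y(1) by (simp add: quot_module_simps a_rcos_sum)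
      then have "x \<oplus>\<^bsub>M\<^esub> y \<in> N" using a_rcos_self[of "x \<oplus>\<^bsub>M\<^esub> y"] cos(2)[OF x] y(1) by simp
      then have "\<ominus>\<^bsub>M\<^esub> (x \<oplus>\<^bsub>M\<^esub> y) \<in> \<Union>S" using submodule_minus_closed[OF N] NS by blast
      moreover have "y \<in> \<Union>S" using iff[OF y(1)] Y y(2) by simp
      ultimately have "\<ominus>\<^bsub>M\<^esub> (x \<oplus>\<^bsub>M\<^esub> y) \<oplus>\<^bsub>M\<^esub> y \<in> \<Union>S" by (rule sum)
      moreover have "\<ominus>\<^bsub>M\<^esub> (x \<oplus>\<^bsub>M\<^esub> y) \<oplus>\<^bsub>M\<^esub> y = \<ominus>\<^bsub>M\<^esub> x"
        using cos(2)[OF x] y(1) by (simp add: minus_add a_assoc l_neg)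
      ultimately show ?thesis by simp
    qed
  qed
qed

lemma submodule_trivial:
  assumes M: "lmodule R M"
  shows "submodule {\<zero>\<^bsub>M\<^esub>} R M" "submodule (carrier M) R M"
proof -
  interpret abelian_group M by (rule lmoduleD(1)[OF M])
  have "a \<odot>\<^bsub>M\<^esub> \<zero>\<^bsub>M\<^esub> = \<zero>\<^bsub>M\<^esub>" if a: "a \<in> carrier R" for a
  proof -
    have "a \<odot>\<^bsub>M\<^esub> \<zero>\<^bsub>M\<^esub> \<oplus>\<^bsub>M\<^esub> a \<odot>\<^bsub>M\<^esub> \<zero>\<^bsub>M\<^esub> = a \<odot>\<^bsub>M\<^esub> \<zero>\<^bsub>M\<^esub>"
      using lmoduleD(3)[OF M a zero_closed zero_closed] by simp
    then show ?thesis using lmoduleD(2)[OF M a zero_closed] by (simp add: add.l_cancel_one)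
  qed
  then show "submodule {\<zero>\<^bsub>M\<^esub>} R M" by (intro submoduleI[OF M]) auto
  show "submodule (carrier M) R M"
    using lmoduleD(2)[OF M] by (intro submoduleI[OF M]) auto
qed

text \<open>Take a longest strict chain of submodules from zero to the whole module. A factor with a
  proper nonzero submodule would allow the preimage of that submodule to be inserted.\<close>

lemma exists_composition_series:
  assumes M: "lmodule R M"
    and bound: "\<And>Ns. sorted_wrt (\<subset>) Ns \<Longrightarrow> (\<And>N. N \<in> set Ns \<Longrightarrow> submodule N R M) \<Longrightarrow> length Ns < d"
  shows "\<exists>Ns. composition_series R M Ns"
proof -
  define C where "C Ns \<longleftrightarrow> Ns \<noteq> [] \<and> hd Ns = {\<zero>\<^bsub>M\<^esub>} \<and> last Ns = carrier M \<and>
      (\<forall>N\<in>set Ns. submodule N R M) \<and> sorted_wrt (\<subset>) Ns" for Ns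
  have "\<exists>Ns. C Ns"
  proof (cases "carrier M = {\<zero>\<^bsub>M\<^esub>}")
    case True
    then have "C [{\<zero>\<^bsub>M\<^esub>}]" using submodule_trivial[OF M] by (simp add: C_def)
    then show ?thesis by blast
  next
    case False
    have "{\<zero>\<^bsub>M\<^esub>} \<subset> carrier M" using False submoduleD(1)[OF submodule_trivial(1)[OF M]] by blast
    then have "C [{\<zero>\<^bsub>M\<^esub>}, carrier M]" using submodule_trivial[OF M] by (simp add: C_def)
    then show ?thesis by blast
  qed
  moreover have "\<forall>Ns. C Ns \<longrightarrow> length Ns < d" using bound by (simp add: C_def)
  ultimately obtain Ns where Ns: "C Ns" and max: "\<And>Ns'. C Ns' \<Longrightarrow> length Ns' \<le> length Ns"
    using ex_has_greatest_nat[of C _ length d] by blast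
  have sub: "submodule N R M" if "N \<in> set Ns" for N using Ns that by (simp add: C_def)
  have simple: "Ns ! i \<subseteq> Ns ! Suc i \<and> simple_module R (series_factor M Ns i)" if i: "Suc i < length Ns" for i
  proof
    let ?N = "Ns ! i" and ?N' = "Ns ! Suc i"
    let ?M = "M\<lparr>carrier := ?N'\<rparr>"
    have less: "?N \<subset> ?N'" using Ns i sorted_wrt_nth_less[of "(\<subset>)" Ns i "Suc i"] by (simp add: C_def)
    then show "?N \<subseteq> ?N'" by blast
    have N: "submodule ?N R M" "submodule ?N' R M" using sub i by simp_all
    have M': "lmodule R ?M" by (rule lmodule_restrict[OF M N(2)])
    have N': "submodule ?N R ?M" using submodule_restrict_iff[OF M N(2)] N(1) less by blast
    interpret abelian_subgroup ?N ?M by (rule submodule_abelian_subgroup[OF M' N'])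
    let ?Q = "quot_module ?M ?N"
    show "simple_module R (series_factor M Ns i)"
      unfolding simple_module_def series_factor_def
    proof (intro conjI allI impI)
      obtain x where x: "x \<in> ?N'" "x \<notin> ?N" using less by blast
      then have "?N +>\<^bsub>?M\<^esub> x \<in> carrier ?Q" "x \<in> ?N +>\<^bsub>?M\<^esub> x"
        using coset_in_quot_module[of x ?M ?N] a_rcos_self[of x] by simp_all
      then show "carrier ?Q \<noteq> {\<zero>\<^bsub>?Q\<^esub>}" using x(2) by (metis quot_module_simps(2) singletonD)
      fix S assume S: "submodule S R ?Q"
      let ?U = "\<Union>S"
      note U = Union_submodule_quot_module[OF M' N' S]
      have UN': "?U \<subseteq> ?N'" using submoduleD(1)[OF U(1)] by simp
      have UM: "submodule ?U R M" using submodule_restrict_iff[OF M N(2) UN'] U(1) by simp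
      have SQ: "S \<subseteq> carrier ?Q" by (rule submoduleD(1)[OF S])
      show "S = {\<zero>\<^bsub>?Q\<^esub>} \<or> S = carrier ?Q"
      proof (rule ccontr)
        assume no: "\<not> (S = {\<zero>\<^bsub>?Q\<^esub>} \<or> S = carrier ?Q)"
        have "?U \<noteq> ?N"
        proof
          assume UN: "?U = ?N"
          have "X = ?N" if X: "X \<in> S" for X
          proof -
            obtain x where x: "x \<in> carrier ?M" "X = ?N +>\<^bsub>?M\<^esub> x" using SQ X by (meson quot_moduleE subsetD)
            then have "x \<in> ?N" using U(3)[OF x(1)] X UN by simp
            then show ?thesis using a_coset_join2[OF x(1) submoduleD(5)[OF N']] x(2) by simp
          qed
          moreover have "?N \<in> S" using submoduleD(2)[OF S] by (simp only: quot_module_simps(2))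
          ultimately have "S = {?N}" by blast
          then show False using no by (simp add: quot_module_simps)
        qed
        then have 1: "?N \<subset> ?U" using U(2) by blast
        have "?U \<noteq> ?N'"
        proof
          assume UN: "?U = ?N'"
          have "X \<in> S" if X: "X \<in> carrier ?Q" for X
          proof -
            obtain x where x: "x \<in> carrier ?M" "X = ?N +>\<^bsub>?M\<^esub> x" using X by (rule quot_moduleE)
            then show ?thesis using U(3)[OF x(1)] UN by simp
          qed
          then show False using no SQ by blast
        qed
        then have 2: "?U \<subset> ?N'" using UN' by blast
        let ?A = "take (Suc i) Ns" and ?B = "drop (Suc i) Ns"
        have A: "V \<subseteq> ?N" if V: "V \<in> set ?A" for V
        proof -
          obtain k where k: "k \<le> i" "V = Ns ! k"
            using V i by (auto simp: in_set_conv_nth less_Suc_eq_le)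
          then show ?thesis using Ns i sorted_wrt_nth_less[of "(\<subset>)" Ns k i] by (cases "k = i") (auto simp: C_def)
        qed
        have B: "?N' \<subseteq> V" if V: "V \<in> set ?B" for V
        proof -
          obtain k where k: "k < length Ns - Suc i" "V = Ns ! (Suc i + k)"
            using V i by (auto simp: in_set_conv_nth)
          then have "Suc i + k < length Ns" by simp
          then have "?N' \<subset> Ns ! (Suc i + k)" if "k \<noteq> 0"
            using Ns sorted_wrt_nth_less[of "(\<subset>)" Ns "Suc i" "Suc i + k"] that by (simp add: C_def)
          then show ?thesis using k(2) by (cases "k = 0") auto
        qed
        have sorted: "sorted_wrt (\<subset>) (?A @ ?B)" using Ns by (simp add: C_def)
        have "C (?A @ ?U # ?B)"
          unfolding C_def
        proof (intro conjI)
          show "sorted_wrt (\<subset>) (?A @ ?U # ?B)"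
          proof -
            have "V \<subset> ?U" if "V \<in> set ?A" for V using A[OF that] 1 by (rule subset_psubset_trans)
            moreover have "?U \<subset> V" if "V \<in> set ?B" for V using 2 B[OF that] by (rule psubset_subset_trans)
            moreover have "sorted_wrt (\<subset>) ?A" "sorted_wrt (\<subset>) ?B" "\<forall>V\<in>set ?A. \<forall>W\<in>set ?B. V \<subset> W"
              using sorted unfolding sorted_wrt_append by blast+
            ultimately show ?thesis unfolding sorted_wrt_append sorted_wrt.simps(2) set_simps by blast
          qed
          show "\<forall>N\<in>set (?A @ ?U # ?B). submodule N R M"
            using UM sub by (auto dest: in_set_takeD in_set_dropD)
          show "hd (?A @ ?U # ?B) = {\<zero>\<^bsub>M\<^esub>}" using Ns by (cases Ns) (auto simp: C_def)
          show "last (?A @ ?U # ?B) = carrier M" using Ns i by (simp add: C_def)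
        qed simp
        from max[OF this] i show False by simp
      qed
    qed
  qed
  have "composition_series R M Ns"
    unfolding composition_series_def using Ns simple by (auto simp: C_def)
  then show ?thesis by blast
qed

lemma submodule_radical:
  assumes L: "lmodule R L"
  shows "submodule (radical R L) R L"
proof -
  interpret abelian_group L by (rule lmoduleD(1)[OF L])
  have m: "submodule N R L" if "maximal_submodule R L N" for N
    using that by (simp add: maximal_submodule_def)
  show ?thesis
  proof (rule submoduleI[OF L])
    show "\<zero>\<^bsub>L\<^esub> \<in> radical R L" using submoduleD(2)[OF m] by (auto simp: radical_def)
    show "x \<oplus>\<^bsub>L\<^esub> y \<in> radical R L" if "x \<in> radical R L" "y \<in> radical R L" for x y
      using that submoduleD(3)[OF m] by (auto simp: radical_def)
    show "\<ominus>\<^bsub>L\<^esub> x \<in> radical R L" if "x \<in> radical R L" for x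
      using that submodule_minus_closed[OF m] by (auto simp: radical_def)
    show "a \<odot>\<^bsub>L\<^esub> x \<in> radical R L" if "a \<in> carrier R" "x \<in> radical R L" for a x
      using that submoduleD(4)[OF m] lmoduleD(2)[OF L] by (auto simp: radical_def)
  qed (auto simp: radical_def)
qed

text \<open>An element that annihilates \<open>M\<close> and is the identity on \<open>L\<close> separates their composition
  factors.\<close>

lemma factor_not_isomorphic_head:
  assumes M: "lmodule R M" and L: "lmodule R L" and e: "e \<in> carrier R"
    and eM: "\<And>x. x \<in> carrier M \<Longrightarrow> e \<odot>\<^bsub>M\<^esub> x = \<zero>\<^bsub>M\<^esub>" and eL: "\<And>x. x \<in> carrier L \<Longrightarrow> e \<odot>\<^bsub>L\<^esub> x = x"
    and Ns: "composition_series R M Ns" and i: "Suc i < length Ns"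
  shows "\<not> module_isomorphic R (series_factor M Ns i) (head R L)"
proof
  let ?N = "Ns ! i" and ?N' = "Ns ! Suc i"
  let ?M = "M\<lparr>carrier := ?N'\<rparr>"
  have N: "submodule ?N R M" "submodule ?N' R M" "?N \<subseteq> ?N'"
    and simple: "simple_module R (quot_module ?M ?N)"
    using Ns i by (simp_all add: composition_series_def series_factor_def)
  have M': "lmodule R ?M" by (rule lmodule_restrict[OF M N(2)])
  have N': "submodule ?N R ?M" using submodule_restrict_iff[OF M N(2,3)] N(1) by blast
  interpret abelian_subgroup ?N ?M by (rule submodule_abelian_subgroup[OF M' N'])
  let ?Q = "quot_module ?M ?N" and ?H = "head R L"
  assume "module_isomorphic R (series_factor M Ns i) ?H"
  then obtain f where f: "bij_betw f (carrier ?Q) (carrier ?H)"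
    and fs: "\<And>a x. a \<in> carrier R \<Longrightarrow> x \<in> carrier ?Q \<Longrightarrow> f (a \<odot>\<^bsub>?Q\<^esub> x) = a \<odot>\<^bsub>?H\<^esub> f x"
    unfolding module_isomorphic_def series_factor_def by blast
  have zQ: "\<zero>\<^bsub>?Q\<^esub> \<in> carrier ?Q" using lmoduleD(1)[OF lmodule_quot_module[OF M' N']]
    by (simp add: abelian_group.axioms(1) abelian_monoid.zero_closed)
  have eQ: "e \<odot>\<^bsub>?Q\<^esub> X = \<zero>\<^bsub>?Q\<^esub>" if X: "X \<in> carrier ?Q" for X
  proof -
    obtain x where x: "x \<in> carrier ?M" "X = ?N +>\<^bsub>?M\<^esub> x" using X by (rule quot_moduleE)
    then have "e \<odot>\<^bsub>?M\<^esub> x = \<zero>\<^bsub>?M\<^esub>" using eM submoduleD(1)[OF N(2)] by auto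
    then have "e \<odot>\<^bsub>?Q\<^esub> X = ?N +>\<^bsub>?M\<^esub> \<zero>\<^bsub>?M\<^esub>"
      using quot_module_smult[OF M' N' e x(1)] x(2) by simp
    also have "\<dots> = ?N" by (rule a_coset_join2[OF zero_closed submoduleD(5)[OF N'] submoduleD(2)[OF N']])
    finally show ?thesis by (simp add: quot_module_simps)
  qed
  have eH: "e \<odot>\<^bsub>?H\<^esub> X = X" if X: "X \<in> carrier ?H" for X
  proof -
    obtain x where x: "x \<in> carrier L" "X = radical R L +>\<^bsub>L\<^esub> x"
      using X unfolding head_def by (rule quot_moduleE)
    then show ?thesis
      unfolding head_def using quot_module_smult[OF L submodule_radical[OF L] e x(1)] eL[OF x(1)] by simp
  qed
  have "X = \<zero>\<^bsub>?Q\<^esub>" if X: "X \<in> carrier ?Q" for X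
  proof -
    have "f X \<in> carrier ?H" using bij_betwE[OF f] X by blast
    then have "f X = f \<zero>\<^bsub>?Q\<^esub>" using fs[OF e X] eQ[OF X] eH by simp
    then show ?thesis using inj_onD[OF bij_betw_imp_inj_on[OF f] _ X zQ] by blast
  qed
  then have "carrier ?Q = {\<zero>\<^bsub>?Q\<^esub>}" using zQ by blast
  then show False using simple by (simp add: simple_module_def)
qed

text \<open>The existence of a series gives meaning to the \<open>SOME\<close> in the multiplicity;
  a nonzero count then exhibits a factor of the chosen series.\<close>

lemma composition_multiplicityE:
  assumes "composition_multiplicity R M L \<noteq> 0" and "\<exists>Ns. composition_series R M Ns"
  obtains Ns i where "composition_series R M Ns" "Suc i < length Ns"
    "module_isomorphic R (series_factor M Ns i) L"
proof -
  have "\<exists>m Ns. composition_series R M Ns \<and>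
      m = card {i. Suc i < length Ns \<and> module_isomorphic R (series_factor M Ns i) L}"
    using assms(2) by blast
  from someI_ex[OF this] obtain Ns where Ns: "composition_series R M Ns"
    "composition_multiplicity R M L = card {i. Suc i < length Ns \<and> module_isomorphic R (series_factor M Ns i) L}"
    unfolding composition_multiplicity_def by blast
  then have "{i. Suc i < length Ns \<and> module_isomorphic R (series_factor M Ns i) L} \<noteq> {}"
    using assms(1) by (metis card.empty)
  then show ?thesis using that Ns(1) by blast
qed

text \<open>Each proper step of the chain supplies a vector outside the previous subspace, hence one
  more independent vector. A chain of \<open>l\<close> subspaces gives \<open>l - 1\<close> of them,
  so \<open>l\<close> is at most \<open>card B + 1\<close>.\<close>

lemma length_chain_bound:
  fixes B :: "('a \<Rightarrow> 'b \<Rightarrow> 'k::field) set"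
  assumes B: "finite B"
    and add: "\<And>V f g. V \<in> set Vs \<Longrightarrow> f \<in> V \<Longrightarrow> g \<in> V \<Longrightarrow> (\<lambda>v x. f v x + g v x) \<in> V"
    and scale: "\<And>V c f. V \<in> set Vs \<Longrightarrow> f \<in> V \<Longrightarrow> (\<lambda>v x. c * f v x) \<in> V"
    and zero: "\<And>V. V \<in> set Vs \<Longrightarrow> (\<lambda>v x. 0) \<in> V"
    and span: "\<And>V. V \<in> set Vs \<Longrightarrow> V \<subseteq> Modules.module.span (\<lambda>c f v x. c * f v x) B"
    and sorted: "sorted_wrt (\<subset>) Vs"
  shows "length Vs < card B + 2"
proof (cases "Vs = []")
  case False
  interpret vs: vector_space "\<lambda>c (f :: 'a \<Rightarrow> 'b \<Rightarrow> 'k) v x. c * f v x" by (rule vector_space_fun2)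
  have sub: "vs.subspace V" if "V \<in> set Vs" for V
    unfolding vs.subspace_def
    using add[OF that] scale[OF that] zero[OF that] by (auto simp: zero_fun_def plus_fun_def)
  have "\<exists>I. vs.independent I \<and> I \<subseteq> last Ws \<and> finite I \<and> Suc (card I) = length Ws"
    if "Ws \<noteq> []" "set Ws \<subseteq> set Vs" "sorted_wrt (\<subset>) Ws" for Ws
    using that
  proof (induction Ws rule: rev_induct)
    case (snoc W Ws)
    show ?case
    proof (cases "Ws = []")
      case True
      then show ?thesis by (intro exI[of _ "{}"]) (simp add: vs.independent_empty)
    next
      case False
      with snoc obtain I where I: "vs.independent I" "I \<subseteq> last Ws" "finite I" "Suc (card I) = length Ws"
        by (auto simp: sorted_wrt_append)
      have lW: "last Ws \<in> set Ws" using False by simp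
      then have "last Ws \<subset> W" using snoc.prems(3) by (simp add: sorted_wrt_append)
      then obtain f where f: "f \<in> W" "f \<notin> last Ws" and LW: "last Ws \<subseteq> W" by blast
      have "vs.subspace (last Ws)" using lW snoc.prems(2) by (intro sub) auto
      then have "vs.span I \<subseteq> last Ws" using I(2) by (intro vs.span_minimal)
      then have "f \<notin> vs.span I" using f(2) by blast
      then have "vs.independent (insert f I)" using I(1) by (rule vs.independent_insertI)
      moreover have "f \<notin> I" using f(2) I(2) by blast
      then have "Suc (card (insert f I)) = length (Ws @ [W])" using I(3,4) by simp
      moreover have "insert f I \<subseteq> last (Ws @ [W])" using f(1) I(2) LW by auto
      ultimately show ?thesis using I(3) by blast
    qed
  qed simp
  from this[OF False subset_refl sorted] obtain I where
    I: "vs.independent I" "I \<subseteq> last Vs" "Suc (card I) = length Vs" by blast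
  have "I \<subseteq> vs.span B" using I(2) span[of "last Vs"] False by auto
  then have "card I \<le> card B" using vs.independent_span_bound[OF B I(1)] by blast
  then show ?thesis using I(3) by simp
qed simp

section \<open>Cell modules as modules with composition series\<close>

context
  fixes n m :: nat and \<delta> :: "'k::field" and lam :: "nat list"
  assumes lam: "lam \<in> partitions m" and m: "m \<le> n"
begin

private abbreviation "P \<equiv> partition_algebra n \<delta>"
private abbreviation "M \<equiv> cell_tensor n \<delta> lam"
private abbreviation "B \<equiv> balancing_relations n lam :: (diagram \<Rightarrow> tabloid \<Rightarrow> 'k) set"

lemma neg_in_cell_tensor:
  assumes "f \<in> carrier M"
  shows "(\<lambda>v T. - 1 * f v T) \<in> carrier M"
  unfolding cell_tensor_simps
proof (intro CollectI conjI ballI allI impI)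
  show "(\<lambda>T. - 1 * f v T) \<in> specht lam" if "v \<in> half_diagrams n (sum_list lam)" for v
    using assms that by (intro specht_closed(3)) (simp add: cell_tensor_simps)
qed (use assms in \<open>simp add: cell_tensor_simps\<close>)

lemma abelian_group_cell_tensor: "abelian_group M"
proof (rule abelian_groupI)
  fix f assume "f \<in> carrier M"
  from neg_in_cell_tensor[OF this] show "\<exists>g\<in>carrier M. g \<oplus>\<^bsub>M\<^esub> f = \<zero>\<^bsub>M\<^esub>"
    by (rule bexI[rotated]) (simp add: cell_tensor_simps)
qed (auto simp: cell_tensor_simps specht_closed add_ac)

lemma minus_cell_tensor:
  assumes f: "f \<in> carrier M"
  shows "\<ominus>\<^bsub>M\<^esub> f = (\<lambda>v T. - 1 * f v T)"
proof (rule abelian_group.minus_equality[OF abelian_group_cell_tensor])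
  show "(\<lambda>v T. - 1 * f v T) \<in> carrier M" using f by (rule neg_in_cell_tensor)
qed (use f in \<open>simp_all add: cell_tensor_simps\<close>)

lemma lmodule_cell_tensor: "lmodule P M"
  unfolding lmodule_def
proof (intro conjI ballI abelian_group_cell_tensor)
  fix a f assume f: "f \<in> carrier M"
  show "a \<odot>\<^bsub>M\<^esub> f \<in> carrier M"
    unfolding cell_tensor_simps
  proof (intro CollectI conjI ballI allI impI)
    fix w assume "w \<in> half_diagrams n (sum_list lam)"
    then have "(a \<odot>\<^bsub>M\<^esub> f) w = (\<lambda>T. \<Sum>v\<in>half_diagrams n (sum_list lam). coefficient n \<delta> a v w * f v T)"
      by (simp add: cell_tensor_smult)
    also have "\<dots> \<in> specht lam"
      using f by (intro specht_sum specht_closed(3)) (simp add: cell_tensor_simps)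
    finally show "(a \<odot>\<^bsub>M\<^esub> f) w \<in> specht lam" .
  qed (simp add: cell_tensor_smult)
  fix g
  show "a \<odot>\<^bsub>M\<^esub> (f \<oplus>\<^bsub>M\<^esub> g) = a \<odot>\<^bsub>M\<^esub> f \<oplus>\<^bsub>M\<^esub> a \<odot>\<^bsub>M\<^esub> g"
    unfolding cell_tensor_simps by (rule cell_tensor_smult_add)
qed

lemma submodule_balancing: "submodule B P M"
proof (rule submoduleI[OF lmodule_cell_tensor])
  show sub: "B \<subseteq> carrier M" by (rule balancing_subset[OF lam m])
  show "\<ominus>\<^bsub>M\<^esub> f \<in> B" if "f \<in> B" for f
    using minus_cell_tensor[OF subsetD[OF sub that]] balancing_closed(3)[OF that] by (simp only:)
  show "a \<odot>\<^bsub>M\<^esub> f \<in> B" if "f \<in> B" for a f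
  proof (rule smult_balancing[OF _ that])
    show "sum_list lam \<le> n" using lam m by (simp add: partitions_def)
  qed
qed (simp_all only: cell_tensor_simps balancing_closed)

lemma lmodule_cell_module: "lmodule P (cell_module n \<delta> lam)"
  unfolding cell_module_def by (rule lmodule_quot_module[OF lmodule_cell_tensor submodule_balancing])

lemma scalar_in_partition_algebra: "(\<lambda>d. if d = id_diagram n then c else 0) \<in> carrier P"
  using id_diagram_in[of n] by (auto simp: partition_algebra_def)

text \<open>The spanning functions are the indicators of pairs of a half diagram and a tabloid. They
  belong to the ambient function space, where being in the span of a finite set already bounds
  chains of subspaces.\<close>

lemma cell_tensor_spanned:
  "\<exists>F. finite F \<and> carrier M \<subseteq> Modules.module.span (\<lambda>c f v x. c * f v x) F"
proof -
  interpret vs: vector_space "\<lambda>c (f :: diagram \<Rightarrow> tabloid \<Rightarrow> 'k) v x. c * f v x" by (rule vector_space_fun2)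
  let ?I = "half_diagrams n (sum_list lam) \<times> shape_tabloids lam"
  have sum_apply2: "(\<Sum>p\<in>A. g p) w T = (\<Sum>p\<in>A. g p w T)"
    for A and g :: "diagram \<times> tabloid \<Rightarrow> diagram \<Rightarrow> tabloid \<Rightarrow> 'k" and w T
    by (induction A rule: infinite_finite_induct) (simp_all add: zero_fun_def plus_fun_def)
  let ?u = "\<lambda>p w T. if p = (w, T) then 1 else 0 :: 'k"
  have finI: "finite ?I" by (simp add: finite_shape_tabloids)
  have "f \<in> vs.span (?u ` ?I)" if f: "f \<in> carrier M" for f
  proof -
    have "f = (\<Sum>p\<in>?I. (\<lambda>v x. f (fst p) (snd p) * ?u p v x))"
    proof (intro ext)
      fix w T
      have "(\<Sum>p\<in>?I. (\<lambda>v x. f (fst p) (snd p) * ?u p v x)) w T = (\<Sum>p\<in>?I. f (fst p) (snd p) * ?u p w T)"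
        by (rule sum_apply2)
      also have "\<dots> = (\<Sum>p\<in>?I. if p = (w, T) then f w T else 0)"
        by (intro sum.cong refl) auto
      also have "\<dots> = (if (w, T) \<in> ?I then f w T else 0)" using finI by (rule sum.delta)
      also have "\<dots> = f w T"
      proof (cases "(w, T) \<in> ?I")
        case False
        then have "f w T = 0"
          using f specht_support[of "f w" lam T]
          by (cases "w \<in> half_diagrams n (sum_list lam)") (auto simp: cell_tensor_simps)
        then show ?thesis by simp
      qed simp
      finally show "f w T = (\<Sum>p\<in>?I. (\<lambda>v x. f (fst p) (snd p) * ?u p v x)) w T" by simp
    qed
    also have "\<dots> \<in> vs.span (?u ` ?I)"
      by (intro vs.span_sum vs.span_scale vs.span_base) simp
    finally show ?thesis .
  qed
  moreover have "finite (?u ` ?I)" using finI by simp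
  ultimately show ?thesis by blast
qed

text \<open>A strict chain of submodules of the quotient lifts, by taking unions of cosets, to a
  strict chain of subspaces of the finite-dimensional tensor product.\<close>

lemma exists_composition_series_cell_module:
  "\<exists>Ns. composition_series P (cell_module n \<delta> lam) Ns"
proof -
  obtain F where F: "finite F" "carrier M \<subseteq> Modules.module.span (\<lambda>c f v x. c * f v x) F"
    using cell_tensor_spanned by blast
  show ?thesis
  proof (rule exists_composition_series[OF lmodule_cell_module, where d = "card F + 2"])
    fix Ns assume sorted: "sorted_wrt (\<subset>) Ns"
      and sub: "\<And>N. N \<in> set Ns \<Longrightarrow> submodule N P (cell_module n \<delta> lam)"
    note U = Union_submodule_quot_module[OF lmodule_cell_tensor submodule_balancing sub[unfolded cell_module_def]]
    have mono: "\<Union>S \<subset> \<Union>S'" if S: "S \<in> set Ns" "S' \<in> set Ns" "S \<subset> S'" for S S'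
    proof -
      obtain X where X: "X \<in> S'" "X \<notin> S" using S(3) by blast
      have "X \<in> carrier (quot_module M B)"
        using submoduleD(1)[OF sub[OF S(2)]] X(1) by (auto simp: cell_module_def)
      then obtain x where x: "x \<in> carrier M" "X = B +>\<^bsub>M\<^esub> x" by (rule quot_moduleE)
      have "x \<in> \<Union>S'" "x \<notin> \<Union>S" using U(3)[OF S(1) x(1)] U(3)[OF S(2) x(1)] X x(2) by auto
      then show ?thesis using S(3) by blast
    qed
    have "length (map Union Ns) < card F + 2"
    proof (rule length_chain_bound[OF F(1)])
      have "sorted_wrt (\<lambda>S S'. \<Union>S \<subset> \<Union>S') Ns"
        using sorted mono by (rule sorted_wrt_mono_rel[rotated])
      then show "sorted_wrt (\<subset>) (map Union Ns)" by (simp add: sorted_wrt_map)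
      fix V assume "V \<in> set (map Union Ns)"
      then obtain S where S: "S \<in> set Ns" "V = \<Union>S" by auto
      note V = U(1)[OF S(1), folded S(2)]
      show "V \<subseteq> Modules.module.span (\<lambda>c f v x. c * f v x) F" using submoduleD(1)[OF V] F(2) by blast
      show "(\<lambda>v x. 0) \<in> V" using submoduleD(2)[OF V] by (simp add: cell_tensor_simps)
      show "(\<lambda>v x. f v x + g v x) \<in> V" if "f \<in> V" "g \<in> V" for f g
        using submoduleD(3)[OF V that] by (simp add: cell_tensor_simps)
      show "(\<lambda>v x. c * f v x) \<in> V" if "f \<in> V" for c f
        using submoduleD(4)[OF V scalar_in_partition_algebra that]
          cell_tensor_smult_id[OF subsetD[OF submoduleD(1)[OF V] that]] by (simp only:)
    qed
    then show "length Ns < card F + 2" by simp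
  qed
qed

text \<open>The quotient record carries no multiplication by field elements, so acting by the scalar
  \<open>c\<close> is expressed for the two values 0 and 1, where it needs none.\<close>

lemma cell_module_smult:
  assumes e: "e \<in> carrier P" and X: "X \<in> carrier (cell_module n \<delta> lam)"
    and f: "\<And>f. f \<in> carrier M \<Longrightarrow> (\<lambda>v T. (e \<odot>\<^bsub>M\<^esub> f) v T - c * f v T) \<in> B"
  shows "c = 0 \<Longrightarrow> e \<odot>\<^bsub>cell_module n \<delta> lam\<^esub> X = \<zero>\<^bsub>cell_module n \<delta> lam\<^esub>"
    and "c = 1 \<Longrightarrow> e \<odot>\<^bsub>cell_module n \<delta> lam\<^esub> X = X"
proof -
  interpret abelian_subgroup B M by (rule submodule_abelian_subgroup[OF lmodule_cell_tensor submodule_balancing])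
  obtain x where x: "x \<in> carrier M" "X = B +>\<^bsub>M\<^esub> x"
    using X unfolding cell_module_def by (rule quot_moduleE)
  have eX: "e \<odot>\<^bsub>cell_module n \<delta> lam\<^esub> X = B +>\<^bsub>M\<^esub> (e \<odot>\<^bsub>M\<^esub> x)"
    unfolding x(2) cell_module_def by (rule quot_module_smult[OF lmodule_cell_tensor submodule_balancing e x(1)])
  note ex = lmoduleD(2)[OF lmodule_cell_tensor e x(1)]
  show "e \<odot>\<^bsub>cell_module n \<delta> lam\<^esub> X = \<zero>\<^bsub>cell_module n \<delta> lam\<^esub>" if "c = 0"
  proof -
    have "e \<odot>\<^bsub>M\<^esub> x \<in> B" using f[OF x(1)] that by simp
    then have "B +>\<^bsub>M\<^esub> (e \<odot>\<^bsub>M\<^esub> x) = B" using a_coset_join2[OF ex submoduleD(5)[OF submodule_balancing]] by simp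
    then show ?thesis unfolding eX by (simp add: cell_module_def quot_module_simps)
  qed
  show "e \<odot>\<^bsub>cell_module n \<delta> lam\<^esub> X = X" if "c = 1"
  proof -
    have "(\<lambda>v T. (e \<odot>\<^bsub>M\<^esub> x) v T - x v T) \<in> B" using f[OF x(1)] that by simp
    moreover have "e \<odot>\<^bsub>M\<^esub> x = (\<lambda>v T. (e \<odot>\<^bsub>M\<^esub> x) v T - x v T) \<oplus>\<^bsub>M\<^esub> x"
      by (simp add: cell_tensor_simps)
    ultimately have "e \<odot>\<^bsub>M\<^esub> x \<in> B +>\<^bsub>M\<^esub> x" unfolding mem_coset_iff by blast
    then have "B +>\<^bsub>M\<^esub> x = B +>\<^bsub>M\<^esub> (e \<odot>\<^bsub>M\<^esub> x)"
      by (rule a_repr_independence[OF _ x(1) submoduleD(5)[OF submodule_balancing]])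
    then show ?thesis using eX x(2) by simp
  qed
qed

end

text \<open>The scalar \<open>F(T)\<close> of the overview.\<close>

definition cell_scalar :: "nat \<Rightarrow> 'k::field \<Rightarrow> nat list \<Rightarrow> 'k \<Rightarrow> 'k" where
  "cell_scalar n \<delta> lam T = (\<Prod>j\<in>{sum_list lam<..n}. T + \<delta> - of_nat j) * content_product lam (T - 1)"

text \<open>If the scalars differed at some \<open>T\<close>, a suitable element would annihilate
  the cell module of \<open>\<mu>\<close> and be the identity on that of \<open>lam\<close>, hence
  on its head, so the head could not be a composition factor of the former.\<close>

lemma cell_linked_cell_scalar:
  assumes linked: "(\<mu>, lam) \<in> cell_linked n \<delta>"
  shows "cell_scalar n \<delta> \<mu> T = cell_scalar n \<delta> lam T"
proof (rule ccontr)
  assume ne: "cell_scalar n \<delta> \<mu> T \<noteq> cell_scalar n \<delta> lam T"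
  let ?P = "partition_algebra n \<delta>"
  obtain k l where \<mu>: "\<mu> \<in> partitions k" "k \<le> n" and lam: "lam \<in> partitions l" "l \<le> n"
    using linked by (auto simp: cell_linked_def partitions_upto_def)
  have s: "sum_list \<mu> = k" "sum_list lam = l" using \<mu> lam by (simp_all add: partitions_def)
  obtain z where z: "z \<in> carrier ?P"
    and act: "\<And>lam m f. lam \<in> partitions m \<Longrightarrow> m \<le> n \<Longrightarrow> f \<in> carrier (cell_tensor n \<delta> lam) \<Longrightarrow>
      (\<lambda>v U. (z \<odot>\<^bsub>cell_tensor n \<delta> lam\<^esub> f) v U -
        (\<Prod>j\<in>{m<..n}. T + \<delta> - of_nat j) * content_product lam (T - 1) * f v U) \<in> balancing_relations n lam"
    using scalar_element_acts[where n = n and \<delta> = \<delta> and ?T0.0 = T] by blast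
  define \<alpha> where "\<alpha> = inverse (cell_scalar n \<delta> lam T - cell_scalar n \<delta> \<mu> T)"
  \<comment> \<open>Linear interpolation: \<open>(z - F\<mu>) / (F\<lambda> - F\<mu>)\<close> with
    the scalars of the two cell modules takes the value 0 on the first and 1 on the second.\<close>
  define e where "e = (\<lambda>d. \<alpha> * z d + (- \<alpha> * cell_scalar n \<delta> \<mu> T) * (if d = id_diagram n then 1 else 0))"
  have eP: "e \<in> carrier ?P"
    using z id_diagram_in[of n] by (auto simp: e_def partition_algebra_def)
  have ef: "(\<lambda>v U. (e \<odot>\<^bsub>cell_tensor n \<delta> \<nu>\<^esub> f) v U - \<alpha> * (cell_scalar n \<delta> \<nu> T - cell_scalar n \<delta> \<mu> T) * f v U)
      \<in> balancing_relations n \<nu>"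
    if \<nu>: "\<nu> \<in> partitions j" "j \<le> n" and f: "f \<in> carrier (cell_tensor n \<delta> \<nu>)" for \<nu> j f
  proof -
    have sj: "sum_list \<nu> = j" using \<nu> by (simp add: partitions_def)
    have "(\<lambda>v U. (e \<odot>\<^bsub>cell_tensor n \<delta> \<nu>\<^esub> f) v U - \<alpha> * (cell_scalar n \<delta> \<nu> T - cell_scalar n \<delta> \<mu> T) * f v U) =
        (\<lambda>v U. \<alpha> * ((z \<odot>\<^bsub>cell_tensor n \<delta> \<nu>\<^esub> f) v U - cell_scalar n \<delta> \<nu> T * f v U))"
      unfolding e_def cell_tensor_smult_linear cell_tensor_smult_id[OF f]
      by (simp add: fun_eq_iff algebra_simps)
    also have "\<dots> \<in> balancing_relations n \<nu>"
      using act[OF \<nu> f] unfolding cell_scalar_def sj by (rule balancing_closed(3))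
    finally show ?thesis .
  qed
  have a1: "\<alpha> * (cell_scalar n \<delta> lam T - cell_scalar n \<delta> \<mu> T) = 1" using ne by (simp add: \<alpha>_def)
  have mult: "composition_multiplicity ?P (cell_module n \<delta> \<mu>) (simple_head n \<delta> lam) \<noteq> 0"
    using linked by (simp add: cell_linked_def)
  obtain Ns i where Ns: "composition_series ?P (cell_module n \<delta> \<mu>) Ns" "Suc i < length Ns"
    "module_isomorphic ?P (series_factor (cell_module n \<delta> \<mu>) Ns i) (simple_head n \<delta> lam)"
    using composition_multiplicityE[OF mult exists_composition_series_cell_module[OF \<mu>]] by blast
  have "\<not> module_isomorphic ?P (series_factor (cell_module n \<delta> \<mu>) Ns i) (head ?P (cell_module n \<delta> lam))"
  proof (rule factor_not_isomorphic_head[OF lmodule_cell_module[OF \<mu>] lmodule_cell_module[OF lam] eP _ _ Ns(1,2)])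
    show "e \<odot>\<^bsub>cell_module n \<delta> \<mu>\<^esub> X = \<zero>\<^bsub>cell_module n \<delta> \<mu>\<^esub>" if "X \<in> carrier (cell_module n \<delta> \<mu>)" for X
      by (rule cell_module_smult(1)[OF \<mu> eP that ef[OF \<mu>]]) simp_all
    show "e \<odot>\<^bsub>cell_module n \<delta> lam\<^esub> X = X" if "X \<in> carrier (cell_module n \<delta> lam)" for X
      by (rule cell_module_smult(2)[OF lam eP that ef[OF lam]]) (simp_all add: a1)
  qed
  then show False using Ns(3) by (simp add: simple_head_def)
qed

section \<open>Weights\<close>

text \<open>Over a finite field, the product of all \<open>X - a\<close> plus 1 takes the value 1
  everywhere and has no root.\<close>

lemma infinite_alg_closed: "infinite (UNIV :: 'k::alg_closed_field set)"
proof
  assume fin: "finite (UNIV :: 'k set)"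
  define p :: "'k poly" where "p = (\<Prod>a\<in>UNIV. [:- a, 1:]) + 1"
  have deg: "degree (\<Prod>a\<in>(UNIV :: 'k set). [:- a, 1:]) = card (UNIV :: 'k set)"
    by (subst degree_prod_eq_sum_degree) simp_all
  have "card (UNIV :: 'k set) > 0" using fin by (simp add: card_gt_0_iff)
  then have "degree p > 0" unfolding p_def using deg by (subst degree_add_eq_left) simp_all
  then obtain x where "poly p x = 0" using alg_closed_imp_poly_has_root by blast
  moreover have "poly p x = 1" using fin by (simp add: p_def poly_prod prod_zero)
  ultimately show False by simp
qed

lemma poly_eqI_infinite:
  fixes p q :: "'k::alg_closed_field poly"
  assumes "\<And>x. poly p x = poly q x"
  shows "p = q"
proof (rule ccontr)
  assume "p \<noteq> q"
  then have "finite {x. poly (p - q) x = 0}" by (intro poly_roots_finite) simp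
  moreover have "{x. poly (p - q) x = 0} = UNIV" using assms by simp
  ultimately show False using infinite_alg_closed by metis
qed

lemma length_partition_le: "lam \<in> partitions m \<Longrightarrow> length lam \<le> m"
proof -
  assume "lam \<in> partitions m"
  then have "0 \<notin> set lam" "sum_list lam = m" by (auto simp: partitions_def)
  moreover have "0 \<notin> set xs \<Longrightarrow> length xs \<le> sum_list xs" for xs :: "nat list"
    by (induction xs) auto
  ultimately show ?thesis by auto
qed

text \<open>Padding with empty rows up to \<open>n\<close> makes the number of rows independent of
  the partition, as in the weights.\<close>

lemma content_product_part:
  assumes "length lam \<le> n"
  shows "content_product lam U = (\<Prod>r<n. \<Prod>c<part lam (Suc r). U + of_nat c - of_nat r)"
proof -
  have "(\<Prod>r<n. \<Prod>c<part lam (Suc r). U + of_nat c - of_nat r) =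
      (\<Prod>r<length lam. \<Prod>c<part lam (Suc r). U + of_nat c - of_nat r)"
    using assms by (intro prod.mono_neutral_right) (auto simp: part_def)
  also have "\<dots> = content_product lam U"
    unfolding content_product_def by (intro prod.cong refl) (simp add: part_def)
  finally show ?thesis by simp
qed

text \<open>Both sides are the product of \<open>T + c - (r + 1)\<close> over
  \<open>0 \<le> c \<le> l\<close>.\<close>

lemma row_telescope:
  fixes T :: "'k::field"
  shows "(\<Prod>c<l. T - 1 + of_nat c - of_nat r) * (T + of_nat l - of_nat (Suc r)) =
    (\<Prod>c<l. T + of_nat c - of_nat r) * (T - of_nat (Suc r))"
proof (induction l)
  case (Suc l)
  have "(\<Prod>c<Suc l. T - 1 + of_nat c - of_nat r) * (T + of_nat (Suc l) - of_nat (Suc r)) =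
      ((\<Prod>c<l. T - 1 + of_nat c - of_nat r) * (T + of_nat l - of_nat (Suc r))) * (T + of_nat l - of_nat r)"
    by (simp add: algebra_simps)
  then show ?case unfolding Suc.IH by (simp add: algebra_simps)
qed simp

text \<open>Both sides are the product of \<open>x - j\<close> over
  \<open>m \<le> j \<le> n\<close>.\<close>

lemma delta_telescope:
  fixes x :: "'k::field"
  assumes "m \<le> n"
  shows "(\<Prod>j\<in>{m<..n}. x - of_nat j) * (x - of_nat m) = (\<Prod>j\<in>{m<..n}. x + 1 - of_nat j) * (x - of_nat n)"
  using assms
proof (induction n rule: dec_induct)
  case (step n)
  have I: "{m<..Suc n} = insert (Suc n) {m<..n}" using step.hyps by auto
  have "(\<Prod>j\<in>{m<..Suc n}. x - of_nat j) * (x - of_nat m) =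
      (x - of_nat (Suc n)) * ((\<Prod>j\<in>{m<..n}. x - of_nat j) * (x - of_nat m))"
    unfolding I by (simp add: mult.assoc)
  also have "\<dots> = (\<Prod>j\<in>{m<..Suc n}. x + 1 - of_nat j) * (x - of_nat (Suc n))"
    unfolding step.IH I by (simp add: algebra_simps)
  finally show ?case .
qed simp

text \<open>The division-free form of the quotient \<open>F(T + 1) / F(T)\<close>. Entry 0 of the
  shifted weight comes from the factors with \<open>\<delta>\<close>, entry \<open>r + 1\<close>
  from row \<open>r\<close>; the last factor on the right is the same for all partitions.\<close>

lemma cell_scalar_shift:
  fixes T \<delta> :: "'k::field"
  assumes lam: "lam \<in> partitions_upto n"
  shows "cell_scalar n \<delta> lam T * (\<Prod>i\<in>{0..n}. T + (hat lam i + rho \<delta> i)) =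
    cell_scalar n \<delta> lam (T + 1) * ((T + \<delta> - of_nat n) * (\<Prod>r<n. T - of_nat (Suc r)))"
proof -
  obtain m where m: "lam \<in> partitions m" "m \<le> n" using lam by (auto simp: partitions_upto_def)
  have s: "sum_list lam = m" using m by (simp add: partitions_def)
  have len: "length lam \<le> n" using length_partition_le[OF m(1)] m(2) by simp
  have "{0..n} = insert 0 (Suc ` {..<n})" unfolding lessThan_Suc_eq_insert_0[symmetric] by auto
  then have "(\<Prod>i\<in>{0..n}. T + (hat lam i + rho \<delta> i)) =
      (T + \<delta> - of_nat m) * (\<Prod>r<n. T + of_nat (part lam (Suc r)) - of_nat (Suc r))"
    by (simp add: prod.reindex hat_def rho_def s algebra_simps)
  then have "cell_scalar n \<delta> lam T * (\<Prod>i\<in>{0..n}. T + (hat lam i + rho \<delta> i)) =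
      ((\<Prod>j\<in>{m<..n}. (T + \<delta>) - of_nat j) * ((T + \<delta>) - of_nat m)) *
      (\<Prod>r<n. (\<Prod>c<part lam (Suc r). T - 1 + of_nat c - of_nat r) * (T + of_nat (part lam (Suc r)) - of_nat (Suc r)))"
    unfolding cell_scalar_def content_product_part[OF len] s prod.distrib by (simp only: mult_ac)
  also have "\<dots> = ((\<Prod>j\<in>{m<..n}. (T + \<delta>) + 1 - of_nat j) * ((T + \<delta>) - of_nat n)) *
      (\<Prod>r<n. (\<Prod>c<part lam (Suc r). T + of_nat c - of_nat r) * (T - of_nat (Suc r)))"
    unfolding delta_telescope[OF m(2)] row_telescope ..
  also have "\<dots> = cell_scalar n \<delta> lam (T + 1) * ((T + \<delta> - of_nat n) * (\<Prod>r<n. T - of_nat (Suc r)))"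
    unfolding cell_scalar_def content_product_part[OF len] s prod.distrib by (simp add: algebra_simps)
  finally show ?thesis .
qed

text \<open>The roots of the product, with multiplicities, are the negatives of the entries of the
  tuple; tuples with equal multisets of entries differ by a permutation of positions.\<close>

lemma perm_equivI_prod:
  fixes x y :: "nat \<Rightarrow> 'k::field"
  assumes "(\<Prod>i\<in>{0..n}. [:x i, 1:]) = (\<Prod>i\<in>{0..n}. [:y i, 1:])"
  shows "perm_equiv n x y"
proof -
  let ?xs = "map x [0..<Suc n]" and ?ys = "map y [0..<Suc n]"
  have pr: "proots (\<Prod>i\<in>{0..n}. [:z i, 1:]) = image_mset uminus (mset (map z [0..<Suc n]))" for z :: "nat \<Rightarrow> 'k"
  proof -
    have sum: "(\<Sum>i\<in>A. {#- z i#}) = image_mset uminus (image_mset z (mset_set A))" if "finite A" for A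
      using that by (induction A rule: finite_induct) simp_all
    have "proots (\<Prod>i\<in>{0..n}. [:z i, 1:]) = (\<Sum>i\<in>{0..n}. {#- z i#})"
      by (subst proots_prod) simp_all
    then show ?thesis
      using sum[of "{0..n}"] by (simp add: atLeastLessThanSuc_atLeastAtMost del: upt_Suc)
  qed
  have "image_mset uminus (image_mset uminus (mset ?xs)) = image_mset uminus (image_mset uminus (mset ?ys))"
    using arg_cong[OF assms, of proots] unfolding pr by simp
  then have "mset ?xs = mset ?ys" by (simp add: multiset.map_comp comp_def del: mset_map)
  then obtain p where p: "p permutes {..<length ?ys}" "permute_list p ?ys = ?xs" by (rule mset_eq_permutation)
  have len: "{..<length ?ys} = {0..n}" by auto
  have "x i = y (p i)" if "i \<in> {0..n}" for i
  proof -
    have "p i \<in> {0..n}" using p(1) that unfolding len by (simp only: permutes_in_image)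
    then have "?ys ! (p i) = y (p i)" by (simp del: upt_Suc)
    moreover have "?xs ! i = x i" using that by (simp del: upt_Suc)
    moreover have "?xs ! i = ?ys ! p i"
      unfolding p(2)[symmetric] using p(1) that by (intro permute_list_nth) auto
    ultimately show ?thesis by simp
  qed
  then show ?thesis unfolding perm_equiv_def using p(1) len by auto
qed

lemma perm_equiv_if_cell_scalar_eq:
  fixes \<delta> :: "'k::alg_closed_field"
  assumes lam: "lam \<in> partitions_upto n" and \<mu>: "\<mu> \<in> partitions_upto n"
    and eq: "\<And>T. cell_scalar n \<delta> \<mu> T = cell_scalar n \<delta> lam T"
  shows "perm_equiv n (\<lambda>i. hat \<mu> i + rho \<delta> i) (\<lambda>i. hat lam i + rho \<delta> i)"
proof (rule perm_equivI_prod)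
  define F where "F = (\<Prod>j\<in>{sum_list lam<..n}. [:\<delta> - of_nat j, 1:]) *
      (\<Prod>r<length lam. \<Prod>c<lam ! r. [:of_nat c - of_nat r - 1, 1:])"
  have F: "poly F T = cell_scalar n \<delta> lam T" for T
    unfolding F_def cell_scalar_def content_product_def poly_mult poly_prod
    by (intro arg_cong2[of _ _ _ _ "(*)"] prod.cong refl) simp_all
  \<comment> \<open>As a product of monic linear polynomials, \<open>F\<close> is nonzero and can be
    cancelled even though it has zeros in the field. Passing from values to polynomials uses that
    the field is infinite.\<close>
  have "F \<noteq> 0" by (simp add: F_def prod_zero_iff)
  let ?Q = "\<lambda>\<nu>. \<Prod>i\<in>{0..n}. [:hat \<nu> i + rho \<delta> i, 1:]"
  have Q: "poly (?Q \<nu>) T = (\<Prod>i\<in>{0..n}. T + (hat \<nu> i + rho \<delta> i))" for \<nu> T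
    unfolding poly_prod by (intro prod.cong refl) (simp add: add.commute)
  have "F * ?Q \<mu> = F * ?Q lam"
  proof (rule poly_eqI_infinite)
    fix T
    show "poly (F * ?Q \<mu>) T = poly (F * ?Q lam) T"
      unfolding poly_mult F Q using cell_scalar_shift[OF lam, of \<delta> T] cell_scalar_shift[OF \<mu>, of \<delta> T]
      by (simp only: eq)
  qed
  then show "?Q \<mu> = ?Q lam" using \<open>F \<noteq> 0\<close> by simp
qed

section \<open>Equivalence of weights along chains of linked partitions\<close>

lemma perm_equiv_refl: "perm_equiv n x x"
  unfolding perm_equiv_def using permutes_id by fastforce

lemma perm_equiv_sym:
  assumes "perm_equiv n x y"
  shows "perm_equiv n y x"
proof -
  obtain \<sigma> where \<sigma>: "\<sigma> permutes {0..n}" "\<forall>i\<in>{0..n}. x i = y (\<sigma> i)"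
    using assms unfolding perm_equiv_def by blast
  have "y i = x (inv_into UNIV \<sigma> i)" if "i \<in> {0..n}" for i
  proof -
    have "inv_into UNIV \<sigma> i \<in> {0..n}" using permutes_inv[OF \<sigma>(1)] that by (simp only: permutes_in_image)
    then show ?thesis using \<sigma>(2) permutes_inverses(1)[OF \<sigma>(1)] by simp
  qed
  then show ?thesis unfolding perm_equiv_def using permutes_inv[OF \<sigma>(1)] by blast
qed

lemma perm_equiv_trans:
  assumes "perm_equiv n x y" "perm_equiv n y z"
  shows "perm_equiv n x z"
proof -
  obtain \<sigma> \<tau> where \<sigma>: "\<sigma> permutes {0..n}" "\<forall>i\<in>{0..n}. x i = y (\<sigma> i)"
    and \<tau>: "\<tau> permutes {0..n}" "\<forall>i\<in>{0..n}. y i = z (\<tau> i)"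
    using assms unfolding perm_equiv_def by blast
  have "x i = z ((\<tau> \<circ> \<sigma>) i)" if "i \<in> {0..n}" for i
  proof -
    have "\<sigma> i \<in> {0..n}" using \<sigma>(1) that by (simp only: permutes_in_image)
    then show ?thesis using \<sigma>(2) \<tau>(2) that by simp
  qed
  then show ?thesis unfolding perm_equiv_def using permutes_compose[OF \<sigma>(1) \<tau>(1)] by blast
qed

theorem corollary6p7:
  fixes p n :: nat and \<delta> :: "'k::alg_closed_field" and lam \<mu> :: "nat list"
  assumes "prime p" and "CHAR('k) = p" and "n \<ge> 1" and "\<delta> \<noteq> 0"
    and "lam \<in> partitions_upto n" and "\<mu> \<in> partitions_upto n"
    and "\<mu> \<in> cell_block n \<delta> lam"
  shows "perm_equiv n (\<lambda>i. hat \<mu> i + rho \<delta> i) (\<lambda>i. hat lam i + rho \<delta> i)"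
proof -
  let ?x = "\<lambda>\<nu> i. hat \<nu> i + rho \<delta> i"
  have linked: "perm_equiv n (?x \<alpha>) (?x \<beta>)" if "(\<alpha>, \<beta>) \<in> cell_linked n \<delta>" for \<alpha> \<beta>
    using that cell_linked_cell_scalar[OF that]
    by (intro perm_equiv_if_cell_scalar_eq) (auto simp: cell_linked_def)
  have "(lam, \<mu>) \<in> (cell_linked n \<delta> \<union> (cell_linked n \<delta>)\<inverse>)\<^sup>*"
    using assms(7) by (simp add: cell_block_def cell_block_rel_def)
  then have "perm_equiv n (?x \<mu>) (?x lam)"
  proof (induction rule: rtrancl_induct)
    case base
    show ?case by (rule perm_equiv_refl)
  next
    case (step \<beta> \<gamma>)
    from step.hyps(2) have "perm_equiv n (?x \<gamma>) (?x \<beta>)"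
      using linked perm_equiv_sym by blast
    then show ?case using step.IH by (rule perm_equiv_trans)
  qed
  then show ?thesis .
qed

end
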